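(* Let $\nu>0$, $\alpha>0$, $r\ge\frac12$, and let $\mathbf u^0\in V^r$. Then for every $T>0$ there exists a unique weak solution $\mathbf u$ on $[0,T]$ of the fractional Navier--Stokes--Voigt equations $$(I+\alpha^{2r}A^r)\frac{d}{dt}\mathbf u+\nu A\mathbf u+B(\mathbf u,\mathbf u)=\mathbf 0,\qquad \mathbf u(0)=\mathbf u^0,$$ where a weak solution on $[0,T]$ is a function $\mathbf u\in C([0,T],V^r)\cap L^2(0,T;V\cap V^r)$ with $\frac{d}{dt}\mathbf u\in L^2(0,T;(V\cap V^r)')$ such that $$(\mathbf u(t),\mathbf v)+\alpha^{2r}(A^{r/2}\mathbf u(t),A^{r/2}\mathbf v)+\nu\int_0^t(A^{1/2}\mathbf u(\tau),A^{1/2}\mathbf v)\,d\tau=-\int_0^t\langle B(\mathbf u(\tau),\mathbf u(\tau)),\mathbf v\rangle\,d\tau+(\mathbf u^0,\mathbf v)+\alpha^{2r}(A^{r/2}\mathbf u^0,A^{r/2}\mathbf v)$$ for all $t\in[0,T]$ and all $\mathbf v\in V\cap V^r$.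
   Context: All functions live on the three-dimensional torus $\mathbb T^3=\mathbb R^3/\mathbb Z^3$ (periodic boundary conditions). $\mathcal V$ is the set of $\mathbf u\in C^\infty(\mathbb T^3;\mathbb R^3)$ with $\nabla\cdot\mathbf u=0$ and $\int_{\mathbb T^3}\mathbf u\,d\mathbf x=\mathbf 0$. $H$ is the closure of $\mathcal V$ in $L^2$, $V^s$ is the closure of $\mathcal V$ in the $H^s$ norm ($s>0$), and $V=V^1$; $H$ is identified with its dual, so that $H$ embeds in the duals of these spaces. $(\cdot,\cdot)$ is the $L^2$ inner product and $\langle\cdot,\cdot\rangle$ the duality pairing extending it. $P_\sigma:L^2\to H$ is the Leray--Helmholtz projection onto divergence-free fields. $A=-P_\sigma\triangle$ is the Stokes operator with domain $H^2(\mathbb T^3)\cap H$; it is positive self-adjoint on $H$ with an orthonormal eigenbasis $A\boldsymbol\varphi_k=\lambda_k\boldsymbol\varphi_k$, $0<\lambda_1\le\lambda_2\le\cdots\to\infty$, and $A^s\sum_k u_k\boldsymbol\varphi_k=\sum_k\lambda_k^su_k\boldsymbol\varphi_k$. On divergence-free mean-free fields, $\|\mathbf u\|_{H^s}^2$ is equivalent to $\sum_k\lambda_k^s|u_k|^2=\|A^{s/2}\mathbf u\|_{L^2}^2$. $B(\mathbf u,\mathbf v)=P_\sigma((\mathbf u\cdot\nabla)\mathbf v)$, so $\langle B(\mathbf u,\mathbf v),\mathbf w\rangle=\int_{\mathbb T^3}((\mathbf u\cdot\nabla)\mathbf v)\cdot\mathbf w\,d\mathbf x$. *)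

theory Defs
  imports "HOL-Analysis.Analysis"
begin

section \<open>Function spaces on the three-dimensional torus\<close>

text \<open>
  A function on the torus is a \<open>\<int>\<^sup>3\<close>-periodic function on \<open>\<real>\<^sup>3\<close>, integrated over the unit cube.
  Elements of \<open>L\<^sup>2\<close> and of its subspaces are represented by functions; two functions that agree
  almost everywhere represent the same element, and all norms, inner products and membership
  predicates below respect this.
\<close>

type_synonym field = "real^3 \<Rightarrow> real^3"

definition periodic :: "(real^3 \<Rightarrow> 'b) \<Rightarrow> bool" where
  "periodic f \<longleftrightarrow> (\<forall>x. \<forall>k::int^3. f (x + (\<chi> i. of_int (k $ i))) = f x)"

definition torus :: "(real^3) measure" where
  "torus = lebesgue_on (cbox 0 1)"

definition partial :: "3 \<Rightarrow> (real^3 \<Rightarrow> 'b::real_normed_vector) \<Rightarrow> real^3 \<Rightarrow> 'b" where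
  "partial i f = (\<lambda>x. frechet_derivative f (at x) (axis i 1))"

text \<open>\<open>C\<^sup>\<infinity>\<close>: all iterated partial derivatives exist and are themselves (Frechet) differentiable,
  hence continuous.\<close>

definition smooth :: "(real^3 \<Rightarrow> 'b::real_normed_vector) \<Rightarrow> bool" where
  "smooth f \<longleftrightarrow> (\<forall>is. fold partial is f differentiable_on UNIV)"

definition divergence :: "field \<Rightarrow> real^3 \<Rightarrow> real" where
  "divergence u = (\<lambda>x. \<Sum>i\<in>UNIV. partial i u x $ i)"

definition solenoidal_test :: "field set" where
  "solenoidal_test = {u. periodic u \<and> smooth u \<and> (\<forall>x. divergence u x = 0) \<and> (LINT x|torus. u x) = 0}"

definition L2 :: "(real^3 \<Rightarrow> 'b::euclidean_space) set" where
  "L2 = {f. periodic f \<and> f \<in> borel_measurable torus \<and> integrable torus (\<lambda>x. (norm (f x))\<^sup>2)}"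

definition L2_inner :: "field \<Rightarrow> field \<Rightarrow> real" where
  "L2_inner u v = (LINT x|torus. u x \<bullet> v x)"

definition L2_norm :: "field \<Rightarrow> real" where
  "L2_norm u = sqrt (L2_inner u u)"

definition fourier :: "field \<Rightarrow> int^3 \<Rightarrow> complex^3" where
  "fourier u k = (LINT x|torus. (\<chi> j. of_real (u x $ j) * cis (- 2 * pi * (\<Sum>i\<in>UNIV. of_int (k $ i) * x $ i))))"

text \<open>\<open>(1 + |2\<pi>k|\<^sup>2)\<^sup>s\<close> is the symbol of \<open>(1 - \<Delta>)\<^sup>s\<close>. The value of \<open>Sobolev_norm s u\<close> is only meaningful for
  \<open>u\<close> in \<open>Sobolev s\<close>, since a divergent sum is \<open>0\<close>.\<close>

definition sobolev_weight :: "real \<Rightarrow> int^3 \<Rightarrow> real" where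
  "sobolev_weight s k = (1 + (2 * pi)\<^sup>2 * (\<Sum>i\<in>UNIV. (of_int (k $ i))\<^sup>2)) powr s"

definition Sobolev :: "real \<Rightarrow> field set" where
  "Sobolev s = {u \<in> L2. (\<lambda>k. sobolev_weight s k * (norm (fourier u k))\<^sup>2) summable_on UNIV}"

definition Sobolev_norm :: "real \<Rightarrow> field \<Rightarrow> real" where
  "Sobolev_norm s u = sqrt (\<Sum>\<^sub>\<infinity>k\<in>UNIV. sobolev_weight s k * (norm (fourier u k))\<^sup>2)"

definition H :: "field set" where
  "H = {u \<in> L2. \<forall>e>0. \<exists>v\<in>solenoidal_test. L2_norm (u - v) < e}"

definition V :: "real \<Rightarrow> field set" where
  "V s = {u \<in> Sobolev s. \<forall>e>0. \<exists>v\<in>solenoidal_test. Sobolev_norm s (u - v) < e}"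

section \<open>The Stokes operator and the bilinear form\<close>

text \<open>Operators return a representative of the (a.e. unique) class with the defining property.
  Outside the domain of the operator the value is unspecified.\<close>

definition weak_partial :: "3 \<Rightarrow> (real^3 \<Rightarrow> real) \<Rightarrow> real^3 \<Rightarrow> real" where
  "weak_partial i f = (SOME g. g \<in> L2 \<and>
     (\<forall>\<psi>. periodic \<psi> \<and> smooth \<psi> \<longrightarrow>
        (LINT x|torus. f x * partial i \<psi> x) = - (LINT x|torus. g x * \<psi> x)))"

definition laplacian :: "field \<Rightarrow> field" where
  "laplacian u = (\<lambda>x. \<chi> j. \<Sum>i\<in>UNIV. weak_partial i (weak_partial i (\<lambda>y. u y $ j)) x)"

definition leray :: "field \<Rightarrow> field" where
  "leray f = (SOME w. w \<in> H \<and> (\<forall>v\<in>H. L2_inner (f - w) v = 0))"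

definition stokes :: "field \<Rightarrow> field" where
  "stokes u = (\<lambda>x. - leray (laplacian u) x)"

definition stokes_eigenbasis :: "(nat \<Rightarrow> field) \<Rightarrow> (nat \<Rightarrow> real) \<Rightarrow> bool" where
  "stokes_eigenbasis \<phi> \<mu> \<longleftrightarrow>
     (\<forall>k. \<phi> k \<in> Sobolev 2 \<inter> H) \<and>
     (\<forall>k. AE x in torus. stokes (\<phi> k) x = \<mu> k *\<^sub>R \<phi> k x) \<and>
     (\<forall>j k. L2_inner (\<phi> j) (\<phi> k) = (if j = k then 1 else 0)) \<and>
     (\<forall>u\<in>H. (\<lambda>n. L2_norm (\<lambda>x. u x - (\<Sum>k<n. L2_inner u (\<phi> k) *\<^sub>R \<phi> k x))) \<longlonglongrightarrow> 0) \<and>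
     0 < \<mu> 0 \<and> mono \<mu> \<and> filterlim \<mu> at_top sequentially"

text \<open>\<open>A\<^sup>s u\<close> (defined when the series converges) does not depend on the eigenbasis that is used to
  compute it.\<close>

definition stokes_power :: "real \<Rightarrow> field \<Rightarrow> field" where
  "stokes_power s u = (SOME w. w \<in> H \<and> (\<exists>\<phi> \<mu>. stokes_eigenbasis \<phi> \<mu> \<and>
     (\<lambda>n. L2_norm (\<lambda>x. w x - (\<Sum>k<n. (\<mu> k powr s * L2_inner u (\<phi> k)) *\<^sub>R \<phi> k x))) \<longlonglongrightarrow> 0))"

definition advect :: "field \<Rightarrow> field \<Rightarrow> field" where
  "advect u v = (\<lambda>x. \<chi> j. \<Sum>i\<in>UNIV. u x $ i * weak_partial i (\<lambda>y. v y $ j) x)"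

text \<open>The duality pairing of \<open>B(u,v)\<close> with a divergence-free \<open>w\<close>.\<close>

definition B_pairing :: "field \<Rightarrow> field \<Rightarrow> field \<Rightarrow> real" where
  "B_pairing u v w = (LINT x|torus. advect u v x \<bullet> w x)"

section \<open>Time-dependent functions\<close>

text \<open>\<open>L\<^sup>2(0,T;X)\<close> for a normed space with carrier \<open>X\<close> and norm \<open>N\<close>: strongly measurable
  (an a.e. limit of simple functions) and with square integrable norm.\<close>

definition bochner_L2 :: "real \<Rightarrow> 'v::minus set \<Rightarrow> ('v \<Rightarrow> real) \<Rightarrow> (real \<Rightarrow> 'v) set" where
  "bochner_L2 T X N = {f.
     (AE t in lebesgue_on {0<..<T}. f t \<in> X) \<and>
     (\<exists>s :: nat \<Rightarrow> real \<Rightarrow> 'v.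
        (\<forall>n. simple_function (lebesgue_on {0<..<T}) (s n) \<and> (\<forall>t\<in>{0<..<T}. s n t \<in> X)) \<and>
        (AE t in lebesgue_on {0<..<T}. (\<lambda>n. N (s n t - f t)) \<longlonglongrightarrow> 0)) \<and>
     integrable (lebesgue_on {0<..<T}) (\<lambda>t. (N (f t))\<^sup>2)}"

definition continuous_V :: "real \<Rightarrow> real \<Rightarrow> (real \<Rightarrow> field) set" where
  "continuous_V T r = {u. (\<forall>t\<in>{0..T}. u t \<in> V r) \<and>
     (\<forall>t\<in>{0..T}. ((\<lambda>t'. Sobolev_norm r (u t' - u t)) \<longlongrightarrow> 0) (at t within {0..T}))}"

definition V_inter :: "real \<Rightarrow> field set" where
  "V_inter r = V 1 \<inter> V r"

definition V_inter_norm :: "real \<Rightarrow> field \<Rightarrow> real" where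
  "V_inter_norm r u = Sobolev_norm 1 u + Sobolev_norm r u"

text \<open>Elements of \<open>(V \<inter> V\<^sup>r)'\<close> are represented by functionals on all fields, of which only the
  values on \<open>V \<inter> V\<^sup>r\<close> matter.\<close>

definition V_dual :: "real \<Rightarrow> (field \<Rightarrow> real) set" where
  "V_dual r = {l.
     (\<forall>u\<in>V_inter r. \<forall>v\<in>V_inter r. l (\<lambda>x. u x + v x) = l u + l v) \<and>
     (\<forall>c. \<forall>u\<in>V_inter r. l (\<lambda>x. c *\<^sub>R u x) = c * l u) \<and>
     (\<exists>C. \<forall>u\<in>V_inter r. \<bar>l u\<bar> \<le> C * V_inter_norm r u)}"

definition V_dual_norm :: "real \<Rightarrow> (field \<Rightarrow> real) \<Rightarrow> real" where
  "V_dual_norm r l = (SUP v\<in>{v \<in> V_inter r. V_inter_norm r v \<le> 1}. \<bar>l v\<bar>)"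

definition time_test :: "real \<Rightarrow> (real \<Rightarrow> real) set" where
  "time_test T = {\<psi>. (\<forall>n. (deriv ^^ n) \<psi> differentiable_on UNIV) \<and>
     (\<exists>a b. 0 < a \<and> b < T \<and> (\<forall>t. t \<notin> {a..b} \<longrightarrow> \<psi> t = 0))}"

text \<open>\<open>g\<close> is the distributional time derivative of \<open>u\<close> as a function with values in
  \<open>(V \<inter> V\<^sup>r)'\<close>, where \<open>u(t) \<in> H\<close> is identified with the functional \<open>(u(t), \<cdot>)\<close>.\<close>

definition has_time_derivative ::
    "real \<Rightarrow> real \<Rightarrow> (real \<Rightarrow> field) \<Rightarrow> (real \<Rightarrow> field \<Rightarrow> real) \<Rightarrow> bool" where
  "has_time_derivative T r u g \<longleftrightarrow>
     (\<forall>\<psi>\<in>time_test T. \<forall>v\<in>V_inter r.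
        (LINT t|lebesgue_on {0<..<T}. deriv \<psi> t * L2_inner (u t) v) =
        - (LINT t|lebesgue_on {0<..<T}. \<psi> t * g t v))"

definition weak_solution ::
    "real \<Rightarrow> real \<Rightarrow> real \<Rightarrow> field \<Rightarrow> real \<Rightarrow> (real \<Rightarrow> field) \<Rightarrow> bool" where
  "weak_solution \<nu> \<alpha> r u0 T u \<longleftrightarrow>
     u \<in> continuous_V T r \<and>
     u \<in> bochner_L2 T (V_inter r) (V_inter_norm r) \<and>
     (\<exists>g. g \<in> bochner_L2 T (V_dual r) (V_dual_norm r) \<and> has_time_derivative T r u g) \<and>
     (\<forall>t\<in>{0..T}. \<forall>v\<in>V_inter r.
        L2_inner (u t) v
        + \<alpha> powr (2 * r) * L2_inner (stokes_power (r / 2) (u t)) (stokes_power (r / 2) v)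
        + \<nu> * (LINT \<tau>|lebesgue_on {0..t}.
                 L2_inner (stokes_power (1 / 2) (u \<tau>)) (stokes_power (1 / 2) v))
        = - (LINT \<tau>|lebesgue_on {0..t}. B_pairing (u \<tau>) (u \<tau>) v)
          + L2_inner u0 v
          + \<alpha> powr (2 * r) * L2_inner (stokes_power (r / 2) u0) (stokes_power (r / 2) v))"

end

theory Submission
  imports Defs
begin

text \<open>
  The Stokes operator is diagonalised by Hartley functions times vectors orthogonal to the frequency.
  In these coordinates the equation becomes \<open>m n * c' n + \<nu> * l n * c n + F c c n = 0\<close> with eigenvalues \<open>l n\<close> and
  \<open>m n = 1 + \<alpha> powr (2 * r) * l n powr r\<close>. Products of two functions of Sobolev order 3/4 are square integrable, and
  \<open>\<sigma> n = sqrt (m n * l n)\<close> dominates \<open>l n powr (3 / 4)\<close> because \<open>r \<ge> 1 / 2\<close>. So \<open>F\<close> maps the space with weight \<open>\<sigma>\<close>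
  to the one with weight \<open>1 / l\<close>. The weight \<open>\<sigma>\<close> lies halfway between \<open>m\<close> and \<open>l\<close>, so the \<open>\<sigma>\<close>-norm of a solution is in
  \<open>L\<^sup>4\<close> in time, and Picard iteration contracts as soon as this \<open>L\<^sup>4\<close> norm is small. Since \<open>F\<close> is
  skew, the energy inequality bounds this norm a priori and the solution is continued to all times.
  A field is a weak solution if and only if its coefficients solve the diagonal system.\<close>

section \<open>Weighted square sums and time integrals\<close>

text \<open>At \<open>r = 1 / 2\<close> the estimate of the quadratic term has no slack: it gains no
  power of time, and the length of an interval on which Picard iteration contracts depends on the
  linear flow of the datum itself, not only on its norm. An energy bound alone therefore gives no
  uniform time step for continuation. The time integral \<open>Z\<close> of the fourth power of the
  \<open>\<sigma>\<close>-norm takes its place. It is additive over adjacent intervals, so being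
  bounded it leaves little for late times; and where a solution has small \<open>Z\<close>, so has
  the linear flow from the same datum, which is the hypothesis of the local theory.

  Sums are kept in \<open>ennreal\<close>: membership in a weighted space is finiteness of
  \<open>sqn\<close>, and inequalities need no summability conditions. Coefficients also remove the
  null sets, since they are determined while operators and synthesis only return representatives
  chosen up to equality almost everywhere.\<close>

definition sqn :: "(nat \<Rightarrow> real) \<Rightarrow> (nat \<Rightarrow> real) \<Rightarrow> ennreal" where
  "sqn w c = (\<Sum>n. ennreal (w n * (c n)^2))"

lemma sqn_finite_iff:
  assumes "\<And>n. 0 \<le> w n"
  shows "sqn w c < \<infinity> \<longleftrightarrow> summable (\<lambda>n. w n * (c n)^2)"
proof
  assume "sqn w c < \<infinity>"
  then show "summable (\<lambda>n. w n * (c n)^2)" unfolding sqn_def using assms by (intro summable_suminf_not_top) auto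
next
  assume "summable (\<lambda>n. w n * (c n)^2)"
  then have "(\<Sum>n. ennreal (w n * (c n)^2)) \<noteq> top" using assms by (intro ennreal_suminf_neq_top) auto
  then show "sqn w c < \<infinity>" by (simp only: sqn_def infinity_ennreal_def less_top)
qed

lemma sqn_eq_suminf:
  assumes "\<And>n. 0 \<le> w n" "summable (\<lambda>n. w n * (c n)^2)"
  shows "sqn w c = ennreal (\<Sum>n. w n * (c n)^2)"
  unfolding sqn_def using assms by (intro suminf_ennreal2) auto

lemma sqn_term_le:
  shows "ennreal (w n * (c n)^2) \<le> sqn w c"
  unfolding sqn_def
  using sum_le_suminf[of "\<lambda>n. ennreal (w n * (c n)^2)" "{n}"] by simp

lemma sqn_add:
  assumes "\<And>n. 0 \<le> w n"
  shows "sqn w (\<lambda>n. c n + d n) \<le> 2 * sqn w c + 2 * sqn w d"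
proof -
  have "sqn w (\<lambda>n. c n + d n) \<le> (\<Sum>n. 2 * ennreal (w n * (c n)^2) + 2 * ennreal (w n * (d n)^2))" unfolding sqn_def
  proof (intro suminf_le allI)
    fix n
    have "(c n + d n)^2 \<le> 2 * (c n)^2 + 2 * (d n)^2" using zero_le_power2[of "c n - d n"] by (simp add: power2_eq_square algebra_simps)
    then have "w n * (c n + d n)^2 \<le> 2 * (w n * (c n)^2) + 2 * (w n * (d n)^2)"
      using mult_left_mono[OF _ assms[of n]] by (fastforce simp: algebra_simps)
    then have "ennreal (w n * (c n + d n)^2) \<le> ennreal (2 * (w n * (c n)^2) + 2 * (w n * (d n)^2))" by (rule ennreal_leI)
    also have "... = 2 * ennreal (w n * (c n)^2) + 2 * ennreal (w n * (d n)^2)"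
      using assms[of n] by (simp add: ennreal_plus ennreal_mult)
    finally show "ennreal (w n * (c n + d n)^2) \<le> 2 * ennreal (w n * (c n)^2) + 2 * ennreal (w n * (d n)^2)" .
  qed auto
  also have "... = 2 * sqn w c + 2 * sqn w d" unfolding sqn_def by (simp add: suminf_add[symmetric])
  finally show ?thesis .
qed

lemma sqn_uminus: "sqn w (\<lambda>n. - c n) = sqn w c" by (simp add: sqn_def)

lemma sqn_minus_commute: "sqn w (\<lambda>n. c n - d n) = sqn w (\<lambda>n. d n - c n)" by (simp add: sqn_def power2_commute)

lemma sqn_zero [simp]: "sqn w (\<lambda>n. 0) = 0" by (simp add: sqn_def)

lemma sqn_diff:
  assumes "\<And>n. 0 \<le> w n"
  shows "sqn w (\<lambda>n. c n - d n) \<le> 2 * sqn w c + 2 * sqn w d"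
  using sqn_add[OF assms, where c = c and d = "\<lambda>n. - d n"] by (simp add: sqn_uminus)

lemma sqn_mono:
  assumes "\<And>n. w n * (c n)^2 \<le> w' n * (c' n)^2"
  shows "sqn w c \<le> sqn w' c'"
  unfolding sqn_def using assms by (intro suminf_le ennreal_leI) auto

lemma sqn_scale:
  assumes "0 \<le> a" "\<And>n. 0 \<le> w n"
  shows "sqn (\<lambda>n. a * w n) c = ennreal a * sqn w c"
  using assms by (simp add: sqn_def mult.assoc ennreal_mult)

lemma sqn_eq_0:
  assumes "\<And>n. 0 < w n" "sqn w c = 0"
  shows "c = (\<lambda>n. 0)"
proof
  fix n
  have "ennreal (w n * (c n)^2) \<le> 0" using sqn_term_le[of w n c] assms by simp
  then have "w n * (c n)^2 \<le> 0" by (simp add: ennreal_eq_0_iff)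
  then show "c n = 0" using assms(1)[of n] by (simp add: mult_le_0_iff)
qed

lemma sqn_measurable [measurable (raw)]:
  assumes [measurable]: "\<And>n. (\<lambda>t. c t n) \<in> borel_measurable M"
  shows "(\<lambda>t. sqn w (c t)) \<in> borel_measurable M"
  unfolding sqn_def by measurable

text \<open>Cauchy-Schwarz on the counting measure, with each term split as
  \<open>sqrt (m n) * \<bar>c n\<bar>\<close> times
  \<open>sqrt (l n) * \<bar>c n\<bar>\<close>.\<close>

lemma sqn_interpolate:
  assumes "\<And>n. 0 \<le> m n" "\<And>n. 0 \<le> l n"
  shows "(sqn (\<lambda>n. sqrt (m n * l n)) c)^2 \<le> sqn m c * sqn l c"
proof -
  let ?f = "\<lambda>n. ennreal (sqrt (m n) * \<bar>c n\<bar>)" and ?g = "\<lambda>n. ennreal (sqrt (l n) * \<bar>c n\<bar>)"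
  have "(\<integral>\<^sup>+n. ?f n * ?g n \<partial>count_space UNIV)^2
      \<le> (\<integral>\<^sup>+n. (?f n)^2 \<partial>count_space UNIV) * (\<integral>\<^sup>+n. (?g n)^2 \<partial>count_space UNIV)" by (intro Cauchy_Schwarz_nn_integral) auto
  moreover have "?f n * ?g n = ennreal (sqrt (m n * l n) * (c n)^2)" for n
  proof -
    have "sqrt (m n) * \<bar>c n\<bar> * (sqrt (l n) * \<bar>c n\<bar>) = sqrt (m n * l n) * (c n)^2" by (simp add: real_sqrt_mult power2_eq_square) 
    then show ?thesis using assms by (simp add: ennreal_mult'[symmetric])
  qed
  moreover have "(?f n)^2 = ennreal (m n * (c n)^2)" "(?g n)^2 = ennreal (l n * (c n)^2)" for n
    using assms by (auto simp: ennreal_power power_mult_distrib)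
  ultimately show ?thesis unfolding sqn_def by (simp add: nn_integral_count_space_nat)
qed

text \<open>Fatou's lemma for sums: every finite partial sum passes to the limit, and the supremum
  over them keeps the bound \<open>B\<close>.\<close>

lemma sqn_limit_le:
  assumes w: "\<And>n. 0 \<le> w n" and lim: "\<And>n. (\<lambda>j. c j n) \<longlonglongrightarrow> d n"
    and B: "\<forall>\<^sub>F j in sequentially. sqn w (c j) \<le> B"
  shows "sqn w d \<le> B"
  unfolding sqn_def suminf_eq_SUP
proof (rule SUP_least)
  fix N
  have "(\<lambda>j. \<Sum>n<N. ennreal (w n * (c j n)^2)) \<longlonglongrightarrow> (\<Sum>n<N. ennreal (w n * (d n)^2))"
    by (intro tendsto_sum tendsto_ennrealI tendsto_intros lim)
  moreover have "\<forall>\<^sub>F j in sequentially. (\<Sum>n<N. ennreal (w n * (c j n)^2)) \<le> B" using B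
  proof eventually_elim
    case (elim j)
    have "(\<Sum>n<N. ennreal (w n * (c j n)^2)) \<le> sqn w (c j)" unfolding sqn_def by (rule sum_le_suminf) auto
    with elim show ?case by order
  qed
  ultimately show "(\<Sum>n<N. ennreal (w n * (d n)^2)) \<le> B" by (rule tendsto_upperbound) simp
qed

text \<open>The form needed inside a time integral, where no bound uniform in the index is at hand.
  A number above the liminf bounds infinitely many members, and along that subsequence
  \<open>sqn_limit_le\<close> applies.\<close>

lemma sqn_liminf_le:
  assumes w: "\<And>n. 0 \<le> w n" and lim: "\<And>n. (\<lambda>j. c j n) \<longlonglongrightarrow> d n"
  shows "sqn w d \<le> liminf (\<lambda>j. sqn w (c j))"
proof (rule dense_ge)
  fix y assume y: "liminf (\<lambda>j. sqn w (c j)) < y"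
  have ex: "\<exists>j\<ge>N. sqn w (c j) < y" for N
  proof (rule ccontr)
    assume "\<not> (\<exists>j\<ge>N. sqn w (c j) < y)"
    then have "\<forall>\<^sub>F j in sequentially. y \<le> sqn w (c j)" unfolding eventually_sequentially by (intro exI[of _ N]) (auto simp: not_less)
    then have "y \<le> liminf (\<lambda>j. sqn w (c j))" by (rule Liminf_bounded)
    with y show False by simp
  qed
  then have "\<exists>\<^sub>\<infinity>j. sqn w (c j) < y" by (auto simp: INFM_nat_le)
  then have inf: "infinite {j. sqn w (c j) < y}" by (simp add: INFM_iff_infinite)
  define r where "r = enumerate {j. sqn w (c j) < y}"
  have r: "strict_mono r" "\<And>j. sqn w (c (r j)) < y" using strict_mono_enumerate[OF inf] enumerate_in_set[OF inf] by (auto simp: r_def)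
  show "sqn w d \<le> y"
  proof (rule sqn_limit_le[OF w])
    show "(\<lambda>j. c (r j) n) \<longlonglongrightarrow> d n" for n using LIMSEQ_subseq_LIMSEQ[OF lim r(1)] by (simp add: o_def)
    show "\<forall>\<^sub>F j in sequentially. sqn w (c (r j)) \<le> y" using r(2) by (auto intro!: always_eventually less_imp_le)
  qed
qed

section \<open>Integrals over time intervals\<close>

definition II :: "real \<Rightarrow> real \<Rightarrow> (real \<Rightarrow> ennreal) \<Rightarrow> ennreal" where
  "II s t g = (\<integral>\<^sup>+\<tau>. g \<tau> \<partial>lebesgue_on {s..t})"

abbreviation sqn_int :: "real \<Rightarrow> real \<Rightarrow> (nat \<Rightarrow> real) \<Rightarrow> (real \<Rightarrow> nat \<Rightarrow> real) \<Rightarrow> ennreal" where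
  "sqn_int s t w u \<equiv> II s t (\<lambda>\<tau>. sqn w (u \<tau>))"

lemma II_eq: "II s t g = (\<integral>\<^sup>+\<tau>. g \<tau> * indicator {s..t} \<tau> \<partial>lebesgue)"
  unfolding II_def by (simp add: nn_integral_restrict_space)

lemma II_mono: "(\<And>\<tau>. \<tau> \<in> {s..t} \<Longrightarrow> g \<tau> \<le> h \<tau>) \<Longrightarrow> II s t g \<le> II s t h"
  unfolding II_def by (intro nn_integral_mono) simp

lemma II_cong: "(\<And>\<tau>. \<tau> \<in> {s..t} \<Longrightarrow> g \<tau> = h \<tau>) \<Longrightarrow> II s t g = II s t h"
  unfolding II_def by (intro nn_integral_cong) simp

lemma II_subset: "s \<le> s' \<Longrightarrow> t' \<le> t \<Longrightarrow> II s' t' g \<le> II s t g"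
  unfolding II_eq by (intro nn_integral_mono mult_left_mono) (auto simp: indicator_def)

lemma II_split:
  assumes "g \<in> borel_measurable (lebesgue_on {s..t})" "s \<le> r" "r \<le> t"
  shows "II s t g = II s r g + II r t g"
proof -
  have m: "(\<lambda>\<tau>. g \<tau> * indicator {s..t} \<tau>) \<in> borel_measurable lebesgue"
    using assms(1) borel_measurable_restrict_space_iff_ennreal by (simp add: borel_measurable_restrict_space_iff_ennreal)
  have ae: "AE \<tau> in lebesgue. \<tau> \<noteq> r" using AE_completion[OF AE_lborel_singleton] by blast
  have "II s t g = (\<integral>\<^sup>+\<tau>. (g \<tau> * indicator {s..t} \<tau>) * indicator {s..r} \<tau> + (g \<tau> * indicator {s..t} \<tau>) * indicator {r..t} \<tau> \<partial>lebesgue)"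
    unfolding II_eq by (intro nn_integral_cong_AE eventually_mono[OF ae]) (use assms in \<open>auto simp: indicator_def\<close>)
  also have "... = (\<integral>\<^sup>+\<tau>. (g \<tau> * indicator {s..t} \<tau>) * indicator {s..r} \<tau> \<partial>lebesgue) + (\<integral>\<^sup>+\<tau>. (g \<tau> * indicator {s..t} \<tau>) * indicator {r..t} \<tau> \<partial>lebesgue)"
    by (intro nn_integral_add borel_measurable_times_ennreal m borel_measurable_indicator) auto
  also have "... = II s r g + II r t g" unfolding II_eq using assms
    by (intro arg_cong2[where f="(+)"] nn_integral_cong) (auto simp: indicator_def)
  finally show ?thesis .
qed

lemma II_continuous:
  assumes "continuous_on {s..t} f" "\<And>\<tau>. \<tau> \<in> {s..t} \<Longrightarrow> 0 \<le> f \<tau>"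
  shows "II s t (\<lambda>\<tau>. ennreal (f \<tau>)) = ennreal (integral {s..t} f)"
proof -
  have i: "integrable (lebesgue_on {s..t}) f" using continuous_imp_integrable_real assms(1) by blast
  have "II s t (\<lambda>\<tau>. ennreal (f \<tau>)) = ennreal (integral\<^sup>L (lebesgue_on {s..t}) f)"
    unfolding II_def using assms by (intro nn_integral_eq_integral[OF i]) auto
  also have "integral\<^sup>L (lebesgue_on {s..t}) f = integral {s..t} f" by (rule lebesgue_integral_eq_integral[OF i]) simp
  finally show ?thesis .
qed

text \<open>Absolute continuity of the integral: the primitive of \<open>h\<close> is uniformly
  continuous on the compact interval. The same \<open>\<delta>\<close> works for every starting
  point, which is what allows stepping through \<open>{s..T}\<close>.\<close>

lemma II_small:
  assumes m: "g \<in> borel_measurable (lebesgue_on {s..T})" and fin: "II s T g < \<infinity>" and "0 < (e::real)"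
  obtains \<delta> where "\<delta> > 0" "\<And>t t'. s \<le> t \<Longrightarrow> t' \<le> T \<Longrightarrow> t' \<le> t + \<delta> \<Longrightarrow> II t t' g \<le> ennreal e"
proof -
  define h where "h \<tau> = enn2real (g \<tau>)" for \<tau>
  have ae: "AE \<tau> in lebesgue_on {s..T}. g \<tau> = ennreal (h \<tau>)" using nn_integral_PInf_AE[OF m] fin unfolding II_def h_def
    by (auto simp: less_top[symmetric] elim!: eventually_mono)
  have hm: "h \<in> borel_measurable (lebesgue_on {s..T})" unfolding h_def using m by measurable
  have eq0: "II s T g = (\<integral>\<^sup>+\<tau>. ennreal (h \<tau>) \<partial>lebesgue_on {s..T})" unfolding II_def using ae by (rule nn_integral_cong_AE)
  have hi: "integrable (lebesgue_on {s..T}) h" using hm fin eq0 by (intro integrableI_nonneg) (auto simp: h_def)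
  then have hio: "h integrable_on {s..T}"
    by (meson integrable_on_lebesgue_on lmeasurable_cbox[of s T] fmeasurableD lmeasurable_interval(1))
  have "continuous_on {s..T} (\<lambda>x. integral {s..x} h)" by (rule indefinite_integral_continuous_1[OF hio])
  then have "uniformly_continuous_on {s..T} (\<lambda>x. integral {s..x} h)" by (rule compact_uniformly_continuous) simp
  then obtain d where d: "d > 0" "\<And>x y. x \<in> {s..T} \<Longrightarrow> y \<in> {s..T} \<Longrightarrow> dist x y < d \<Longrightarrow>
      dist (integral {s..x} h) (integral {s..y} h) < e" unfolding uniformly_continuous_on_def using \<open>0 < e\<close> by metis
  show ?thesis
  proof (rule that[of "d / 2"])
    fix t t' assume t: "s \<le> t" "t' \<le> T" "t' \<le> t + d / 2"
    show "II t t' g \<le> ennreal e"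
    proof (cases "t \<le> t'")
      case True
      have hi': "integrable (lebesgue_on {t..t'}) h" using t by (intro integrable_subinterval[OF hi]) auto
      have "II t t' g = II t t' (\<lambda>\<tau>. ennreal (h \<tau>))"
      proof -
        have "AE \<tau> in lebesgue. \<tau> \<in> {s..T} \<longrightarrow> g \<tau> = ennreal (h \<tau>)" using ae by (simp add: AE_restrict_space_iff)
        then show ?thesis unfolding II_eq by (intro nn_integral_cong_AE) (use t in \<open>auto elim!: eventually_mono simp: indicator_def\<close>)
      qed
      also have "... = ennreal (integral\<^sup>L (lebesgue_on {t..t'}) h)"
        unfolding II_def by (intro nn_integral_eq_integral[OF hi']) (auto simp: h_def)
      also have "integral\<^sup>L (lebesgue_on {t..t'}) h = integral {t..t'} h" by (rule lebesgue_integral_eq_integral[OF hi']) simp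
      also have "integral {t..t'} h = integral {s..t'} h - integral {s..t} h"
        using Henstock_Kurzweil_Integration.integral_combine[of s t t' h] t True
          integrable_on_subinterval[OF hio, of s t'] by auto
      also have "ennreal ... \<le> ennreal e" using d(2)[of t' t] t True d(1) by (intro ennreal_leI) (auto simp: dist_real_def)
      finally show ?thesis .
    next
      case False
      then show ?thesis by (simp add: II_eq)
    qed
  qed (use d in simp)
qed

section \<open>Diagonal linear evolution equations\<close>

lemma continuous_integral_equation_deriv:
  fixes y h :: "real \<Rightarrow> real"
  assumes "0 < \<mu>" and h: "continuous_on {s..T} h"
    and eq: "\<And>t. t \<in> {s..T} \<Longrightarrow> \<mu> * y t = \<mu> * y s + integral {s..t} h"
    and t: "t \<in> {s..T}"
  shows "(y has_real_derivative h t / \<mu>) (at t within {s..T})"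
proof -
  have "((\<lambda>t. integral {s..t} h) has_real_derivative h t) (at t within {s..T})" by (rule integral_has_real_derivative[OF h t])
  then have d: "((\<lambda>t. y s + integral {s..t} h / \<mu>) has_real_derivative h t / \<mu>) (at t within {s..T})"
    using \<open>0 < \<mu>\<close> by (auto intro!: derivative_eq_intros)
  have e: "y t' = y s + integral {s..t'} h / \<mu>" if "t' \<in> {s..T}" for t' using eq[OF that] \<open>0 < \<mu>\<close> by (simp add: field_simps)
  show ?thesis by (rule has_field_derivative_transform_within[OF d zero_less_one t]) (rule e[symmetric])
qed

text \<open>The fundamental theorem of calculus for \<open>\<mu> * (y t)^2\<close>, whose derivative
  along the equation is \<open>2 * (f * y) - 2 * \<kappa> * y^2\<close>.\<close>

lemma mode_energy:
  fixes y f :: "real \<Rightarrow> real"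
  assumes "0 < \<mu>" and f: "continuous_on {s..T} f" and y: "continuous_on {s..T} y"
    and eq: "\<And>t. t \<in> {s..T} \<Longrightarrow> \<mu> * y t = \<mu> * y s + integral {s..t} (\<lambda>\<tau>. f \<tau> - \<kappa> * y \<tau>)"
    and t: "t \<in> {s..T}"
  shows "\<mu> * (y t)^2 + 2 * \<kappa> * integral {s..t} (\<lambda>\<tau>. (y \<tau>)^2)
       = \<mu> * (y s)^2 + 2 * integral {s..t} (\<lambda>\<tau>. f \<tau> * y \<tau>)"
proof -
  have sub: "{s..t} \<subseteq> {s..T}" using t by auto
  note f' = continuous_on_subset[OF f sub] and y' = continuous_on_subset[OF y sub]
  have "((\<lambda>\<tau>. \<mu> * (y \<tau>)^2) has_vector_derivative 2 * (f \<tau> * y \<tau>) - 2 * \<kappa> * (y \<tau>)^2) (at \<tau> within {s..t})"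
    if "\<tau> \<in> {s..t}" for \<tau>
  proof -
    have "(y has_real_derivative (f \<tau> - \<kappa> * y \<tau>) / \<mu>) (at \<tau> within {s..T})"
      using that t by (intro continuous_integral_equation_deriv[OF \<open>0 < \<mu>\<close> _ eq]) (auto intro!: continuous_intros f y)
    then have "(y has_real_derivative (f \<tau> - \<kappa> * y \<tau>) / \<mu>) (at \<tau> within {s..t})" using sub by (rule has_field_derivative_subset)
    then have "((\<lambda>\<tau>. \<mu> * (y \<tau>)^2) has_real_derivative 2 * (f \<tau> * y \<tau>) - 2 * \<kappa> * (y \<tau>)^2) (at \<tau> within {s..t})"
      using \<open>0 < \<mu>\<close> by (auto intro!: derivative_eq_intros simp: field_simps power2_eq_square)
    then show ?thesis by (simp add: has_real_derivative_iff_has_vector_derivative)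
  qed
  then have "((\<lambda>\<tau>. 2 * (f \<tau> * y \<tau>) - 2 * \<kappa> * (y \<tau>)^2) has_integral \<mu> * (y t)^2 - \<mu> * (y s)^2) {s..t}"
    using t by (intro fundamental_theorem_of_calculus) auto
  moreover have "((\<lambda>\<tau>. 2 * (f \<tau> * y \<tau>) - 2 * \<kappa> * (y \<tau>)^2) has_integral
      2 * integral {s..t} (\<lambda>\<tau>. f \<tau> * y \<tau>) - 2 * \<kappa> * integral {s..t} (\<lambda>\<tau>. (y \<tau>)^2)) {s..t}"
    by (intro has_integral_diff has_integral_mult_right integrable_integral integrable_continuous_interval continuous_intros f' y')
  ultimately have "\<mu> * (y t)^2 - \<mu> * (y s)^2 = 2 * integral {s..t} (\<lambda>\<tau>. f \<tau> * y \<tau>) - 2 * \<kappa> * integral {s..t} (\<lambda>\<tau>. (y \<tau>)^2)"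
    by (rule has_integral_unique)
  then show ?thesis by simp
qed

text \<open>Young's inequality \<open>2 * (f * y) \<le> \<kappa> * y^2 + f^2 / \<kappa>\<close>
  spends half of the dissipation on the source. With \<open>\<kappa>\<close> proportional to the
  eigenvalue, this is why sources are measured with the inverse eigenvalue as weight.\<close>

lemma mode_energy_le:
  fixes y f :: "real \<Rightarrow> real"
  assumes "0 < \<mu>" "0 < \<kappa>" and f: "continuous_on {s..T} f" and y: "continuous_on {s..T} y"
    and eq: "\<And>t. t \<in> {s..T} \<Longrightarrow> \<mu> * y t = \<mu> * y s + integral {s..t} (\<lambda>\<tau>. f \<tau> - \<kappa> * y \<tau>)"
    and t: "t \<in> {s..T}"
  shows "\<mu> * (y t)^2 + \<kappa> * integral {s..t} (\<lambda>\<tau>. (y \<tau>)^2)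
       \<le> \<mu> * (y s)^2 + integral {s..t} (\<lambda>\<tau>. (f \<tau>)^2) / \<kappa>"
proof -
  have sub: "{s..t} \<subseteq> {s..T}" using t by auto
  note f' = continuous_on_subset[OF f sub] and y' = continuous_on_subset[OF y sub]
  have "integral {s..t} (\<lambda>\<tau>. 2 * (f \<tau> * y \<tau>)) \<le> integral {s..t} (\<lambda>\<tau>. \<kappa> * (y \<tau>)^2 + (f \<tau>)^2 / \<kappa>)"
  proof (intro integral_le integrable_continuous_interval continuous_intros f' y')
    fix \<tau>
    have "0 \<le> (\<kappa> * y \<tau> - f \<tau>)^2 / \<kappa>" using \<open>0 < \<kappa>\<close> by simp
    also have "... = \<kappa> * (y \<tau>)^2 + (f \<tau>)^2 / \<kappa> - 2 * (f \<tau> * y \<tau>)" using \<open>0 < \<kappa>\<close> by (simp add: power2_eq_square field_simps)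
    finally show "2 * (f \<tau> * y \<tau>) \<le> \<kappa> * (y \<tau>)^2 + (f \<tau>)^2 / \<kappa>" by simp
  qed (use \<open>0 < \<kappa>\<close> in auto)
  also have "... = \<kappa> * integral {s..t} (\<lambda>\<tau>. (y \<tau>)^2) + integral {s..t} (\<lambda>\<tau>. (f \<tau>)^2) / \<kappa>"
    by (subst Henstock_Kurzweil_Integration.integral_add)
       (use \<open>0 < \<kappa>\<close> in \<open>auto intro!: integrable_continuous_interval continuous_intros f' y'\<close>)
  finally show ?thesis using mode_energy[OF \<open>0 < \<mu>\<close> f y eq t] by simp
qed

text \<open>Variation of constants: \<open>h\<close> is the source divided by \<open>\<mu>\<close>
  and multiplied by the integrating factor \<open>exp (k * (\<tau> - s))\<close>.\<close>

lemma mode_exists: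
  fixes f :: "real \<Rightarrow> real"
  assumes "0 < \<mu>" and f: "continuous_on {s..T} f"
  obtains y where "y s = a" "continuous_on {s..T} y"
    "\<And>t. t \<in> {s..T} \<Longrightarrow> \<mu> * y t = \<mu> * a + integral {s..t} (\<lambda>\<tau>. f \<tau> - \<kappa> * y \<tau>)"
proof -
  define k where "k = \<kappa> / \<mu>"
  define h where "h \<tau> = exp (k * (\<tau> - s)) * f \<tau> / \<mu>" for \<tau>
  define y where "y t = exp (- k * (t - s)) * (a + integral {s..t} h)" for t
  have h: "continuous_on {s..T} h" unfolding h_def using \<open>0 < \<mu>\<close> by (intro continuous_intros f) auto
  have der: "(y has_real_derivative (f t - \<kappa> * y t) / \<mu>) (at t within {s..T})" if t: "t \<in> {s..T}" for t
  proof -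
    have "((\<lambda>t. integral {s..t} h) has_real_derivative h t) (at t within {s..T})" by (rule integral_has_real_derivative[OF h t])
    then have "(y has_real_derivative (- k) * exp (- k * (t - s)) * (a + integral {s..t} h) + exp (- k * (t - s)) * h t) (at t within {s..T})"
      unfolding y_def[abs_def] by (auto intro!: derivative_eq_intros)
    moreover have "exp (- k * (t - s)) * h t = f t / \<mu>" by (simp add: h_def exp_minus_inverse mult.assoc[symmetric] exp_add[symmetric])
    moreover have "(- k) * exp (- k * (t - s)) * (a + integral {s..t} h) = - \<kappa> * y t / \<mu>" by (simp add: y_def k_def)
    ultimately show ?thesis by (simp add: diff_divide_distrib)
  qed
  have y: "continuous_on {s..T} y" by (rule DERIV_continuous_on) (rule der)
  show ?thesis
  proof (rule that[of y])
    show "y s = a" by (simp add: y_def)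
    show "\<mu> * y t = \<mu> * a + integral {s..t} (\<lambda>\<tau>. f \<tau> - \<kappa> * y \<tau>)" if t: "t \<in> {s..T}" for t
    proof -
      have sub: "{s..t} \<subseteq> {s..T}" using t by auto
      have "((\<lambda>\<tau>. f \<tau> - \<kappa> * y \<tau>) has_integral \<mu> * y t - \<mu> * y s) {s..t}"
      proof (rule fundamental_theorem_of_calculus)
        fix \<tau> assume \<tau>: "\<tau> \<in> {s..t}"
        then have "(y has_real_derivative (f \<tau> - \<kappa> * y \<tau>) / \<mu>) (at \<tau> within {s..t})"
          using has_field_derivative_subset[OF der sub] sub by auto
        then have "((\<lambda>\<tau>. \<mu> * y \<tau>) has_real_derivative f \<tau> - \<kappa> * y \<tau>) (at \<tau> within {s..t})"
          using \<open>0 < \<mu>\<close> by (auto intro!: derivative_eq_intros)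
        then show "((\<lambda>\<tau>. \<mu> * y \<tau>) has_vector_derivative f \<tau> - \<kappa> * y \<tau>) (at \<tau> within {s..t})"
          by (simp add: has_real_derivative_iff_has_vector_derivative)
      qed (use t in auto)
      then show ?thesis by (simp add: integral_unique y_def)
    qed
  qed (fact y)
qed

locale diagonal_evolution =
  fixes m l :: "nat \<Rightarrow> real" and \<nu> :: real
  assumes m_ge: "\<And>n. 1 \<le> m n" and l_ge: "\<And>n. 1 \<le> l n" and \<nu>_pos: "0 < \<nu>"
begin

lemma m_nonneg [simp]: "0 \<le> m n" and m_pos: "0 < m n"
  using m_ge[of n] by auto

lemma l_nonneg [simp]: "0 \<le> l n" and l_pos: "0 < l n"
  using l_ge[of n] by auto

definition il :: "nat \<Rightarrow> real" where "il n = 1 / l n"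
definition \<sigma> :: "nat \<Rightarrow> real" where "\<sigma> n = sqrt (m n * l n)"

lemma il_nonneg [simp]: "0 \<le> il n" and \<sigma>_nonneg [simp]: "0 \<le> \<sigma> n" and \<sigma>_pos: "0 < \<sigma> n"
  using m_pos l_pos by (auto simp: il_def \<sigma>_def)

text \<open>The equation is imposed mode by mode and integrated in time. Modewise continuity
  suffices to state it; bounds in weighted spaces are consequences.\<close>

definition linear_solution :: "real \<Rightarrow> real \<Rightarrow> (real \<Rightarrow> nat \<Rightarrow> real) \<Rightarrow> (real \<Rightarrow> nat \<Rightarrow> real) \<Rightarrow> bool" where
  "linear_solution s T f y \<longleftrightarrow> (\<forall>n. continuous_on {s..T} (\<lambda>t. f t n) \<and> continuous_on {s..T} (\<lambda>t. y t n) \<and>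
     (\<forall>t\<in>{s..T}. m n * y t n = m n * y s n + integral {s..t} (\<lambda>\<tau>. f \<tau> n - (\<nu> * l n) * y \<tau> n)))"

definition weighted_continuous :: "real \<Rightarrow> real \<Rightarrow> (real \<Rightarrow> nat \<Rightarrow> real) \<Rightarrow> bool" where
  "weighted_continuous s T u \<longleftrightarrow> (\<forall>t\<in>{s..T}. sqn m (u t) < \<infinity> \<and>
     ((\<lambda>t'. sqn m (\<lambda>n. u t' n - u t n)) \<longlongrightarrow> 0) (at t within {s..T}))"

text \<open>\<open>sqn \<sigma>\<close> is already a squared norm, so this is the fourth power of an
  L4 norm in time.\<close>

definition Z :: "real \<Rightarrow> real \<Rightarrow> (real \<Rightarrow> nat \<Rightarrow> real) \<Rightarrow> ennreal" where
  "Z s t u = II s t (\<lambda>\<tau>. (sqn \<sigma> (u \<tau>))^2)"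

lemma measurable_sqn_interval:
  fixes s t :: real
  assumes "\<And>n. continuous_on {s..t} (\<lambda>\<tau>. u \<tau> n)"
  shows "(\<lambda>\<tau>. sqn w (u \<tau>)) \<in> borel_measurable (lebesgue_on {s..t})"
  using assms by (intro sqn_measurable continuous_imp_measurable_on_sets_lebesgue) auto

lemma II_sqn:
  assumes "\<And>n. continuous_on {s..t} (\<lambda>\<tau>. u \<tau> n)" "\<And>n. 0 \<le> w n"
  shows "sqn_int s t w u = (\<Sum>n. ennreal (w n * integral {s..t} (\<lambda>\<tau>. (u \<tau> n)^2)))"
proof -
  have "sqn_int s t w u = (\<Sum>n. II s t (\<lambda>\<tau>. ennreal (w n * (u \<tau> n)^2)))" unfolding II_def sqn_def
    by (intro nn_integral_suminf measurable_compose[OF _ measurable_ennreal]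
        continuous_imp_measurable_on_sets_lebesgue continuous_intros assms) auto
  also have "... = (\<Sum>n. ennreal (w n * integral {s..t} (\<lambda>\<tau>. (u \<tau> n)^2)))"
    using assms by (subst II_continuous) (auto intro!: continuous_intros)
  finally show ?thesis .
qed

lemma linear_solutionD:
  assumes "linear_solution s T f y"
  shows "continuous_on {s..T} (\<lambda>t. f t n)" "continuous_on {s..T} (\<lambda>t. y t n)"
    "t \<in> {s..T} \<Longrightarrow> m n * y t n = m n * y s n + integral {s..t} (\<lambda>\<tau>. f \<tau> n - (\<nu> * l n) * y \<tau> n)"
  using assms unfolding linear_solution_def by blast+

lemma linear_solution_mono:
  assumes "linear_solution s T f y" "s \<le> s'" "T' \<le> T"
  shows "linear_solution s' T' f y"
  unfolding linear_solution_def
proof (intro allI conjI ballI)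
  fix n
  have sub: "{s'..T'} \<subseteq> {s..T}" using assms by auto
  have c: "continuous_on {s..T} (\<lambda>t. f t n)" "continuous_on {s..T} (\<lambda>t. y t n)"
    and eq: "\<And>t. t \<in> {s..T} \<Longrightarrow> m n * y t n = m n * y s n + integral {s..t} (\<lambda>\<tau>. f \<tau> n - (\<nu> * l n) * y \<tau> n)"
    using linear_solutionD[OF assms(1)] by blast+
  then show "continuous_on {s'..T'} (\<lambda>t. f t n)" "continuous_on {s'..T'} (\<lambda>t. y t n)" using continuous_on_subset[OF _ sub] by auto
  fix t assume t: "t \<in> {s'..T'}"
  have "(\<lambda>\<tau>. f \<tau> n - (\<nu> * l n) * y \<tau> n) integrable_on {s..t}"
    using t sub assms by (intro integrable_continuous_interval continuous_intros continuous_on_subset[OF c(1)] continuous_on_subset[OF c(2)]) auto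
  then have "integral {s..t} (\<lambda>\<tau>. f \<tau> n - (\<nu> * l n) * y \<tau> n) = integral {s..s'} (\<lambda>\<tau>. f \<tau> n - (\<nu> * l n) * y \<tau> n) + integral {s'..t} (\<lambda>\<tau>. f \<tau> n - (\<nu> * l n) * y \<tau> n)"
    using assms t by (intro Henstock_Kurzweil_Integration.integral_combine[symmetric]) auto
  then show "m n * y t n = m n * y s' n + integral {s'..t} (\<lambda>\<tau>. f \<tau> n - (\<nu> * l n) * y \<tau> n)" using eq[of t] eq[of s'] t assms by simp
qed

lemma linear_solution_diff:
  assumes "linear_solution s T f y" "linear_solution s T g x"
  shows "linear_solution s T (\<lambda>t n. f t n - g t n) (\<lambda>t n. y t n - x t n)"
  unfolding linear_solution_def
proof (intro allI conjI ballI)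
  fix n t assume t: "t \<in> {s..T}"
  have i: "(\<lambda>\<tau>. f \<tau> n - (\<nu> * l n) * y \<tau> n) integrable_on {s..t}" "(\<lambda>\<tau>. g \<tau> n - (\<nu> * l n) * x \<tau> n) integrable_on {s..t}"
    using t by (auto intro!: integrable_continuous_interval continuous_intros
        continuous_on_subset[OF linear_solutionD(1)[OF assms(1)]] continuous_on_subset[OF linear_solutionD(2)[OF assms(1)]]
        continuous_on_subset[OF linear_solutionD(1)[OF assms(2)]] continuous_on_subset[OF linear_solutionD(2)[OF assms(2)]])
  have "m n * (y t n - x t n) = (m n * y s n + integral {s..t} (\<lambda>\<tau>. f \<tau> n - (\<nu> * l n) * y \<tau> n)) -
      (m n * x s n + integral {s..t} (\<lambda>\<tau>. g \<tau> n - (\<nu> * l n) * x \<tau> n))"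
    by (simp only: right_diff_distrib linear_solutionD(3)[OF assms(1) t] linear_solutionD(3)[OF assms(2) t])
  also have "... = m n * (y s n - x s n) + integral {s..t} (\<lambda>\<tau>. (f \<tau> n - (\<nu> * l n) * y \<tau> n) - (g \<tau> n - (\<nu> * l n) * x \<tau> n))"
    by (subst Henstock_Kurzweil_Integration.integral_diff[OF i]) (simp add: algebra_simps)
  also have "(\<lambda>\<tau>. (f \<tau> n - (\<nu> * l n) * y \<tau> n) - (g \<tau> n - (\<nu> * l n) * x \<tau> n)) =
      (\<lambda>\<tau>. f \<tau> n - g \<tau> n - (\<nu> * l n) * (y \<tau> n - x \<tau> n))" by (simp add: fun_eq_iff algebra_simps)
  finally show "m n * (y t n - x t n) = m n * (y s n - x s n) + integral {s..t} (\<lambda>\<tau>. f \<tau> n - g \<tau> n - (\<nu> * l n) * (y \<tau> n - x \<tau> n))" .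
qed (intro continuous_intros linear_solutionD[OF assms(1)] linear_solutionD[OF assms(2)])+

lemma linear_solution_exists:
  fixes a :: "nat \<Rightarrow> real"
  assumes "\<And>n. continuous_on {s..T} (\<lambda>t. f t n)"
  obtains y where "y s = a" "linear_solution s T f y"
proof -
  have "\<exists>y. y s = a n \<and> continuous_on {s..T} y \<and>
    (\<forall>t\<in>{s..T}. m n * y t = m n * a n + integral {s..t} (\<lambda>\<tau>. f \<tau> n - (\<nu> * l n) * y \<tau>))" for n
    by (rule mode_exists[OF m_pos[of n] assms[of n], where a = "a n" and \<kappa> = "\<nu> * l n"]) blast
  then have "\<exists>y. \<forall>n. y n s = a n \<and> continuous_on {s..T} (y n) \<and>
    (\<forall>t\<in>{s..T}. m n * y n t = m n * a n + integral {s..t} (\<lambda>\<tau>. f \<tau> n - (\<nu> * l n) * y n \<tau>))" by (intro choice allI)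
  then obtain y where y: "\<And>n. y n s = a n" "\<And>n. continuous_on {s..T} (y n)"
    "\<And>n t. t \<in> {s..T} \<Longrightarrow> m n * y n t = m n * a n + integral {s..t} (\<lambda>\<tau>. f \<tau> n - (\<nu> * l n) * y n \<tau>)" by blast
  show ?thesis by (rule that[of "\<lambda>t n. y n t"]) (use y assms in \<open>auto simp: linear_solution_def\<close>)
qed

lemma linear_mode_bound:
  assumes "linear_solution s T f y" "t \<in> {s..T}"
  shows "m n * (y t n)^2 + \<nu> * (l n * integral {s..t} (\<lambda>\<tau>. (y \<tau> n)^2))
    \<le> m n * (y s n)^2 + 1 / \<nu> * (il n * integral {s..t} (\<lambda>\<tau>. (f \<tau> n)^2))"
proof -
  have "m n * (y t n)^2 + (\<nu> * l n) * integral {s..t} (\<lambda>\<tau>. (y \<tau> n)^2)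
      \<le> m n * (y s n)^2 + integral {s..t} (\<lambda>\<tau>. (f \<tau> n)^2) / (\<nu> * l n)"
    by (rule mode_energy_le[OF m_pos mult_pos_pos[OF \<nu>_pos l_pos] linear_solutionD(1,2)[OF assms(1)] linear_solutionD(3)[OF assms(1)] assms(2)])
  then show ?thesis by (simp add: il_def mult.assoc)
qed

lemma integral_square_nonneg: "0 \<le> integral {s..t} (\<lambda>\<tau>. (y \<tau>)^2)" for y :: "real \<Rightarrow> real"
  by (cases "(\<lambda>\<tau>. (y \<tau>)^2) integrable_on {s..t}") (auto intro: Henstock_Kurzweil_Integration.integral_nonneg simp: not_integrable_integral)

text \<open>Puts the value at one time and the time integral into a single series, so that
  \<open>linear_mode_bound\<close> can be summed over the modes.\<close>

lemma sqn_plus_II: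
  assumes y: "\<And>n. continuous_on {s..t} (\<lambda>\<tau>. y \<tau> n)" and w: "\<And>n. 0 \<le> w n" and "0 \<le> c"
  shows "sqn m a + ennreal c * sqn_int s t w y =
      (\<Sum>n. ennreal (m n * (a n)^2 + c * (w n * integral {s..t} (\<lambda>\<tau>. (y \<tau> n)^2))))"
proof -
  have "sqn m a + ennreal c * sqn_int s t w y =
      (\<Sum>n. ennreal (m n * (a n)^2)) + (\<Sum>n. ennreal c * ennreal (w n * integral {s..t} (\<lambda>\<tau>. (y \<tau> n)^2)))"
    unfolding II_sqn[OF y w] unfolding sqn_def ennreal_suminf_cmult ..
  also have "... = (\<Sum>n. ennreal (m n * (a n)^2) + ennreal c * ennreal (w n * integral {s..t} (\<lambda>\<tau>. (y \<tau> n)^2)))"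
    by (intro suminf_add) auto
  also have "... = (\<Sum>n. ennreal (m n * (a n)^2 + c * (w n * integral {s..t} (\<lambda>\<tau>. (y \<tau> n)^2))))"
    using w \<open>0 \<le> c\<close> by (intro suminf_cong) (simp add: ennreal_plus ennreal_mult integral_square_nonneg)
  finally show ?thesis .
qed

lemma linear_bound:
  assumes "linear_solution s T f y" "t \<in> {s..T}"
  shows "sqn m (y t) + ennreal \<nu> * sqn_int s t l y
    \<le> sqn m (y s) + ennreal (1 / \<nu>) * sqn_int s t il f"
proof -
  have c: "continuous_on {s..t} (\<lambda>t. f t n)" "continuous_on {s..t} (\<lambda>t. y t n)" for n
    using assms(2) by (auto intro!: continuous_on_subset[OF linear_solutionD(1)[OF assms(1)]] continuous_on_subset[OF linear_solutionD(2)[OF assms(1)]])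
  have "sqn m (y t) + ennreal \<nu> * sqn_int s t l y =
     (\<Sum>n. ennreal (m n * (y t n)^2 + \<nu> * (l n * integral {s..t} (\<lambda>\<tau>. (y \<tau> n)^2))))"
    using sqn_plus_II[where w = l and y = y and a = "y t" and c = \<nu>, OF c(2) l_nonneg] \<nu>_pos by simp
  also have "... \<le> (\<Sum>n. ennreal (m n * (y s n)^2 + 1 / \<nu> * (il n * integral {s..t} (\<lambda>\<tau>. (f \<tau> n)^2))))"
    by (intro suminf_le ennreal_leI linear_mode_bound[OF assms]) auto
  also have "... = sqn m (y s) + ennreal (1 / \<nu>) * sqn_int s t il f"
    using sqn_plus_II[where w = il and y = f and a = "y s" and c = "1 / \<nu>", OF c(1) il_nonneg] \<nu>_pos by simp
  finally show ?thesis .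
qed

lemma linear_sup_bound:
  assumes "linear_solution s T f y" "t \<in> {s..T}"
  shows "sqn m (y t) \<le> sqn m (y s) + ennreal (1 / \<nu>) * sqn_int s T il f"
proof -
  have "sqn m (y t) \<le> sqn m (y t) + ennreal \<nu> * sqn_int s t l y" by simp
  also have "... \<le> sqn m (y s) + ennreal (1 / \<nu>) * sqn_int s t il f" by (rule linear_bound[OF assms])
  also have "... \<le> sqn m (y s) + ennreal (1 / \<nu>) * sqn_int s T il f" using assms by (intro add_left_mono mult_left_mono II_subset) auto
  finally show ?thesis .
qed

lemma linear_int_bound:
  assumes "linear_solution s T f y" "s \<le> T"
  shows "sqn_int s T l y \<le> ennreal (1 / \<nu>) * (sqn m (y s) + ennreal (1 / \<nu>) * sqn_int s T il f)"
proof -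
  have "ennreal \<nu> * sqn_int s T l y \<le> sqn m (y T) + ennreal \<nu> * sqn_int s T l y" by simp
  also have "... \<le> sqn m (y s) + ennreal (1 / \<nu>) * sqn_int s T il f" using assms by (intro linear_bound) auto
  finally have "ennreal (1 / \<nu>) * (ennreal \<nu> * sqn_int s T l y) \<le> ennreal (1 / \<nu>) * (sqn m (y s) + ennreal (1 / \<nu>) * sqn_int s T il f)"
    by (rule mult_left_mono) simp
  then show ?thesis using \<nu>_pos by (simp add: mult.assoc[symmetric] ennreal_mult'[symmetric])
qed

text \<open>Interpolation: one factor of \<open>sqn_interpolate\<close> is bounded uniformly in
  time, the other is integrated.\<close>

lemma Z_le:
  assumes "\<And>\<tau>. \<tau> \<in> {s..t} \<Longrightarrow> sqn m (u \<tau>) \<le> A" and "\<And>n. continuous_on {s..t} (\<lambda>\<tau>. u \<tau> n)"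
  shows "Z s t u \<le> A * sqn_int s t l u"
proof -
  have "Z s t u \<le> II s t (\<lambda>\<tau>. A * sqn l (u \<tau>))" unfolding Z_def
  proof (rule II_mono)
    fix \<tau> assume \<tau>: "\<tau> \<in> {s..t}"
    have "(sqn \<sigma> (u \<tau>))^2 \<le> sqn m (u \<tau>) * sqn l (u \<tau>)" unfolding \<sigma>_def[abs_def] by (rule sqn_interpolate) auto
    also have "... \<le> A * sqn l (u \<tau>)" by (intro mult_right_mono assms \<tau>) auto
    finally show "(sqn \<sigma> (u \<tau>))^2 \<le> A * sqn l (u \<tau>)" .
  qed
  also have "... = A * sqn_int s t l u" unfolding II_def by (intro nn_integral_cmult measurable_sqn_interval assms)
  finally show ?thesis .
qed

text \<open>With zero initial value and \<open>G\<close> the weighted integral of the source, the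
  supremum of \<open>sqn m\<close> is at most \<open>G / \<nu>\<close> and the integral of
  \<open>sqn l\<close> at most \<open>G / \<nu>^2\<close>. Their product gives the power
  \<open>\<nu> ^ 3\<close>.\<close>

lemma linear_Z:
  assumes y: "linear_solution s T f y" "s \<le> T" "y s = (\<lambda>n. 0)"
  shows "Z s T y \<le> ennreal (1 / \<nu> ^ 3) * (sqn_int s T il f)^2"
proof -
  let ?G = "sqn_int s T il f"
  have "Z s T y \<le> (ennreal (1 / \<nu>) * ?G) * sqn_int s T l y"
    using linear_sup_bound[OF y(1)] y by (intro Z_le linear_solutionD(2)[OF y(1)]) auto
  also have "... \<le> (ennreal (1 / \<nu>) * ?G) * (ennreal (1 / \<nu>) * (ennreal (1 / \<nu>) * ?G))"
    using linear_int_bound[OF y(1,2)] y(3) by (intro mult_left_mono) auto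
  also have "... = (ennreal (1 / \<nu>) * ennreal (1 / \<nu>) * ennreal (1 / \<nu>)) * ?G^2" by (simp add: power2_eq_square mult_ac)
  also have "ennreal (1 / \<nu>) * ennreal (1 / \<nu>) * ennreal (1 / \<nu>) = ennreal (1 / \<nu> ^ 3)"
    using \<nu>_pos by (simp add: ennreal_mult'[symmetric] power3_eq_cube)
  finally show ?thesis .
qed

lemma linear_weighted_continuous:
  assumes y: "linear_solution s T f y" and a: "sqn m (y s) < \<infinity>" and f: "sqn_int s T il f < \<infinity>"
  shows "weighted_continuous s T y"
proof -
  have c: "continuous_on {s..T} (\<lambda>t. f t n)" "continuous_on {s..T} (\<lambda>t. y t n)" for n using linear_solutionD[OF y] by blast+
  \<comment> \<open>A summable majorant of \<open>m n * (y t n)^2\<close> that does not depend on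
    time: it turns modewise continuity into uniform convergence by the Weierstrass test.\<close>
  define M where "M n = m n * (y s n)^2 + 1 / \<nu> * (il n * integral {s..T} (\<lambda>\<tau>. (f \<tau> n)^2))" for n
  have "summable (\<lambda>n. il n * integral {s..T} (\<lambda>\<tau>. (f \<tau> n)^2))" using f unfolding II_sqn[OF c(1) il_nonneg]
    by (intro summable_suminf_not_top) (auto simp: integral_square_nonneg less_top)
  moreover have "summable (\<lambda>n. m n * (y s n)^2)" using a sqn_finite_iff[of m "y s"] by simp
  ultimately have M: "summable M" unfolding M_def by (intro summable_add summable_mult)
  have yM: "m n * (y t n)^2 \<le> M n" if t: "t \<in> {s..T}" for t n
  proof -
    have "integral {s..t} (\<lambda>\<tau>. (f \<tau> n)^2) \<le> integral {s..T} (\<lambda>\<tau>. (f \<tau> n)^2)"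
      using t by (intro integral_subset_le integrable_continuous_interval continuous_intros c(1) continuous_on_subset[OF c(1)]) auto
    then have "1 / \<nu> * (il n * integral {s..t} (\<lambda>\<tau>. (f \<tau> n)^2)) \<le> 1 / \<nu> * (il n * integral {s..T} (\<lambda>\<tau>. (f \<tau> n)^2))"
      using \<nu>_pos by (intro mult_left_mono) auto
    moreover have "0 \<le> \<nu> * (l n * integral {s..t} (\<lambda>\<tau>. (y \<tau> n)^2))"
      using \<nu>_pos by (intro mult_nonneg_nonneg integral_square_nonneg) auto
    ultimately show ?thesis using linear_mode_bound[OF y t, of n] by (simp add: M_def)
  qed
  have fin: "sqn m (y t) < \<infinity>" if t: "t \<in> {s..T}" for t unfolding sqn_finite_iff[OF m_nonneg]
    by (rule summable_comparison_test'[OF M, of 0]) (use yM[OF t] in auto)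
  show ?thesis unfolding weighted_continuous_def
  proof (intro ballI conjI fin)
    fix t assume t: "t \<in> {s..T}"
    define g where "g t' = (\<Sum>n. m n * (y t' n - y t n)^2)" for t'
    have gM: "norm (m n * (y t' n - y t n)^2) \<le> 4 * M n" if "t' \<in> {s..T}" for t' n
    proof -
      have "(y t' n - y t n)^2 \<le> 2 * (y t' n)^2 + 2 * (y t n)^2"
        using zero_le_power2[of "y t' n + y t n"] by (simp add: power2_eq_square algebra_simps)
      then have "m n * (y t' n - y t n)^2 \<le> m n * (2 * (y t' n)^2 + 2 * (y t n)^2)" by (rule mult_left_mono) simp
      then show ?thesis using yM[OF that, of n] yM[OF t, of n] by (simp add: algebra_simps)
    qed
    have "uniform_limit {s..T} (\<lambda>N t'. \<Sum>n<N. m n * (y t' n - y t n)^2) g sequentially"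
      unfolding g_def using gM by (intro Weierstrass_m_test[where M = "\<lambda>n. 4 * M n"] summable_mult M) auto
    then have "continuous_on {s..T} g" by (rule uniform_limit_theorem[rotated]) (auto intro!: always_eventually continuous_intros c)
    then have "(g \<longlongrightarrow> g t) (at t within {s..T})" using t by (simp add: continuous_on)
    then have "((\<lambda>t'. ennreal (g t')) \<longlongrightarrow> ennreal (g t)) (at t within {s..T})" by (rule tendsto_ennrealI)
    moreover have "g t = 0" by (simp add: g_def)
    moreover have "\<forall>\<^sub>F t' in at t within {s..T}. ennreal (g t') = sqn m (\<lambda>n. y t' n - y t n)"
    proof -
      have "ennreal (g t') = sqn m (\<lambda>n. y t' n - y t n)" if "t' \<in> {s..T}" for t' unfolding g_def using gM[OF that]
        by (intro sqn_eq_suminf[symmetric] m_nonneg summable_comparison_test'[OF summable_mult[OF M, of 4], of 0])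
      then show ?thesis by (auto simp: eventually_at_filter)
    qed
    ultimately show "((\<lambda>t'. sqn m (\<lambda>n. y t' n - y t n)) \<longlongrightarrow> 0) (at t within {s..T})" by (simp add: tendsto_cong)
  qed
qed

end

section \<open>Inequalities for extended nonnegative reals and geometric convergence\<close>

lemma ennreal_square_le_imp_le:
  fixes x y :: ennreal
  assumes "x^2 \<le> y^2" shows "x \<le> y"
proof (rule ccontr)
  assume "\<not> x \<le> y"
  then have "y < x" by simp
  then have "y * y < x * x"
    by (cases x; cases y) (auto simp: ennreal_mult[symmetric] ennreal_less_iff ennreal_top_mult ennreal_mult_top ennreal_mult_less_top intro: mult_strict_mono)
  with assms show False by (simp add: power2_eq_square)
qed

lemma ennreal_square_add_le:
  fixes x y :: ennreal
  shows "(x + y)^2 \<le> 2 * x^2 + 2 * y^2"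
proof (cases x; cases y)
  fix a b :: real assume ab: "x = ennreal a" "y = ennreal b" "0 \<le> a" "0 \<le> b"
  have "(a + b)^2 \<le> 2 * a^2 + 2 * b^2" using zero_le_power2[of "a - b"] by (simp add: power2_eq_square algebra_simps)
  then have "ennreal ((a + b)^2) \<le> ennreal (2 * a^2 + 2 * b^2)" by (rule ennreal_leI)
  moreover have "(x + y)^2 = ennreal ((a + b)^2)" using ab ennreal_power[of "a + b" 2] by simp
  moreover have "2 * x^2 + 2 * y^2 = ennreal (2 * a^2 + 2 * b^2)" using ab by (simp add: ennreal_power ennreal_mult)
  ultimately show ?thesis by simp
qed (auto simp: power2_eq_square)

lemma ennreal_tendsto_0D:
  fixes f :: "'a \<Rightarrow> ennreal"
  assumes "(f \<longlongrightarrow> 0) F" "0 < (e::real)"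
  shows "\<forall>\<^sub>F x in F. f x \<le> ennreal e"
  using order_tendstoD(2)[OF assms(1), of "ennreal e"] assms(2) by (auto elim!: eventually_mono)

lemma uniform_limit_geometric:
  fixes f :: "nat \<Rightarrow> 'a \<Rightarrow> real"
  assumes "\<And>k x. x \<in> S \<Longrightarrow> (f k x - g x)^2 \<le> c / 16 ^ k"
  shows "uniform_limit S f g sequentially"
proof (rule uniform_limitI)
  fix e :: real assume "0 < e"
  have "(\<lambda>k. c * (1 / 16) ^ k) \<longlonglongrightarrow> c * 0" by (intro tendsto_intros) auto
  then have "\<forall>\<^sub>F k in sequentially. c * (1 / 16) ^ k < e^2" using \<open>0 < e\<close> by (intro order_tendstoD) auto
  then show "\<forall>\<^sub>F k in sequentially. \<forall>x\<in>S. dist (f k x) (g x) < e"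
  proof eventually_elim
    case (elim k)
    show ?case
    proof
      fix x assume "x \<in> S"
      then have "(f k x - g x)^2 < e^2" using assms[of x k] elim by (simp add: power_divide)
      then show "dist (f k x) (g x) < e"
        using \<open>0 < e\<close> by (simp add: dist_real_def abs_le_square_iff abs_square_less_1 power2_less_imp_less[of "\<bar>_\<bar>"] real_sqrt_less_iff)
    qed
  qed
qed

lemma numeral_times_ennreal: "0 \<le> x \<Longrightarrow> numeral w * ennreal x = ennreal (numeral w * x)"
  by (simp add: ennreal_mult)

lemmas two_ennreal = numeral_times_ennreal[where w = "num.Bit0 num.One"]

text \<open>Each use of \<open>sqn_add\<close> loses a factor 2, which the ratio 16 absorbs:
  \<open>2 * 4 / 16 + 2 \<le> 4\<close> closes the induction.\<close>

lemma sqn_telescope: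
  assumes w: "\<And>n. 0 \<le> w n" and "0 \<le> c"
    and step: "\<And>k. sqn w (\<lambda>n. W (Suc k) n - W k n) \<le> ennreal (c / 16 ^ k)"
  shows "sqn w (\<lambda>n. W (k + i) n - W k n) \<le> ennreal (4 * c / 16 ^ k)"
proof (induction i arbitrary: k)
  case 0
  show ?case by simp
next
  case (Suc i)
  have "sqn w (\<lambda>n. (W (Suc k + i) n - W (Suc k) n) + (W (Suc k) n - W k n))
      \<le> 2 * sqn w (\<lambda>n. W (Suc k + i) n - W (Suc k) n) + 2 * sqn w (\<lambda>n. W (Suc k) n - W k n)" by (rule sqn_add[OF w])
  also have "... \<le> 2 * ennreal (4 * c / 16 ^ Suc k) + 2 * ennreal (c / 16 ^ k)" by (intro add_mono mult_left_mono Suc step) auto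
  also have "... = ennreal (2 * (4 * c / 16 ^ Suc k) + 2 * (c / 16 ^ k))"
    using \<open>0 \<le> c\<close> two_ennreal[of "4 * c / 16 ^ Suc k"] two_ennreal[of "c / 16 ^ k"] by (simp del: power_Suc)
  also have "... \<le> ennreal (4 * c / 16 ^ k)" using \<open>0 \<le> c\<close> by (intro ennreal_leI) (simp add: field_simps)
  finally show ?case by simp
qed

lemma abs_mult_le_weighted:
  fixes a c d :: real
  assumes "0 < a"
  shows "\<bar>c * d\<bar> \<le> 1 / a * c^2 + a * d^2"
proof -
  have "2 * \<bar>c * d\<bar> \<le> 1 / a * c^2 + a * d^2" using sum_squares_bound[of "\<bar>c\<bar> / sqrt a" "sqrt a * \<bar>d\<bar>"] assms
    by (simp add: power_mult_distrib power_divide abs_mult)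
  then show ?thesis using abs_ge_zero[of "c * d"] by linarith
qed

text \<open>Completeness of Lebesgue measure. It supplies measurability of pairings that are only
  known to agree almost everywhere with a series or with a continuous function.\<close>

lemma borel_measurable_AE_interval:
  fixes f g :: "real \<Rightarrow> real"
  assumes "f \<in> borel_measurable (lebesgue_on {s..t})" "AE \<tau> in lebesgue_on {s..t}. f \<tau> = g \<tau>"
  shows "g \<in> borel_measurable (lebesgue_on {s..t})"
proof -
  have "AE \<tau> in lebesgue. indicator {s..t} \<tau> *\<^sub>R f \<tau> = indicator {s..t} \<tau> *\<^sub>R g \<tau>"
    using assms(2) by (auto simp: AE_restrict_space_iff indicator_def elim!: eventually_mono)
  from borel_measurable_AE[OF _ this] assms(1) show ?thesis by (simp add: borel_measurable_restrict_space_iff)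
qed

section \<open>Consequences of weighted continuity in time\<close>

context diagonal_evolution
begin

lemma weighted_continuousD:
  assumes "weighted_continuous s T u" "t \<in> {s..T}"
  shows "sqn m (u t) < \<infinity>" "((\<lambda>t'. sqn m (\<lambda>n. u t' n - u t n)) \<longlongrightarrow> 0) (at t within {s..T})"
  using assms by (auto simp: weighted_continuous_def)

lemma weighted_continuous_modes:
  assumes "weighted_continuous s T u"
  shows "continuous_on {s..T} (\<lambda>t. u t n)"
  unfolding continuous_on
proof
  fix t assume t: "t \<in> {s..T}"
  have "((\<lambda>t'. ennreal ((u t' n - u t n)^2)) \<longlongrightarrow> 0) (at t within {s..T})"
  proof (rule tendsto_sandwich[OF always_eventually always_eventually tendsto_const weighted_continuousD(2)[OF assms t]])
    show "\<forall>t'. ennreal ((u t' n - u t n)^2) \<le> sqn m (\<lambda>n. u t' n - u t n)"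
    proof
      fix t'
      have "1 * (u t' n - u t n)^2 \<le> m n * (u t' n - u t n)^2" by (intro mult_right_mono m_ge) auto
      then show "ennreal ((u t' n - u t n)^2) \<le> sqn m (\<lambda>n. u t' n - u t n)"
        using sqn_term_le[of m n "\<lambda>n. u t' n - u t n"] by (auto intro: order_trans[rotated] ennreal_leI)
    qed
  qed auto
  then have "((\<lambda>t'. (u t' n - u t n)^2) \<longlongrightarrow> 0) (at t within {s..T})"
    using tendsto_ennreal_iff[where F = "at t within {s..T}" and f = "\<lambda>t'. (u t' n - u t n)^2" and x = 0] by simp
  then have "((\<lambda>t'. u t' n - u t n) \<longlongrightarrow> 0) (at t within {s..T})"
    using tendsto_real_sqrt[of "\<lambda>t'. (u t' n - u t n)^2" 0] by (simp add: tendsto_rabs_zero_iff)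
  then show "((\<lambda>t. u t n) \<longlongrightarrow> u t n) (at t within {s..T})" by (simp add: LIM_zero_iff)
qed

lemma weighted_continuous_mono:
  assumes "weighted_continuous s T u" "s \<le> s'" "T' \<le> T"
  shows "weighted_continuous s' T' u"
proof -
  have "{s'..T'} \<subseteq> {s..T}" using assms by auto
  then show ?thesis using assms(1) tendsto_within_subset unfolding weighted_continuous_def by blast
qed

text \<open>Compactness is used through sequences, as \<open>sqn m\<close> is not the distance of a
  metric type: times with \<open>sqn m\<close> above every integer would accumulate at some
  \<open>t\<close>, near which the values are at most
  \<open>2 * 1 + 2 * sqn m (u t)\<close>.\<close>

lemma weighted_continuous_bounded:
  assumes u: "weighted_continuous s T u"
  obtains A :: real where "0 \<le> A" "\<And>t. t \<in> {s..T} \<Longrightarrow> sqn m (u t) \<le> ennreal A"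
proof -
  have "\<exists>A::nat. \<forall>t\<in>{s..T}. sqn m (u t) \<le> of_nat A"
  proof (rule ccontr)
    assume "\<not> ?thesis"
    then have "\<forall>A::nat. \<exists>t\<in>{s..T}. \<not> sqn m (u t) \<le> of_nat A" by simp
    then obtain x :: "nat \<Rightarrow> real" where x: "\<And>A. x A \<in> {s..T}" "\<And>A. of_nat A < sqn m (u (x A))" unfolding not_le by metis
    have "compact {s..T}" by simp
    then obtain t r where t: "t \<in> {s..T}" and r: "strict_mono r" "(x \<circ> r) \<longlonglongrightarrow> t" using x(1) unfolding compact_def by metis
    have "continuous (at t within {s..T}) (\<lambda>t'. sqn m (\<lambda>n. u t' n - u t n))"
      unfolding continuous_within using weighted_continuousD(2)[OF u t] by simp
    from continuous_within_tendsto_compose'[OF this _ r(2)] x(1)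
    have "(\<lambda>k. sqn m (\<lambda>n. u (x (r k)) n - u t n)) \<longlonglongrightarrow> 0" by simp
    from ennreal_tendsto_0D[OF this, of 1] obtain M where M: "\<And>k. M \<le> k \<Longrightarrow> sqn m (\<lambda>n. u (x (r k)) n - u t n) \<le> 1"
      by (auto simp: eventually_sequentially)
    have "2 * 1 + 2 * sqn m (u t) < top" using weighted_continuousD(1)[OF u t] by (simp add: ennreal_mult_less_top)
    then obtain N :: nat where N: "2 * 1 + 2 * sqn m (u t) < of_nat N" using ennreal_Ex_less_of_nat by blast
    define k where "k = max M N"
    have "of_nat N \<le> (of_nat (r k) :: ennreal)" using seq_suble[OF r(1), of k] by (simp add: k_def)
    also have "... < sqn m (u (x (r k)))" by (rule x(2))
    also have "... \<le> 2 * sqn m (\<lambda>n. u (x (r k)) n - u t n) + 2 * sqn m (u t)"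
      using sqn_add[where w = m and c = "\<lambda>n. u (x (r k)) n - u t n" and d = "u t"] by simp
    also have "... \<le> 2 * 1 + 2 * sqn m (u t)" by (intro add_right_mono mult_left_mono M) (auto simp: k_def)
    finally show False using N by (meson less_asym)
  qed
  then obtain A :: nat where "\<forall>t\<in>{s..T}. sqn m (u t) \<le> of_nat A" ..
  then show ?thesis by (intro that[of "real A"]) (auto simp: ennreal_of_nat_eq_real_of_nat)
qed

lemma Z_finite:
  assumes "weighted_continuous s T u" "sqn_int s T l u < \<infinity>"
  shows "Z s T u < \<infinity>"
proof -
  obtain A :: real where "\<And>t. t \<in> {s..T} \<Longrightarrow> sqn m (u t) \<le> ennreal A" using weighted_continuous_bounded[OF assms(1)] by metis
  then have "Z s T u \<le> ennreal A * sqn_int s T l u" by (intro Z_le weighted_continuous_modes[OF assms(1)])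
  also have "... < \<infinity>" using assms(2) by (simp add: ennreal_mult_less_top)
  finally show ?thesis .
qed

lemma Z_measurable:
  fixes s t :: real
  assumes "\<And>n. continuous_on {s..t} (\<lambda>\<tau>. u \<tau> n)"
  shows "(\<lambda>\<tau>. (sqn \<sigma> (u \<tau>))^2) \<in> borel_measurable (lebesgue_on {s..t})"
  using measurable_sqn_interval[OF assms] by (rule borel_measurable_power_ennreal)

lemma Z_add:
  fixes s t :: real
  assumes "\<And>n. continuous_on {s..t} (\<lambda>\<tau>. u \<tau> n)" "\<And>n. continuous_on {s..t} (\<lambda>\<tau>. v \<tau> n)"
  shows "Z s t (\<lambda>\<tau> n. u \<tau> n + v \<tau> n) \<le> 8 * Z s t u + 8 * Z s t v"
proof -
  have "Z s t (\<lambda>\<tau> n. u \<tau> n + v \<tau> n) \<le> II s t (\<lambda>\<tau>. 8 * (sqn \<sigma> (u \<tau>))^2 + 8 * (sqn \<sigma> (v \<tau>))^2)" unfolding Z_def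
  proof (rule II_mono)
    fix \<tau>
    have "(sqn \<sigma> (\<lambda>n. u \<tau> n + v \<tau> n))^2 \<le> (2 * sqn \<sigma> (u \<tau>) + 2 * sqn \<sigma> (v \<tau>))^2" by (intro power_mono sqn_add) auto
    also have "... \<le> 2 * (2 * sqn \<sigma> (u \<tau>))^2 + 2 * (2 * sqn \<sigma> (v \<tau>))^2" by (rule ennreal_square_add_le)
    also have "... = 8 * (sqn \<sigma> (u \<tau>))^2 + 8 * (sqn \<sigma> (v \<tau>))^2" by (simp add: power_mult_distrib mult.assoc[symmetric])
    finally show "(sqn \<sigma> (\<lambda>n. u \<tau> n + v \<tau> n))^2 \<le> 8 * (sqn \<sigma> (u \<tau>))^2 + 8 * (sqn \<sigma> (v \<tau>))^2" .
  qed
  also have "... = 8 * Z s t u + 8 * Z s t v" unfolding Z_def II_def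
    using Z_measurable[where u = u, OF assms(1)] Z_measurable[where u = v, OF assms(2)] by (simp add: nn_integral_add nn_integral_cmult)
  finally show ?thesis .
qed

lemma II_AE_finite:
  assumes "\<And>n. continuous_on {s..t} (\<lambda>\<tau>. u \<tau> n)" "sqn_int s t w u < \<infinity>"
  shows "AE \<tau> in lebesgue_on {s..t}. sqn w (u \<tau>) < \<infinity>"
  using nn_integral_PInf_AE[OF measurable_sqn_interval[where u = u and w = w, OF assms(1)]] assms(2)
  unfolding II_def by (auto simp: less_top)

text \<open>Dominated convergence: \<open>sqn il (y \<tau>) + sqn l (d \<tau>)\<close> bounds all
  partial sums, because \<open>\<bar>y * d\<bar> \<le> y^2 / l + l * d^2\<close>. Every exchange of
  a time integral with a series of mixed sign goes through this lemma.\<close>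

lemma mode_series_integral:
  fixes s t :: real
  assumes y: "\<And>n. continuous_on {s..t} (\<lambda>\<tau>. y \<tau> n)" "sqn_int s t il y < \<infinity>"
    and d: "\<And>n. continuous_on {s..t} (\<lambda>\<tau>. d \<tau> n)" "sqn_int s t l d < \<infinity>"
    and f: "AE \<tau> in lebesgue_on {s..t}. (\<lambda>n. y \<tau> n * d \<tau> n) sums f \<tau>"
  shows "integrable (lebesgue_on {s..t}) f"
    "(\<lambda>n. integral {s..t} (\<lambda>\<tau>. y \<tau> n * d \<tau> n)) sums (LINT \<tau>|lebesgue_on {s..t}. f \<tau>)"
proof -
  let ?M = "lebesgue_on {s..t}"
  define G where "G \<tau> = sqn il (y \<tau>) + sqn l (d \<tau>)" for \<tau>
  have i: "integrable ?M (\<lambda>\<tau>. y \<tau> n * d \<tau> n)" for n by (intro continuous_imp_integrable_real continuous_intros y d)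
  have m: "(\<lambda>\<tau>. \<Sum>n. y \<tau> n * d \<tau> n) \<in> borel_measurable ?M" using borel_measurable_integrable[OF i] by simp
  have fm: "f \<in> borel_measurable ?M"
    by (rule borel_measurable_AE_interval[OF m]) (use f in eventually_elim, rule sums_unique[symmetric])
  have mG: "G \<in> borel_measurable ?M" unfolding G_def[abs_def] by (intro borel_measurable_add measurable_sqn_interval y d)
  have "(\<integral>\<^sup>+\<tau>. G \<tau> \<partial>?M) = sqn_int s t il y + sqn_int s t l d"
    unfolding G_def II_def by (intro nn_integral_add measurable_sqn_interval y d)
  then have Gf: "(\<integral>\<^sup>+\<tau>. G \<tau> \<partial>?M) < \<infinity>" using y(2) d(2) by simp
  have Ga: "AE \<tau> in ?M. G \<tau> \<noteq> \<infinity>" using Gf by (intro nn_integral_PInf_AE mG) auto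
  have Gi: "integrable ?M (\<lambda>\<tau>. enn2real (G \<tau>))"
  proof (rule integrableI_bounded)
    show "(\<lambda>\<tau>. enn2real (G \<tau>)) \<in> borel_measurable ?M" using mG by simp
    have "(\<integral>\<^sup>+\<tau>. ennreal (norm (enn2real (G \<tau>))) \<partial>?M) = (\<integral>\<^sup>+\<tau>. G \<tau> \<partial>?M)"
      by (rule nn_integral_cong_AE) (use Ga in eventually_elim, simp add: less_top)
    then show "(\<integral>\<^sup>+\<tau>. ennreal (norm (enn2real (G \<tau>))) \<partial>?M) < \<infinity>" using Gf by simp
  qed
  have bd: "AE \<tau> in ?M. norm (\<Sum>n<N. y \<tau> n * d \<tau> n) \<le> enn2real (G \<tau>)" for N using Ga
  proof eventually_elim
    case (elim \<tau>)
    have "\<bar>\<Sum>n<N. y \<tau> n * d \<tau> n\<bar> \<le> (\<Sum>n<N. il n * (y \<tau> n)^2 + l n * (d \<tau> n)^2)"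
      unfolding il_def by (rule order_trans[OF sum_abs sum_mono[OF abs_mult_le_weighted[OF l_pos]]])
    then have "ennreal \<bar>\<Sum>n<N. y \<tau> n * d \<tau> n\<bar> \<le> (\<Sum>n<N. ennreal (il n * (y \<tau> n)^2)) + (\<Sum>n<N. ennreal (l n * (d \<tau> n)^2))"
      by (simp add: sum.distrib sum_nonneg ennreal_leI sum_ennreal flip: ennreal_plus)
    also have "... \<le> G \<tau>" unfolding G_def sqn_def by (intro add_mono sum_le_suminf) auto
    finally have "ennreal \<bar>\<Sum>n<N. y \<tau> n * d \<tau> n\<bar> \<le> G \<tau>" .
    from enn2real_mono[OF this] elim show ?case by (simp add: top.not_eq_extremum)
  qed
  have lim: "AE \<tau> in ?M. (\<lambda>N. \<Sum>n<N. y \<tau> n * d \<tau> n) \<longlonglongrightarrow> f \<tau>" using f unfolding sums_def .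
  have sm: "(\<lambda>\<tau>. \<Sum>n<N. y \<tau> n * d \<tau> n) \<in> borel_measurable ?M" for N using borel_measurable_integrable[OF i] by simp
  show "integrable ?M f" by (rule integrable_dominated_convergence[OF fm sm Gi lim bd])
  have "(\<lambda>N. LINT \<tau>|?M. (\<Sum>n<N. y \<tau> n * d \<tau> n)) \<longlonglongrightarrow> (LINT \<tau>|?M. f \<tau>)" by (rule integral_dominated_convergence[OF fm sm Gi lim bd])
  moreover have "(LINT \<tau>|?M. (\<Sum>n<N. y \<tau> n * d \<tau> n)) = (\<Sum>n<N. integral {s..t} (\<lambda>\<tau>. y \<tau> n * d \<tau> n))" for N
    using i lebesgue_integral_eq_integral[OF i] by (subst Bochner_Integration.integral_sum) auto
  ultimately show "(\<lambda>n. integral {s..t} (\<lambda>\<tau>. y \<tau> n * d \<tau> n)) sums (LINT \<tau>|?M. f \<tau>)" unfolding sums_def by simp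
qed

lemma Z_diff_le:
  fixes s t :: real
  assumes "\<And>n. continuous_on {s..t} (\<lambda>\<tau>. u \<tau> n)" "\<And>n. continuous_on {s..t} (\<lambda>\<tau>. v \<tau> n)"
  shows "Z s t (\<lambda>\<tau> n. u \<tau> n - v \<tau> n) \<le> 8 * Z s t u + 8 * Z s t v"
  using Z_add[where u = u and v = "\<lambda>\<tau> n. - v \<tau> n", OF assms(1) continuous_on_minus[OF assms(2)]] by (simp add: Z_def sqn_uminus)

end

section \<open>Semilinear evolution equations with a skew quadratic term\<close>

text \<open>\<open>F_bound\<close> drives the contraction and \<open>F_energy\<close> the a priori
  bound. \<open>F_comp\<close> is a crude estimate whose constant may depend on the mode; it makes
  each component of \<open>F\<close> continuous in the \<open>m\<close>-norm. Bilinearity enters as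
  the difference identity \<open>F_diff\<close>.\<close>

locale semilinear_evolution = diagonal_evolution +
  fixes F :: "(nat \<Rightarrow> real) \<Rightarrow> (nat \<Rightarrow> real) \<Rightarrow> nat \<Rightarrow> real" and K :: real and C :: "nat \<Rightarrow> real"
  assumes K_pos: "0 < K" and C_nonneg: "\<And>n. 0 \<le> C n"
    and F_diff: "\<And>c d n. sqn m c < \<infinity> \<Longrightarrow> sqn m d < \<infinity> \<Longrightarrow>
        F c c n - F d d n = F (\<lambda>n. c n - d n) c n + F d (\<lambda>n. c n - d n) n"
    and F_comp: "\<And>c d n. sqn m c < \<infinity> \<Longrightarrow> sqn m d < \<infinity> \<Longrightarrow>
        ennreal ((F c d n)^2) \<le> ennreal (C n) * (sqn m c * sqn m d)"
    and F_bound: "\<And>c d. sqn m c < \<infinity> \<Longrightarrow> sqn m d < \<infinity> \<Longrightarrow>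
        sqn il (F c d) \<le> ennreal K * (sqn \<sigma> c * sqn \<sigma> d)"
    and F_energy: "\<And>c. sqn m c < \<infinity> \<Longrightarrow> sqn l c < \<infinity> \<Longrightarrow> (\<lambda>n. F c c n * c n) sums 0"
begin

abbreviation source :: "(real \<Rightarrow> nat \<Rightarrow> real) \<Rightarrow> real \<Rightarrow> nat \<Rightarrow> real" where
  "source u \<equiv> (\<lambda>t n. - F (u t) (u t) n)"

definition solution :: "real \<Rightarrow> real \<Rightarrow> (real \<Rightarrow> nat \<Rightarrow> real) \<Rightarrow> bool" where
  "solution s T u \<longleftrightarrow> weighted_continuous s T u \<and> sqn_int s T l u < \<infinity> \<and>
     linear_solution s T (source u) u"

text \<open>Calibrated to a Picard ball of \<open>Z\<close>-radius \<open>16 * eps\<close>: there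
  the source contributes at most \<open>(16 * K * eps)^2 / \<nu> ^ 3 = eps / 256\<close>, and
  differences shrink in \<open>Z\<close> by the factor 1/256.\<close>

definition eps :: real where "eps = \<nu> ^ 3 / (65536 * K^2)"

lemma eps_pos: "0 < eps"
  using \<nu>_pos K_pos by (simp add: eps_def)

lemma sqn_m_diff_finite: "sqn m c < \<infinity> \<Longrightarrow> sqn m d < \<infinity> \<Longrightarrow> sqn m (\<lambda>n. c n - d n) < \<infinity>"
proof -
  assume "sqn m c < \<infinity>" "sqn m d < \<infinity>"
  then have "2 * sqn m c + 2 * sqn m d < \<infinity>" by (simp add: ennreal_mult_less_top)
  then show ?thesis using sqn_diff[where w = m and c = c and d = d] by (auto intro: le_less_trans)
qed

lemma F_diff_component:
  assumes "sqn m c \<le> ennreal A" "sqn m d \<le> ennreal A" "sqn m (\<lambda>n. c n - d n) \<le> ennreal \<delta>" "0 \<le> A" "0 \<le> \<delta>"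
  shows "(F c c n - F d d n)^2 \<le> 4 * C n * A * \<delta>"
proof -
  have fin: "sqn m c < \<infinity>" "sqn m d < \<infinity>" "sqn m (\<lambda>n. c n - d n) < \<infinity>" using assms by (auto intro: le_less_trans)
  have b: "(F x y n)^2 \<le> C n * (a * b)" if "sqn m x \<le> ennreal a" "sqn m y \<le> ennreal b" "0 \<le> a" "0 \<le> b" for x y a b
  proof -
    have "ennreal ((F x y n)^2) \<le> ennreal (C n) * (sqn m x * sqn m y)" using that by (intro F_comp) (auto intro: le_less_trans)
    also have "... \<le> ennreal (C n) * (ennreal a * ennreal b)" using that by (intro mult_left_mono mult_mono) auto
    also have "... = ennreal (C n * (a * b))" using that C_nonneg by (simp add: ennreal_mult)
    finally show ?thesis using C_nonneg that by (simp add: ennreal_le_iff)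
  qed
  let ?d = "\<lambda>n. c n - d n"
  have "(F ?d c n + F d ?d n)^2 \<le> 2 * (F ?d c n)^2 + 2 * (F d ?d n)^2"
    using zero_le_power2[of "F ?d c n - F d ?d n"] by (simp add: power2_eq_square algebra_simps)
  also have "... \<le> 2 * (C n * (\<delta> * A)) + 2 * (C n * (A * \<delta>))" using assms by (intro add_mono mult_left_mono b) auto
  also have "... = 4 * C n * A * \<delta>" by simp
  finally show ?thesis using F_diff[OF fin(1,2)] by simp
qed

lemma F_continuous:
  assumes u: "weighted_continuous s T u"
  shows "continuous_on {s..T} (\<lambda>t. F (u t) (u t) n)"
  unfolding continuous_on_def
proof
  fix t assume t: "t \<in> {s..T}"
  obtain A :: real where A: "0 \<le> A" "\<And>t. t \<in> {s..T} \<Longrightarrow> sqn m (u t) \<le> ennreal A" using weighted_continuous_bounded[OF u] by metis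
  have "\<forall>\<^sub>F t' in at t within {s..T}. dist (F (u t') (u t') n) (F (u t) (u t) n) < e" if "0 < e" for e
  proof -
    \<comment> \<open>With this choice \<open>4 * C n * A * \<delta>\<close> is at most
      \<open>e^2 / 2\<close>; the summand 1 keeps the denominator positive when
      \<open>C n * A = 0\<close>.\<close>
    define \<delta> where "\<delta> = e^2 / (8 * (C n * A + 1))"
    have CA: "0 \<le> C n * A" using A C_nonneg by simp
    then have \<delta>: "0 < \<delta>" using that by (simp add: \<delta>_def)
    have "4 * (C n * A) * \<delta> \<le> 4 * (C n * A + 1) * \<delta>" using \<delta> by (intro mult_right_mono) auto
    also have "... = e^2 / 2"
    proof -
      have "C n * A + 1 \<noteq> 0" using CA by simp
      then show ?thesis unfolding \<delta>_def by (simp add: divide_simps)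
    qed
    also have "... < e^2" using that by simp
    finally have less: "4 * C n * A * \<delta> < e^2" by (simp add: mult.assoc)
    have "\<forall>\<^sub>F t' in at t within {s..T}. t' \<in> {s..T}" by (simp add: eventually_at_filter)
    with ennreal_tendsto_0D[OF weighted_continuousD(2)[OF u t] \<delta>] show ?thesis
    proof eventually_elim
      case (elim t')
      have "(F (u t') (u t') n - F (u t) (u t) n)^2 \<le> 4 * C n * A * \<delta>" using A elim t \<delta> by (intro F_diff_component) auto
      with less have "\<bar>F (u t') (u t') n - F (u t) (u t) n\<bar>^2 < e^2" by simp
      then show ?case using that unfolding dist_real_def by (meson less_imp_le power2_less_imp_less)
    qed
  qed
  then show "((\<lambda>t. F (u t) (u t) n) \<longlongrightarrow> F (u t) (u t) n) (at t within {s..T})" by (rule tendstoI)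
qed

lemma source_bound:
  assumes u: "\<And>n. continuous_on {s..T} (\<lambda>\<tau>. u \<tau> n)" "\<And>\<tau>. \<tau> \<in> {s..T} \<Longrightarrow> sqn m (u \<tau>) < \<infinity>"
  shows "II s T (\<lambda>\<tau>. sqn il (source u \<tau>)) \<le> ennreal K * Z s T u"
proof -
  have "II s T (\<lambda>\<tau>. sqn il (source u \<tau>)) \<le> II s T (\<lambda>\<tau>. ennreal K * (sqn \<sigma> (u \<tau>))^2)"
    using F_bound u by (intro II_mono) (simp add: sqn_uminus power2_eq_square)
  also have "... = ennreal K * Z s T u" unfolding Z_def II_def by (intro nn_integral_cmult Z_measurable u)
  finally show ?thesis .
qed

text \<open>After \<open>F_diff\<close> and \<open>F_bound\<close> the integrand is a product
  \<open>p \<tau> * q \<tau>\<close>, with \<open>p\<close> from the difference of the two functions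
  and \<open>q\<close> from both of them. Cauchy-Schwarz in time separates the factors, hence the
  square on the left.\<close>

lemma source_diff_bound:
  assumes u: "\<And>n. continuous_on {s..T} (\<lambda>\<tau>. u \<tau> n)" "\<And>\<tau>. \<tau> \<in> {s..T} \<Longrightarrow> sqn m (u \<tau>) < \<infinity>"
    and v: "\<And>n. continuous_on {s..T} (\<lambda>\<tau>. v \<tau> n)" "\<And>\<tau>. \<tau> \<in> {s..T} \<Longrightarrow> sqn m (v \<tau>) < \<infinity>"
  shows "(II s T (\<lambda>\<tau>. sqn il (\<lambda>n. source u \<tau> n - source v \<tau> n)))^2
    \<le> ennreal (8 * K^2) * (Z s T (\<lambda>\<tau> n. u \<tau> n - v \<tau> n) * (Z s T u + Z s T v))"
proof -
  define d where "d \<tau> n = u \<tau> n - v \<tau> n" for \<tau> n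
  have dc: "continuous_on {s..T} (\<lambda>\<tau>. d \<tau> n)" for n unfolding d_def by (intro continuous_intros u v)
  define p where "p \<tau> = sqn \<sigma> (d \<tau>)" for \<tau>
  define q where "q \<tau> = sqn \<sigma> (u \<tau>) + sqn \<sigma> (v \<tau>)" for \<tau>
  have pm: "p \<in> borel_measurable (lebesgue_on {s..T})" unfolding p_def by (intro measurable_sqn_interval dc)
  have qm: "q \<in> borel_measurable (lebesgue_on {s..T})" unfolding q_def by (intro borel_measurable_add measurable_sqn_interval u v)
  have "II s T (\<lambda>\<tau>. sqn il (\<lambda>n. source u \<tau> n - source v \<tau> n)) \<le> II s T (\<lambda>\<tau>. ennreal (2 * K) * (p \<tau> * q \<tau>))"
  proof (rule II_mono)
    fix \<tau> assume \<tau>: "\<tau> \<in> {s..T}"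
    have d: "sqn m (d \<tau>) < \<infinity>" unfolding d_def by (intro sqn_m_diff_finite u(2) v(2) \<tau>)
    have "sqn il (\<lambda>n. source u \<tau> n - source v \<tau> n) = sqn il (\<lambda>n. F (u \<tau>) (u \<tau>) n - F (v \<tau>) (v \<tau>) n)"
      using sqn_minus_commute[of il "source u \<tau>" "source v \<tau>"] by simp
    also have "... = sqn il (\<lambda>n. F (d \<tau>) (u \<tau>) n + F (v \<tau>) (d \<tau>) n)"
      using F_diff[OF u(2)[OF \<tau>] v(2)[OF \<tau>]] by (simp add: d_def[abs_def])
    also have "... \<le> 2 * sqn il (F (d \<tau>) (u \<tau>)) + 2 * sqn il (F (v \<tau>) (d \<tau>))" by (rule sqn_add) simp
    also have "... \<le> 2 * (ennreal K * (sqn \<sigma> (d \<tau>) * sqn \<sigma> (u \<tau>))) + 2 * (ennreal K * (sqn \<sigma> (v \<tau>) * sqn \<sigma> (d \<tau>)))"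
      by (intro add_mono mult_left_mono F_bound d u v \<tau>) auto
    also have "... = ennreal (2 * K) * (p \<tau> * q \<tau>)" using K_pos by (simp add: p_def q_def ennreal_mult algebra_simps)
    finally show "sqn il (\<lambda>n. source u \<tau> n - source v \<tau> n) \<le> ennreal (2 * K) * (p \<tau> * q \<tau>)" .
  qed
  also have "... = ennreal (2 * K) * II s T (\<lambda>\<tau>. p \<tau> * q \<tau>)"
    unfolding II_def by (intro nn_integral_cmult borel_measurable_times_ennreal pm qm)
  finally have "(II s T (\<lambda>\<tau>. sqn il (\<lambda>n. source u \<tau> n - source v \<tau> n)))^2 \<le> (ennreal (2 * K) * II s T (\<lambda>\<tau>. p \<tau> * q \<tau>))^2"
    by (rule power_mono) simp
  also have "... = ennreal (4 * K^2) * (II s T (\<lambda>\<tau>. p \<tau> * q \<tau>))^2" using K_pos by (simp add: power_mult_distrib ennreal_power)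
  also have "... \<le> ennreal (4 * K^2) * (II s T (\<lambda>\<tau>. (p \<tau>)^2) * II s T (\<lambda>\<tau>. (q \<tau>)^2))"
    unfolding II_def by (intro mult_left_mono Cauchy_Schwarz_nn_integral pm qm) auto
  also have "... \<le> ennreal (4 * K^2) * (Z s T d * (2 * (Z s T u + Z s T v)))"
  proof (intro mult_left_mono mult_mono)
    show "II s T (\<lambda>\<tau>. (p \<tau>)^2) \<le> Z s T d" by (simp add: Z_def p_def)
    have "II s T (\<lambda>\<tau>. (q \<tau>)^2) \<le> II s T (\<lambda>\<tau>. 2 * (sqn \<sigma> (u \<tau>))^2 + 2 * (sqn \<sigma> (v \<tau>))^2)"
      unfolding q_def by (intro II_mono ennreal_square_add_le)
    also have "... = 2 * (Z s T u + Z s T v)" unfolding Z_def II_def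
      using Z_measurable[where u = u, OF u(1)] Z_measurable[where u = v, OF v(1)]
      by (simp add: nn_integral_add nn_integral_cmult distrib_left)
    finally show "II s T (\<lambda>\<tau>. (q \<tau>)^2) \<le> 2 * (Z s T u + Z s T v)" .
  qed auto
  also have "... = ennreal (8 * K^2) * (Z s T d * (Z s T u + Z s T v))"
  proof -
    have "ennreal (8 * K^2) = ennreal (4 * K^2) * 2" using two_ennreal[of "4 * K^2"] by (simp add: mult.commute)
    then show ?thesis by (simp only: mult_ac)
  qed
  finally show ?thesis unfolding d_def .
qed

lemma solutionD:
  assumes "solution s T u"
  shows "weighted_continuous s T u" "sqn_int s T l u < \<infinity>" "linear_solution s T (source u) u"
    "\<And>n. continuous_on {s..T} (\<lambda>\<tau>. u \<tau> n)" "\<And>\<tau>. \<tau> \<in> {s..T} \<Longrightarrow> sqn m (u \<tau>) < \<infinity>" "Z s T u < \<infinity>"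
  using assms weighted_continuous_modes weighted_continuousD(1) Z_finite unfolding solution_def by blast+

lemma solution_mono:
  assumes "solution s T u" "s \<le> s'" "T' \<le> T"
  shows "solution s' T' u"
  unfolding solution_def
  using weighted_continuous_mono[OF solutionD(1)[OF assms(1)] assms(2,3)] linear_solution_mono[OF solutionD(3)[OF assms(1)] assms(2,3)]
    II_subset[OF assms(2,3), of "\<lambda>\<tau>. sqn l (u \<tau>)"] solutionD(2)[OF assms(1)] by (auto intro: le_less_trans)

end

section \<open>Picard iteration and uniqueness\<close>

context semilinear_evolution
begin

text \<open>The Picard map preserves its ball. Here \<open>y\<close> is the linear flow of the
  datum, and \<open>z - y\<close> solves the linear equation with zero initial value, so
  \<open>linear_Z\<close> bounds its \<open>Z\<close> by \<open>eps / 256\<close>; then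
  \<open>8 * eps + 8 * (eps / 256) \<le> 16 * eps\<close>.\<close>

lemma picard_step:
  assumes y: "linear_solution s T (\<lambda>t n. 0) y" "sqn m (y s) < \<infinity>" "Z s T y \<le> ennreal eps" and sT: "s \<le> T"
    and u: "\<And>n. continuous_on {s..T} (\<lambda>\<tau>. u \<tau> n)" "\<And>\<tau>. \<tau> \<in> {s..T} \<Longrightarrow> sqn m (u \<tau>) < \<infinity>"
      "Z s T u \<le> ennreal (16 * eps)"
    and z: "linear_solution s T (source u) z" "z s = y s"
  shows "weighted_continuous s T z" "Z s T z \<le> ennreal (16 * eps)"
    "\<And>t. t \<in> {s..T} \<Longrightarrow> sqn m (z t) \<le> sqn m (y s) + ennreal (16 * K * eps / \<nu>)"
    "sqn_int s T l z \<le> ennreal (1 / \<nu>) * (sqn m (y s) + ennreal (16 * K * eps / \<nu>))"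
proof -
  let ?G = "II s T (\<lambda>\<tau>. sqn il (source u \<tau>))"
  have "?G \<le> ennreal K * Z s T u" by (rule source_bound[OF u(1,2)])
  also have "... \<le> ennreal K * ennreal (16 * eps)" by (intro mult_left_mono u) auto
  also have "... = ennreal (16 * K * eps)" using K_pos eps_pos by (subst ennreal_mult[symmetric]) (auto simp: mult_ac)
  finally have G: "?G \<le> ennreal (16 * K * eps)" .
  then have Gfin: "?G < \<infinity>" by (rule le_less_trans) simp
  have G': "ennreal (1 / \<nu>) * ?G \<le> ennreal (16 * K * eps / \<nu>)"
  proof -
    have "ennreal (1 / \<nu>) * ?G \<le> ennreal (1 / \<nu>) * ennreal (16 * K * eps)" by (intro mult_left_mono G) auto
    also have "... = ennreal (16 * K * eps / \<nu>)" using K_pos eps_pos \<nu>_pos by (subst ennreal_mult[symmetric]) auto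
    finally show ?thesis .
  qed
  have zs: "sqn m (z s) < \<infinity>" using y z by simp
  show wz: "weighted_continuous s T z" by (rule linear_weighted_continuous[OF z(1) zs Gfin])
  show "sqn m (z t) \<le> sqn m (y s) + ennreal (16 * K * eps / \<nu>)" if "t \<in> {s..T}" for t
    using linear_sup_bound[OF z(1) that] G' z(2) by (auto intro: order_trans add_left_mono)
  show "sqn_int s T l z \<le> ennreal (1 / \<nu>) * (sqn m (y s) + ennreal (16 * K * eps / \<nu>))"
    by (rule order_trans[OF linear_int_bound[OF z(1) sT]], unfold z(2), intro mult_left_mono add_left_mono G') simp
  define w where "w = (\<lambda>\<tau> n. z \<tau> n - y \<tau> n)"
  have lw: "linear_solution s T (source u) w" using linear_solution_diff[OF z(1) y(1)] by (simp add: w_def)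
  have w0: "w s = (\<lambda>n. 0)" by (simp add: w_def z)
  have "Z s T w \<le> ennreal (1 / \<nu> ^ 3) * ?G^2" by (rule linear_Z[OF lw sT w0])
  also have "... \<le> ennreal (1 / \<nu> ^ 3) * (ennreal (16 * K * eps))^2" by (intro mult_left_mono power_mono G) auto
  also have "... = ennreal (1 / \<nu> ^ 3 * (16 * K * eps)^2)"
    using K_pos eps_pos \<nu>_pos by (subst ennreal_power, simp, subst ennreal_mult[symmetric], auto)
  also have "1 / \<nu> ^ 3 * (16 * K * eps)^2 = eps / 256" using K_pos \<nu>_pos by (simp add: eps_def power2_eq_square field_simps)
  finally have Zw: "Z s T w \<le> ennreal (eps / 256)" .
  have "Z s T z = Z s T (\<lambda>\<tau> n. y \<tau> n + w \<tau> n)" by (simp add: w_def)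
  also have "... \<le> 8 * Z s T y + 8 * Z s T w" by (intro Z_add linear_solutionD(2)[OF y(1)] linear_solutionD(2)[OF lw])
  also have "... \<le> 8 * ennreal eps + 8 * ennreal (eps / 256)" by (intro add_mono mult_left_mono y Zw) auto
  also have "... = ennreal (8 * eps + 8 * (eps / 256))"
    using eps_pos by (simp only: numeral_times_ennreal ennreal_plus mult_nonneg_nonneg less_imp_le zero_le_numeral divide_nonneg_nonneg)
  also have "... \<le> ennreal (16 * eps)" using eps_pos by (intro ennreal_leI) simp
  finally show "Z s T z \<le> ennreal (16 * eps)" .
qed

lemma picard_contraction:
  assumes sT: "s \<le> T"
    and u: "\<And>n. continuous_on {s..T} (\<lambda>\<tau>. u \<tau> n)" "\<And>\<tau>. \<tau> \<in> {s..T} \<Longrightarrow> sqn m (u \<tau>) < \<infinity>" "Z s T u \<le> ennreal (16 * eps)"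
    and v: "\<And>n. continuous_on {s..T} (\<lambda>\<tau>. v \<tau> n)" "\<And>\<tau>. \<tau> \<in> {s..T} \<Longrightarrow> sqn m (v \<tau>) < \<infinity>" "Z s T v \<le> ennreal (16 * eps)"
    and z: "linear_solution s T (source u) z" and x: "linear_solution s T (source v) x" and eq: "z s = x s"
    and D: "Z s T (\<lambda>\<tau> n. u \<tau> n - v \<tau> n) \<le> ennreal D" "0 \<le> D"
  shows "Z s T (\<lambda>\<tau> n. z \<tau> n - x \<tau> n) \<le> ennreal (D / 256)"
    "\<And>t. t \<in> {s..T} \<Longrightarrow> sqn m (\<lambda>n. z t n - x t n) \<le> ennreal (sqrt (\<nu> * D) / 16)"
proof -
  define G where "G = II s T (\<lambda>\<tau>. sqn il (\<lambda>n. source u \<tau> n - source v \<tau> n))"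
  define w where "w = (\<lambda>\<tau> n. z \<tau> n - x \<tau> n)"
  have lw: "linear_solution s T (\<lambda>\<tau> n. source u \<tau> n - source v \<tau> n) w" unfolding w_def by (rule linear_solution_diff[OF z x])
  have w0: "w s = (\<lambda>n. 0)" by (simp add: w_def eq)
  have "G^2 \<le> ennreal (8 * K^2) * (Z s T (\<lambda>\<tau> n. u \<tau> n - v \<tau> n) * (Z s T u + Z s T v))"
    unfolding G_def by (rule source_diff_bound[OF u(1,2) v(1,2)])
  also have "... \<le> ennreal (8 * K^2) * (ennreal D * (ennreal (16 * eps) + ennreal (16 * eps)))"
    by (intro mult_left_mono mult_mono add_mono u v D) auto
  also have "... = ennreal (8 * K^2 * (D * (16 * eps + 16 * eps)))"
    using eps_pos D(2) by (simp only: ennreal_plus ennreal_mult mult_nonneg_nonneg add_nonneg_nonneg zero_le_power2 less_imp_le zero_le_numeral)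
  \<comment> \<open>\<open>8 * K^2 * 32 * eps = \<nu> ^ 3 / 256\<close> by the choice of
    \<open>eps\<close>. The value is written as a square so that a bound on \<open>G\<close> itself
    can be read off.\<close>
  also have "8 * K^2 * (D * (16 * eps + 16 * eps)) = (\<nu> * sqrt (\<nu> * D) / 16)^2"
    using K_pos \<nu>_pos D(2) by (simp add: eps_def power_mult_distrib power_divide) (simp add: power2_eq_square power3_eq_cube field_simps)
  also have "ennreal ... = (ennreal (\<nu> * sqrt (\<nu> * D) / 16))^2" using \<nu>_pos D(2) by (subst ennreal_power) auto
  finally have G: "G \<le> ennreal (\<nu> * sqrt (\<nu> * D) / 16)" by (rule ennreal_square_le_imp_le)
  have "Z s T w \<le> ennreal (1 / \<nu> ^ 3) * G^2" unfolding G_def by (rule linear_Z[OF lw sT w0])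
  also have "... \<le> ennreal (1 / \<nu> ^ 3) * (ennreal (\<nu> * sqrt (\<nu> * D) / 16))^2" by (intro mult_left_mono power_mono G) auto
  also have "... = ennreal (1 / \<nu> ^ 3 * (\<nu> * sqrt (\<nu> * D) / 16)^2)"
    using \<nu>_pos D(2) by (subst ennreal_power, simp, subst ennreal_mult[symmetric], auto)
  also have "1 / \<nu> ^ 3 * (\<nu> * sqrt (\<nu> * D) / 16)^2 = D / 256"
    using \<nu>_pos D(2) by (simp add: power_mult_distrib power_divide) (simp add: power2_eq_square power3_eq_cube)
  finally show "Z s T (\<lambda>\<tau> n. z \<tau> n - x \<tau> n) \<le> ennreal (D / 256)" by (simp add: w_def)
  fix t assume t: "t \<in> {s..T}"
  have "sqn m (w t) \<le> ennreal (1 / \<nu>) * G" using linear_sup_bound[OF lw t] w0 by (simp add: G_def)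
  also have "... \<le> ennreal (1 / \<nu>) * ennreal (\<nu> * sqrt (\<nu> * D) / 16)" by (intro mult_left_mono G) auto
  also have "... = ennreal (sqrt (\<nu> * D) / 16)" using \<nu>_pos D(2) by (subst ennreal_mult[symmetric]) auto
  finally show "sqn m (\<lambda>n. z t n - x t n) \<le> ennreal (sqrt (\<nu> * D) / 16)" by (simp add: w_def)
qed

text \<open>Both solutions are fixed points, so the contraction compares \<open>Z\<close> of their
  difference with itself; being finite, it vanishes. The pointwise bound with \<open>D = 0\<close>
  then gives equality at each time.\<close>

lemma unique_small:
  assumes u: "solution s T u" "Z s T u \<le> ennreal eps" and v: "solution s T v" "Z s T v \<le> ennreal eps"
    and eq: "u s = v s" and t: "t \<in> {s..T}"
  shows "u t = v t"
proof -
  let ?Z = "Z s T (\<lambda>\<tau> n. u \<tau> n - v \<tau> n)"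
  have sT: "s \<le> T" using t by simp
  have e: "ennreal eps \<le> ennreal (16 * eps)" using eps_pos by (intro ennreal_leI) simp
  note contr = picard_contraction[OF sT solutionD(4,5)[OF u(1)] order_trans[OF u(2) e] solutionD(4,5)[OF v(1)] order_trans[OF v(2) e]
      solutionD(3)[OF u(1)] solutionD(3)[OF v(1)] eq]
  have "?Z \<le> 8 * Z s T u + 8 * Z s T v" by (intro Z_diff_le solutionD(4)[OF u(1)] solutionD(4)[OF v(1)])
  also have "... < \<infinity>" using solutionD(6)[OF u(1)] solutionD(6)[OF v(1)] by (simp add: ennreal_mult_less_top)
  finally obtain z where z: "?Z = ennreal z" "0 \<le> z" by (cases ?Z) auto
  have "ennreal z \<le> ennreal (z / 256)" using contr(1)[of z] z by simp
  then have "z \<le> z / 256" using z(2) by (subst (asm) ennreal_le_iff) auto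
  then have "?Z \<le> ennreal 0" using z by simp
  then have "sqn m (\<lambda>n. u t n - v t n) \<le> 0" using contr(2)[of 0 t] t by simp
  then have "(\<lambda>n. u t n - v t n) = (\<lambda>n. 0)" by (intro sqn_eq_0[OF m_pos]) simp
  then show ?thesis by (simp add: fun_eq_iff)
qed

lemma Z_small:
  assumes "weighted_continuous s T u" "Z s T u < \<infinity>" "0 < (e::real)"
  obtains \<delta> where "\<delta> > 0" "\<And>t t'. s \<le> t \<Longrightarrow> t' \<le> T \<Longrightarrow> t' \<le> t + \<delta> \<Longrightarrow> Z t t' u \<le> ennreal e"
  using II_small[OF Z_measurable[where u = u, OF weighted_continuous_modes[OF assms(1)]] assms(2)[unfolded Z_def] assms(3)]
  unfolding Z_def by blast

text \<open>\<open>Z_small\<close> gives a step \<open>d\<close> over which both solutions have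
  small \<open>Z\<close>, wherever the step begins; \<open>unique_small\<close> is iterated along
  steps of that length.\<close>

lemma unique:
  assumes u: "solution s T u" and v: "solution s T v" and eq: "u s = v s" and t: "t \<in> {s..T}"
  shows "u t = v t"
proof -
  obtain a where a: "a > 0" "\<And>t t'. s \<le> t \<Longrightarrow> t' \<le> T \<Longrightarrow> t' \<le> t + a \<Longrightarrow> Z t t' u \<le> ennreal eps"
    using Z_small[OF solutionD(1,6)[OF u] eps_pos] by metis
  obtain b where b: "b > 0" "\<And>t t'. s \<le> t \<Longrightarrow> t' \<le> T \<Longrightarrow> t' \<le> t + b \<Longrightarrow> Z t t' v \<le> ennreal eps"
    using Z_small[OF solutionD(1,6)[OF v] eps_pos] by metis
  define d where "d = min a b"
  have d: "d > 0" using a b by (simp add: d_def)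
  have main: "\<forall>t\<in>{s..min T (s + real k * d)}. u t = v t" for k
  proof (induction k)
    case 0
    show ?case
    proof
      fix t assume "t \<in> {s..min T (s + real 0 * d)}"
      then have "t = s" by simp
      then show "u t = v t" using eq by simp
    qed
  next
    case (Suc k)
    show ?case
    proof
      fix t assume t: "t \<in> {s..min T (s + real (Suc k) * d)}"
      show "u t = v t"
      proof (cases "t \<le> s + real k * d")
        case True
        then show ?thesis using Suc t by simp
      next
        case False
        define s' where "s' = s + real k * d"
        have s': "s \<le> s'" "s' \<le> t" "t \<le> T" "t \<le> s' + d" using False t d by (auto simp: s'_def algebra_simps)
        have "u s' = v s'" using Suc s' by (auto simp: s'_def)
        then show ?thesis
          using s' a b by (intro unique_small[where s = s' and T = t and u = u and v = v and t = t] solution_mono[OF u] solution_mono[OF v]) (auto simp: d_def)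
      qed
    qed
  qed
  obtain k :: nat where "T - s < real k * d" using reals_Archimedean3[OF d] by blast
  then have "t \<in> {s..min T (s + real k * d)}" using t by auto
  then show ?thesis using main by blast
qed

text \<open>The limit is taken mode by mode. Telescoping makes the convergence uniform in time, so
  the integral equations pass to the limit; the weighted bounds survive by Fatou's lemma, both over
  the modes and in time.\<close>

lemma limit_of_picard:
  assumes sT: "s \<le> T" and "0 \<le> c" and B: "0 \<le> B"
    and W: "\<And>k. weighted_continuous s T (W k)" "\<And>k t. t \<in> {s..T} \<Longrightarrow> sqn m (W k t) \<le> ennreal B"
      "\<And>k. II s T (\<lambda>\<tau>. sqn l (W k \<tau>)) \<le> ennreal B" "\<And>k. linear_solution s T (source (W k)) (W (Suc k))"
    and start: "\<And>k. W k s = a"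
    and step: "\<And>k t. t \<in> {s..T} \<Longrightarrow> sqn m (\<lambda>n. W (Suc k) t n - W k t n) \<le> ennreal (c / 16 ^ k)"
  obtains u where "solution s T u" "u s = a"
proof -
  have tele: "sqn m (\<lambda>n. W (k + i) t n - W k t n) \<le> ennreal (4 * c / 16 ^ k)" if "t \<in> {s..T}" for k i t
    by (rule sqn_telescope[where W = "\<lambda>k. W k t", OF m_nonneg \<open>0 \<le> c\<close> step[OF that]])
  have mode: "(x n)^2 \<le> d" if "sqn m x \<le> ennreal d" "0 \<le> d" for x n d
  proof -
    have "1 * (x n)^2 \<le> m n * (x n)^2" by (intro mult_right_mono m_ge) auto
    moreover have "ennreal (m n * (x n)^2) \<le> ennreal d" using that(1) sqn_term_le[of m n x] by order
    ultimately show ?thesis using that(2) by (simp add: ennreal_le_iff)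
  qed
  have small: "\<exists>k. 4 * c / 16 ^ k < e" if "0 < e" for e :: real
  proof -
    have "(\<lambda>k. 4 * c * (1 / 16) ^ k) \<longlonglongrightarrow> 4 * c * 0" by (intro tendsto_intros) auto
    then have "\<forall>\<^sub>F k in sequentially. 4 * c * (1 / 16) ^ k < e" using that by (intro order_tendstoD) auto
    then show ?thesis by (auto simp: eventually_sequentially power_divide)
  qed
  have "convergent (\<lambda>k. W k t n)" if t: "t \<in> {s..T}" for t n
  proof -
    have "Cauchy (\<lambda>k. W k t n)"
    proof (rule CauchyI')
      fix e :: real assume "0 < e"
      then obtain k where k: "4 * c / 16 ^ k < (e / 2)^2" using small[of "(e / 2)^2"] by auto
      have b: "\<bar>W (k + i) t n - W k t n\<bar> < e / 2" for i
      proof -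
        have "(W (k + i) t n - W k t n)^2 \<le> 4 * c / 16 ^ k" using mode[OF tele[OF t]] \<open>0 \<le> c\<close> by simp
        then have "\<bar>W (k + i) t n - W k t n\<bar>^2 < (e / 2)^2" using k by simp
        then show ?thesis by (rule power2_less_imp_less) (use \<open>0 < e\<close> in simp)
      qed
      show "\<exists>M. \<forall>p\<ge>M. \<forall>q>p. dist (W p t n) (W q t n) < e"
      proof (intro exI allI impI)
        fix p q assume "k \<le> p" "p < q"
        then have "\<bar>W p t n - W k t n\<bar> < e / 2" "\<bar>W q t n - W k t n\<bar> < e / 2" using b[of "p - k"] b[of "q - k"] by auto
        then show "dist (W p t n) (W q t n) < e" unfolding dist_real_def by arith
      qed
    qed
    then show ?thesis by (simp add: Cauchy_convergent)
  qed
  then have lim: "(\<lambda>k. W k t n) \<longlonglongrightarrow> lim (\<lambda>k. W k t n)" if "t \<in> {s..T}" for t n using that by (simp add: convergent_LIMSEQ_iff)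
  define u where "u t n = lim (\<lambda>k. W k t n)" for t n
  have lim: "(\<lambda>k. W k t n) \<longlonglongrightarrow> u t n" if "t \<in> {s..T}" for t n using lim[OF that] by (simp add: u_def)
  have us: "u s = a" by (simp add: u_def start fun_eq_iff)
  have ub: "sqn m (u t) \<le> ennreal B" if "t \<in> {s..T}" for t
    by (rule sqn_limit_le[OF m_nonneg lim[OF that]]) (intro always_eventually allI W(2) that)
  have near: "sqn m (\<lambda>n. u t n - W k t n) \<le> ennreal (4 * c / 16 ^ k)" if t: "t \<in> {s..T}" for t k
  proof (rule sqn_limit_le[OF m_nonneg])
    show "(\<lambda>i. W (k + i) t n - W k t n) \<longlonglongrightarrow> u t n - W k t n" for n
      using LIMSEQ_ignore_initial_segment[OF lim[OF t], of k n] by (intro tendsto_intros) (simp add: add.commute)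
  qed (simp add: tele[OF t])
  have "sqn_int s T l u \<le> II s T (\<lambda>\<tau>. liminf (\<lambda>k. sqn l (W k \<tau>)))" by (intro II_mono sqn_liminf_le lim) auto
  also have "... \<le> liminf (\<lambda>k. II s T (\<lambda>\<tau>. sqn l (W k \<tau>)))"
    unfolding II_def by (intro nn_integral_liminf measurable_sqn_interval weighted_continuous_modes W)
  also have "... \<le> liminf (\<lambda>k::nat. ennreal B)" by (intro Liminf_mono always_eventually allI W)
  also have "... = ennreal B" by (simp add: Liminf_const)
  finally have ul: "sqn_int s T l u < \<infinity>" by (rule le_less_trans) simp
  have ulW: "uniform_limit {s..T} (\<lambda>k \<tau>. W (Suc k) \<tau> n) (\<lambda>\<tau>. u \<tau> n) sequentially" for n
  proof (rule uniform_limit_geometric)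
    fix k \<tau> assume "\<tau> \<in> {s..T}"
    then have "(u \<tau> n - W (Suc k) \<tau> n)^2 \<le> 4 * c / 16 ^ Suc k" using mode[OF near, of \<tau> "Suc k" n] \<open>0 \<le> c\<close> by auto
    also have "... \<le> 4 * c / 16 ^ k" using \<open>0 \<le> c\<close> by (simp add: field_simps)
    finally show "(W (Suc k) \<tau> n - u \<tau> n)^2 \<le> 4 * c / 16 ^ k" by (simp add: power2_commute)
  qed
  have ulF: "uniform_limit {s..T} (\<lambda>k \<tau>. F (W k \<tau>) (W k \<tau>) n) (\<lambda>\<tau>. F (u \<tau>) (u \<tau>) n) sequentially" for n
  proof (rule uniform_limit_geometric)
    fix k \<tau> assume \<tau>: "\<tau> \<in> {s..T}"
    have "(F (u \<tau>) (u \<tau>) n - F (W k \<tau>) (W k \<tau>) n)^2 \<le> 4 * C n * B * (4 * c / 16 ^ k)"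
      using \<open>0 \<le> c\<close> B by (intro F_diff_component ub W near \<tau>) auto
    then show "(F (W k \<tau>) (W k \<tau>) n - F (u \<tau>) (u \<tau>) n)^2 \<le> (4 * C n * B * (4 * c)) / 16 ^ k" by (simp add: power2_commute)
  qed
  have cu: "continuous_on {s..T} (\<lambda>\<tau>. u \<tau> n)" for n
    by (rule uniform_limit_theorem[OF always_eventually ulW]) (auto intro: weighted_continuous_modes W)
  have cF: "continuous_on {s..T} (\<lambda>\<tau>. F (u \<tau>) (u \<tau>) n)" for n
    by (rule uniform_limit_theorem[OF always_eventually ulF]) (auto intro: F_continuous W)
  have lu: "linear_solution s T (source u) u" unfolding linear_solution_def
  proof (intro allI conjI ballI cu continuous_on_minus cF)
    fix n t assume t: "t \<in> {s..T}"
    have tT: "{s..t} \<subseteq> {s..T}" using t by auto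
    have "(\<lambda>k. integral {s..t} (\<lambda>\<tau>. source (W k) \<tau> n - \<nu> * l n * W (Suc k) \<tau> n)) \<longlonglongrightarrow> integral {s..t} (\<lambda>\<tau>. source u \<tau> n - \<nu> * l n * u \<tau> n)"
    proof -
      have "uniform_limit (cbox s t) (\<lambda>k \<tau>. source (W k) \<tau> n - \<nu> * l n * W (Suc k) \<tau> n) (\<lambda>\<tau>. source u \<tau> n - \<nu> * l n * u \<tau> n) sequentially"
        unfolding cbox_interval by (intro uniform_limit_intros uniform_limit_on_subset[OF ulF tT] uniform_limit_on_subset[OF ulW tT])
      moreover have "continuous_on (cbox s t) (\<lambda>\<tau>. source (W k) \<tau> n - \<nu> * l n * W (Suc k) \<tau> n)" for k unfolding cbox_interval
        by (intro continuous_intros continuous_on_subset[OF F_continuous[OF W(1)] tT] continuous_on_subset[OF weighted_continuous_modes[OF W(1)] tT])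
      ultimately obtain I J where IJ: "\<And>k. ((\<lambda>\<tau>. source (W k) \<tau> n - \<nu> * l n * W (Suc k) \<tau> n) has_integral I k) (cbox s t)"
        "((\<lambda>\<tau>. source u \<tau> n - \<nu> * l n * u \<tau> n) has_integral J) (cbox s t)" "I \<longlonglongrightarrow> J" by (rule uniform_limit_integral_cbox) auto
      show ?thesis using IJ(3)
        by (simp only: integral_unique[OF IJ(1), unfolded cbox_interval] integral_unique[OF IJ(2), unfolded cbox_interval])
    qed
    then have "(\<lambda>k. m n * a n + integral {s..t} (\<lambda>\<tau>. source (W k) \<tau> n - \<nu> * l n * W (Suc k) \<tau> n)) \<longlonglongrightarrow> m n * a n + integral {s..t} (\<lambda>\<tau>. source u \<tau> n - \<nu> * l n * u \<tau> n)"
      by (intro tendsto_intros)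
    moreover have "m n * a n + integral {s..t} (\<lambda>\<tau>. source (W k) \<tau> n - \<nu> * l n * W (Suc k) \<tau> n) = m n * W (Suc k) t n" for k
      using linear_solutionD(3)[OF W(4) t, of n k] start[of "Suc k"] by simp
    moreover have "(\<lambda>k. m n * W (Suc k) t n) \<longlonglongrightarrow> m n * u t n" using lim[OF t] by (intro tendsto_intros LIMSEQ_Suc)
    ultimately show "m n * u t n = m n * u s n + integral {s..t} (\<lambda>\<tau>. source u \<tau> n - \<nu> * l n * u \<tau> n)" using LIMSEQ_unique us by auto
  qed
  have uf: "sqn m (u t) < \<infinity>" if "t \<in> {s..T}" for t using ub[OF that] by (rule le_less_trans) simp
  have "Z s T u \<le> ennreal B * sqn_int s T l u" by (intro Z_le ub cu)
  also have "... < \<infinity>" using ul by (simp add: ennreal_mult_less_top)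
  finally have "II s T (\<lambda>\<tau>. sqn il (source u \<tau>)) < \<infinity>"
    using source_bound[OF cu uf] by (auto simp: ennreal_mult_less_top intro: le_less_trans)
  from linear_weighted_continuous[OF lu uf this] have "solution s T u" using lu ul sT by (simp add: solution_def)
  then show ?thesis using that us by blast
qed

lemma local_existence:
  assumes y: "linear_solution s T (\<lambda>t n. 0) y" "sqn m (y s) < \<infinity>" "Z s T y \<le> ennreal eps" and sT: "s \<le> T"
  obtains u where "solution s T u" "u s = y s"
proof -
  define good where "good u \<longleftrightarrow> weighted_continuous s T u \<and> Z s T u \<le> ennreal (16 * eps) \<and> u s = y s" for u
  have next_ex: "\<exists>z. z s = y s \<and> linear_solution s T (source u) z" if "good u" for u
  proof -
    have "continuous_on {s..T} (\<lambda>t. source u t n)" for n using that by (intro continuous_intros F_continuous) (simp add: good_def)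
    then show ?thesis by (rule linear_solution_exists[where a = "y s" and f = "source u"]) blast
  qed
  define nxt where "nxt u = (SOME z. z s = y s \<and> linear_solution s T (source u) z)" for u
  have nxt: "nxt u s = y s" "linear_solution s T (source u) (nxt u)" if "good u" for u
    using someI_ex[OF next_ex[OF that]] by (auto simp: nxt_def)
  have fin: "sqn m (u t) < \<infinity>" "continuous_on {s..T} (\<lambda>\<tau>. u \<tau> n)" "Z s T u \<le> ennreal (16 * eps)" if "good u" "t \<in> {s..T}" for u t n
    using that weighted_continuousD(1) weighted_continuous_modes unfolding good_def by blast+
  have s_in: "s \<in> {s..T}" using sT by simp
  have gn: "good (nxt u)" if "good u" for u
    using picard_step(1,2)[OF y sT fin(2)[OF that s_in] fin(1)[OF that] fin(3)[OF that s_in] nxt(2,1)[OF that]] nxt(1)[OF that]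
    by (simp add: good_def)
  have pc: "Z s T (\<lambda>\<tau> n. nxt u \<tau> n - nxt v \<tau> n) \<le> ennreal (d / 256)"
    "\<And>t. t \<in> {s..T} \<Longrightarrow> sqn m (\<lambda>n. nxt u t n - nxt v t n) \<le> ennreal (sqrt (\<nu> * d) / 16)"
    if "good u" "good v" "Z s T (\<lambda>\<tau> n. u \<tau> n - v \<tau> n) \<le> ennreal d" "0 \<le> d" for u v d
    using picard_contraction[OF sT fin(2)[OF that(1) s_in] fin(1)[OF that(1)] fin(3)[OF that(1) s_in] fin(2)[OF that(2) s_in]
        fin(1)[OF that(2)] fin(3)[OF that(2) s_in] nxt(2)[OF that(1)] nxt(2)[OF that(2)] _ that(3,4)] nxt(1) that by simp_all
  \<comment> \<open>The sequence starts at \<open>nxt y\<close> and not at \<open>y\<close>, because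
    the uniform bounds of \<open>picard_step\<close> hold for images under
    \<open>nxt\<close>.\<close>
  define W where "W k = (nxt ^^ Suc k) y" for k
  have gy: "good y"
  proof -
    have "weighted_continuous s T y" by (rule linear_weighted_continuous[OF y(1,2)]) (simp add: II_def)
    moreover have "Z s T y \<le> ennreal (16 * eps)" using y(3) by (rule order_trans) (use eps_pos in \<open>simp add: ennreal_leI\<close>)
    ultimately show ?thesis by (simp add: good_def)
  qed
  have gW: "good ((nxt ^^ k) y)" for k by (induction k) (auto intro: gy gn)
  obtain B0 where B0: "sqn m (y s) = ennreal B0" "0 \<le> B0" using y(2) by (cases "sqn m (y s)") auto
  define B where "B = max (B0 + 16 * K * eps / \<nu>) (1 / \<nu> * (B0 + 16 * K * eps / \<nu>))"
  have pos: "0 \<le> 16 * K * eps / \<nu>" using K_pos eps_pos \<nu>_pos by simp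
  have eB: "sqn m (y s) + ennreal (16 * K * eps / \<nu>) = ennreal (B0 + 16 * K * eps / \<nu>)" using B0 pos by simp
  define D where "D k = Z s T (\<lambda>\<tau> n. (nxt ^^ Suc k) y \<tau> n - (nxt ^^ k) y \<tau> n)" for k
  have "D 0 < \<infinity>"
  proof -
    have "D 0 \<le> 8 * Z s T (nxt y) + 8 * Z s T y" unfolding D_def by simp (intro Z_diff_le fin(2)[OF gy s_in] fin(2)[OF gn[OF gy] s_in])
    also have "... < \<infinity>" using fin(3)[OF gy s_in] fin(3)[OF gn[OF gy] s_in] by (auto simp: ennreal_mult_less_top intro: le_less_trans)
    finally show ?thesis .
  qed
  then obtain D0 where D0: "D 0 = ennreal D0" "0 \<le> D0" by (cases "D 0") auto
  have Dk: "D k \<le> ennreal (D0 / 256 ^ k)" for k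
  proof (induction k)
    case 0
    show ?case by (simp add: D0)
  next
    case (Suc k)
    have "D (Suc k) \<le> ennreal (D0 / 256 ^ k / 256)" using pc(1)[OF gW[of "Suc k"] gW[of k] Suc[unfolded D_def]] D0 by (simp add: D_def)
    then show ?case by (simp add: mult.commute)
  qed
  show ?thesis
  proof (rule limit_of_picard[where W = W and a = "y s" and c = "sqrt (\<nu> * D0) / 16" and B = B, OF sT])
    show "0 \<le> sqrt (\<nu> * D0) / 16" "0 \<le> B" using D0 \<nu>_pos B0 pos by (auto simp: B_def max_def)
    show "weighted_continuous s T (W k)" "W k s = y s" for k using gW[of "Suc k"] by (auto simp: W_def good_def)
    note ps = picard_step(3,4)[OF y sT fin(2)[OF gW s_in] fin(1)[OF gW] fin(3)[OF gW s_in] nxt(2,1)[OF gW]]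
    show "sqn m (W k t) \<le> ennreal B" if "t \<in> {s..T}" for k t
      using order_trans[OF ps(1)[OF _ that, of k, unfolded eB] ennreal_leI[of _ B]] by (simp add: W_def B_def)
    have "ennreal (1 / \<nu>) * ennreal (B0 + 16 * K * eps / \<nu>) = ennreal (1 / \<nu> * (B0 + 16 * K * eps / \<nu>))"
      using \<nu>_pos B0 pos by (subst ennreal_mult) auto
    then show "II s T (\<lambda>\<tau>. sqn l (W k \<tau>)) \<le> ennreal B" for k
      using order_trans[OF ps(2)[of k, unfolded eB] eq_refl] ennreal_leI[of "1 / \<nu> * (B0 + 16 * K * eps / \<nu>)" B]
      by (auto simp: W_def B_def intro: order_trans)
    show "linear_solution s T (source (W k)) (W (Suc k))" for k using nxt(2)[OF gW[of "Suc k"]] by (simp add: W_def)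
    fix k t assume t: "t \<in> {s..T}"
    have "sqn m (\<lambda>n. W (Suc k) t n - W k t n) \<le> ennreal (sqrt (\<nu> * (D0 / 256 ^ k)) / 16)"
      using pc(2)[OF gW[of "Suc k"] gW[of k] Dk[of k, unfolded D_def] _ t] D0 by (simp add: W_def)
    also have "... \<le> ennreal (sqrt (\<nu> * D0) / 16 / 16 ^ k)"
    proof -
      \<comment> \<open>\<open>Z\<close> scales like the square of \<open>sqn m\<close>, so the
        ratio 256 for \<open>Z\<close> becomes 16 for \<open>sqn m\<close>.\<close>
      have "sqrt (256 ^ k) = 16 ^ k" by (rule real_sqrt_unique) (simp_all add: power_mult_distrib[symmetric] power2_eq_square)
      then have "sqrt (\<nu> * (D0 / 256 ^ k)) = sqrt (\<nu> * D0) / 16 ^ k" by (simp add: real_sqrt_divide)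
      then show ?thesis by (simp add: mult.commute)
    qed
    finally show "sqn m (\<lambda>n. W (Suc k) t n - W k t n) \<le> ennreal (sqrt (\<nu> * D0) / 16 / 16 ^ k)" .
  qed (rule that)
qed

section \<open>Energy inequality and continuation\<close>

lemma solution_mode_energy:
  assumes u: "solution s T u" and t: "t \<in> {s..T}"
  shows "m n * (u t n)^2 + 2 * \<nu> * (l n * integral {s..t} (\<lambda>\<tau>. (u \<tau> n)^2))
    = m n * (u s n)^2 - 2 * integral {s..t} (\<lambda>\<tau>. F (u \<tau>) (u \<tau>) n * u \<tau> n)"
proof -
  note lin = solutionD(3)[OF u]
  have "m n * (u t n)^2 + 2 * (\<nu> * l n) * integral {s..t} (\<lambda>\<tau>. (u \<tau> n)^2)
      = m n * (u s n)^2 + 2 * integral {s..t} (\<lambda>\<tau>. source u \<tau> n * u \<tau> n)"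
    by (rule mode_energy[OF m_pos linear_solutionD(1,2)[OF lin] linear_solutionD(3)[OF lin] t])
  then show ?thesis by (simp add: mult.assoc)
qed

text \<open>The modewise identities are summed up to \<open>N\<close>. The contributions
  \<open>e N\<close> of the quadratic term do not cancel at finite \<open>N\<close>; they tend to 0
  because \<open>F_energy\<close> holds at almost every time, namely where \<open>sqn l\<close> is
  finite, and \<open>mode_series_integral\<close> carries this over to the integrals.\<close>

lemma energy_inequality:
  assumes u: "solution s T u" and t: "t \<in> {s..T}"
  shows "sqn m (u t) + ennreal (2 * \<nu>) * sqn_int s t l u \<le> sqn m (u s)"
proof -
  have sT: "s \<le> t" "t \<le> T" using t by auto
  have ut: "solution s t u" by (rule solution_mono[OF u]) (use t in auto)
  note c = solutionD(4)[OF ut]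
  have Fc: "continuous_on {s..t} (\<lambda>\<tau>. F (u \<tau>) (u \<tau>) n)" for n by (rule F_continuous[OF solutionD(1)[OF ut]])
  define e where "e N = (\<Sum>n<N. integral {s..t} (\<lambda>\<tau>. F (u \<tau>) (u \<tau>) n * u \<tau> n))" for N
  have FI: "II s t (\<lambda>\<tau>. sqn il (F (u \<tau>) (u \<tau>))) < \<infinity>" using source_bound[OF c solutionD(5)[OF ut]] solutionD(6)[OF ut]
    by (auto simp: sqn_uminus ennreal_mult_less_top intro: le_less_trans)
  have "AE \<tau> in lebesgue_on {s..t}. \<tau> \<in> {s..t}" by (rule AE_I2) simp
  with II_AE_finite[OF c solutionD(2)[OF ut]] have "AE \<tau> in lebesgue_on {s..t}. (\<lambda>n. F (u \<tau>) (u \<tau>) n * u \<tau> n) sums 0"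
    by eventually_elim (intro F_energy solutionD(5)[OF ut])
  from mode_series_integral(2)[where y = "\<lambda>\<tau>. F (u \<tau>) (u \<tau>)" and d = u, OF Fc FI c solutionD(2)[OF ut] this]
  have e0: "e \<longlonglongrightarrow> 0" unfolding sums_def e_def[abs_def] by simp
  define q where "q n = m n * (u t n)^2 + 2 * \<nu> * (l n * integral {s..t} (\<lambda>\<tau>. (u \<tau> n)^2))" for n
  have q0: "0 \<le> q n" for n unfolding q_def using \<nu>_pos by (intro add_nonneg_nonneg mult_nonneg_nonneg integral_square_nonneg) auto
  have eq: "sqn m (u t) + ennreal (2 * \<nu>) * sqn_int s t l u = (\<Sum>n. ennreal (q n))"
    using sqn_plus_II[where w = l and y = u and a = "u t" and c = "2 * \<nu>", OF c l_nonneg] \<nu>_pos by (simp add: q_def)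
  have le: "(\<Sum>n<N. ennreal (q n)) \<le> sqn m (u s) + ennreal (2 * \<bar>e N\<bar>)" for N
  proof -
    have "(\<Sum>n<N. ennreal (q n)) = ennreal (\<Sum>n<N. q n)" using q0 by (simp add: sum_ennreal)
    also have "(\<Sum>n<N. q n) = (\<Sum>n<N. m n * (u s n)^2) - 2 * e N"
      unfolding q_def e_def solution_mode_energy[OF u t] by (simp add: sum_subtractf sum_distrib_left)
    also have "ennreal ... \<le> ennreal ((\<Sum>n<N. m n * (u s n)^2) + 2 * \<bar>e N\<bar>)" by (intro ennreal_leI) simp
    also have "... = (\<Sum>n<N. ennreal (m n * (u s n)^2)) + ennreal (2 * \<bar>e N\<bar>)"
      by (subst ennreal_plus) (auto intro: sum_nonneg simp: sum_ennreal)
    also have "... \<le> sqn m (u s) + ennreal (2 * \<bar>e N\<bar>)" unfolding sqn_def by (intro add_right_mono sum_le_suminf) auto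
    finally show ?thesis .
  qed
  have "(\<lambda>N. \<Sum>n<N. ennreal (q n)) \<longlonglongrightarrow> (\<Sum>n. ennreal (q n))" by (rule summable_LIMSEQ) simp
  moreover have "(\<lambda>N. sqn m (u s) + ennreal (2 * \<bar>e N\<bar>)) \<longlonglongrightarrow> sqn m (u s) + ennreal (2 * \<bar>0\<bar>)"
    by (intro tendsto_add tendsto_const tendsto_ennrealI tendsto_mult tendsto_rabs e0)
  ultimately have "(\<Sum>n. ennreal (q n)) \<le> sqn m (u s) + ennreal (2 * \<bar>0\<bar>)" using le by (intro LIMSEQ_le) auto
  then show ?thesis by (simp add: eq)
qed

text \<open>The right-hand side does not involve \<open>T\<close>: this makes \<open>Z\<close>
  bounded over all existence times.\<close>

lemma solution_Z_bound:
  assumes u: "solution s T u" and "s \<le> T"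
  shows "Z s T u \<le> ennreal (1 / \<nu>) * (sqn m (u s))^2"
proof -
  have b: "sqn m (u t) \<le> sqn m (u s)" if "t \<in> {s..T}" for t
    using energy_inequality[OF u that] by (meson add_increasing2 order_trans zero_le order_refl)
  have "ennreal (2 * \<nu>) * sqn_int s T l u \<le> sqn m (u s)"
    using energy_inequality[OF u, of T] \<open>s \<le> T\<close> by (auto intro: order_trans[rotated])
  moreover have "ennreal \<nu> * sqn_int s T l u \<le> ennreal (2 * \<nu>) * sqn_int s T l u"
    using \<nu>_pos by (intro mult_right_mono ennreal_leI) auto
  ultimately have "ennreal (1 / \<nu>) * (ennreal \<nu> * sqn_int s T l u) \<le> ennreal (1 / \<nu>) * sqn m (u s)" by (intro mult_left_mono) auto
  then have i: "sqn_int s T l u \<le> ennreal (1 / \<nu>) * sqn m (u s)"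
    using \<nu>_pos by (simp add: mult.assoc[symmetric] ennreal_mult'[symmetric])
  have "Z s T u \<le> sqn m (u s) * sqn_int s T l u" using b by (intro Z_le solutionD(4)[OF u]) auto
  also have "... \<le> sqn m (u s) * (ennreal (1 / \<nu>) * sqn m (u s))" by (intro mult_left_mono i) auto
  finally show ?thesis by (simp add: power2_eq_square mult_ac)
qed

lemma weighted_continuous_join:
  assumes u: "weighted_continuous s r u" and v: "weighted_continuous r T v" and eq: "u r = v r" and le: "s \<le> r" "r \<le> T"
  shows "weighted_continuous s T (\<lambda>t. if t \<le> r then u t else v t)"
  unfolding weighted_continuous_def
proof (intro ballI conjI)
  define w where "w = (\<lambda>t. if t \<le> r then u t else v t)"
  have wu: "w t = u t" if "t \<in> {s..r}" for t using that by (simp add: w_def)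
  have wv: "w t = v t" if "t \<in> {r..T}" for t using that eq by (cases "t = r") (auto simp: w_def)
  fix t assume t: "t \<in> {s..T}"
  show "sqn m (if t \<le> r then u t else v t) < \<infinity>" using t weighted_continuousD(1)[OF u, of t] weighted_continuousD(1)[OF v, of t] by auto
  have un: "{s..T} = {s..r} \<union> {r..T}" using le by auto
  have "((\<lambda>t'. sqn m (\<lambda>n. w t' n - w t n)) \<longlongrightarrow> 0) (at t within {s..r})"
  proof (cases "t \<in> {s..r}")
    case True
    have "\<forall>\<^sub>F t' in at t within {s..r}. sqn m (\<lambda>n. u t' n - u t n) = sqn m (\<lambda>n. w t' n - w t n)"
      unfolding eventually_at_filter by (rule always_eventually) (auto simp: wu True wu[OF True])
    then show ?thesis using tendsto_cong weighted_continuousD(2)[OF u True] by fast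
  next
    case False
    \<comment> \<open>A point outside a closed interval is not a limit point of it, so the filter is
      trivial and any limit holds.\<close>
    then have "at t within {s..r} = bot" by (metis closed_atLeastAtMost closed_limpt trivial_limit_within)
    then show ?thesis by simp
  qed
  moreover have "((\<lambda>t'. sqn m (\<lambda>n. w t' n - w t n)) \<longlongrightarrow> 0) (at t within {r..T})"
  proof (cases "t \<in> {r..T}")
    case True
    have "\<forall>\<^sub>F t' in at t within {r..T}. sqn m (\<lambda>n. v t' n - v t n) = sqn m (\<lambda>n. w t' n - w t n)"
      unfolding eventually_at_filter by (rule always_eventually) (auto simp: wv True wv[OF True])
    then show ?thesis using tendsto_cong weighted_continuousD(2)[OF v True] by fast
  next
    case False
    then have "at t within {r..T} = bot" using t by (metis closed_atLeastAtMost closed_limpt trivial_limit_within)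
    then show ?thesis by simp
  qed
  ultimately show "((\<lambda>t'. sqn m (\<lambda>n. (if t' \<le> r then u t' else v t') n - (if t \<le> r then u t else v t) n)) \<longlongrightarrow> 0) (at t within {s..T})"
    unfolding un w_def by (rule Lim_Un)
qed

lemma solution_join:
  assumes u: "solution s r u" and v: "solution r T v" and eq: "u r = v r" and le: "s \<le> r" "r \<le> T"
  shows "solution s T (\<lambda>t. if t \<le> r then u t else v t)"
proof -
  define w where "w = (\<lambda>t. if t \<le> r then u t else v t)"
  have wu: "w t = u t" if "t \<in> {s..r}" for t using that by (simp add: w_def)
  have wv: "w t = v t" if "t \<in> {r..T}" for t using that eq by (cases "t = r") (auto simp: w_def)
  have wc: "weighted_continuous s T w"
    unfolding w_def by (rule weighted_continuous_join[OF solutionD(1)[OF u] solutionD(1)[OF v] eq le])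
  have wm: "(\<lambda>\<tau>. sqn l (w \<tau>)) \<in> borel_measurable (lebesgue_on {s..T})"
    by (intro measurable_sqn_interval weighted_continuous_modes[OF wc])
  have "sqn_int s T l w = sqn_int s r l u + sqn_int r T l v"
    by (subst II_split[OF wm le]) (intro arg_cong2[where f = "(+)"] II_cong; simp add: wu wv)
  then have wI: "sqn_int s T l w < \<infinity>" using solutionD(2)[OF u] solutionD(2)[OF v] by (simp add: less_top)
  have "linear_solution s T (source w) w" unfolding linear_solution_def
  proof (intro allI conjI ballI)
    fix n
    show Fc: "continuous_on {s..T} (\<lambda>t. source w t n)" by (intro continuous_intros F_continuous wc)
    show c: "continuous_on {s..T} (\<lambda>t. w t n)" by (rule weighted_continuous_modes[OF wc])
    fix t assume t: "t \<in> {s..T}"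
    have ru: "m n * w t n = m n * w s n + integral {s..t} (\<lambda>\<tau>. source w \<tau> n - \<nu> * l n * w \<tau> n)" if t: "t \<in> {s..r}" for t
    proof -
      have "integral {s..t} (\<lambda>\<tau>. source w \<tau> n - \<nu> * l n * w \<tau> n) = integral {s..t} (\<lambda>\<tau>. source u \<tau> n - \<nu> * l n * u \<tau> n)"
        using t by (intro Henstock_Kurzweil_Integration.integral_cong) (simp add: wu)
      then show ?thesis using linear_solutionD(3)[OF solutionD(3)[OF u] t] t wu[of s] wu[OF t] le by simp
    qed
    show "m n * w t n = m n * w s n + integral {s..t} (\<lambda>\<tau>. source w \<tau> n - \<nu> * l n * w \<tau> n)"
    proof (cases "t \<le> r")
      case True
      then show ?thesis using t by (intro ru) simp
    next
      case False
      then have tr: "t \<in> {r..T}" using t by simp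
      have "m n * w t n = m n * w r n + integral {r..t} (\<lambda>\<tau>. source v \<tau> n - \<nu> * l n * v \<tau> n)"
        using linear_solutionD(3)[OF solutionD(3)[OF v] tr, of n] wv[OF tr] wv[of r] le by simp
      also have "integral {r..t} (\<lambda>\<tau>. source v \<tau> n - \<nu> * l n * v \<tau> n) = integral {r..t} (\<lambda>\<tau>. source w \<tau> n - \<nu> * l n * w \<tau> n)"
        using tr by (intro Henstock_Kurzweil_Integration.integral_cong) (simp add: wv)
      also have "m n * w r n = m n * w s n + integral {s..r} (\<lambda>\<tau>. source w \<tau> n - \<nu> * l n * w \<tau> n)" using ru[of r] le by simp
      also have "m n * w s n + integral {s..r} (\<lambda>\<tau>. source w \<tau> n - \<nu> * l n * w \<tau> n) + integral {r..t} (\<lambda>\<tau>. source w \<tau> n - \<nu> * l n * w \<tau> n)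
          = m n * w s n + integral {s..t} (\<lambda>\<tau>. source w \<tau> n - \<nu> * l n * w \<tau> n)"
      proof -
        have "(\<lambda>\<tau>. source w \<tau> n - \<nu> * l n * w \<tau> n) integrable_on {s..t}"
          by (intro integrable_continuous_interval continuous_on_diff continuous_on_mult_left continuous_on_subset[OF Fc] continuous_on_subset[OF c])
             (use t in auto)
        then show ?thesis
          using Henstock_Kurzweil_Integration.integral_combine[of s r t "\<lambda>\<tau>. source w \<tau> n - \<nu> * l n * w \<tau> n"] le tr by simp
      qed
      finally show ?thesis .
    qed
  qed
  then show ?thesis using wc wI by (simp add: solution_def w_def)
qed

text \<open>The Picard estimate read backwards: the linear flow differs from the solution by a
  function with zero initial value, driven by a source that \<open>Z\<close> of the solution
  controls. The constant 32 is twice the \<open>8 + 8\<close> from \<open>Z_add\<close>.\<close>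

lemma heat_Z_bound:
  assumes u: "solution s t u" and y: "linear_solution s t (\<lambda>t n. 0) y" "y s = u s" and st: "s \<le> t"
    and Zu: "Z s t u \<le> ennreal (eps / 32)"
  shows "Z s t y \<le> ennreal (eps / 2)"
proof -
  define z where "z = (\<lambda>\<tau> n. y \<tau> n - u \<tau> n)"
  have lz: "linear_solution s t (\<lambda>\<tau> n. 0 - source u \<tau> n) z" unfolding z_def by (rule linear_solution_diff[OF y(1) solutionD(3)[OF u]])
  have z0: "z s = (\<lambda>n. 0)" by (simp add: z_def y)
  have "II s t (\<lambda>\<tau>. sqn il (\<lambda>n. 0 - source u \<tau> n)) = II s t (\<lambda>\<tau>. sqn il (source u \<tau>))" by (rule II_cong) (simp add: sqn_uminus)
  also have "... \<le> ennreal K * Z s t u" by (rule source_bound[OF solutionD(4,5)[OF u]])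
  also have "... \<le> ennreal K * ennreal (eps / 32)" by (intro mult_left_mono Zu) simp
  also have "... = ennreal (K * eps / 32)" using K_pos eps_pos by (subst ennreal_mult[symmetric]) auto
  finally have G: "II s t (\<lambda>\<tau>. sqn il (\<lambda>n. 0 - source u \<tau> n)) \<le> ennreal (K * eps / 32)" .
  have "Z s t z \<le> ennreal (1 / \<nu> ^ 3) * (II s t (\<lambda>\<tau>. sqn il (\<lambda>n. 0 - source u \<tau> n)))^2" by (rule linear_Z[OF lz st z0])
  also have "... \<le> ennreal (1 / \<nu> ^ 3) * (ennreal (K * eps / 32))^2" by (intro mult_left_mono power_mono G) auto
  also have "... = ennreal (1 / \<nu> ^ 3 * (K * eps / 32)^2)"
    using K_pos eps_pos \<nu>_pos by (subst ennreal_power, simp, subst ennreal_mult[symmetric], auto)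
  also have "... \<le> ennreal (eps / 32)"
  proof (rule ennreal_leI)
    have "1 / \<nu> ^ 3 * (K * eps / 32)^2 = eps / (65536 * 1024)" using K_pos \<nu>_pos by (simp add: eps_def power2_eq_square field_simps)
    then show "1 / \<nu> ^ 3 * (K * eps / 32)^2 \<le> eps / 32" using eps_pos by simp
  qed
  finally have Zz: "Z s t z \<le> ennreal (eps / 32)" .
  have "Z s t y = Z s t (\<lambda>\<tau> n. u \<tau> n + z \<tau> n)" by (simp add: z_def)
  also have "... \<le> 8 * Z s t u + 8 * Z s t z" by (intro Z_add solutionD(4)[OF u] linear_solutionD(2)[OF lz])
  also have "... \<le> 8 * ennreal (eps / 32) + 8 * ennreal (eps / 32)" by (intro add_mono mult_left_mono Zu Zz) auto
  also have "... = ennreal (8 * (eps / 32) + 8 * (eps / 32))"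
    using eps_pos by (simp only: numeral_times_ennreal ennreal_plus mult_nonneg_nonneg less_imp_le zero_le_numeral divide_nonneg_nonneg)
  also have "8 * (eps / 32) + 8 * (eps / 32) = eps / 2" by simp
  finally show ?thesis .
qed

text \<open>Let \<open>A\<close> be the set of existence times. The start \<open>s\<close> is chosen so that \<open>Z 0 s\<close> is within \<open>eps / 32\<close> of its
  supremum over \<open>A\<close> (finite by the energy inequality). Then \<open>Z s t\<close> is small for every later \<open>t\<close> in \<open>A\<close>, hence so is
  \<open>Z\<close> of the linear flow started at \<open>s\<close>, and the local theory applied from \<open>s\<close> reaches past \<open>Sup A\<close>.\<close>

theorem global_existence:
  assumes a: "sqn m a < \<infinity>" and T: "0 \<le> T"
  obtains u where "solution 0 T u" "u 0 = a"
proof -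
  define A where "A = {t. 0 \<le> t \<and> t \<le> T \<and> (\<exists>u. solution 0 t u \<and> u 0 = a)}"
  have zeroA: "0 \<in> A"
  proof -
    have "solution 0 0 (\<lambda>t. a)"
      using a by (auto simp: solution_def weighted_continuous_def linear_solution_def II_eq intro!: continuous_intros)
    then show ?thesis using T by (auto simp: A_def)
  qed
  have bdd: "bdd_above A" by (rule bdd_aboveI[of _ T]) (auto simp: A_def)
  define us where "us t = (SOME u. solution 0 t u \<and> u 0 = a)" for t
  have us: "solution 0 t (us t)" "us t 0 = a" if "t \<in> A" for t
  proof -
    have "\<exists>u. solution 0 t u \<and> u 0 = a" using that by (simp add: A_def)
    from someI_ex[OF this] show "solution 0 t (us t)" "us t 0 = a" by (auto simp: us_def)
  qed
  have A0: "0 \<le> t" "t \<le> T" if "t \<in> A" for t using that by (auto simp: A_def)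
  define z where "z t = enn2real (Z 0 t (us t))" for t
  have zt: "Z 0 t (us t) = ennreal (z t)" if "t \<in> A" for t using solutionD(6)[OF us(1)[OF that]] by (simp add: z_def)
  define B where "B = enn2real (ennreal (1 / \<nu>) * (sqn m a)^2)"
  have zB: "z t \<le> B" if "t \<in> A" for t
  proof -
    have "ennreal (1 / \<nu>) * (sqn m a)^2 < top" using a by (simp add: ennreal_mult_less_top power2_eq_square)
    then show ?thesis
      using solution_Z_bound[OF us(1)[OF that] A0(1)[OF that]] unfolding us(2)[OF that] z_def B_def by (intro enn2real_mono)
  qed
  have z0: "0 \<le> z t" for t by (simp add: z_def)
  have bz: "bdd_above (z ` A)" by (rule bdd_aboveI2[of _ _ B]) (rule zB)
  have "Sup (z ` A) - eps / 32 < Sup (z ` A)" using eps_pos by simp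
  then obtain s where s: "s \<in> A" "Sup (z ` A) - eps / 32 < z s" using less_cSUP_iff[OF _ bz, of "Sup (z ` A) - eps / 32"] zeroA by blast
  define v where "v = us s"
  have vs: "solution 0 s v" "v 0 = a" using us[OF s(1)] by (auto simp: v_def)
  have s0: "0 \<le> s" "s \<le> T" using A0[OF s(1)] .
  obtain y where y: "y s = v s" "linear_solution s T (\<lambda>t n. 0) y"
    by (rule linear_solution_exists[where f = "\<lambda>t n. 0" and a = "v s" and s = s and T = T]) auto
  have ys: "sqn m (y s) < \<infinity>" unfolding y(1) by (rule solutionD(5)[OF vs(1)]) (use s0 in simp)
  have y0: "II s T (\<lambda>\<tau>. sqn il (\<lambda>n. 0)) < \<infinity>" by (simp add: II_def)
  have yc: "weighted_continuous s T y" by (rule linear_weighted_continuous[OF y(2) ys y0])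
  have "sqn_int s T l y \<le> ennreal (1 / \<nu>) * (sqn m (y s) + ennreal (1 / \<nu>) * II s T (\<lambda>\<tau>. sqn il (\<lambda>n. 0)))"
    by (rule linear_int_bound[OF y(2) s0(2)])
  also have "... < \<infinity>" using ys by (simp add: II_def ennreal_mult_less_top)
  finally have Zy: "Z s T y < \<infinity>" by (rule Z_finite[OF yc])
  obtain d where d: "d > 0" "\<And>t t'. s \<le> t \<Longrightarrow> t' \<le> T \<Longrightarrow> t' \<le> t + d \<Longrightarrow> Z t t' y \<le> ennreal (eps / 2)"
    using Z_small[OF yc Zy, of "eps / 2"] eps_pos by auto
  have key: "Z s t y \<le> ennreal (eps / 2)" if t: "t \<in> A" "s \<le> t" for t
  proof (rule heat_Z_bound)
    have uu: "solution 0 s (us t)" by (rule solution_mono[OF us(1)[OF t(1)]]) (use t in auto)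
    \<comment> \<open>Solutions from \<open>a\<close> agree up to \<open>s\<close>. Hence
      \<open>Z 0 t\<close> of the solution on \<open>{0..t}\<close> splits into the value chosen at
      \<open>s\<close> and a remainder, which is at most the gap to the supremum.\<close>
    have eq: "us t \<tau> = v \<tau>" if "\<tau> \<in> {0..s}" for \<tau> by (rule unique[OF uu vs(1) _ that]) (simp add: us(2)[OF t(1)] vs)
    show st: "solution s t (us t)" by (rule solution_mono[OF us(1)[OF t(1)]]) (use s0 in auto)
    show "linear_solution s t (\<lambda>t n. 0) y" by (rule linear_solution_mono[OF y(2)]) (use A0[OF t(1)] in auto)
    show "y s = us t s" using eq[of s] s0 y(1) by simp
    show "s \<le> t" by fact
    have "Z 0 t (us t) = Z 0 s (us t) + Z s t (us t)"
      unfolding Z_def by (rule II_split[OF Z_measurable[where u = "us t", OF solutionD(4)[OF us(1)[OF t(1)]]] s0(1) t(2)])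
    moreover have "Z 0 s (us t) = Z 0 s v" unfolding Z_def by (rule II_cong) (simp add: eq)
    ultimately have "ennreal (z t) = ennreal (z s) + Z s t (us t)" using zt[OF t(1)] zt[OF s(1)] by (simp add: v_def)
    moreover obtain x where x: "Z s t (us t) = ennreal x" "0 \<le> x" using solutionD(6)[OF st] by (cases "Z s t (us t)") auto
    ultimately have "ennreal (z t) = ennreal (z s + x)" using z0 by simp
    then have "z t = z s + x" using z0 x by (subst (asm) ennreal_inj) auto
    moreover have "z t \<le> Sup (z ` A)" by (rule cSUP_upper[OF t(1) bz])
    ultimately show "Z s t (us t) \<le> ennreal (eps / 32)" using s(2) unfolding x(1) by (intro ennreal_leI) linarith
  qed
  obtain t where t: "t \<in> A" "s \<le> t" "Sup A - d < t"
  proof -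
    obtain t' where "t' \<in> A" "Sup A - d < t'" using less_cSup_iff[OF _ bdd, of "Sup A - d"] zeroA d(1) by auto
    then show ?thesis using that[of "max s t'"] s(1) by (auto simp: max_def)
  qed
  define r where "r = min T (t + d)"
  have r: "t \<le> r" "r \<le> T" "s \<le> r" using A0[OF t(1)] d t by (auto simp: r_def)
  have ylin: "linear_solution s r (\<lambda>t n. 0) y" by (rule linear_solution_mono[OF y(2)]) (use r in auto)
  have "Z s r y = Z s t y + Z t r y"
    unfolding Z_def by (rule II_split[OF Z_measurable[where u = y, OF linear_solutionD(2)[OF ylin]] t(2) r(1)])
  also have "... \<le> ennreal (eps / 2) + ennreal (eps / 2)" using key[OF t(1,2)] d(2)[OF t(2) r(2)] by (intro add_mono) (auto simp: r_def)
  also have "... = ennreal eps" using eps_pos by (simp flip: ennreal_plus)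
  finally obtain w where w: "solution s r w" "w s = y s" using local_existence[OF ylin ys _ r(3)] by blast
  have sol: "solution 0 r (\<lambda>t. if t \<le> s then v t else w t)" by (rule solution_join[OF vs(1) w(1) _ s0(1) r(3)]) (simp add: w y)
  then have "r \<in> A" using r A0[OF t(1)] vs s0 by (auto simp: A_def)
  then have "r \<le> Sup A" by (rule cSup_upper[OF _ bdd])
  \<comment> \<open>Otherwise \<open>r = t + d\<close> would exceed \<open>Sup A\<close>.\<close>
  then have "r = T" using t(3) by (auto simp: r_def min_def split: if_splits)
  then show ?thesis using that[OF sol[unfolded \<open>r = T\<close>]] vs s0 by auto
qed

end

abbreviation coord :: "(real^3 \<Rightarrow> real^'n) \<Rightarrow> 'n \<Rightarrow> real^3 \<Rightarrow> real" where
  "coord u j \<equiv> (\<lambda>x. u x $ j)"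

section \<open>Square integrable functions\<close>

definition sq_int :: "'a measure \<Rightarrow> ('a \<Rightarrow> real) \<Rightarrow> bool" where
  "sq_int M f \<longleftrightarrow> f \<in> borel_measurable M \<and> integrable M (\<lambda>x. (f x)^2)"

lemma sq_intD:
  assumes "sq_int M f"
  shows "f \<in> borel_measurable M" "integrable M (\<lambda>x. (f x)^2)"
  using assms by (auto simp: sq_int_def)

lemma sq_int_mult_integrable:
  assumes "sq_int M f" "sq_int M g"
  shows "integrable M (\<lambda>x. f x * g x)"
proof (rule Bochner_Integration.integrable_bound)
  show "integrable M (\<lambda>x. (f x)^2 + (g x)^2)" using assms by (auto simp: sq_int_def)
  show "(\<lambda>x. f x * g x) \<in> borel_measurable M" using assms by (auto simp: sq_int_def)
  have "\<bar>a * b\<bar> \<le> a^2 + b^2" for a b :: real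
  proof -
    have "0 \<le> (\<bar>a\<bar> - \<bar>b\<bar>)^2" by simp
    also have "... = a^2 + b^2 - 2 * \<bar>a * b\<bar>" by (simp add: power2_diff abs_mult)
    finally show ?thesis using abs_ge_zero[of "a * b"] by linarith
  qed
  then show "AE x in M. norm (f x * g x) \<le> norm ((f x)^2 + (g x)^2)" by auto
qed

lemma sq_int_scale: "sq_int M f \<Longrightarrow> sq_int M (\<lambda>x. c * f x)" by (auto simp: sq_int_def power_mult_distrib)

lemma sq_int_add:
  assumes "sq_int M f" "sq_int M g"
  shows "sq_int M (\<lambda>x. f x + g x)"
proof -
  have "integrable M (\<lambda>x. (f x)^2 + (g x)^2 + 2 * (f x * g x))" using assms sq_int_mult_integrable[OF assms] by (auto simp: sq_int_def)
  then have "integrable M (\<lambda>x. (f x + g x)^2)" by (simp add: power2_sum mult.assoc)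
  then show ?thesis using assms by (auto simp: sq_int_def)
qed

lemma sq_int_diff: "sq_int M f \<Longrightarrow> sq_int M g \<Longrightarrow> sq_int M (\<lambda>x. f x - g x)"
  using sq_int_add[of M f "\<lambda>x. - 1 * g x"] sq_int_scale[of M g "- 1"] by simp

lemma sq_int_zero: "sq_int M (\<lambda>x. 0)" by (simp add: sq_int_def)

lemma sq_int_sum: "(\<And>i. i \<in> I \<Longrightarrow> sq_int M (f i)) \<Longrightarrow> sq_int M (\<lambda>x. \<Sum>i\<in>I. f i x)"
  by (induction I rule: infinite_finite_induct) (auto intro: sq_int_add sq_int_zero)

lemma sq_int_Cauchy_Schwarz:
  assumes "sq_int M f" "sq_int M g"
  shows "(\<integral>x. f x * g x \<partial>M)^2 \<le> (\<integral>x. (f x)^2 \<partial>M) * (\<integral>x. (g x)^2 \<partial>M)"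
proof -
  define A B D where "A = (\<integral>x. (f x)^2 \<partial>M)" and "B = (\<integral>x. (g x)^2 \<partial>M)" and "D = (\<integral>x. f x * g x \<partial>M)"
  have q: "0 \<le> A - 2 * t * D + t^2 * B" for t
  proof -
    have "0 \<le> (\<integral>x. (f x - t * g x)^2 \<partial>M)" by simp
    also have "... = (\<integral>x. (f x)^2 - 2 * t * (f x * g x) + t^2 * (g x)^2 \<partial>M)"
      by (intro Bochner_Integration.integral_cong) (auto simp: power2_eq_square algebra_simps)
    also have "... = A - 2 * t * D + t^2 * B" using sq_int_mult_integrable[OF assms] assms by (simp add: A_def B_def D_def sq_int_def)
    finally show ?thesis .
  qed
  have A: "0 \<le> A" and B: "0 \<le> B" by (auto simp: A_def B_def)
  have "D^2 \<le> A * B"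
  proof (cases "B = 0")
    case True
    have "D = 0"
    proof (rule ccontr)
      assume "D \<noteq> 0"
      \<comment> \<open>For \<open>B = 0\<close> the quadratic expression is affine in
        \<open>t\<close>; at this point it equals -1.\<close>
      then show False using q[of "(A + 1) / (2 * D)"] True by simp
    qed
    then show ?thesis using A B by simp
  next
    case False
    then have "0 < B" using B by simp
    have "0 \<le> (A - 2 * (D / B) * D + (D / B)^2 * B) * B" using q[of "D / B"] B by simp
    also have "... = A * B - D^2" using \<open>0 < B\<close> by (simp add: power2_eq_square field_simps)
    finally show ?thesis by simp
  qed
  then show ?thesis by (simp add: A_def B_def D_def)
qed

lemma tendsto_0_of_square:
  fixes f :: "'a \<Rightarrow> real"
  assumes "((\<lambda>x. (f x)^2) \<longlongrightarrow> 0) F"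
  shows "(f \<longlongrightarrow> 0) F"
  using tendsto_real_sqrt[OF assms] by (simp add: tendsto_rabs_zero_iff)

lemma L2_tendsto_integral_mult:
  assumes f: "\<And>n. sq_int M (f n)" "sq_int M g" "sq_int M h" and lim: "(\<lambda>n. \<integral>x. (f n x - g x)^2 \<partial>M) \<longlonglongrightarrow> 0"
  shows "(\<lambda>n. \<integral>x. f n x * h x \<partial>M) \<longlonglongrightarrow> (\<integral>x. g x * h x \<partial>M)"
proof -
  have "(\<lambda>n. (\<integral>x. (f n x - g x)^2 \<partial>M) * (\<integral>x. (h x)^2 \<partial>M)) \<longlonglongrightarrow> 0 * (\<integral>x. (h x)^2 \<partial>M)" by (intro tendsto_intros lim)
  then have lim0: "(\<lambda>n. (\<integral>x. (f n x - g x)^2 \<partial>M) * (\<integral>x. (h x)^2 \<partial>M)) \<longlonglongrightarrow> 0" by simp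
  have eq: "(\<integral>x. f n x * h x \<partial>M) - (\<integral>x. g x * h x \<partial>M) = (\<integral>x. (f n x - g x) * h x \<partial>M)" for n
    using sq_int_mult_integrable[OF f(1,3)] sq_int_mult_integrable[OF f(2,3)] by (simp add: left_diff_distrib)
  have "(\<lambda>n. ((\<integral>x. f n x * h x \<partial>M) - (\<integral>x. g x * h x \<partial>M))^2) \<longlonglongrightarrow> 0"
    by (rule tendsto_sandwich[OF always_eventually always_eventually tendsto_const lim0])
       (use sq_int_Cauchy_Schwarz[OF sq_int_diff[OF f(1,2)] f(3)] in \<open>auto simp: eq\<close>)
  then have "(\<lambda>n. (\<integral>x. f n x * h x \<partial>M) - (\<integral>x. g x * h x \<partial>M)) \<longlonglongrightarrow> 0" by (rule tendsto_0_of_square)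
  then show ?thesis by (simp add: LIM_zero_iff)
qed

lemma L2_tendsto_AE_subseq:
  assumes f: "\<And>n. sq_int M (f n)" "sq_int M g" and lim: "(\<lambda>n. \<integral>x. (f n x - g x)^2 \<partial>M) \<longlonglongrightarrow> 0"
  obtains r where "strict_mono r" "AE x in M. (\<lambda>n. f (r n) x) \<longlonglongrightarrow> g x"
proof -
  have "\<exists>r::nat\<Rightarrow>nat. strict_mono r \<and> (AE x in M. (\<lambda>n. (f (r n) x - g x)^2) \<longlonglongrightarrow> 0)"
    using lim sq_intD(2)[OF sq_int_diff[OF f(1,2)]] by (intro tendsto_L1_AE_subseq) auto
  then obtain r :: "nat \<Rightarrow> nat" where r: "strict_mono r" "AE x in M. (\<lambda>n. (f (r n) x - g x)^2) \<longlonglongrightarrow> 0" by blast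
  have "AE x in M. (\<lambda>n. f (r n) x) \<longlonglongrightarrow> g x" using r(2)
  proof eventually_elim
    case (elim x)
    then have "(\<lambda>n. f (r n) x - g x) \<longlonglongrightarrow> 0" by (rule tendsto_0_of_square)
    then show ?case by (simp add: LIM_zero_iff)
  qed
  then show ?thesis using that r(1) by blast
qed

lemma L2_Fatou:
  assumes f: "\<And>n. sq_int M (f n)" and g: "g \<in> borel_measurable M" and lim: "AE x in M. (\<lambda>n. f n x) \<longlonglongrightarrow> g x"
    and B: "\<forall>\<^sub>F n in sequentially. (\<integral>x. (f n x)^2 \<partial>M) \<le> B" "0 \<le> B"
  shows "sq_int M g" "(\<integral>x. (g x)^2 \<partial>M) \<le> B"
proof -
  have "(\<integral>\<^sup>+x. ennreal ((g x)^2) \<partial>M) = (\<integral>\<^sup>+x. liminf (\<lambda>n. ennreal ((f n x)^2)) \<partial>M)"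
  proof (rule nn_integral_cong_AE, use lim in eventually_elim)
    case (elim x)
    have "(\<lambda>n. ennreal ((f n x)^2)) \<longlonglongrightarrow> ennreal ((g x)^2)" by (intro tendsto_ennrealI tendsto_intros elim)
    then show ?case by (intro lim_imp_Liminf[symmetric]) auto
  qed
  also have "... \<le> liminf (\<lambda>n. \<integral>\<^sup>+x. ennreal ((f n x)^2) \<partial>M)" by (rule nn_integral_liminf) (use sq_intD(1)[OF f] in auto)
  also have "... = liminf (\<lambda>n. ennreal (\<integral>x. (f n x)^2 \<partial>M))" using sq_intD(2)[OF f] by (simp add: nn_integral_eq_integral)
  also have "... \<le> liminf (\<lambda>n::nat. ennreal B)" by (rule Liminf_mono) (use B(1) in \<open>auto elim!: eventually_mono intro: ennreal_leI\<close>)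
  finally have le: "(\<integral>\<^sup>+x. ennreal ((g x)^2) \<partial>M) \<le> ennreal B" by (simp add: Liminf_const)
  then have fin: "(\<integral>\<^sup>+x. ennreal ((g x)^2) \<partial>M) < \<infinity>" by (rule le_less_trans) simp
  show si: "sq_int M g" unfolding sq_int_def using g fin by (auto intro!: integrableI_nonneg)
  show "(\<integral>x. (g x)^2 \<partial>M) \<le> B" using le B(2) sq_intD(2)[OF si] by (simp add: nn_integral_eq_integral ennreal_le_iff)
qed

text \<open>The weight \<open>2 ^ j\<close> forces the increments to decay geometrically, so the
  telescoping series converges absolutely.\<close>

lemma convergent_of_summable_weighted_squares:
  fixes a :: "nat \<Rightarrow> real"
  assumes "summable (\<lambda>j. 2 ^ j * (a (Suc j) - a j)^2)"
  shows "convergent a"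
proof -
  obtain C where C: "0 < C" "\<And>j. 2 ^ j * (a (Suc j) - a j)^2 \<le> C"
  proof -
    have "Bseq (\<lambda>j. 2 ^ j * (a (Suc j) - a j)^2)"
      by (rule convergent_imp_Bseq) (use summable_LIMSEQ_zero[OF assms] in \<open>auto simp: convergent_def\<close>)
    then obtain K where "0 < K" "\<And>j. norm (2 ^ j * (a (Suc j) - a j)^2) \<le> K" by (auto simp: Bseq_def)
    then show ?thesis using that[of K] by auto
  qed
  have le: "norm (a (Suc j) - a j) \<le> sqrt C * (1 / sqrt 2) ^ j" for j
  proof -
    have "(a (Suc j) - a j)^2 \<le> C / 2 ^ j" using C(2)[of j] by (simp add: field_simps)
    then have "\<bar>a (Suc j) - a j\<bar> \<le> sqrt (C / 2 ^ j)" by (simp add: real_le_rsqrt)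
    also have "... = sqrt C * (1 / sqrt 2) ^ j" by (simp add: real_sqrt_divide real_sqrt_power power_divide)
    finally show ?thesis by simp
  qed
  have "summable (\<lambda>j. sqrt C * (1 / sqrt 2) ^ j)" by (intro summable_mult summable_geometric) (simp add: abs_divide)
  then have s: "summable (\<lambda>j. a (Suc j) - a j)" by (rule summable_comparison_test'[where N = 0]) (rule le)
  have "a n = a 0 + (\<Sum>j<n. a (Suc j) - a j)" for n by (simp add: sum_lessThan_telescope)
  moreover have "convergent (\<lambda>n. a 0 + (\<Sum>j<n. a (Suc j) - a j))"
    using summable_LIMSEQ[OF s] by (intro convergent_add convergent_const) (auto simp: convergent_def)
  ultimately show ?thesis by (metis (no_types, lifting) ext)
qed

text \<open>The limit is exported as a formula that is defined at every point. A limit determined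
  only almost everywhere would lose the periodicity that \<open>Riesz_Fischer\<close> reads off from
  it.\<close>

lemma L2_complete:
  assumes S: "\<And>n. sq_int M (S n)"
    and Cauchy: "\<And>e. 0 < e \<Longrightarrow> \<exists>N. \<forall>p\<ge>N. \<forall>q\<ge>N. (\<integral>x. (S p x - S q x)^2 \<partial>M) < e"
  obtains r :: "nat \<Rightarrow> nat" and f where "strict_mono r" "f = (\<lambda>x. lim (\<lambda>j. S (r j) x))"
    "sq_int M f" "(\<lambda>n. \<integral>x. (S n x - f x)^2 \<partial>M) \<longlonglongrightarrow> 0"
proof -
  have "\<forall>j. \<exists>N. \<forall>p\<ge>N. \<forall>q\<ge>N. (\<integral>x. (S p x - S q x)^2 \<partial>M) < (1 / 4) ^ j" by (intro allI Cauchy) simp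
  then obtain N where N: "\<And>j p q. p \<ge> N j \<Longrightarrow> q \<ge> N j \<Longrightarrow> (\<integral>x. (S p x - S q x)^2 \<partial>M) < (1 / 4) ^ j" by metis
  \<comment> \<open>Strictly increasing and above \<open>N j\<close>, so that successive differences
    are below \<open>(1 / 4) ^ j\<close> and stay summable after multiplication by
    \<open>2 ^ j\<close>.\<close>
  define r where "r j = (\<Sum>i\<le>j. N i) + j" for j
  have r: "strict_mono r" by (rule strict_monoI_Suc) (simp add: r_def)
  have rN: "N j \<le> r j" for j unfolding r_def by (rule trans_le_add1, rule member_le_sum) auto
  have rs: "(\<integral>x. (S (r (Suc j)) x - S (r j) x)^2 \<partial>M) < (1 / 4) ^ j" for j
    using rN[of j] strict_monoD[OF r, of j "Suc j"] by (intro N) auto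
  define d where "d j x = 2 ^ j * (S (r (Suc j)) x - S (r j) x)^2" for j x
  have di: "integrable M (d j)" for j unfolding d_def using sq_intD(2)[OF sq_int_diff[OF S S]] by (intro integrable_mult_right)
  have "(\<integral>\<^sup>+x. (\<Sum>j. ennreal (d j x)) \<partial>M) = (\<Sum>j. \<integral>\<^sup>+x. ennreal (d j x) \<partial>M)" using di by (intro nn_integral_suminf) auto
  also have "... = (\<Sum>j. ennreal (\<integral>x. d j x \<partial>M))" by (intro suminf_cong nn_integral_eq_integral di) (simp add: d_def)
  also have "... \<le> (\<Sum>j. ennreal ((1 / 2) ^ j))"
  proof (intro suminf_le ennreal_leI allI)
    fix j
    have "(\<integral>x. d j x \<partial>M) = 2 ^ j * (\<integral>x. (S (r (Suc j)) x - S (r j) x)^2 \<partial>M)" by (simp add: d_def)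
    also have "... \<le> 2 ^ j * (1 / 4) ^ j" using rs[of j] by (intro mult_left_mono) auto
    also have "... = (1 / 2) ^ j" by (simp add: power_mult_distrib[symmetric])
    finally show "(\<integral>x. d j x \<partial>M) \<le> (1 / 2) ^ j" .
  qed auto
  also have "... < \<infinity>" unfolding infinity_ennreal_def less_top[symmetric] by (intro ennreal_suminf_neq_top summable_geometric) auto
  finally have "AE x in M. (\<Sum>j. ennreal (d j x)) \<noteq> \<infinity>" using di by (intro nn_integral_PInf_AE) auto
  then have conv: "AE x in M. convergent (\<lambda>j. S (r j) x)"
  proof eventually_elim
    case (elim x)
    then have "summable (\<lambda>j. d j x)" by (intro summable_suminf_not_top) (auto simp: d_def)
    then show ?case by (intro convergent_of_summable_weighted_squares) (simp add: d_def)
  qed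
  define f where "f = (\<lambda>x. lim (\<lambda>j. S (r j) x))"
  have fm: "f \<in> borel_measurable M" unfolding f_def using sq_intD(1)[OF S] by (intro borel_measurable_lim_metric) auto
  have Sf: "AE x in M. (\<lambda>j. S (r j) x) \<longlonglongrightarrow> f x" using conv by eventually_elim (simp add: f_def convergent_LIMSEQ_iff)
  have key: "sq_int M (\<lambda>x. S p x - f x) \<and> (\<integral>x. (S p x - f x)^2 \<partial>M) \<le> (1 / 4) ^ j" if "p \<ge> N j" for p j
  proof -
    have a: "\<And>i. sq_int M (\<lambda>x. S p x - S (r i) x)" by (intro sq_int_diff S)
    have b: "(\<lambda>x. S p x - f x) \<in> borel_measurable M" using sq_intD(1)[OF S] fm by auto
    have c: "AE x in M. (\<lambda>i. S p x - S (r i) x) \<longlonglongrightarrow> S p x - f x" using Sf by eventually_elim (intro tendsto_intros)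
    have d: "\<forall>\<^sub>F i in sequentially. (\<integral>x. (S p x - S (r i) x)^2 \<partial>M) \<le> (1 / 4) ^ j" unfolding eventually_sequentially
    proof (intro exI allI impI)
      fix i assume "N j \<le> i"
      then have "N j \<le> r i" using seq_suble[OF r, of i] by simp
      then show "(\<integral>x. (S p x - S (r i) x)^2 \<partial>M) \<le> (1 / 4) ^ j" using N[OF that] by (intro less_imp_le) auto
    qed
    show ?thesis using L2_Fatou[OF a b c d] by simp
  qed
  have "sq_int M (\<lambda>x. S (N 0) x - f x)" using key[of 0 "N 0"] by simp
  from sq_int_diff[OF S[of "N 0"] this] have fs: "sq_int M f" by simp
  have "(\<lambda>n. \<integral>x. (S n x - f x)^2 \<partial>M) \<longlonglongrightarrow> 0"
  proof (rule LIMSEQ_I)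
    fix e :: real assume "0 < e"
    then obtain j where j: "(1 / 4) ^ j < e" using real_arch_pow_inv[of e "1 / 4"] by auto
    show "\<exists>no. \<forall>n\<ge>no. norm ((\<integral>x. (S n x - f x)^2 \<partial>M) - 0) < e"
    proof (intro exI allI impI)
      fix n assume "N j \<le> n"
      then show "norm ((\<integral>x. (S n x - f x)^2 \<partial>M) - 0) < e" using key[of j n] j by auto
    qed
  qed
  then show ?thesis using that[OF r f_def fs] by blast
qed

section \<open>Hartley functions on the torus\<close>

abbreviation kvec :: "int^3 \<Rightarrow> real^3" where
  "kvec k \<equiv> (\<chi> i. of_int (k $ i))"

lemma periodicD: "periodic f \<Longrightarrow> f (x + kvec k) = f x" by (simp add: periodic_def)

lemma periodic_axis:
  assumes "periodic f"
  shows "f (x + axis i 1) = f x"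
proof -
  have "kvec (axis i 1) = axis i 1" by (simp add: vec_eq_iff axis_def)
  then show ?thesis using periodicD[OF assms, of x "axis i 1"] by simp
qed

lemma periodic_combine:
  assumes "periodic f" "periodic g"
  shows "periodic (\<lambda>x. h (f x) (g x))"
  using assms by (simp add: periodic_def)

lemma periodic_compose: "periodic f \<Longrightarrow> periodic (\<lambda>x. h (f x))" by (simp add: periodic_def)

lemma space_torus [simp]: "space torus = cbox 0 1" by (simp add: torus_def)

lemma emeasure_torus: "emeasure torus (space torus) = 1"
proof -
  have "emeasure torus (cbox 0 (1 :: real^3)) = emeasure lebesgue (cbox 0 (1 :: real^3))"
    unfolding torus_def by (intro emeasure_restrict_space) auto
  also have "... = 1" by (subst emeasure_completion) (auto simp: emeasure_lborel_cbox_eq Basis_vec_def inner_axis intro!: prod.neutral)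
  finally show ?thesis by simp
qed

interpretation torus: finite_measure torus
  by (rule finite_measureI) (simp only: emeasure_torus, simp)

lemma integral_torus_const: "(LINT x|torus. c) = (c :: real)"
  using emeasure_torus by (simp add: measure_def)

text \<open>Cutting a box by a hyperplane orthogonal to axis \<open>i\<close> affects that
  coordinate only; the identities between boxes below are reduced to it.\<close>

lemma ball_split_conj:
  assumes "\<And>j. j \<noteq> i \<Longrightarrow> A j \<longleftrightarrow> C j" "A i \<and> B \<longleftrightarrow> C i"
  shows "(\<forall>j. A j) \<and> B \<longleftrightarrow> (\<forall>j. C j)"
  using assms by metis

section \<open>Integrals of continuous periodic functions\<close>

lemma continuous_torus_measurable:
  fixes f :: "real^3 \<Rightarrow> 'b::euclidean_space"
  assumes "continuous_on UNIV f"
  shows "f \<in> borel_measurable torus"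
  unfolding torus_def
  by (intro continuous_imp_measurable_on_sets_lebesgue continuous_on_subset[OF assms]) auto

lemma continuous_torus_integrable:
  fixes f :: "real^3 \<Rightarrow> 'b::euclidean_space"
  assumes "continuous_on UNIV f"
  shows "integrable torus f"
proof -
  have "f absolutely_integrable_on (cbox 0 1)" by (intro absolutely_integrable_continuous continuous_on_subset[OF assms]) auto
  then show ?thesis unfolding torus_def set_integrable_def by (simp add: integrable_restrict_space)
qed

lemma continuous_torus_integral:
  fixes f :: "real^3 \<Rightarrow> 'b::euclidean_space"
  assumes "continuous_on UNIV f"
  shows "(LINT x|torus. f x) = integral (cbox 0 1) f"
  using continuous_torus_integrable[OF assms] unfolding torus_def
  by (intro lebesgue_integral_eq_integral) auto

lemma continuous_torus_sq_int:
  assumes "continuous_on UNIV f"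
  shows "sq_int torus f"
  unfolding sq_int_def
  by (intro conjI continuous_torus_measurable continuous_torus_integrable continuous_intros assms)

text \<open>The shifted cube is cut at the face where coordinate \<open>i\<close> is 1. The piece
  beyond the face is moved back by one period and completes the rest to the unit cube.\<close>

lemma integral_translate_axis:
  fixes f :: "real^3 \<Rightarrow> real"
  assumes f: "continuous_on UNIV f" and p: "periodic f" and t: "0 \<le> t" "t \<le> 1"
  shows "integral (cbox 0 1) (\<lambda>x. f (x + t *\<^sub>R axis i 1)) = integral (cbox 0 1) f"
proof -
  define c :: "real^3" where "c = t *\<^sub>R axis i 1"
  define e :: "real^3" where "e = axis i 1"
  have B: "e \<in> Basis" by (auto simp: e_def Basis_vec_def)
  have io: "f integrable_on (cbox a b)" for a b by (intro integrable_continuous continuous_on_subset[OF f]) auto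
  have ei: "x \<bullet> e = x $ i" for x :: "real^3" by (simp add: e_def inner_axis)
  have cn: "c $ j = (if j = i then t else 0)" for j by (simp add: c_def axis_def)
  have en: "e $ j = (if j = i then 1 else 0)" for j by (simp add: e_def axis_def)
  have "integral (cbox 0 1) (\<lambda>x. f (x + c)) = integral (cbox c (1 + c)) f" using integral_shift_cbox[of c c "1 + c" f] by simp
  also have "... = integral (cbox c (1 + c) \<inter> {x. x \<bullet> e \<le> 1}) f + integral (cbox c (1 + c) \<inter> {x. x \<bullet> e \<ge> 1}) f"
    by (rule integral_split[OF io B])
  also have "cbox c (1 + c) \<inter> {x. x \<bullet> e \<le> 1} = cbox c 1"
    by (intro set_eqI, unfold Int_iff mem_Collect_eq mem_box_cart ei, rule ball_split_conj[where i = i]) (use t in \<open>auto simp: cn\<close>)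
  also have "cbox c (1 + c) \<inter> {x. x \<bullet> e \<ge> 1} = cbox e (1 + c)"
    by (intro set_eqI, unfold Int_iff mem_Collect_eq mem_box_cart ei, rule ball_split_conj[where i = i]) (use t in \<open>auto simp: cn en\<close>)
  also have "integral (cbox e (1 + c)) f = integral (cbox 0 (1 + c - e)) f"
    using integral_shift_cbox[of e e "1 + c" f] periodic_axis[OF p] by (simp add: e_def)
  also have "integral (cbox c 1) f + integral (cbox 0 (1 + c - e)) f =
     integral (cbox 0 1 \<inter> {x. x \<bullet> e \<le> t}) f + integral (cbox 0 1 \<inter> {x. x \<bullet> e \<ge> t}) f"
  proof -
    have "cbox 0 1 \<inter> {x. x \<bullet> e \<le> t} = cbox 0 (1 + c - e)"
      by (intro set_eqI, unfold Int_iff mem_Collect_eq mem_box_cart ei, rule ball_split_conj[where i = i]) (use t in \<open>auto simp: cn en\<close>)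
    moreover have "cbox 0 1 \<inter> {x. x \<bullet> e \<ge> t} = cbox c 1"
      by (intro set_eqI, unfold Int_iff mem_Collect_eq mem_box_cart ei, rule ball_split_conj[where i = i]) (use t in \<open>auto simp: cn\<close>)
    ultimately show ?thesis by simp
  qed
  also have "... = integral (cbox 0 1) f" by (rule integral_split[OF io B, symmetric])
  finally show ?thesis by (simp add: c_def)
qed

text \<open>The integral of the translates along axis \<open>i\<close> is constant in the shift, and
  its derivative at shift 0 is the integral of the partial derivative. All integrations by parts on
  the torus rest on this.\<close>

lemma integral_partial_periodic:
  fixes f :: "real^3 \<Rightarrow> real"
  assumes d: "\<And>x. (f has_derivative f' x) (at x)" and c: "continuous_on UNIV (\<lambda>x. f' x (axis i 1))" and p: "periodic f"
  shows "(LINT x|torus. f' x (axis i 1)) = 0"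
proof -
  have fc: "continuous_on UNIV f" by (rule has_derivative_continuous_on[OF has_derivative_at_withinI[OF d]])
  define J where "J t = integral (cbox 0 1) (\<lambda>x. f (x + t *\<^sub>R axis i 1))" for t :: real
  have J1: "(J has_field_derivative integral (cbox 0 1) (\<lambda>x. f' (x + 0 *\<^sub>R axis i 1) (axis i 1))) (at 0 within {0..1})" unfolding J_def
  proof (rule leibniz_rule_field_derivative)
    fix t :: real and x :: "real^3"
    have "((\<lambda>t. x + t *\<^sub>R axis i 1) has_derivative (\<lambda>s. s *\<^sub>R axis i 1)) (at t within {0..1})" by (auto intro!: derivative_eq_intros)
    from has_derivative_compose[OF this d]
    have "((\<lambda>t. f (x + t *\<^sub>R axis i 1)) has_derivative (\<lambda>s. f' (x + t *\<^sub>R axis i 1) (s *\<^sub>R axis i 1))) (at t within {0..1})" .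
    moreover have "(\<lambda>s. f' (x + t *\<^sub>R axis i 1) (s *\<^sub>R axis i 1)) = (*) (f' (x + t *\<^sub>R axis i 1) (axis i 1))"
      using linear_scale[OF has_derivative_linear[OF d]] by (auto simp: mult.commute)
    ultimately show "((\<lambda>t. f (x + t *\<^sub>R axis i 1)) has_field_derivative f' (x + t *\<^sub>R axis i 1) (axis i 1)) (at t within {0..1})"
      by (simp add: has_field_derivative_def)
  next
    show "(\<lambda>x. f (x + t *\<^sub>R axis i 1)) integrable_on cbox 0 1" for t
      by (intro integrable_continuous continuous_on_compose2[OF fc] continuous_intros) auto
    show "continuous_on ({0..1} \<times> cbox 0 1) (\<lambda>(t, x). f' (x + t *\<^sub>R axis i 1) (axis i 1))"
      unfolding split_beta by (intro continuous_on_compose2[OF c] continuous_intros) auto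
  qed auto
  have J2: "(J has_field_derivative 0) (at 0 within {0..1})"
  proof (rule has_field_derivative_transform_within[OF DERIV_const zero_less_one])
    show "J 0 = J t" if "t \<in> {0..1}" for t using that integral_translate_axis[OF fc p, of t i] by (simp add: J_def)
  qed auto
  have J3: "at (0::real) within {0..1} \<noteq> bot" by (simp add: trivial_limit_within islimpt_Icc)
  have "integral (cbox 0 1) (\<lambda>x. f' (x + 0 *\<^sub>R axis i 1) (axis i 1)) = 0"
    by (rule vector_derivative_unique_within[OF J3 J1[unfolded has_real_derivative_iff_has_vector_derivative] J2[unfolded has_real_derivative_iff_has_vector_derivative]])
  then show ?thesis by (simp add: continuous_torus_integral[OF c])
qed

lemma partial_eq: "(f has_derivative f') (at x) \<Longrightarrow> partial i f x = f' (axis i 1)"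
  unfolding partial_def by (simp add: frechet_derivative_at[symmetric])

section \<open>Hartley functions and trigonometric polynomials\<close>

definition phase :: "int^3 \<Rightarrow> real^3 \<Rightarrow> real" where
  "phase k x = 2 * pi * (\<Sum>i\<in>UNIV. of_int (k $ i) * x $ i)"

text \<open>One real function per frequency instead of a cosine and a sine. Differentiation maps the Hartley
  function of \<open>k\<close> to a multiple of that of \<open>- k\<close>, which is the source of the reflections below.\<close>

definition hartley :: "int^3 \<Rightarrow> real^3 \<Rightarrow> real" where
  "hartley k x = cos (phase k x) + sin (phase k x)"

lemma phase_uminus [simp]: "phase (- k) x = - phase k x" by (simp add: phase_def sum_negf)

lemma phase_add: "phase (k + l) x = phase k x + phase l x" by (simp add: phase_def sum.distrib algebra_simps)

lemma phase_diff: "phase (k - l) x = phase k x - phase l x"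
  using phase_add[of k "- l" x] by simp

lemma phase_zero [simp]: "phase 0 x = 0" by (simp add: phase_def)

lemma phase_periodic: "\<exists>n::int. phase k (x + kvec l) = phase k x + 2 * pi * of_int n"
  by (rule exI[of _ "\<Sum>i\<in>UNIV. k $ i * l $ i"]) (simp add: phase_def sum.distrib algebra_simps)

lemma periodic_hartley: "periodic (hartley k)"
  unfolding periodic_def
proof (intro allI)
  fix x l
  obtain n :: int where "phase k (x + kvec l) = phase k x + 2 * pi * of_int n" using phase_periodic by blast
  then show "hartley k (x + kvec l) = hartley k x"
    by (simp only: hartley_def sin_add cos_add sin_int_2pin cos_int_2pin mult_1_right mult_zero_right diff_zero add_0_right)
qed

lemma hartley_zero [simp]: "hartley 0 x = 1" by (simp add: hartley_def)

lemma abs_hartley_le: "\<bar>hartley k x\<bar> \<le> 2"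
  using abs_cos_le_one[of "phase k x"] abs_sin_le_one[of "phase k x"] unfolding hartley_def by arith

lemma hartley_mult:
  "hartley k x * hartley l x = (hartley (k - l) x + hartley (l - k) x + hartley (k + l) x - hartley (- k - l) x) / 2"
proof -
  have e: "phase (- k - l) x = - (phase k x + phase l x)" using phase_diff[of "- k" l x] by simp
  show ?thesis unfolding hartley_def phase_diff phase_add e by (simp add: cos_add sin_add cos_diff sin_diff algebra_simps)
qed

lemma phase_has_derivative: "(phase k has_derivative phase k) (at x)"
proof (rule bounded_linear_imp_has_derivative)
  have "linear (phase k)" by (intro linearI) (simp_all add: phase_def sum.distrib sum_distrib_left algebra_simps)
  then show "bounded_linear (phase k)" by (simp add: linear_conv_bounded_linear)
qed

lemma hartley_has_derivative: "(hartley k has_derivative (\<lambda>v. hartley (- k) x * phase k v)) (at x)"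
proof -
  have "(hartley k has_derivative (\<lambda>v. - (phase k v * sin (phase k x)) + phase k v * cos (phase k x))) (at x)"
    unfolding hartley_def[abs_def]
    using has_derivative_cos[OF phase_has_derivative[of k x]] has_derivative_sin[OF phase_has_derivative[of k x]]
    by (intro has_derivative_add) (simp_all add: mult.commute)
  then show ?thesis by (simp add: hartley_def algebra_simps)
qed

lemma phase_axis: "phase k (axis i 1) = 2 * pi * of_int (k $ i)"
  by (simp add: phase_def axis_def if_distrib cong: if_cong)

lemma partial_hartley: "partial i (hartley k) = (\<lambda>x. 2 * pi * of_int (k $ i) * hartley (- k) x)"
  using partial_eq[OF hartley_has_derivative] by (simp add: phase_axis fun_eq_iff)

text \<open>The real linear span of the Hartley functions, given inductively so that closure under
  products and partial derivatives follows by rule induction.\<close>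

inductive_set trig_poly :: "(real^3 \<Rightarrow> real) set" where
  trig_hartley: "hartley k \<in> trig_poly"
| trig_add: "f \<in> trig_poly \<Longrightarrow> g \<in> trig_poly \<Longrightarrow> (\<lambda>x. f x + g x) \<in> trig_poly"
| trig_scale: "f \<in> trig_poly \<Longrightarrow> (\<lambda>x. c * f x) \<in> trig_poly"

lemma trig_const: "(\<lambda>x. c) \<in> trig_poly"
  using trig_scale[OF trig_hartley[of 0], of c] by simp

lemma trig_diff: "f \<in> trig_poly \<Longrightarrow> g \<in> trig_poly \<Longrightarrow> (\<lambda>x. f x - g x) \<in> trig_poly"
  using trig_add[OF _ trig_scale[of g "- 1"], of f] by simp

lemma trig_sum: "(\<And>i. i \<in> I \<Longrightarrow> f i \<in> trig_poly) \<Longrightarrow> (\<lambda>x. \<Sum>i\<in>I. f i x) \<in> trig_poly"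
  by (induction I rule: infinite_finite_induct) (auto intro: trig_add trig_const)

lemma trig_mult:
  assumes "f \<in> trig_poly" "g \<in> trig_poly"
  shows "(\<lambda>x. f x * g x) \<in> trig_poly"
  using assms(1)
proof induction
  case (trig_hartley k)
  show ?case using assms(2)
  proof induction
    case (trig_hartley l)
    have "(\<lambda>x. 1 / 2 * (((hartley (k - l) x + hartley (l - k) x) + hartley (k + l) x) - hartley (- k - l) x)) \<in> trig_poly"
      by (intro trig_scale trig_add trig_diff trig_poly.trig_hartley)
    then show ?case by (simp add: hartley_mult)
  qed (use trig_poly.trig_add trig_poly.trig_scale in \<open>fastforce simp: algebra_simps\<close>)+
qed (use trig_poly.trig_add trig_poly.trig_scale in \<open>fastforce simp: algebra_simps\<close>)+

lemma trig_cos: "(\<lambda>x. cos (phase k x)) \<in> trig_poly"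
  using trig_scale[OF trig_add[OF trig_hartley[of k] trig_hartley[of "- k"]], of "1 / 2"] by (simp add: hartley_def)

lemma trig_sin: "(\<lambda>x. sin (phase k x)) \<in> trig_poly"
  using trig_scale[OF trig_diff[OF trig_hartley[of k] trig_hartley[of "- k"]], of "1 / 2"] by (simp add: hartley_def)

lemma trig_periodic: "f \<in> trig_poly \<Longrightarrow> periodic f"
  by (induction rule: trig_poly.induct) (auto simp: periodic_hartley intro: periodic_combine periodic_compose[where h = "\<lambda>y. _ * y"])

lemma trig_derivative: "f \<in> trig_poly \<Longrightarrow> \<exists>f'. (\<forall>x. (f has_derivative f' x) (at x)) \<and> (\<forall>i. (\<lambda>x. f' x (axis i 1)) \<in> trig_poly)"
proof (induction rule: trig_poly.induct)
  case (trig_hartley k)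
  show ?case by (rule exI[of _ "\<lambda>x v. hartley (- k) x * phase k v"])
       (auto simp: hartley_has_derivative phase_axis intro!: trig_mult trig_const trig_poly.trig_hartley)
next
  case (trig_add f g)
  then obtain f' g' where "\<forall>x. (f has_derivative f' x) (at x)" "\<forall>i. (\<lambda>x. f' x (axis i 1)) \<in> trig_poly"
    "\<forall>x. (g has_derivative g' x) (at x)" "\<forall>i. (\<lambda>x. g' x (axis i 1)) \<in> trig_poly" by blast
  then show ?case by (intro exI[of _ "\<lambda>x v. f' x v + g' x v"]) (auto intro!: has_derivative_add trig_poly.trig_add)
next
  case (trig_scale f c)
  then obtain f' where "\<forall>x. (f has_derivative f' x) (at x)" "\<forall>i. (\<lambda>x. f' x (axis i 1)) \<in> trig_poly" by blast
  then show ?case by (intro exI[of _ "\<lambda>x v. c * f' x v"]) (auto intro!: has_derivative_mult_right trig_poly.trig_scale)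
qed

lemma trig_partial: "f \<in> trig_poly \<Longrightarrow> partial i f \<in> trig_poly"
proof -
  assume "f \<in> trig_poly"
  then obtain f' where f': "\<forall>x. (f has_derivative f' x) (at x)" "\<forall>i. (\<lambda>x. f' x (axis i 1)) \<in> trig_poly" using trig_derivative by blast
  then have "partial i f = (\<lambda>x. f' x (axis i 1))" using partial_eq[OF spec[OF f'(1)]] by (simp add: fun_eq_iff)
  then show ?thesis using f' by simp
qed

lemma trig_differentiable: "f \<in> trig_poly \<Longrightarrow> f differentiable_on UNIV"
  using trig_derivative unfolding differentiable_on_def differentiable_def by (metis has_derivative_at_withinI)

lemma trig_smooth: "f \<in> trig_poly \<Longrightarrow> smooth f"
proof -
  have "fold partial is f \<in> trig_poly" if "f \<in> trig_poly" for "is" f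
    using that by (induction "is" arbitrary: f) (auto intro: trig_partial)
  then show "f \<in> trig_poly \<Longrightarrow> smooth f" using trig_differentiable by (auto simp: smooth_def)
qed

lemma trig_continuous: "f \<in> trig_poly \<Longrightarrow> continuous_on UNIV f"
  using trig_differentiable differentiable_imp_continuous_on by blast

lemma trig_sq_int: "f \<in> trig_poly \<Longrightarrow> sq_int torus f" by (intro continuous_torus_sq_int trig_continuous)

text \<open>For \<open>k \<noteq> 0\<close> some component of \<open>k\<close> is nonzero, and
  \<open>hartley k\<close> is a nonzero multiple of the partial derivative of the periodic function
  \<open>hartley (- k)\<close> in that direction.\<close>

lemma integral_hartley: "(LINT x|torus. hartley k x) = (if k = 0 then 1 else 0)"
proof (cases "k = 0")
  case True
  then show ?thesis using integral_torus_const[of 1] by simp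
next
  case False
  then obtain i where i: "k $ i \<noteq> 0" by (auto simp: vec_eq_iff)
  have "(LINT x|torus. hartley (- (- k)) x * phase (- k) (axis i 1)) = 0"
    by (rule integral_partial_periodic[OF hartley_has_derivative _ periodic_hartley])
       (intro continuous_intros trig_continuous trig_hartley)
  then show ?thesis using i False by (simp add: phase_axis)
qed

lemma hartley_orthonormal: "(LINT x|torus. hartley k x * hartley l x) = (if k = l then 1 else 0)"
proof -
  have i: "integrable torus (hartley j)" for j by (intro continuous_torus_integrable trig_continuous trig_hartley)
  have "(LINT x|torus. hartley k x * hartley l x) =
      ((LINT x|torus. hartley (k - l) x) + (LINT x|torus. hartley (l - k) x) + (LINT x|torus. hartley (k + l) x) - (LINT x|torus. hartley (- k - l) x)) / 2"
    unfolding hartley_mult using i by simp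
  also have "... = (if k = l then 1 else 0)"
  proof -
    have "l - k = - (k - l)" "- k - l = - (k + l)" by simp_all
    then have "(l - k = 0) = (k = l)" "(- k - l = 0) = (k + l = 0)" by (metis neg_equal_0_iff_equal right_minus_eq)+
    then show ?thesis unfolding integral_hartley by simp
  qed
  finally show ?thesis .
qed

section \<open>Completeness and Parseval's identity\<close>

text \<open>Realises the torus as a compact subset of \<open>complex^3\<close>, where the real and
  imaginary parts of the coordinates separate points, as Stone-Weierstrass requires.\<close>

definition circle_map :: "real^3 \<Rightarrow> complex^3" where
  "circle_map x = (\<chi> i. cis (2 * pi * x $ i))"

lemma continuous_circle_map: "continuous_on UNIV circle_map"
  unfolding circle_map_def cis_conv_exp by (intro continuous_intros)

lemma phase_axis_eq: "phase (axis i 1) x = 2 * pi * x $ i"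
proof -
  have "(\<Sum>j\<in>UNIV. of_int ((axis i 1 :: int^3) $ j) * x $ j) = (\<Sum>j\<in>UNIV. if j = i then x $ j else 0)"
    by (intro sum.cong) (auto simp: axis_def)
  then show ?thesis by (simp add: phase_def)
qed

text \<open>Only points on faces of the cube can be identified. This weak form suffices for
  functions that vanish on all faces.\<close>

lemma circle_map_eqD:
  assumes "circle_map x = circle_map y" "x \<in> cbox 0 1" "y \<in> cbox 0 1"
  shows "x = y \<or> (\<exists>i. x $ i \<in> {0, 1} \<and> (\<exists>j. y $ j \<in> {0, 1}))"
proof (rule ccontr)
  assume neg: "\<not> ?thesis"
  then obtain i where i: "x $ i \<noteq> y $ i" by (auto simp: vec_eq_iff)
  have "cis (2 * pi * x $ i) = cis (2 * pi * y $ i)" using assms(1) by (simp add: circle_map_def vec_eq_iff)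
  then have "sin (2 * pi * x $ i) = sin (2 * pi * y $ i)" "cos (2 * pi * x $ i) = cos (2 * pi * y $ i)"
    by (simp_all add: complex_eq_iff)
  then obtain n :: int where n: "2 * pi * x $ i = 2 * pi * y $ i + 2 * pi * n"
    using sin_cos_eq_iff[of "2 * pi * x $ i" "2 * pi * y $ i"] by auto
  then have "2 * pi * x $ i = 2 * pi * (y $ i + n)" by (simp add: algebra_simps)
  then have xy: "x $ i = y $ i + n" by simp
  have b: "0 \<le> x $ i" "x $ i \<le> 1" "0 \<le> y $ i" "y $ i \<le> 1" using assms by (auto simp: mem_box_cart)
  have "n \<noteq> 0" using i xy by auto
  then have "n \<ge> 1 \<or> n \<le> - 1" by linarith
  then have "real_of_int n \<ge> 1 \<or> real_of_int n \<le> - 1" by linarith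
  then have "x $ i \<in> {0, 1} \<and> y $ i \<in> {0, 1}" using xy b by auto
  then show False using neg by blast
qed

text \<open>A function vanishing on the faces takes equal values at points with the same image, so
  it factors through \<open>circle_map\<close> as \<open>G\<close>, and Stone-Weierstrass applies to
  \<open>G\<close>.\<close>

lemma trig_poly_uniform_approx:
  fixes \<phi> :: "real^3 \<Rightarrow> real"
  assumes c: "continuous_on (cbox 0 1) \<phi>" and bd: "\<And>x i. x \<in> cbox 0 1 \<Longrightarrow> x $ i \<in> {0, 1} \<Longrightarrow> \<phi> x = 0" and "0 < e"
  obtains g where "g \<in> trig_poly" "\<And>x. x \<in> cbox 0 1 \<Longrightarrow> \<bar>\<phi> x - g x\<bar> < e"
proof -
  define S where "S = circle_map ` cbox 0 1"
  have cc: "continuous_on (cbox 0 1) circle_map" by (rule continuous_on_subset[OF continuous_circle_map]) simp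
  have comp: "compact S" unfolding S_def by (intro compact_continuous_image cc compact_cbox)
  define R where "R = {p. continuous_on S p \<and> (\<lambda>x. p (circle_map x)) \<in> trig_poly}"
  have fr: "function_ring_on R S"
  proof
    fix z w assume "z \<in> S" "w \<in> S" "z \<noteq> w"
    then obtain i where i: "z $ i \<noteq> w $ i" by (auto simp: vec_eq_iff)
    have 1: "(\<lambda>z. Re (z $ i)) \<in> R"
      unfolding R_def using trig_cos[of "axis i 1"] by (auto intro!: continuous_intros simp: circle_map_def phase_axis_eq)
    have 2: "(\<lambda>z. Im (z $ i)) \<in> R"
      unfolding R_def using trig_sin[of "axis i 1"] by (auto intro!: continuous_intros simp: circle_map_def phase_axis_eq)
    show "\<exists>f\<in>R. f z \<noteq> f w" using i 1 2 by (metis complex_eqI)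
  qed (auto simp: R_def comp intro: continuous_intros trig_add trig_mult trig_const)
  interpret function_ring_on R S by (rule fr)
  have fib: "\<phi> x = \<phi> y" if "circle_map x = circle_map y" "x \<in> cbox 0 1" "y \<in> cbox 0 1" for x y
    using circle_map_eqD[OF that] bd that by metis
  define G where "G z = \<phi> (SOME x. x \<in> cbox 0 1 \<and> circle_map x = z)" for z
  have G: "G (circle_map x) = \<phi> x" if "x \<in> cbox 0 1" for x unfolding G_def using that by (rule_tac someI2[of _ x]) (auto intro: fib)
  \<comment> \<open>\<open>circle_map\<close> is a closed map on the compact cube: preimages of
    closed sets under \<open>G\<close> are images of compact sets.\<close>
  have "continuous_on S G" unfolding continuous_on_closed_vimage[OF compact_imp_closed[OF comp]]
  proof (intro allI impI)
    fix B :: "real set" assume "closed B"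
    have "G -` B \<inter> S = circle_map ` (\<phi> -` B \<inter> cbox 0 1)" using G by (auto simp: S_def)
    moreover have "compact (circle_map ` (\<phi> -` B \<inter> cbox 0 1))"
    proof (rule compact_continuous_image)
      show "continuous_on (\<phi> -` B \<inter> cbox 0 1) circle_map" by (rule continuous_on_subset[OF cc]) auto
      have "closed (\<phi> -` B \<inter> cbox 0 1)" using c \<open>closed B\<close> continuous_on_closed_vimage[OF closed_cbox] by blast
      then show "compact (\<phi> -` B \<inter> cbox 0 1)" by (auto simp: compact_eq_bounded_closed intro: bounded_subset[OF bounded_cbox])
    qed
    ultimately show "closed (G -` B \<inter> S)" by (simp add: compact_imp_closed)
  qed
  then obtain p where p: "p \<in> R" "\<forall>z\<in>S. \<bar>G z - p z\<bar> < e" using Stone_Weierstrass_basic \<open>0 < e\<close> by blast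
  show ?thesis
  proof (rule that[of "\<lambda>x. p (circle_map x)"])
    show "(\<lambda>x. p (circle_map x)) \<in> trig_poly" using p by (simp add: R_def)
    show "\<bar>\<phi> x - p (circle_map x)\<bar> < e" if "x \<in> cbox 0 1" for x using p(2) G[OF that] that by (auto simp: S_def)
  qed
qed

definition hc :: "(real^3 \<Rightarrow> real) \<Rightarrow> int^3 \<Rightarrow> real" where
  "hc f k = (LINT x|torus. f x * hartley k x)"

lemma hartley_sq_int: "sq_int torus (hartley k)" by (intro trig_sq_int trig_hartley)

lemma hc_add: "sq_int torus f \<Longrightarrow> sq_int torus g \<Longrightarrow> hc (\<lambda>x. f x + g x) k = hc f k + hc g k"
  unfolding hc_def using sq_int_mult_integrable[OF _ hartley_sq_int] by (simp add: distrib_right)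

lemma hc_diff: "sq_int torus f \<Longrightarrow> sq_int torus g \<Longrightarrow> hc (\<lambda>x. f x - g x) k = hc f k - hc g k"
  unfolding hc_def using sq_int_mult_integrable[OF _ hartley_sq_int] by (simp add: left_diff_distrib)

lemma hc_scale: "hc (\<lambda>x. c * f x) k = c * hc f k"
  unfolding hc_def by (simp add: mult.assoc)

lemma hc_cong_AE:
  assumes "AE x in torus. f x = g x" "f \<in> borel_measurable torus" "g \<in> borel_measurable torus"
  shows "hc f k = hc g k"
  unfolding hc_def
proof (rule integral_cong_AE)
  show "AE x in torus. f x * hartley k x = g x * hartley k x" using assms(1) by eventually_elim simp
qed (use assms sq_intD(1)[OF hartley_sq_int] in auto)

lemma negligible_AE: "negligible N \<Longrightarrow> AE x in lebesgue. x \<notin> N" by (simp add: negligible_iff_null_sets AE_not_in)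

lemma AE_torusI: "AE x in lebesgue. x \<in> cbox 0 1 \<longrightarrow> P x \<Longrightarrow> AE x in torus. P x"
  unfolding torus_def by (subst AE_restrict_space_iff) auto

lemma AE_torus_interior: "AE x :: real^3 in torus. \<forall>i. 0 < x $ i \<and> x $ i < 1"
proof -
  have "negligible (cbox 0 (1::real^3) - box 0 1)" by (rule negligible_frontier_interval)
  then have "AE x :: real^3 in lebesgue. x \<in> cbox 0 1 \<longrightarrow> (\<forall>i. 0 < x $ i \<and> x $ i < 1)"
    by (rule eventually_mono[OF negligible_AE]) (auto simp: mem_box_cart)
  then show ?thesis by (rule AE_torusI)
qed

text \<open>Orthogonality passes from trigonometric polynomials to continuous functions vanishing on
  the faces by uniform approximation, and from these to the clipped function \<open>h\<close> by
  dominated convergence. Then \<open>f x * h x \<ge> 0\<close> has integral 0.\<close>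

theorem hartley_complete:
  assumes f: "sq_int torus f" and z: "\<And>k. hc f k = 0"
  shows "AE x in torus. f x = 0"
proof -
  have fi: "integrable torus f" using sq_int_mult_integrable[OF f hartley_sq_int[of 0]] by simp
  have fm: "f \<in> borel_measurable torus" by (rule sq_intD(1)[OF f])
  have orth: "(LINT x|torus. f x * g x) = 0" if "g \<in> trig_poly" for g using that
  proof induction
    case (trig_hartley k)
    then show ?case using z by (simp add: hc_def)
  next
    case (trig_add g h)
    then show ?case using sq_int_mult_integrable[OF f trig_sq_int] by (simp add: distrib_left)
  next
    case (trig_scale g c)
    then show ?case by (simp add: mult.left_commute)
  qed
  have orthc: "(LINT x|torus. f x * \<phi> x) = 0"
    if c: "continuous_on UNIV \<phi>" and bd: "\<And>x i. x \<in> cbox 0 1 \<Longrightarrow> x $ i \<in> {0, 1} \<Longrightarrow> \<phi> x = 0" for \<phi>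
  proof (rule ccontr)
    define I where "I = (LINT x|torus. f x * \<phi> x)"
    define N where "N = (LINT x|torus. \<bar>f x\<bar>)"
    assume "(LINT x|torus. f x * \<phi> x) \<noteq> 0"
    then have I: "0 < \<bar>I\<bar>" by (simp add: I_def)
    have N: "0 \<le> N" by (simp add: N_def)
    \<comment> \<open>Makes the approximation error \<open>N * e\<close> at most half of
      \<open>\<bar>I\<bar>\<close>; \<open>N + 1\<close> avoids a division by zero.\<close>
    define e where "e = (\<bar>I\<bar> / 2) / (N + 1)"
    have e: "0 < e" using I N by (simp add: e_def)
    obtain g where g: "g \<in> trig_poly" "\<And>x. x \<in> cbox 0 1 \<Longrightarrow> \<bar>\<phi> x - g x\<bar> < e"
      by (rule trig_poly_uniform_approx[OF continuous_on_subset[OF c subset_UNIV] bd e]) auto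
    have fg: "integrable torus (\<lambda>x. f x * g x)" "integrable torus (\<lambda>x. f x * \<phi> x)"
      using sq_int_mult_integrable[OF f trig_sq_int[OF g(1)]] sq_int_mult_integrable[OF f continuous_torus_sq_int[OF c]] by auto
    have "I = (LINT x|torus. f x * (\<phi> x - g x))" using orth[OF g(1)] fg by (simp add: I_def right_diff_distrib)
    also have "\<bar>...\<bar> \<le> (LINT x|torus. \<bar>f x\<bar> * e)"
    proof (rule integral_abs_bound_integral)
      show "integrable torus (\<lambda>x. f x * (\<phi> x - g x))" using fg by (simp add: right_diff_distrib)
      show "integrable torus (\<lambda>x. \<bar>f x\<bar> * e)" using fi by simp
      show "\<bar>f x * (\<phi> x - g x)\<bar> \<le> \<bar>f x\<bar> * e" if "x \<in> space torus" for x
        using g(2)[of x] that by (auto simp: abs_mult intro!: mult_left_mono)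
    qed
    also have "... = N * e" by (simp add: N_def)
    also have "... \<le> (N + 1) * e" using e by (intro mult_right_mono) auto
    also have "(N + 1) * e = \<bar>I\<bar> / 2"
    proof -
      have "N + 1 \<noteq> 0" using N by simp
      from nonzero_eq_divide_eq[THEN iffD1, OF this e_def] show ?thesis by (simp add: mult.commute)
    qed
    also have "... < \<bar>I\<bar>" using I by simp
    finally show False by simp
  qed
  \<comment> \<open>A bounded continuous function with the sign of its argument and its only zero at
    0: the product of \<open>f\<close> with the clipped \<open>f\<close> is integrable and vanishes
    only where \<open>f\<close> does.\<close>
  define clip where "clip y = max (- 1) (min 1 y)" for y :: real
  have clip: "\<bar>clip y\<bar> \<le> 1" for y by (auto simp: clip_def)
  have clipc: "continuous_on UNIV clip" unfolding clip_def by (intro continuous_intros)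
  define h where "h x = (if x \<in> cbox 0 1 then clip (f x) else 0)" for x
  have hm: "h \<in> borel_measurable lebesgue" unfolding h_def using fm unfolding torus_def clip_def by (subst borel_measurable_if) auto
  have "h measurable_on UNIV" by (rule lebesgue_measurable_imp_measurable_on[OF hm]) simp
  then obtain N g where N: "negligible N" and g: "\<And>n::nat. continuous_on UNIV (g n)" "\<And>x. x \<notin> N \<Longrightarrow> (\<lambda>n. g n x) \<longlonglongrightarrow> h x"
    unfolding measurable_on_def by auto
  have AEN: "AE x in torus. x \<notin> N" by (rule AE_torusI) (use negligible_AE[OF N] in \<open>auto elim: eventually_mono\<close>)
  \<comment> \<open>A cutoff that is 0 on the faces and equals 1 for large \<open>n\<close> at each
    interior point.\<close>
  define \<eta> where "\<eta> n x = min 1 (real n * (\<Prod>i\<in>UNIV. max 0 (x $ i * (1 - x $ i))))" for n and x :: "real^3"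
  define \<phi> where "\<phi> n x = clip (g n x) * \<eta> n x" for n x
  have \<eta>01: "0 \<le> \<eta> n x" "\<eta> n x \<le> 1" for n x by (auto simp: \<eta>_def intro!: mult_nonneg_nonneg prod_nonneg)
  have \<phi>c: "continuous_on UNIV (\<phi> n)" for n
    unfolding \<phi>_def \<eta>_def by (intro continuous_intros continuous_on_compose2[OF clipc g(1)]) auto
  have \<phi>0: "\<phi> n x = 0" if "x $ i \<in> {0, 1}" for n x i
  proof -
    have "(\<Prod>i\<in>UNIV. max 0 (x $ i * (1 - x $ i))) = 0" using that by (intro prod_zero bexI[of _ i]) auto
    then show ?thesis unfolding \<phi>_def \<eta>_def by (simp only: mult_zero_right)
  qed
  have lim: "(\<lambda>n. LINT x|torus. f x * \<phi> n x) \<longlonglongrightarrow> (LINT x|torus. f x * h x)"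
  proof (rule integral_dominated_convergence[where w = "\<lambda>x. \<bar>f x\<bar>"])
    show "(\<lambda>x. f x * h x) \<in> borel_measurable torus" using fm measurable_restrict_space1[OF hm] by (auto simp: torus_def)
    show "(\<lambda>x. f x * \<phi> n x) \<in> borel_measurable torus" for n using fm continuous_torus_measurable[OF \<phi>c] by auto
    show "integrable torus (\<lambda>x. \<bar>f x\<bar>)" using fi by simp
    show "AE x in torus. norm (f x * \<phi> n x) \<le> \<bar>f x\<bar>" for n
    proof (rule AE_I2)
      fix x
      have "\<bar>clip (g n x)\<bar> * \<eta> n x \<le> 1 * 1" using clip \<eta>01 by (intro mult_mono) auto
      then have "\<bar>\<phi> n x\<bar> \<le> 1" using \<eta>01[of n x] by (simp add: \<phi>_def abs_mult)
      then show "norm (f x * \<phi> n x) \<le> \<bar>f x\<bar>" by (simp add: abs_mult mult_left_le)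
    qed
    show "AE x in torus. (\<lambda>n. f x * \<phi> n x) \<longlonglongrightarrow> f x * h x" using AEN AE_torus_interior AE_space
    proof eventually_elim
      case (elim x)
      have p: "0 < (\<Prod>i\<in>UNIV. max 0 (x $ i * (1 - x $ i)))" using elim(2) by (intro prod_pos) (auto simp: less_max_iff_disj)
      obtain M :: nat where M: "1 < real M * (\<Prod>i\<in>UNIV. max 0 (x $ i * (1 - x $ i)))" using reals_Archimedean3[OF p] by blast
      have "\<forall>\<^sub>F n in sequentially. \<eta> n x = 1" unfolding eventually_sequentially
      proof (intro exI allI impI)
        fix n assume "M \<le> n"
        then have "real M * (\<Prod>i\<in>UNIV. max 0 (x $ i * (1 - x $ i))) \<le> real n * (\<Prod>i\<in>UNIV. max 0 (x $ i * (1 - x $ i)))"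
          using p by (intro mult_right_mono) auto
        then show "\<eta> n x = 1" using M by (simp add: \<eta>_def)
      qed
      then have l1: "(\<lambda>n. \<eta> n x) \<longlonglongrightarrow> 1" by (rule tendsto_eventually)
      have "(\<lambda>n. clip (g n x)) \<longlonglongrightarrow> clip (h x)" by (rule continuous_on_tendsto_compose[OF clipc g(2)[OF elim(1)]]) auto
      moreover have "clip (h x) = h x" using clip[of "f x"] elim(3) by (auto simp: h_def clip_def)
      ultimately have l2: "(\<lambda>n. clip (g n x)) \<longlonglongrightarrow> h x" by simp
      have "(\<lambda>n. f x * (clip (g n x) * \<eta> n x)) \<longlonglongrightarrow> f x * (h x * 1)" by (rule tendsto_mult[OF tendsto_const tendsto_mult[OF l2 l1]])
      then show ?case by (simp add: \<phi>_def)
    qed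
  qed
  have z: "(LINT x|torus. f x * \<phi> n x) = 0" for n by (rule orthc[OF \<phi>c]) (rule \<phi>0)
  have I0: "(LINT x|torus. f x * h x) = 0" by (rule LIMSEQ_unique[OF lim[unfolded z] tendsto_const])
  have hi: "integrable torus (\<lambda>x. f x * h x)"
  proof (rule Bochner_Integration.integrable_bound[of _ "\<lambda>x. \<bar>f x\<bar>"])
    show "integrable torus (\<lambda>x. \<bar>f x\<bar>)" using fi by simp
    show "(\<lambda>x. f x * h x) \<in> borel_measurable torus" using fm measurable_restrict_space1[OF hm] by (auto simp: torus_def)
    show "AE x in torus. norm (f x * h x) \<le> norm \<bar>f x\<bar>" using clip by (intro AE_I2) (auto simp: h_def abs_mult intro!: mult_left_le)
  qed
  have "AE x in torus. f x * h x = 0"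
  proof (subst integral_nonneg_eq_0_iff_AE[symmetric])
    show "AE x in torus. 0 \<le> f x * h x"
      by (intro AE_I2) (auto simp: h_def clip_def max_def min_def mult_nonneg_nonneg mult_nonpos_nonpos)
  qed (use hi I0 in auto)
  with AE_space show ?thesis
  proof eventually_elim
    case (elim x)
    then show ?case by (auto simp: h_def clip_def max_def min_def split: if_splits)
  qed
qed

section \<open>Bessel, Riesz-Fischer and Parseval\<close>

lemma hartley_complete_eq:
  assumes "sq_int torus f" "sq_int torus g" "\<And>k. hc f k = hc g k"
  shows "AE x in torus. f x = g x"
  using hartley_complete[OF sq_int_diff[OF assms(1,2)]] assms by (simp add: hc_diff)

lemma integral_hartley_sum_square:
  assumes "finite A"
  shows "(LINT x|torus. (\<Sum>k\<in>A. a k * hartley k x)^2) = (\<Sum>k\<in>A. (a k)^2)"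
proof -
  have i: "integrable torus (\<lambda>x. hartley k x * hartley l x)" for k l by (rule sq_int_mult_integrable[OF hartley_sq_int hartley_sq_int])
  have "(\<Sum>k\<in>A. a k * hartley k x)^2 = (\<Sum>k\<in>A. \<Sum>l\<in>A. a k * a l * (hartley k x * hartley l x))" for x
    by (simp add: power2_eq_square sum_product mult_ac)
  then have "(LINT x|torus. (\<Sum>k\<in>A. a k * hartley k x)^2) = (\<Sum>k\<in>A. \<Sum>l\<in>A. a k * a l * (if k = l then 1 else 0))"
    using i by (simp add: hartley_orthonormal)
  also have "... = (\<Sum>k\<in>A. (a k)^2)"
  proof (intro sum.cong refl)
    fix k assume "k \<in> A"
    have "(\<Sum>l\<in>A. a k * a l * (if k = l then 1 else 0)) = (\<Sum>l\<in>A. if k = l then (a k)^2 else 0)"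
      by (intro sum.cong) (auto simp: power2_eq_square)
    then show "(\<Sum>l\<in>A. a k * a l * (if k = l then 1 else 0)) = (a k)^2" using \<open>finite A\<close> \<open>k \<in> A\<close> by simp
  qed
  finally show ?thesis .
qed

lemma hartley_sum_sq_int: "sq_int torus (\<lambda>x. \<Sum>k\<in>A. a k * hartley k x)"
  by (intro sq_int_sum sq_int_scale hartley_sq_int)

lemma hc_hartley: "hc (hartley l) k = (if l = k then 1 else 0)" by (simp add: hc_def hartley_orthonormal)

lemma hc_sum: "(\<And>i. i \<in> I \<Longrightarrow> sq_int torus (f i)) \<Longrightarrow> hc (\<lambda>x. \<Sum>i\<in>I. f i x) k = (\<Sum>i\<in>I. hc (f i) k)"
  unfolding hc_def using sq_int_mult_integrable[OF _ hartley_sq_int] by (simp add: sum_distrib_right)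

lemma hc_hartley_sum: "finite A \<Longrightarrow> hc (\<lambda>x. \<Sum>l\<in>A. a l * hartley l x) k = (if k \<in> A then a k else 0)"
  by (subst hc_sum) (auto simp: hc_scale hc_hartley hartley_sq_int sq_int_scale if_distrib cong: if_cong)

lemma integral_diff_hartley_sum:
  assumes f: "sq_int torus f" and A: "finite A"
  shows "(LINT x|torus. (f x - (\<Sum>k\<in>A. hc f k * hartley k x))^2) = (LINT x|torus. (f x)^2) - (\<Sum>k\<in>A. (hc f k)^2)"
proof -
  let ?S = "\<lambda>x. \<Sum>k\<in>A. hc f k * hartley k x"
  have fh: "integrable torus (\<lambda>x. f x * hartley k x)" for k by (rule sq_int_mult_integrable[OF f hartley_sq_int])
  have "f x * ?S x = (\<Sum>k\<in>A. hc f k * (f x * hartley k x))" for x by (simp add: sum_distrib_left mult.left_commute)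
  then have "(LINT x|torus. f x * ?S x) = (\<Sum>k\<in>A. hc f k * (LINT x|torus. f x * hartley k x))" using fh by simp
  then have 1: "(LINT x|torus. f x * ?S x) = (\<Sum>k\<in>A. (hc f k)^2)" by (simp add: hc_def power2_eq_square)
  have "(LINT x|torus. (f x - ?S x)^2) = (LINT x|torus. (f x)^2 + (?S x)^2 - 2 * (f x * ?S x))" by (simp add: power2_diff mult.assoc)
  also have "... = (LINT x|torus. (f x)^2) + (LINT x|torus. (?S x)^2) - 2 * (LINT x|torus. f x * ?S x)"
    using sq_int_mult_integrable[OF f hartley_sum_sq_int] sq_intD(2)[OF f] sq_intD(2)[OF hartley_sum_sq_int] by simp
  also have "... = (LINT x|torus. (f x)^2) - (\<Sum>k\<in>A. (hc f k)^2)" unfolding 1 integral_hartley_sum_square[OF A] by simp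
  finally show ?thesis .
qed

lemma Bessel:
  assumes "sq_int torus f" "finite A"
  shows "(\<Sum>k\<in>A. (hc f k)^2) \<le> (LINT x|torus. (f x)^2)"
proof -
  have "0 \<le> (LINT x|torus. (f x - (\<Sum>k\<in>A. hc f k * hartley k x))^2)" by simp
  then show ?thesis unfolding integral_diff_hartley_sum[OF assms] by simp
qed

definition lattice_enum :: "nat \<Rightarrow> int^3" where
  "lattice_enum = from_nat_into UNIV"

lemma lattice_enum_bij: "bij lattice_enum"
  unfolding lattice_enum_def by (intro bij_betw_from_nat_into) (auto simp: infinite_UNIV_char_0)

lemma summable_on_lattice_iff:
  fixes a :: "int^3 \<Rightarrow> real"
  assumes "\<And>k. 0 \<le> a k"
  shows "a summable_on UNIV \<longleftrightarrow> summable (\<lambda>n. a (lattice_enum n))"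
  using summable_on_reindex_bij_betw[OF lattice_enum_bij, of a] summable_on_UNIV_nonneg_real_iff[of "\<lambda>n. a (lattice_enum n)"] assms by simp

lemma has_sum_lattice_iff:
  fixes a :: "int^3 \<Rightarrow> real"
  assumes "\<And>k. 0 \<le> a k"
  shows "(a has_sum s) UNIV \<longleftrightarrow> (\<lambda>n. a (lattice_enum n)) sums s"
  using has_sum_reindex_bij_betw[OF lattice_enum_bij, of a s] has_sum_imp_sums sums_nonneg_imp_has_sum[of "\<lambda>n. a (lattice_enum n)" s] assms by auto

definition partial_sum :: "(int^3 \<Rightarrow> real) \<Rightarrow> nat \<Rightarrow> real^3 \<Rightarrow> real" where
  "partial_sum a N x = (\<Sum>k\<in>lattice_enum ` {..<N}. a k * hartley k x)"

lemma partial_sum_trig: "partial_sum a N \<in> trig_poly"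
  unfolding partial_sum_def by (intro trig_sum trig_scale trig_hartley)

theorem Riesz_Fischer:
  fixes a :: "int^3 \<Rightarrow> real"
  assumes a: "(\<lambda>k. (a k)^2) summable_on UNIV"
  obtains f where "sq_int torus f" "periodic f" "\<And>k. hc f k = a k"
    "(\<lambda>N. LINT x|torus. (partial_sum a N x - f x)^2) \<longlonglongrightarrow> 0"
proof -
  have inj: "inj lattice_enum" using lattice_enum_bij by (rule bij_is_inj)
  define c where "c n = (a (lattice_enum n))^2" for n
  have c: "summable c" using a summable_on_lattice_iff[of "\<lambda>k. (a k)^2"] by (simp add: c_def[abs_def])
  have d: "(LINT x|torus. (partial_sum a p x - partial_sum a q x)^2) = \<bar>(\<Sum>n<p. c n) - (\<Sum>n<q. c n)\<bar>" for p q
  proof -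
    have *: "(LINT x|torus. (partial_sum a p x - partial_sum a q x)^2) = (\<Sum>n<p. c n) - (\<Sum>n<q. c n)" if "q \<le> p" for p q
    proof -
      have un: "lattice_enum ` {..<p} = lattice_enum ` {..<q} \<union> lattice_enum ` {q..<p}" using that by (auto simp: image_Un[symmetric] ivl_disj_un)
      have dj: "lattice_enum ` {..<q} \<inter> lattice_enum ` {q..<p} = {}" using inj by (auto dest: injD)
      have "partial_sum a p x - partial_sum a q x = (\<Sum>k\<in>lattice_enum ` {q..<p}. a k * hartley k x)" for x
        unfolding partial_sum_def un by (subst sum.union_disjoint) (use dj in auto)
      then have "(LINT x|torus. (partial_sum a p x - partial_sum a q x)^2) = (\<Sum>k\<in>lattice_enum ` {q..<p}. (a k)^2)"
        by (simp add: integral_hartley_sum_square)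
      also have "... = (\<Sum>n\<in>{q..<p}. c n)" unfolding c_def by (subst sum.reindex) (auto intro: inj_on_subset[OF inj])
      also have "... = (\<Sum>n<p. c n) - (\<Sum>n<q. c n)"
      proof -
        have "{q..<p} = {..<p} - {..<q}" by auto
        moreover have "sum c ({..<p} - {..<q}) = sum c {..<p} - sum c {..<q}" by (rule sum_diff) (use that in auto)
        ultimately show ?thesis by (simp only:)
      qed
      finally show ?thesis .
    qed
    show ?thesis
    proof (cases "q \<le> p")
      case True
      have "0 \<le> (LINT x|torus. (partial_sum a p x - partial_sum a q x)^2)" by simp
      then show ?thesis using *[OF True] by simp
    next
      case False
      have ge: "0 \<le> (LINT x|torus. (partial_sum a q x - partial_sum a p x)^2)" by simp
      have eq: "(LINT x|torus. (partial_sum a p x - partial_sum a q x)^2) = (LINT x|torus. (partial_sum a q x - partial_sum a p x)^2)"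
        by (simp add: power2_commute)
      show ?thesis using *[of p q] ge False unfolding eq by simp
    qed
  qed
  have Cau: "Cauchy (\<lambda>p. \<Sum>n<p. c n)" using c by (simp add: summable_iff_convergent convergent_Cauchy)
  have C2: "\<exists>N. \<forall>p\<ge>N. \<forall>q\<ge>N. (LINT x|torus. (partial_sum a p x - partial_sum a q x)^2) < e" if "0 < e" for e
    unfolding d using CauchyD[OF Cau that] by simp
  obtain r f where r: "strict_mono r" and f: "f = (\<lambda>x. lim (\<lambda>j. partial_sum a (r j) x))" "sq_int torus f"
      "(\<lambda>N. LINT x|torus. (partial_sum a N x - f x)^2) \<longlonglongrightarrow> 0" by (rule L2_complete[OF trig_sq_int[OF partial_sum_trig] C2])
  \<comment> \<open>The value of \<open>lim\<close> depends on the sequence alone, so periodicity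
    holds also at points where the partial sums diverge.\<close>
  have p: "periodic f" unfolding f(1) periodic_def using periodicD[OF trig_periodic[OF partial_sum_trig]] by simp
  have "hc f k = a k" for k
  proof -
    have "(\<lambda>N. hc (partial_sum a N) k) \<longlonglongrightarrow> hc f k"
      unfolding hc_def by (rule L2_tendsto_integral_mult[OF trig_sq_int[OF partial_sum_trig] f(2) hartley_sq_int f(3)])
    moreover obtain n0 where n0: "k = lattice_enum n0" using lattice_enum_bij by (meson bij_pointE)
    have "\<forall>\<^sub>F N in sequentially. hc (partial_sum a N) k = a k" unfolding eventually_sequentially
    proof (intro exI allI impI)
      fix N assume "Suc n0 \<le> N"
      then have "k \<in> lattice_enum ` {..<N}" by (auto simp: n0)
      then show "hc (partial_sum a N) k = a k" unfolding partial_sum_def[abs_def] by (simp add: hc_hartley_sum)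
    qed
    ultimately show ?thesis by (metis LIMSEQ_unique tendsto_eventually)
  qed
  then show ?thesis using that[OF f(2) p _ f(3)] by blast
qed

lemma hc_square_summable:
  assumes "sq_int torus f"
  shows "(\<lambda>k. (hc f k)^2) summable_on UNIV"
  by (rule nonneg_bdd_above_summable_on) (use Bessel[OF assms] in \<open>auto intro!: bdd_aboveI2\<close>)

lemma partial_sum_tendsto:
  assumes f: "sq_int torus f"
  shows "(\<lambda>N. LINT x|torus. (partial_sum (hc f) N x - f x)^2) \<longlonglongrightarrow> 0"
proof -
  obtain g where g: "sq_int torus g" "\<And>k. hc g k = hc f k" "(\<lambda>N. LINT x|torus. (partial_sum (hc f) N x - g x)^2) \<longlonglongrightarrow> 0"
    by (rule Riesz_Fischer[OF hc_square_summable[OF f]]) blast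
  have "AE x in torus. g x = f x" by (rule hartley_complete_eq[OF g(1) f g(2)])
  then have eq: "(LINT x|torus. (partial_sum (hc f) N x - g x)^2) = (LINT x|torus. (partial_sum (hc f) N x - f x)^2)" for N
  proof (intro integral_cong_AE)
    show "AE x in torus. (partial_sum (hc f) N x - g x)^2 = (partial_sum (hc f) N x - f x)^2"
      by (rule eventually_mono[OF \<open>AE x in torus. g x = f x\<close>]) simp
  qed (intro borel_measurable_power borel_measurable_diff sq_intD(1)[OF f] sq_intD(1)[OF g(1)] sq_intD(1)[OF trig_sq_int[OF partial_sum_trig]])+
  show ?thesis using g(3) unfolding eq .
qed

theorem Parseval_square:
  assumes f: "sq_int torus f"
  shows "((\<lambda>k. (hc f k)^2) has_sum (LINT x|torus. (f x)^2)) UNIV"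
proof -
  have inj: "inj lattice_enum" using lattice_enum_bij by (rule bij_is_inj)
  have "(LINT x|torus. (partial_sum (hc f) N x - f x)^2) = (LINT x|torus. (f x)^2) - (\<Sum>n<N. (hc f (lattice_enum n))^2)" for N
  proof -
    have "(LINT x|torus. (partial_sum (hc f) N x - f x)^2) = (LINT x|torus. (f x - (\<Sum>k\<in>lattice_enum ` {..<N}. hc f k * hartley k x))^2)"
      by (simp add: partial_sum_def power2_commute)
    also have "... = (LINT x|torus. (f x)^2) - (\<Sum>k\<in>lattice_enum ` {..<N}. (hc f k)^2)" by (rule integral_diff_hartley_sum[OF f]) simp
    finally show ?thesis by (subst (asm) sum.reindex) (auto intro: inj_on_subset[OF inj])
  qed
  then have "(\<lambda>N. (LINT x|torus. (f x)^2) - (\<Sum>n<N. (hc f (lattice_enum n))^2)) \<longlonglongrightarrow> 0" using partial_sum_tendsto[OF f] by simp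
  then have "(\<lambda>N. (LINT x|torus. (f x)^2) - ((LINT x|torus. (f x)^2) - (\<Sum>n<N. (hc f (lattice_enum n))^2))) \<longlonglongrightarrow> (LINT x|torus. (f x)^2) - 0"
    by (intro tendsto_diff tendsto_const)
  then have "(\<lambda>n. (hc f (lattice_enum n))^2) sums (LINT x|torus. (f x)^2)" by (simp add: sums_def)
  then show ?thesis by (subst has_sum_lattice_iff) auto
qed

lemma has_sum_diff_real:
  fixes f g :: "'a \<Rightarrow> real"
  assumes "(f has_sum a) A" "(g has_sum b) A"
  shows "((\<lambda>x. f x - g x) has_sum (a - b)) A"
  using has_sum_add[OF assms(1), of "\<lambda>x. - g x" "- b"] assms(2) by (simp add: has_sum_uminus)

theorem Parseval:
  assumes f: "sq_int torus f" and g: "sq_int torus g"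
  shows "((\<lambda>k. hc f k * hc g k) has_sum (LINT x|torus. f x * g x)) UNIV"
proof -
  have "((\<lambda>k. 1 / 4 * ((hc (\<lambda>x. f x + g x) k)^2 - (hc (\<lambda>x. f x - g x) k)^2)) has_sum
      1 / 4 * ((LINT x|torus. (f x + g x)^2) - (LINT x|torus. (f x - g x)^2))) UNIV"
    by (intro has_sum_cmult_right has_sum_diff_real Parseval_square sq_int_add sq_int_diff f g)
  moreover have "1 / 4 * ((hc (\<lambda>x. f x + g x) k)^2 - (hc (\<lambda>x. f x - g x) k)^2) = hc f k * hc g k" for k
    using f g by (simp add: hc_add hc_diff power2_eq_square algebra_simps)
  moreover have "1 / 4 * ((LINT x|torus. (f x + g x)^2) - (LINT x|torus. (f x - g x)^2)) = (LINT x|torus. f x * g x)"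
  proof -
    have "(LINT x|torus. (f x + g x)^2) - (LINT x|torus. (f x - g x)^2) = (LINT x|torus. (f x + g x)^2 - (f x - g x)^2)"
      using sq_intD(2)[OF sq_int_add[OF f g]] sq_intD(2)[OF sq_int_diff[OF f g]] by simp
    also have "... = (LINT x|torus. 4 * (f x * g x))"
      by (intro Bochner_Integration.integral_cong) (auto simp: power2_eq_square algebra_simps)
    finally show ?thesis by simp
  qed
  ultimately show ?thesis by simp
qed

section \<open>Products of functions of Sobolev order 3/4\<close>

text \<open>The maximum norm plus 1, so that sizes start at 1 and their powers can be divided
  by.\<close>

definition ksize :: "int^3 \<Rightarrow> nat" where
  "ksize k = Suc (Max (range (\<lambda>i. nat \<bar>k $ i\<bar>)))"

lemma ksize_pos: "0 < ksize k" by (simp add: ksize_def)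

lemma card_lattice_box:
  assumes "\<And>i. finite (A i)"
  shows "finite {k :: int^3. \<forall>i. k $ i \<in> A i}" "card {k :: int^3. \<forall>i. k $ i \<in> A i} \<le> (\<Prod>i\<in>UNIV. card (A i))"
proof -
  have e: "{k :: int^3. \<forall>i. k $ i \<in> A i} = vec_lambda ` (PiE UNIV A)"
  proof (intro set_eqI iffI)
    fix k :: "int^3" assume "k \<in> {k. \<forall>i. k $ i \<in> A i}"
    then have "($) k \<in> PiE UNIV A" by auto
    then show "k \<in> vec_lambda ` (PiE UNIV A)" by (intro image_eqI[where x = "($) k"]) auto
  qed auto
  have fin: "finite (PiE UNIV A)" using assms by (intro finite_PiE) auto
  show "finite {k :: int^3. \<forall>i. k $ i \<in> A i}" unfolding e using fin by simp
  have "card {k :: int^3. \<forall>i. k $ i \<in> A i} \<le> card (PiE UNIV A)" unfolding e by (rule card_image_le[OF fin])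
  also have "... = (\<Prod>i\<in>UNIV. card (A i))" by (rule card_PiE) simp
  finally show "card {k :: int^3. \<forall>i. k $ i \<in> A i} \<le> (\<Prod>i\<in>UNIV. card (A i))" .
qed

text \<open>One of three coordinates equals \<open>j - 1\<close> up to sign, and the other two lie
  in an interval of \<open>2 * j - 1\<close> integers:
  \<open>3 * 2 * (2 * j)^2 = 24 * j^2\<close>.\<close>

lemma shell:
  assumes "0 < j"
  shows "finite {k. ksize k = j}" "card {k. ksize k = j} \<le> 24 * j^2"
proof -
  define n where "n = int j - 1"
  have n: "0 \<le> n" using assms by (simp add: n_def)
  define B where "B i s = {k :: int^3. \<forall>i'. k $ i' \<in> (if i' = i then {s} else {- n..n})}" for i :: 3 and s :: int
  have fB: "finite (B i s)" for i s unfolding B_def by (rule card_lattice_box) auto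
  have cB: "card (B i s) \<le> 4 * j^2" for i s
  proof -
    have "card (B i s) \<le> (\<Prod>i'\<in>UNIV. card (if i' = i then {s} else {- n..n}))" unfolding B_def by (rule card_lattice_box) auto
    also have "... = (2 * j - 1)^2"
    proof -
      have c: "nat (2 * n + 1) = 2 * j - Suc 0" using assms by (auto simp: n_def)
      have "(\<Prod>i'\<in>UNIV. card (if i' = i then {s} else {- n..n})) = card {s} * (\<Prod>i'\<in>UNIV - {i}. card (if i' = i then {s} else {- n..n}))"
        by (subst prod.remove[of _ i]) auto
      also have "(\<Prod>i'\<in>UNIV - {i}. card (if i' = i then {s} else {- n..n})) = (\<Prod>i'\<in>UNIV - {i}. 2 * j - 1)"
        by (intro prod.cong) (auto simp: c)
      finally show ?thesis by (simp add: card_Diff_singleton)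
    qed
    also have "... \<le> (2 * j)^2" by (intro power_mono) auto
    finally show ?thesis by (simp add: power_mult_distrib)
  qed
  have sub: "{k. ksize k = j} \<subseteq> (\<Union>i\<in>UNIV. B i n \<union> B i (- n))"
  proof
    fix k assume "k \<in> {k. ksize k = j}"
    then have mx: "Max (range (\<lambda>i. nat \<bar>k $ i\<bar>)) = nat n" using assms by (auto simp: ksize_def n_def)
    have "Max (range (\<lambda>i. nat \<bar>k $ i\<bar>)) \<in> range (\<lambda>i. nat \<bar>k $ i\<bar>)" by (rule Max_in) auto
    then obtain i where i: "nat \<bar>k $ i\<bar> = nat n" using mx by auto
    have "nat \<bar>k $ i'\<bar> \<le> nat n" for i' using mx by (metis Max_ge finite finite_imageI rangeI)
    then have a: "\<bar>k $ i'\<bar> \<le> n" for i' using n by (simp add: nat_le_eq_zle)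
    have "k $ i = n \<or> k $ i = - n" using i n by linarith
    then have "k \<in> B i n \<union> B i (- n)" using a unfolding B_def by (auto simp: abs_le_iff minus_le_iff)
    then show "k \<in> (\<Union>i\<in>UNIV. B i n \<union> B i (- n))" by blast
  qed
  show "finite {k. ksize k = j}" using sub fB by (meson finite finite_UN finite_UnI finite_subset)
  have "card {k. ksize k = j} \<le> card (\<Union>i\<in>UNIV. B i n \<union> B i (- n))" using fB by (intro card_mono[OF _ sub]) auto
  also have "... \<le> (\<Sum>i\<in>UNIV. card (B i n \<union> B i (- n)))" by (rule card_UN_le) simp
  also have "... \<le> (\<Sum>i\<in>(UNIV :: 3 set). 8 * j^2)"
  proof (rule sum_mono)
    fix i :: 3
    show "card (B i n \<union> B i (- n)) \<le> 8 * j^2" using card_Un_le[of "B i n" "B i (- n)"] cB[of i n] cB[of i "- n"] by simp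
  qed
  also have "... = 24 * j^2" by simp
  finally show "card {k. ksize k = j} \<le> 24 * j^2" .
qed

text \<open>The sum of \<open>1 / kw\<close> over the frequencies of size at most \<open>n\<close> is of order \<open>n powr (3 / 2)\<close>, the value of \<open>kw\<close>
  at the edge. Schur's test then bounds products.\<close>

definition kw :: "int^3 \<Rightarrow> real" where
  "kw k = real (ksize k) powr (3 / 2)"

lemma kw_ge_1: "1 \<le> kw k"
  unfolding kw_def using ksize_pos[of k] by (intro ge_one_powr_ge_zero) auto

lemma kw_pos: "0 < kw k" and kw_nonneg [simp]: "0 \<le> kw k"
  using kw_ge_1[of k] by auto

text \<open>The shell of size \<open>j\<close> contributes at most
  \<open>24 * j^2 / j powr (3 / 2) = 24 * sqrt j\<close>. There are \<open>ksize k\<close> shells,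
  each bounded by the value of the outermost.\<close>

lemma lattice_sum_le:
  assumes "finite S"
  shows "(\<Sum>l\<in>{l\<in>S. ksize l \<le> ksize k}. 1 / kw l) \<le> 24 * kw k"
proof -
  let ?R = "ksize k"
  have "(\<Sum>l\<in>{l\<in>S. ksize l \<le> ?R}. 1 / kw l) = (\<Sum>j\<in>{1..?R}. \<Sum>l\<in>{l \<in> {l\<in>S. ksize l \<le> ?R}. ksize l = j}. 1 / kw l)"
    by (rule sum.group[symmetric]) (use assms ksize_pos in \<open>auto simp: Suc_le_eq\<close>)
  also have "... \<le> (\<Sum>j\<in>{1..?R}. 24 * sqrt (real ?R))"
  proof (rule sum_mono)
    fix j assume j: "j \<in> {1..?R}"
    then have j0: "0 < j" by simp
    have "(\<Sum>l\<in>{l \<in> {l\<in>S. ksize l \<le> ?R}. ksize l = j}. 1 / kw l) \<le> (\<Sum>l\<in>{l. ksize l = j}. 1 / kw l)"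
      by (intro sum_mono2 shell(1)[OF j0]) auto
    also have "... = (\<Sum>l\<in>{l. ksize l = j}. 1 / real j powr (3 / 2))" by (intro sum.cong) (auto simp: kw_def)
    also have "... = real (card {l. ksize l = j}) * (1 / real j powr (3 / 2))" by simp
    also have "... \<le> real (24 * j^2) * (1 / real j powr (3 / 2))" by (intro mult_right_mono of_nat_mono shell(2)[OF j0]) auto
    also have "... = 24 * (real j powr 2 / real j powr (3 / 2))" using j0 by simp
    also have "real j powr 2 / real j powr (3 / 2) = sqrt (real j)" by (simp only: powr_diff[symmetric]) (simp add: powr_half_sqrt)
    also have "24 * sqrt (real j) \<le> 24 * sqrt (real ?R)" using j by simp
    finally show "(\<Sum>l\<in>{l \<in> {l\<in>S. ksize l \<le> ?R}. ksize l = j}. 1 / kw l) \<le> 24 * sqrt (real ?R)" .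
  qed
  also have "... = 24 * (real ?R powr 1 * real ?R powr (1 / 2))" using ksize_pos[of k] by (simp add: powr_half_sqrt)
  also have "real ?R powr 1 * real ?R powr (1 / 2) = kw k" unfolding kw_def by (simp only: powr_add[symmetric]) simp
  finally show ?thesis .
qed

text \<open>Cauchy-Schwarz over the pairs with weight \<open>kw l\<close>. In the region
  \<open>ksize l \<le> ksize k\<close> the sum of \<open>1 / kw l\<close> is at most
  \<open>24 * kw k\<close>; since \<open>p\<close> is injective in \<open>k\<close>, each
  coefficient of \<open>c\<close> occurs at most once for fixed \<open>l\<close> and their squares
  sum to at most \<open>P\<close>.\<close>

lemma convolution_region_bound:
  fixes a b c :: "int^3 \<Rightarrow> real"
  assumes S: "finite S" and P: "\<And>F. finite F \<Longrightarrow> (\<Sum>m\<in>F. (c m)^2) \<le> P" and inj: "\<And>l. inj (\<lambda>k. p k l)"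
  shows "(\<Sum>k\<in>S. \<Sum>l\<in>{l\<in>S. ksize l \<le> ksize k}. \<bar>a k\<bar> * \<bar>b l\<bar> * \<bar>c (p k l)\<bar>)
    \<le> sqrt (24 * (\<Sum>k\<in>S. kw k * (a k)^2) * (\<Sum>k\<in>S. kw k * (b k)^2) * P)"
proof -
  let ?T = "Sigma S (\<lambda>k. {l\<in>S. ksize l \<le> ksize k})"
  let ?x = "\<lambda>(k, l). \<bar>a k\<bar> / sqrt (kw l)" and ?y = "\<lambda>(k, l). sqrt (kw l) * (\<bar>b l\<bar> * \<bar>c (p k l)\<bar>)"
  have P0: "0 \<le> P" using P[of "{}"] by simp
  have "(\<Sum>k\<in>S. \<Sum>l\<in>{l\<in>S. ksize l \<le> ksize k}. \<bar>a k\<bar> * \<bar>b l\<bar> * \<bar>c (p k l)\<bar>) = (\<Sum>z\<in>?T. ?x z * ?y z)"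
    using S by (subst sum.Sigma) (auto intro!: sum.cong simp: kw_pos less_imp_neq[OF kw_pos, symmetric])
  also have "... \<le> sqrt ((\<Sum>z\<in>?T. ?x z * ?y z)^2)" by simp
  also have "... \<le> sqrt ((\<Sum>z\<in>?T. (?x z)^2) * (\<Sum>z\<in>?T. (?y z)^2))" by (intro real_sqrt_le_mono Cauchy_Schwarz_ineq_sum)
  also have "... \<le> sqrt ((24 * (\<Sum>k\<in>S. kw k * (a k)^2)) * ((\<Sum>k\<in>S. kw k * (b k)^2) * P))"
  proof (intro real_sqrt_le_mono mult_mono)
    have "(\<Sum>z\<in>?T. (?x z)^2) = (\<Sum>(k, l)\<in>?T. (a k)^2 * (1 / kw l))" by (intro sum.cong) (auto simp: power_divide)
    also have "... = (\<Sum>k\<in>S. \<Sum>l\<in>{l\<in>S. ksize l \<le> ksize k}. (a k)^2 * (1 / kw l))" by (rule sum.Sigma[symmetric]) (use S in auto)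
    also have "... = (\<Sum>k\<in>S. (a k)^2 * (\<Sum>l\<in>{l\<in>S. ksize l \<le> ksize k}. 1 / kw l))" by (simp only: sum_distrib_left)
    also have "... \<le> (\<Sum>k\<in>S. (a k)^2 * (24 * kw k))" by (intro sum_mono mult_left_mono lattice_sum_le S) auto
    finally show "(\<Sum>z\<in>?T. (?x z)^2) \<le> 24 * (\<Sum>k\<in>S. kw k * (a k)^2)" by (simp add: sum_distrib_left mult_ac)
    have "(\<Sum>z\<in>?T. (?y z)^2) \<le> (\<Sum>z\<in>S \<times> S. (?y z)^2)" using S by (intro sum_mono2) auto
    also have "... = (\<Sum>(k, l)\<in>S \<times> S. kw l * (b l)^2 * (c (p k l))^2)" by (intro sum.cong) (auto simp: power_mult_distrib)
    also have "... = (\<Sum>k\<in>S. \<Sum>l\<in>S. kw l * (b l)^2 * (c (p k l))^2)" by (rule sum.cartesian_product[symmetric])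
    also have "... = (\<Sum>l\<in>S. \<Sum>k\<in>S. kw l * (b l)^2 * (c (p k l))^2)" by (rule sum.swap)
    also have "... = (\<Sum>l\<in>S. kw l * (b l)^2 * (\<Sum>k\<in>S. (c (p k l))^2))" by (simp add: sum_distrib_left)
    also have "... \<le> (\<Sum>l\<in>S. kw l * (b l)^2 * P)"
    proof (intro sum_mono mult_left_mono)
      fix l
      have "(\<Sum>k\<in>S. (c (p k l))^2) = (\<Sum>m\<in>(\<lambda>k. p k l) ` S. (c m)^2)" by (subst sum.reindex) (auto intro: inj_on_subset[OF inj])
      also have "... \<le> P" using S by (intro P) auto
      finally show "(\<Sum>k\<in>S. (c (p k l))^2) \<le> P" .
    qed auto
    finally show "(\<Sum>z\<in>?T. (?y z)^2) \<le> (\<Sum>k\<in>S. kw k * (b k)^2) * P" by (simp add: sum_distrib_right)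
  qed (auto intro!: sum_nonneg mult_nonneg_nonneg)
  finally show ?thesis by (simp add: mult_ac)
qed

text \<open>Every pair lies in one of two regions, according to which frequency is larger; the
  second region is the first with the roles of \<open>a\<close> and \<open>b\<close>
  exchanged.\<close>

lemma convolution_bound:
  fixes a b c :: "int^3 \<Rightarrow> real"
  assumes S: "finite S" and P: "\<And>F. finite F \<Longrightarrow> (\<Sum>m\<in>F. (c m)^2) \<le> P"
    and inj: "\<And>l. inj (\<lambda>k. p k l)" "\<And>k. inj (\<lambda>l. p k l)"
  shows "(\<Sum>k\<in>S. \<Sum>l\<in>S. \<bar>a k\<bar> * \<bar>b l\<bar> * \<bar>c (p k l)\<bar>)
    \<le> 2 * sqrt (24 * (\<Sum>k\<in>S. kw k * (a k)^2) * (\<Sum>k\<in>S. kw k * (b k)^2) * P)"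
proof -
  let ?t = "\<lambda>k l. \<bar>a k\<bar> * \<bar>b l\<bar> * \<bar>c (p k l)\<bar>"
  have "(\<Sum>k\<in>S. \<Sum>l\<in>S. ?t k l) \<le> (\<Sum>k\<in>S. \<Sum>l\<in>S. (if ksize l \<le> ksize k then ?t k l else 0) + (if ksize k \<le> ksize l then ?t k l else 0))"
    by (intro sum_mono) auto
  also have "... = (\<Sum>k\<in>S. \<Sum>l\<in>S. if ksize l \<le> ksize k then ?t k l else 0) + (\<Sum>k\<in>S. \<Sum>l\<in>S. if ksize k \<le> ksize l then ?t k l else 0)"
    by (simp add: sum.distrib)
  also have "(\<Sum>k\<in>S. \<Sum>l\<in>S. if ksize k \<le> ksize l then ?t k l else 0) = (\<Sum>l\<in>S. \<Sum>k\<in>S. if ksize k \<le> ksize l then ?t k l else 0)"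
    by (rule sum.swap)
  also have "(\<Sum>k\<in>S. \<Sum>l\<in>S. if ksize l \<le> ksize k then ?t k l else 0) = (\<Sum>k\<in>S. \<Sum>l\<in>{l\<in>S. ksize l \<le> ksize k}. ?t k l)"
    using S by (simp add: sum.inter_filter)
  also have "(\<Sum>l\<in>S. \<Sum>k\<in>S. if ksize k \<le> ksize l then ?t k l else 0) = (\<Sum>l\<in>S. \<Sum>k\<in>{k\<in>S. ksize k \<le> ksize l}. ?t k l)"
    using S by (simp add: sum.inter_filter)
  also have "(\<Sum>k\<in>S. \<Sum>l\<in>{l\<in>S. ksize l \<le> ksize k}. ?t k l) + ... \<le>
      sqrt (24 * (\<Sum>k\<in>S. kw k * (a k)^2) * (\<Sum>k\<in>S. kw k * (b k)^2) * P) + sqrt (24 * (\<Sum>k\<in>S. kw k * (b k)^2) * (\<Sum>k\<in>S. kw k * (a k)^2) * P)"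
  proof (rule add_mono)
    show "(\<Sum>l\<in>S. \<Sum>k\<in>{k\<in>S. ksize k \<le> ksize l}. ?t k l) \<le> sqrt (24 * (\<Sum>k\<in>S. kw k * (b k)^2) * (\<Sum>k\<in>S. kw k * (a k)^2) * P)"
      using convolution_region_bound[where c = c and p = "\<lambda>l k. p k l" and a = b and b = a, OF S P inj(2)] by (simp add: mult.commute)
  qed (rule convolution_region_bound[OF S P inj(1)])
  finally show ?thesis by (simp add: mult_ac)
qed

text \<open>Of the two factors \<open>q\<close> in \<open>q^2\<close> only one is expanded by the
  product formula, so that the coefficients of \<open>q\<close> itself appear. This gives
  \<open>P \<le> 4 * D\<close>, where \<open>D\<close> contains \<open>sqrt P\<close>; solving for
  \<open>P\<close> produces \<open>16 * 24 = 384\<close>.\<close>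

lemma product_finite:
  fixes a b :: "int^3 \<Rightarrow> real"
  assumes S: "finite S"
  defines "f \<equiv> (\<lambda>x. \<Sum>k\<in>S. a k * hartley k x)" and "g \<equiv> (\<lambda>x. \<Sum>k\<in>S. b k * hartley k x)"
  shows "(LINT x|torus. (f x * g x)^2) \<le> 384 * (\<Sum>k\<in>S. kw k * (a k)^2) * (\<Sum>k\<in>S. kw k * (b k)^2)"
proof -
  define q where "q x = f x * g x" for x
  have qt: "q \<in> trig_poly" unfolding q_def f_def g_def by (intro trig_mult trig_sum trig_scale trig_hartley)
  have qs: "sq_int torus q" by (rule trig_sq_int[OF qt])
  define P where "P = (LINT x|torus. (q x)^2)"
  define D where "D = sqrt (24 * (\<Sum>k\<in>S. kw k * (a k)^2) * (\<Sum>k\<in>S. kw k * (b k)^2) * P)"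
  have qi: "integrable torus (\<lambda>x. q x * hartley k x)" for k by (rule sq_int_mult_integrable[OF qs hartley_sq_int])
  let ?t = "\<lambda>p k l. \<bar>a k\<bar> * \<bar>b l\<bar> * \<bar>hc q (p k l)\<bar>"
  have bound: "(\<Sum>k\<in>S. \<Sum>l\<in>S. ?t p k l) \<le> 2 * D" if "\<And>l. inj (\<lambda>k. p k l)" "\<And>k. inj (\<lambda>l. p k l)" for p
    unfolding D_def by (rule convolution_bound[OF S _ that]) (simp add: P_def Bessel[OF qs])
  have "(q x)^2 = (\<Sum>k\<in>S. \<Sum>l\<in>S. a k * b l / 2 * (q x * hartley (k - l) x + q x * hartley (l - k) x + q x * hartley (k + l) x - q x * hartley (- k - l) x))" for x
  proof -
    have "(q x)^2 = (\<Sum>k\<in>S. \<Sum>l\<in>S. (a k * hartley k x) * (b l * hartley l x)) * q x"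
      by (simp add: power2_eq_square q_def f_def g_def sum_product)
    also have "... = (\<Sum>k\<in>S. \<Sum>l\<in>S. a k * b l * (hartley k x * hartley l x) * q x)"
      by (simp add: sum_distrib_right sum_distrib_left mult_ac)
    finally have *: "(q x)^2 = (\<Sum>k\<in>S. \<Sum>l\<in>S. a k * b l * (hartley k x * hartley l x) * q x)" .
    show ?thesis unfolding * by (intro sum.cong refl) (simp add: hartley_mult algebra_simps add_divide_distrib diff_divide_distrib)
  qed
  then have "P = (\<Sum>k\<in>S. \<Sum>l\<in>S. a k * b l / 2 * (hc q (k - l) + hc q (l - k) + hc q (k + l) - hc q (- k - l)))"
    unfolding P_def hc_def using qi by simp
  also have "... \<le> (\<Sum>k\<in>S. \<Sum>l\<in>S. 1 / 2 * (?t (\<lambda>k l. k - l) k l + ?t (\<lambda>k l. l - k) k l + ?t (\<lambda>k l. k + l) k l + ?t (\<lambda>k l. - k - l) k l))"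
  proof (intro sum_mono)
    fix k l
    have "a k * b l / 2 * (hc q (k - l) + hc q (l - k) + hc q (k + l) - hc q (- k - l))
        \<le> \<bar>a k * b l / 2\<bar> * \<bar>hc q (k - l) + hc q (l - k) + hc q (k + l) - hc q (- k - l)\<bar>"
      unfolding abs_mult[symmetric] by (rule abs_ge_self)
    also have "... \<le> \<bar>a k * b l / 2\<bar> * (\<bar>hc q (k - l)\<bar> + \<bar>hc q (l - k)\<bar> + \<bar>hc q (k + l)\<bar> + \<bar>hc q (- k - l)\<bar>)"
      by (intro mult_left_mono) auto
    finally show "a k * b l / 2 * (hc q (k - l) + hc q (l - k) + hc q (k + l) - hc q (- k - l))
        \<le> 1 / 2 * (?t (\<lambda>k l. k - l) k l + ?t (\<lambda>k l. l - k) k l + ?t (\<lambda>k l. k + l) k l + ?t (\<lambda>k l. - k - l) k l)"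
      by (simp add: abs_mult algebra_simps)
  qed
  also have "... = 1 / 2 * ((\<Sum>k\<in>S. \<Sum>l\<in>S. ?t (\<lambda>k l. k - l) k l) + (\<Sum>k\<in>S. \<Sum>l\<in>S. ?t (\<lambda>k l. l - k) k l) +
      (\<Sum>k\<in>S. \<Sum>l\<in>S. ?t (\<lambda>k l. k + l) k l) + (\<Sum>k\<in>S. \<Sum>l\<in>S. ?t (\<lambda>k l. - k - l) k l))"
    by (simp only: sum_distrib_left[symmetric] sum.distrib)
  also have "... \<le> 1 / 2 * (2 * D + 2 * D + 2 * D + 2 * D)" by (intro mult_left_mono add_mono bound) (auto simp: inj_on_def)
  finally have PD: "P \<le> 4 * D" by simp
  let ?A = "\<Sum>k\<in>S. kw k * (a k)^2" and ?B = "\<Sum>k\<in>S. kw k * (b k)^2"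
  have P0: "0 \<le> P" and A0: "0 \<le> ?A" and B0: "0 \<le> ?B" by (auto simp: P_def intro!: sum_nonneg)
  have "P^2 \<le> (4 * D)^2" by (rule power_mono[OF PD P0])
  also have "... = 384 * ?A * ?B * P" unfolding D_def using P0 A0 B0 by (simp add: power_mult_distrib)
  finally have "P * P \<le> (384 * ?A * ?B) * P" by (simp add: power2_eq_square)
  then have "P \<le> 384 * ?A * ?B" using P0 A0 B0 by (cases "P = 0") auto
  then show ?thesis by (simp add: P_def q_def)
qed

definition kw_norm2 :: "(real^3 \<Rightarrow> real) \<Rightarrow> real" where
  "kw_norm2 f = (\<Sum>\<^sub>\<infinity>k\<in>UNIV. kw k * (hc f k)^2)"

definition kw_summable :: "(real^3 \<Rightarrow> real) \<Rightarrow> bool" where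
  "kw_summable f \<longleftrightarrow> sq_int torus f \<and> (\<lambda>k. kw k * (hc f k)^2) summable_on UNIV"

lemma kw_norm2_nonneg: "0 \<le> kw_norm2 f"
  unfolding kw_norm2_def by (intro infsum_nonneg) auto

text \<open>The partial sums of both factors converge almost everywhere along a common subsequence,
  and Fatou's lemma transfers the bound of \<open>product_finite\<close>.\<close>

theorem product_estimate:
  assumes f: "kw_summable f" and g: "kw_summable g"
  shows "sq_int torus (\<lambda>x. f x * g x)" "(LINT x|torus. (f x * g x)^2) \<le> 384 * kw_norm2 f * kw_norm2 g"
proof -
  have fs: "sq_int torus f" and gs: "sq_int torus g" using f g by (auto simp: kw_summable_def)
  let ?f = "partial_sum (hc f)" and ?g = "partial_sum (hc g)"
  have tf: "sq_int torus (?f n)" and tg: "sq_int torus (?g n)" for n by (auto intro: trig_sq_int partial_sum_trig)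
  obtain r where r: "strict_mono r" "AE x in torus. (\<lambda>n. ?f (r n) x) \<longlonglongrightarrow> f x"
    by (rule L2_tendsto_AE_subseq[OF tf fs partial_sum_tendsto[OF fs]])
  have "(\<lambda>n. LINT x|torus. (?g (r n) x - g x)^2) \<longlonglongrightarrow> 0"
    using LIMSEQ_subseq_LIMSEQ[OF partial_sum_tendsto[OF gs] r(1)] by (simp add: o_def)
  then obtain r' where r': "strict_mono r'" "AE x in torus. (\<lambda>n. ?g (r (r' n)) x) \<longlonglongrightarrow> g x"
    by (rule L2_tendsto_AE_subseq[where f = "\<lambda>n. ?g (r n)", OF tg gs])
  define p where "p n x = ?f (r (r' n)) x * ?g (r (r' n)) x" for n x
  have pt: "sq_int torus (p n)" for n unfolding p_def by (intro trig_sq_int trig_mult partial_sum_trig)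
  have pm: "(\<lambda>x. f x * g x) \<in> borel_measurable torus" using sq_intD(1)[OF fs] sq_intD(1)[OF gs] by simp
  have lim: "AE x in torus. (\<lambda>n. p n x) \<longlonglongrightarrow> f x * g x" using r(2) r'(2)
  proof eventually_elim
    case (elim x)
    have "(\<lambda>n. ?f (r (r' n)) x) \<longlonglongrightarrow> f x" using LIMSEQ_subseq_LIMSEQ[OF elim(1) r'(1)] by (simp add: o_def)
    then show ?case unfolding p_def by (intro tendsto_mult elim(2))
  qed
  have fin: "(\<Sum>k\<in>lattice_enum ` {..<N}. kw k * (hc h k)^2) \<le> kw_norm2 h" if "kw_summable h" for N h
    unfolding kw_norm2_def using that by (intro finite_sum_le_infsum) (auto simp: kw_summable_def)
  have bd: "(LINT x|torus. (p n x)^2) \<le> 384 * kw_norm2 f * kw_norm2 g" for n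
  proof -
    let ?S = "lattice_enum ` {..<r (r' n)}"
    have "(LINT x|torus. (p n x)^2) \<le> 384 * (\<Sum>k\<in>?S. kw k * (hc f k)^2) * (\<Sum>k\<in>?S. kw k * (hc g k)^2)"
      unfolding p_def partial_sum_def by (rule product_finite) simp
    also have "... \<le> 384 * kw_norm2 f * kw_norm2 g"
      by (intro mult_mono fin f g mult_left_mono mult_nonneg_nonneg kw_norm2_nonneg sum_nonneg) auto
    finally show ?thesis .
  qed
  have "0 \<le> 384 * kw_norm2 f * kw_norm2 g" by (simp add: kw_norm2_nonneg)
  note L2_Fatou[OF pt pm lim always_eventually[OF allI[OF bd]] this]
  then show "sq_int torus (\<lambda>x. f x * g x)" "(LINT x|torus. (f x * g x)^2) \<le> 384 * kw_norm2 f * kw_norm2 g" by blast+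
qed

section \<open>Sobolev spaces of divergence-free fields\<close>

definition FC :: "field \<Rightarrow> int^3 \<Rightarrow> real^3" where
  "FC u k = (\<chi> j. hc (coord u j) k)"

lemma L2_scalar_iff: "f \<in> L2 \<longleftrightarrow> periodic f \<and> sq_int torus f" for f :: "real^3 \<Rightarrow> real"
  by (simp add: L2_def sq_int_def)

lemma norm_vec3_square: "(norm (v :: real^3))^2 = (\<Sum>j\<in>UNIV. (v $ j)^2)"
  by (simp add: norm_vec_def L2_set_def sum_nonneg)

lemma L2_component:
  assumes "u \<in> L2"
  shows "sq_int torus (coord u j)" "periodic (coord u j)"
proof -
  have u: "periodic u" "u \<in> borel_measurable torus" "integrable torus (\<lambda>x. (norm (u x))^2)" using assms by (auto simp: L2_def)
  have m: "(coord u j) \<in> borel_measurable torus"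
    using borel_measurable_inner[OF u(2) borel_measurable_const[of "axis j 1"]] by (simp add: inner_axis)
  moreover have "integrable torus (\<lambda>x. (u x $ j)^2)"
  proof (rule Bochner_Integration.integrable_bound[OF u(3)])
    show "AE x in torus. norm ((u x $ j)^2) \<le> norm ((norm (u x))^2)"
      by (intro AE_I2) (simp add: abs_le_square_iff[symmetric] component_le_norm_cart)
  qed (use m in auto)
  ultimately show "sq_int torus (coord u j)" by (simp add: sq_int_def)
  show "periodic (coord u j)" using u(1) by (simp add: periodic_def)
qed

lemma L2_fieldI:
  assumes "\<And>j. sq_int torus (coord u j)" "\<And>j. periodic (coord u j)"
  shows "(u :: field) \<in> L2"
proof -
  have "u \<in> borel_measurable torus"
  proof -
    have "(\<lambda>x. \<Sum>j\<in>UNIV. (u x $ j) *\<^sub>R (axis j 1 :: real^3)) \<in> borel_measurable torus"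
      using sq_intD(1)[OF assms(1)] by (intro borel_measurable_sum borel_measurable_scaleR) auto
    moreover have "(\<Sum>j\<in>UNIV. (u x $ j) *\<^sub>R (axis j 1 :: real^3)) = u x" for x
      by (simp add: vec_eq_iff axis_def if_distrib cong: if_cong)
    ultimately show ?thesis by simp
  qed
  moreover have "integrable torus (\<lambda>x. (norm (u x))^2)" unfolding norm_vec3_square using sq_intD(2)[OF assms(1)] by simp
  moreover have "periodic u" using assms(2) by (auto simp: periodic_def vec_eq_iff)
  ultimately show ?thesis by (simp add: L2_def)
qed

lemma L2_inner_eq:
  assumes "u \<in> L2" "v \<in> L2"
  shows "L2_inner u v = (\<Sum>j\<in>UNIV. LINT x|torus. u x $ j * v x $ j)"
  unfolding L2_inner_def inner_vec_def
  using sq_int_mult_integrable[OF L2_component(1)[OF assms(1)] L2_component(1)[OF assms(2)]] by simp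

lemma L2_field_add: "u \<in> L2 \<Longrightarrow> v \<in> L2 \<Longrightarrow> (\<lambda>x. u x + v x) \<in> L2" for u v :: field
  by (intro L2_fieldI) (auto intro!: sq_int_add L2_component periodic_combine[where h = "(+)"])

lemma L2_field_scale: "u \<in> L2 \<Longrightarrow> (\<lambda>x. c *\<^sub>R u x) \<in> L2" for u :: field
  by (intro L2_fieldI) (auto intro!: sq_int_scale L2_component periodic_compose[where h = "\<lambda>y. c * y"])

lemma L2_field_diff: "u \<in> L2 \<Longrightarrow> v \<in> L2 \<Longrightarrow> u - v \<in> L2" for u v :: field
  by (intro L2_fieldI) (auto intro!: sq_int_diff L2_component periodic_combine[where h = "(-)"])

lemma L2_field_zero: "(\<lambda>x. 0) \<in> (L2 :: field set)" by (intro L2_fieldI) (auto simp: periodic_def sq_int_zero)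

lemma L2_field_sum: "(\<And>i. i \<in> I \<Longrightarrow> u i \<in> L2) \<Longrightarrow> (\<lambda>x. \<Sum>i\<in>I. u i x) \<in> L2" for u :: "'i \<Rightarrow> field"
  by (induction I rule: infinite_finite_induct) (auto intro: L2_field_add L2_field_zero)

lemma FC_add: "u \<in> L2 \<Longrightarrow> v \<in> L2 \<Longrightarrow> FC (\<lambda>x. u x + v x) k = FC u k + FC v k"
  by (simp add: FC_def vec_eq_iff hc_add L2_component)

lemma FC_diff: "u \<in> L2 \<Longrightarrow> v \<in> L2 \<Longrightarrow> FC (u - v) k = FC u k - FC v k"
  by (simp add: FC_def vec_eq_iff hc_diff L2_component)

lemma FC_scale: "FC (\<lambda>x. c *\<^sub>R u x) k = c *\<^sub>R FC u k" by (simp add: FC_def vec_eq_iff hc_scale)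

lemma FC_eq_AE:
  assumes "u \<in> L2" "v \<in> L2" "\<And>k. FC u k = FC v k"
  shows "AE x in torus. u x = v x"
proof -
  have "AE x in torus. u x $ j = v x $ j" for j using assms by (intro hartley_complete_eq L2_component) (auto simp: FC_def vec_eq_iff)
  then have "AE x in torus. \<forall>j\<in>UNIV. u x $ j = v x $ j" by (subst AE_finite_all) auto
  then show ?thesis by eventually_elim (auto simp: vec_eq_iff)
qed

lemma FC_cong_AE:
  assumes "AE x in torus. u x = v x" "u \<in> L2" "v \<in> L2"
  shows "FC u k = FC v k"
  unfolding FC_def vec_eq_iff vec_lambda_beta
  using L2_component(1)[OF assms(2), THEN sq_intD(1)] L2_component(1)[OF assms(3), THEN sq_intD(1)] assms(1)
  by (intro allI hc_cong_AE) (auto elim!: eventually_mono)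

text \<open>With \<open>P\<close> and \<open>Q\<close> the cosine and sine integrals, the Hartley
  coefficients at \<open>k\<close> and \<open>- k\<close> are \<open>P + Q\<close> and
  \<open>P - Q\<close>. As Sobolev weights are even in \<open>k\<close>, the norms may be computed
  from either kind of coefficient.\<close>

lemma norm_fourier_square:
  assumes u: "u \<in> L2"
  shows "(norm (fourier u k))^2 = ((norm (FC u k))^2 + (norm (FC u (- k)))^2) / 2"
proof -
  define g where "g j x = of_real (u x $ j) * cis (- 2 * pi * (\<Sum>i\<in>UNIV. of_int (k $ i) * x $ i))" for j x
  define P where "P j = (LINT x|torus. u x $ j * cos (phase k x))" for j
  define Q where "Q j = (LINT x|torus. u x $ j * sin (phase k x))" for j
  have iP: "integrable torus (\<lambda>x. u x $ j * cos (phase k x))" for j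
    by (rule sq_int_mult_integrable[OF L2_component(1)[OF u] trig_sq_int[OF trig_cos]])
  have iQ: "integrable torus (\<lambda>x. u x $ j * sin (phase k x))" for j
    by (rule sq_int_mult_integrable[OF L2_component(1)[OF u] trig_sq_int[OF trig_sin]])
  have g_eq: "g j x = of_real (u x $ j * cos (phase k x)) - \<i> * of_real (u x $ j * sin (phase k x))" for j x
    by (simp add: g_def phase_def complex_eq_iff)
  have gi: "integrable torus (g j)" for j
    unfolding g_eq[abs_def] using iP iQ by (intro Bochner_Integration.integrable_diff integrable_mult_right integrable_of_real)
  have gI: "(LINT x|torus. g j x) = of_real (P j) - \<i> * of_real (Q j)" for j unfolding g_eq P_def Q_def
    by (simp only: Bochner_Integration.integral_diff[OF integrable_of_real[OF iP] integrable_mult_right[OF integrable_of_real[OF iQ]]]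
        integral_mult_right_zero integral_complex_of_real)
  have bl: "bounded_linear (axis j :: complex \<Rightarrow> complex^3)" for j unfolding linear_conv_bounded_linear[symmetric]
    by (intro linearI) (auto simp: axis_def vec_eq_iff)
  have vi: "integrable torus (\<lambda>x. (\<chi> j. g j x))"
  proof -
    have "integrable torus (\<lambda>x. \<Sum>j\<in>UNIV. axis j (g j x))"
      by (intro Bochner_Integration.integrable_sum integrable_bounded_linear[OF bl gi])
    moreover have "(\<Sum>j\<in>UNIV. axis j (g j x)) = (\<chi> j. g j x)" for x by (simp add: vec_eq_iff axis_def if_distrib cong: if_cong)
    ultimately show ?thesis by simp
  qed
  have "fourier u k $ j = (LINT x|torus. g j x)" for j
  proof -
    have "fourier u k $ j = (LINT x|torus. (\<chi> j. g j x)) $ j" by (simp add: fourier_def g_def)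
    also have "... = (LINT x|torus. (\<chi> j. g j x) $ j)" by (rule integral_bounded_linear[OF bounded_linear_vec_nth vi, symmetric])
    finally show ?thesis by simp
  qed
  then have F: "fourier u k $ j = of_real (P j) - \<i> * of_real (Q j)" for j by (simp add: gI)
  have n: "(norm (fourier u k $ j))^2 = (P j)^2 + (Q j)^2" for j unfolding F cmod_power2 by simp
  have "(norm (fourier u k))^2 = (\<Sum>j\<in>UNIV. (P j)^2 + (Q j)^2)" by (simp add: norm_vec_def L2_set_def sum_nonneg n[symmetric])
  moreover have h1: "FC u k $ j = P j + Q j" and h2: "FC u (- k) $ j = P j - Q j" for j
    using iP iQ by (simp_all add: FC_def hc_def hartley_def P_def Q_def distrib_left right_diff_distrib)
  ultimately show ?thesis unfolding norm_vec3_square h1 h2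
    by (simp add: sum.distrib[symmetric] sum_divide_distrib power2_sum power2_diff add_divide_distrib)
qed

definition lam :: "int^3 \<Rightarrow> real" where
  "lam k = (2 * pi)^2 * (\<Sum>i\<in>UNIV. (of_int (k $ i))^2)"

lemma lam_nonneg [simp]: "0 \<le> lam k" by (auto simp: lam_def intro!: mult_nonneg_nonneg sum_nonneg)

lemma lam_uminus [simp]: "lam (- k) = lam k" by (simp add: lam_def)

lemma sobolev_weight_eq: "sobolev_weight s k = (1 + lam k) powr s" by (simp add: sobolev_weight_def lam_def)

lemma one_plus_lam_pos: "0 < 1 + lam k"
  using lam_nonneg[of k] by linarith

lemma sobolev_weight_pos: "0 < sobolev_weight s k"
  unfolding sobolev_weight_eq using one_plus_lam_pos[of k] by simp

lemma sobolev_weight_nonneg [simp]: "0 \<le> sobolev_weight s k"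
  using sobolev_weight_pos less_imp_le by blast

lemma has_sum_finite_sum:
  fixes f :: "'j \<Rightarrow> 'a \<Rightarrow> real"
  assumes "finite J" "\<And>j. j \<in> J \<Longrightarrow> (f j has_sum s j) A"
  shows "((\<lambda>x. \<Sum>j\<in>J. f j x) has_sum (\<Sum>j\<in>J. s j)) A"
  using assms by (induction J rule: finite_induct) (auto intro: has_sum_add)

lemma summable_on_finite_sum:
  fixes f :: "'j \<Rightarrow> 'a \<Rightarrow> real"
  assumes "finite J" "\<And>j. j \<in> J \<Longrightarrow> f j summable_on A"
  shows "(\<lambda>x. \<Sum>j\<in>J. f j x) summable_on A"
proof (rule has_sum_imp_summable[OF has_sum_finite_sum[OF assms(1)]])
  show "(f j has_sum infsum (f j) A) A" if "j \<in> J" for j by (rule has_sum_infsum[OF assms(2)[OF that]])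
qed

lemma bij_uminus_lattice: "bij (uminus :: int^3 \<Rightarrow> int^3)" by (rule bij_betw_byWitness[where f' = uminus]) auto

lemma summable_on_uminus_lattice_iff:
  "(\<lambda>k. f (- k)) summable_on (UNIV :: (int^3) set) \<longleftrightarrow> f summable_on UNIV" for f :: "int^3 \<Rightarrow> real"
  using summable_on_reindex_bij_betw[OF bij_uminus_lattice, of f] by simp

lemma infsum_uminus_lattice: "(\<Sum>\<^sub>\<infinity>k. f (- k)) = (\<Sum>\<^sub>\<infinity>k. f k)" for f :: "int^3 \<Rightarrow> real"
  using infsum_reindex_bij_betw[OF bij_uminus_lattice, of f] by simp

lemma Sobolev_iff: "u \<in> Sobolev s \<longleftrightarrow> u \<in> L2 \<and> (\<lambda>k. sobolev_weight s k * (norm (FC u k))^2) summable_on UNIV"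
  and Sobolev_norm_eq: "u \<in> Sobolev s \<Longrightarrow> Sobolev_norm s u = sqrt (\<Sum>\<^sub>\<infinity>k. sobolev_weight s k * (norm (FC u k))^2)"
proof -
  let ?a = "\<lambda>k. sobolev_weight s k * (norm (FC u k))^2" and ?b = "\<lambda>k. sobolev_weight s k * (norm (fourier u k))^2"
  have ev: "sobolev_weight s (- k) = sobolev_weight s k" for k by (simp add: sobolev_weight_eq)
  have ab: "?b k = 1 / 2 * (?a k + ?a (- k))" if "u \<in> L2" for k unfolding norm_fourier_square[OF that] ev by (simp add: field_simps)
  have s1: "?b summable_on UNIV" if "u \<in> L2" "?a summable_on UNIV"
    unfolding ab[OF that(1)] using that(2) summable_on_uminus_lattice_iff[of ?a] by (intro summable_on_cmult_right summable_on_add) auto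
  have s2: "?a summable_on UNIV" if "u \<in> L2" "?b summable_on UNIV"
  proof -
    have "(\<lambda>k. 2 * ?b k) summable_on UNIV" by (intro summable_on_cmult_right that)
    then show ?thesis by (rule summable_on_comparison_test) (auto simp: ab[OF that(1)] ev)
  qed
  show iff: "u \<in> Sobolev s \<longleftrightarrow> u \<in> L2 \<and> ?a summable_on UNIV" unfolding Sobolev_def using s1 s2 by blast
  show "Sobolev_norm s u = sqrt (\<Sum>\<^sub>\<infinity>k. ?a k)" if "u \<in> Sobolev s"
  proof -
    have u: "u \<in> L2" "?a summable_on UNIV" using that iff by auto
    have "(\<Sum>\<^sub>\<infinity>k. ?b k) = 1 / 2 * ((\<Sum>\<^sub>\<infinity>k. ?a k) + (\<Sum>\<^sub>\<infinity>k. ?a (- k)))"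
      unfolding ab[OF u(1)] using u(2) summable_on_uminus_lattice_iff[of ?a] by (subst infsum_cmult_right', subst infsum_add) auto
    then show ?thesis unfolding Sobolev_norm_def infsum_uminus_lattice[of ?a] by simp
  qed
qed

lemma FC_square_has_sum:
  assumes "u \<in> L2"
  shows "((\<lambda>k. (norm (FC u k))^2) has_sum L2_inner u u) UNIV"
proof -
  have "((\<lambda>k. \<Sum>j\<in>UNIV. (hc (coord u j) k)^2) has_sum (\<Sum>j\<in>UNIV. LINT x|torus. (u x $ j)^2)) UNIV"
    by (intro has_sum_finite_sum Parseval_square L2_component[OF assms]) simp
  moreover have "L2_inner u u = (\<Sum>j\<in>UNIV. LINT x|torus. (u x $ j)^2)" by (simp add: L2_inner_eq[OF assms assms] power2_eq_square)
  ultimately show ?thesis by (simp add: norm_vec3_square FC_def)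
qed

lemma sobolev_weight_0 [simp]: "sobolev_weight 0 k = 1"
  using one_plus_lam_pos[of k] by (simp add: sobolev_weight_eq)

lemma L2_eq_Sobolev_0: "(L2 :: field set) = Sobolev 0"
  using has_sum_imp_summable[OF FC_square_has_sum] by (auto simp: Sobolev_iff)

lemma L2_norm_eq: "u \<in> L2 \<Longrightarrow> L2_norm u = Sobolev_norm 0 u"
  using Sobolev_norm_eq[of u 0] infsumI[OF FC_square_has_sum] by (simp add: L2_norm_def L2_eq_Sobolev_0)

lemma Sobolev_add:
  assumes u: "u \<in> Sobolev s" and v: "v \<in> Sobolev s"
  shows "(\<lambda>x. u x + v x) \<in> Sobolev s"
proof -
  have L: "u \<in> L2" "v \<in> L2" using u v by (auto simp: Sobolev_iff)
  have "(\<lambda>k. 2 * (sobolev_weight s k * (norm (FC u k))^2) + 2 * (sobolev_weight s k * (norm (FC v k))^2)) summable_on UNIV"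
    using u v by (intro summable_on_add summable_on_cmult_right) (auto simp: Sobolev_iff)
  then have "(\<lambda>k. sobolev_weight s k * (norm (FC (\<lambda>x. u x + v x) k))^2) summable_on UNIV"
  proof (rule summable_on_comparison_test)
    fix k
    have "(norm (FC u k + FC v k))^2 \<le> (norm (FC u k) + norm (FC v k))^2" by (intro power_mono norm_triangle_ineq) auto
    also have "... \<le> 2 * (norm (FC u k))^2 + 2 * (norm (FC v k))^2"
      using zero_le_power2[of "norm (FC u k) - norm (FC v k)"] by (simp add: power2_eq_square algebra_simps)
    finally have "sobolev_weight s k * (norm (FC u k + FC v k))^2 \<le> sobolev_weight s k * (2 * (norm (FC u k))^2 + 2 * (norm (FC v k))^2)"
      using sobolev_weight_pos[of s k] by (intro mult_left_mono) auto
    then show "sobolev_weight s k * (norm (FC (\<lambda>x. u x + v x) k))^2 \<le> 2 * (sobolev_weight s k * (norm (FC u k))^2) + 2 * (sobolev_weight s k * (norm (FC v k))^2)"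
      by (simp add: FC_add[OF L] algebra_simps)
  qed auto
  then show ?thesis by (simp add: Sobolev_iff L2_field_add L)
qed

lemma Sobolev_scale:
  assumes "u \<in> Sobolev s"
  shows "(\<lambda>x. c *\<^sub>R u x) \<in> Sobolev s"
proof -
  have "(\<lambda>k. c^2 * (sobolev_weight s k * (norm (FC u k))^2)) summable_on UNIV"
    using assms by (intro summable_on_cmult_right) (auto simp: Sobolev_iff)
  then show ?thesis using assms by (simp add: Sobolev_iff L2_field_scale FC_scale power_mult_distrib mult_ac)
qed

lemma Sobolev_diff:
  assumes "u \<in> Sobolev s" "v \<in> Sobolev s"
  shows "u - v \<in> Sobolev s"
  using Sobolev_add[OF assms(1) Sobolev_scale[OF assms(2), of "- 1"]] by (simp add: fun_diff_def)

text \<open>Mean zero and divergence-free, read off the coefficients. Differentiation reflects the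
  frequency of a Hartley function, but a condition imposed at all \<open>k\<close> absorbs the
  reflection and looks as for Fourier coefficients.\<close>

definition divfree :: "field \<Rightarrow> bool" where
  "divfree u \<longleftrightarrow> FC u 0 = 0 \<and> (\<forall>k. (\<Sum>i\<in>UNIV. of_int (k $ i) * FC u k $ i) = 0)"

lemma divfree_add: "u \<in> L2 \<Longrightarrow> v \<in> L2 \<Longrightarrow> divfree u \<Longrightarrow> divfree v \<Longrightarrow> divfree (\<lambda>x. u x + v x)"
  by (simp add: divfree_def FC_add distrib_left sum.distrib)

lemma divfree_scale: "divfree u \<Longrightarrow> divfree (\<lambda>x. c *\<^sub>R u x)"
  by (simp add: divfree_def FC_scale mult.left_commute sum_distrib_left[symmetric])

section \<open>Smooth fields and the closure of the test fields\<close>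

lemma smoothD: "smooth f \<Longrightarrow> f differentiable_on UNIV" "smooth f \<Longrightarrow> smooth (partial i f)"
proof -
  assume f: "smooth f"
  show "f differentiable_on UNIV" using f[unfolded smooth_def, rule_format, of "[]"] by simp
  show "smooth (partial i f)" unfolding smooth_def using f[unfolded smooth_def, rule_format, of "i # _"] by simp
qed

lemma smooth_has_derivative: "smooth f \<Longrightarrow> (f has_derivative frechet_derivative f (at x)) (at x)"
  using smoothD(1)[of f] by (auto simp: differentiable_on_def frechet_derivative_works)

lemma smooth_continuous: "smooth f \<Longrightarrow> continuous_on UNIV f" by (intro differentiable_imp_continuous_on smoothD)

lemma smooth_component:
  fixes f :: field
  assumes "smooth f"
  shows "smooth (coord f j)"
proof -
  have "fold partial is (coord f j) = (\<lambda>x. fold partial is f x $ j)" if "smooth f" for "is" and f :: field using that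
  proof (induction "is" arbitrary: f)
    case (Cons i "is")
    have "partial i (coord f j) = (\<lambda>x. partial i f x $ j)"
    proof
      fix x
      have "((coord f j) has_derivative (\<lambda>v. frechet_derivative f (at x) v $ j)) (at x)"
        by (rule bounded_linear.has_derivative[OF bounded_linear_vec_nth smooth_has_derivative[OF Cons.prems]])
      then show "partial i (coord f j) x = partial i f x $ j" using partial_eq by (auto simp: partial_def)
    qed
    then show ?case using Cons.IH[OF smoothD(2)[OF Cons.prems, of i]] by simp
  qed simp
  note eq = this[OF assms]
  show ?thesis unfolding smooth_def eq differentiable_on_def differentiable_def
    using bounded_linear.has_derivative[OF bounded_linear_vec_nth] assms[unfolded smooth_def differentiable_on_def differentiable_def] by blast
qed

lemma partial_component:
  fixes f :: field
  assumes "smooth f"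
  shows "partial i (coord f j) x = partial i f x $ j"
  using partial_eq[OF bounded_linear.has_derivative[OF bounded_linear_vec_nth smooth_has_derivative[OF assms]]]
  by (simp add: partial_def)

lemma periodic_partial:
  assumes "periodic f" "f differentiable_on UNIV"
  shows "periodic (partial i f)"
  unfolding periodic_def
proof (intro allI)
  fix x and k :: "int^3"
  let ?D = "frechet_derivative f (at (x + kvec k))"
  have "(f has_derivative ?D) (at (x + kvec k))" using assms(2) by (auto simp: differentiable_on_def frechet_derivative_works)
  moreover have "((\<lambda>x. x + kvec k) has_derivative (\<lambda>v. v)) (at x)" by (auto intro!: derivative_eq_intros)
  ultimately have "((\<lambda>x. f (x + kvec k)) has_derivative ?D) (at x)"
    using has_derivative_compose[of "\<lambda>x. x + kvec k" "\<lambda>v. v" x UNIV f ?D] by simp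
  then have "(f has_derivative ?D) (at x)" using periodicD[OF assms(1)] by simp
  from partial_eq[OF this, of i] show "partial i f (x + kvec k) = partial i f x" by (simp only: partial_def)
qed

lemma hc_partial:
  assumes f: "smooth f" "periodic f"
  shows "hc (partial i f) k = - (2 * pi * of_int (k $ i)) * hc f (- k)"
proof -
  have d: "((\<lambda>x. f x * hartley k x) has_derivative
      (\<lambda>v. f x * (hartley (- k) x * phase k v) + frechet_derivative f (at x) v * hartley k x)) (at x)" for x
    by (rule has_derivative_mult[OF smooth_has_derivative[OF f(1)] hartley_has_derivative])
  have fc: "continuous_on UNIV f" "continuous_on UNIV (partial i f)" by (intro smooth_continuous smoothD f)+
  have hcn: "continuous_on UNIV (hartley k)" for k by (intro trig_continuous trig_hartley)
  have "(LINT x|torus. f x * (hartley (- k) x * phase k (axis i 1)) + frechet_derivative f (at x) (axis i 1) * hartley k x) = 0"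
  proof (rule integral_partial_periodic[OF d])
    show "continuous_on UNIV (\<lambda>x. f x * (hartley (- k) x * phase k (axis i 1)) + frechet_derivative f (at x) (axis i 1) * hartley k x)"
      using fc(2) by (intro continuous_on_add continuous_on_mult fc(1) hcn continuous_on_const) (simp add: partial_def)
    show "periodic (\<lambda>x. f x * hartley k x)" by (rule periodic_combine[OF f(2) periodic_hartley])
  qed
  moreover have "(LINT x|torus. f x * (hartley (- k) x * phase k (axis i 1)) + frechet_derivative f (at x) (axis i 1) * hartley k x)
      = (LINT x|torus. phase k (axis i 1) * (f x * hartley (- k) x) + partial i f x * hartley k x)"
    by (intro Bochner_Integration.integral_cong) (auto simp: partial_def)
  moreover have "... = phase k (axis i 1) * hc f (- k) + hc (partial i f) k" unfolding hc_def
    by (subst Bochner_Integration.integral_add) (auto intro!: continuous_torus_integrable continuous_intros fc hcn)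
  ultimately show ?thesis by (simp add: phase_axis)
qed

lemma smooth_sq_int: "smooth f \<Longrightarrow> sq_int torus f" by (intro continuous_torus_sq_int smooth_continuous)

text \<open>Each derivative reflects the frequency, so the induction closes for the symmetric sum
  over \<open>k\<close> and \<open>- k\<close>.\<close>

lemma smooth_hc_decay:
  assumes f: "smooth f" "periodic f"
  shows "(\<lambda>k. ((2 * pi * of_int (k $ i))^2) ^ n * ((hc f k)^2 + (hc f (- k))^2)) summable_on UNIV"
  using f
proof (induction n arbitrary: f)
  case 0
  have "(\<lambda>k. (hc f k)^2) summable_on UNIV" by (rule hc_square_summable[OF smooth_sq_int[OF 0(1)]])
  then show ?case using summable_on_uminus_lattice_iff[of "\<lambda>k. (hc f k)^2"] by (auto intro: summable_on_add)
next
  case (Suc n)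
  have "(\<lambda>k. ((2 * pi * of_int (k $ i))^2) ^ n * ((hc (partial i f) k)^2 + (hc (partial i f) (- k))^2)) summable_on UNIV"
    by (intro Suc.IH smoothD(2) periodic_partial smoothD(1) Suc.prems)
  then show ?case unfolding hc_partial[OF Suc.prems] by (simp add: power_mult_distrib algebra_simps)
qed

text \<open>Comparison with the largest of 1 and the three numbers; the constant is
  \<open>4 = 1 + 3\<close>.\<close>

lemma power_sum3_le:
  fixes x :: "3 \<Rightarrow> real"
  assumes "\<And>i. 0 \<le> x i"
  shows "(1 + (\<Sum>i\<in>UNIV. x i)) ^ n \<le> 4 ^ n * (1 + (\<Sum>i\<in>UNIV. (x i) ^ n))"
proof -
  define y where "y = Max (insert 1 (range x))"
  have y: "1 \<le> y" "x i \<le> y" for i unfolding y_def by (rule Max_ge; simp)+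
  have s0: "0 \<le> (\<Sum>i\<in>UNIV. x i)" using assms by (simp add: sum_nonneg)
  have "(\<Sum>i\<in>UNIV. x i) \<le> of_nat (card (UNIV :: 3 set)) * y" by (rule sum_bounded_above) (use y in auto)
  then have "1 + (\<Sum>i\<in>UNIV. x i) \<le> 4 * y" using y(1) by simp
  then have "(1 + (\<Sum>i\<in>UNIV. x i)) ^ n \<le> (4 * y) ^ n" using s0 by (intro power_mono) auto
  also have "... = 4 ^ n * y ^ n" by (rule power_mult_distrib)
  also have "y ^ n \<le> 1 + (\<Sum>i\<in>UNIV. (x i) ^ n)"
  proof -
    have "y \<in> insert 1 (range x)" unfolding y_def by (rule Max_in) auto
    then show ?thesis
    proof
      assume "y = 1"
      then show ?thesis using assms by (auto intro!: sum_nonneg)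
    next
      assume "y \<in> range x"
      then obtain i where "y = x i" by auto
      then have "y ^ n \<le> (\<Sum>i\<in>UNIV. (x i) ^ n)" using assms by (auto intro!: member_le_sum)
      then show ?thesis by simp
    qed
  qed
  finally show ?thesis by simp
qed

lemma smooth_Sobolev:
  assumes u: "smooth u" "periodic u"
  shows "u \<in> Sobolev s"
proof -
  have uj: "smooth (coord u j)" "periodic (coord u j)" for j using smooth_component[OF u(1)] u(2) by (auto simp: periodic_def)
  have L: "u \<in> L2" by (intro L2_fieldI uj smooth_sq_int)
  obtain n :: nat where n: "s \<le> real n" using real_arch_simple by blast
  define D where "D j k = (hc (coord u j) k)^2 + (hc (coord u j) (- k))^2" for j k
  \<comment> \<open>The factor with exponent 0 equals 1. It is written this way so that the summand
    1 of \<open>power_sum3_le\<close> is an instance of \<open>smooth_hc_decay\<close> too.\<close>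
  have "(\<lambda>k. \<Sum>j\<in>UNIV. 4 ^ n * (((2 * pi * of_int (k $ 1))^2) ^ 0 * D j k + (\<Sum>i\<in>UNIV. ((2 * pi * of_int (k $ i))^2) ^ n * D j k))) summable_on UNIV"
    unfolding D_def by (intro summable_on_finite_sum finite summable_on_cmult_right summable_on_add smooth_hc_decay uj)
  then have "(\<lambda>k. sobolev_weight s k * (norm (FC u k))^2) summable_on UNIV"
  proof (rule summable_on_comparison_test)
    fix k
    have "sobolev_weight s k \<le> (1 + lam k) powr real n" unfolding sobolev_weight_eq using n lam_nonneg[of k] by (intro powr_mono) auto
    also have "... = (1 + lam k) ^ n" using lam_nonneg[of k] by (simp add: powr_realpow add_pos_nonneg)
    also have "lam k = (\<Sum>i\<in>UNIV. (2 * pi * of_int (k $ i))^2)" by (simp add: lam_def power_mult_distrib sum_distrib_left)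
    also have "(1 + ...) ^ n \<le> 4 ^ n * (1 + (\<Sum>i\<in>UNIV. ((2 * pi * of_int (k $ i))^2) ^ n))" by (rule power_sum3_le) simp
    finally have w: "sobolev_weight s k \<le> 4 ^ n * (1 + (\<Sum>i\<in>UNIV. ((2 * pi * of_int (k $ i))^2) ^ n))" .
    have "sobolev_weight s k * (norm (FC u k))^2 \<le> (4 ^ n * (1 + (\<Sum>i\<in>UNIV. ((2 * pi * of_int (k $ i))^2) ^ n))) * (\<Sum>j\<in>UNIV. D j k)"
    proof (intro mult_mono w)
      show "(norm (FC u k))^2 \<le> (\<Sum>j\<in>UNIV. D j k)" unfolding norm_vec3_square FC_def D_def by (intro sum_mono) simp
    qed (auto intro!: mult_nonneg_nonneg add_nonneg_nonneg sum_nonneg)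
    then show "sobolev_weight s k * (norm (FC u k))^2 \<le> (\<Sum>j\<in>UNIV. 4 ^ n * (((2 * pi * of_int (k $ 1))^2) ^ 0 * D j k + (\<Sum>i\<in>UNIV. ((2 * pi * of_int (k $ i))^2) ^ n * D j k)))"
      by (simp add: sum_distrib_left sum_distrib_right distrib_right distrib_left mult.assoc)
  qed auto
  then show ?thesis using L by (simp add: Sobolev_iff)
qed

lemma solenoidal_test_divfree:
  assumes "v \<in> solenoidal_test"
  shows "divfree v" "v \<in> Sobolev s"
proof -
  have v: "periodic v" "smooth v" "\<And>x. divergence v x = 0" "(LINT x|torus. v x) = 0" using assms by (auto simp: solenoidal_test_def)
  show "v \<in> Sobolev s" by (rule smooth_Sobolev[OF v(2,1)])
  have vj: "smooth (coord v j)" "periodic (coord v j)" for j using smooth_component[OF v(2)] v(1) by (auto simp: periodic_def)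
  have "FC v 0 $ j = 0" for j
  proof -
    have "FC v 0 $ j = (LINT x|torus. v x $ j)" by (simp add: FC_def hc_def)
    also have "... = (LINT x|torus. v x) $ j"
      by (rule integral_bounded_linear[OF bounded_linear_vec_nth continuous_torus_integrable[OF smooth_continuous[OF v(2)]]])
    finally show ?thesis by (simp add: v)
  qed
  moreover have "(\<Sum>i\<in>UNIV. of_int (k $ i) * FC v k $ i) = 0" for k
  proof -
    have "(\<Sum>i\<in>UNIV. hc (partial i (coord v i)) (- k)) = hc (\<lambda>x. \<Sum>i\<in>UNIV. partial i (coord v i) x) (- k)"
      by (intro hc_sum[symmetric] smooth_sq_int smoothD(2) vj)
    also have "(\<lambda>x. \<Sum>i\<in>UNIV. partial i (coord v i) x) = (\<lambda>x. 0)" using v(3) by (simp add: partial_component[OF v(2)] divergence_def)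
    also have "hc (\<lambda>x. 0) (- k) = 0" by (simp add: hc_def)
    finally have "(\<Sum>i\<in>UNIV. 2 * pi * (of_int (k $ i) * FC v k $ i)) = 0" using hc_partial[OF vj] by (simp add: FC_def mult.assoc)
    then show ?thesis by (simp add: sum_distrib_left[symmetric])
  qed
  ultimately show "divfree v" by (simp add: divfree_def vec_eq_iff)
qed

definition truncate_field :: "(int^3) set \<Rightarrow> field \<Rightarrow> field" where
  "truncate_field A u = (\<lambda>x. \<chi> j. \<Sum>k\<in>A. FC u k $ j * hartley k x)"

lemma truncate_component: "(\<lambda>x. truncate_field A u x $ j) \<in> trig_poly"
  unfolding truncate_field_def by (simp add: trig_sum trig_scale trig_hartley)

lemma FC_truncate: "finite A \<Longrightarrow> FC (truncate_field A u) k = (if k \<in> A then FC u k else 0)"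
  by (simp add: FC_def truncate_field_def vec_eq_iff hc_hartley_sum)

lemma trig_field_smooth:
  assumes t: "\<And>j. (coord v j) \<in> trig_poly"
  shows "smooth (v :: field)" "periodic v" "\<And>i j x. partial i v x $ j = partial i (coord v j) x"
proof -
  have der: "(v has_derivative (\<lambda>h. \<chi> j. frechet_derivative (coord v j) (at x) h)) (at x)"
    if t: "\<And>j. (coord v j) \<in> trig_poly" for v :: field and x
  proof -
    have "((\<lambda>x. v x \<bullet> b) has_derivative (\<lambda>h. (\<chi> j. frechet_derivative (coord v j) (at x) h) \<bullet> b)) (at x)" if "b \<in> Basis" for b
    proof -
      obtain j where b: "b = axis j 1" using \<open>b \<in> Basis\<close> by (auto simp: Basis_vec_def)
      show ?thesis unfolding b using smooth_has_derivative[OF trig_smooth[OF t, of j]] by (simp add: inner_axis)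
    qed
    then show ?thesis by (subst has_derivative_componentwise_within) auto
  qed
  have pc: "partial i v x $ j = partial i (coord v j) x" if t: "\<And>j. (coord v j) \<in> trig_poly" for v :: field and i j x
    using partial_eq[OF der[OF t]] by (simp add: partial_def)
  then show "\<And>i j x. partial i v x $ j = partial i (coord v j) x" using t by blast
  have "(\<lambda>x. fold partial is v x $ j) \<in> trig_poly" if t: "\<And>j. (coord v j) \<in> trig_poly" for "is" and v :: field and j using t
  proof (induction "is" arbitrary: v)
    case (Cons i "is")
    have "(\<lambda>x. partial i v x $ j) \<in> trig_poly" for j using trig_partial[OF Cons.prems, of i j] pc[OF Cons.prems] by simp
    then show ?case using Cons.IH by simp
  qed simp
  then show "smooth v" unfolding smooth_def differentiable_on_def differentiable_def using der t by (metis has_derivative_at_withinI)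
  show "periodic v" using trig_periodic[OF t] by (auto simp: periodic_def vec_eq_iff)
qed

lemma truncate_solenoidal:
  assumes u: "divfree u" and A: "finite A"
  shows "truncate_field A u \<in> solenoidal_test"
proof -
  let ?v = "truncate_field A u"
  note t = truncate_component[of A u]
  note tf = trig_field_smooth[OF t]
  have L: "?v \<in> L2" by (intro L2_fieldI trig_sq_int trig_periodic t)
  have "divergence ?v x = 0" for x
  proof -
    have "partial i (coord ?v i) x = (\<Sum>k\<in>A. FC u k $ i * (hartley (- k) x * phase k (axis i 1)))" for i
    proof (rule partial_eq)
      show "((coord ?v i) has_derivative (\<lambda>v. \<Sum>k\<in>A. FC u k $ i * (hartley (- k) x * phase k v))) (at x)"
        unfolding truncate_field_def vec_lambda_beta by (intro has_derivative_sum has_derivative_mult_right hartley_has_derivative)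
    qed
    then have "divergence ?v x = (\<Sum>i\<in>UNIV. \<Sum>k\<in>A. 2 * pi * hartley (- k) x * (of_int (k $ i) * FC u k $ i))"
      unfolding divergence_def tf(3) by (simp add: phase_axis mult_ac)
    also have "... = (\<Sum>k\<in>A. \<Sum>i\<in>UNIV. 2 * pi * hartley (- k) x * (of_int (k $ i) * FC u k $ i))" by (rule sum.swap)
    also have "... = (\<Sum>k\<in>A. 2 * pi * hartley (- k) x * (\<Sum>i\<in>UNIV. of_int (k $ i) * FC u k $ i))" by (simp only: sum_distrib_left)
    also have "... = 0" using u by (simp add: divfree_def)
    finally show ?thesis .
  qed
  moreover have "(LINT x|torus. ?v x) = 0"
  proof -
    have "(LINT x|torus. ?v x) $ j = 0" for j
    proof -
      have "(LINT x|torus. ?v x) $ j = (LINT x|torus. ?v x $ j)"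
        by (rule integral_bounded_linear[OF bounded_linear_vec_nth continuous_torus_integrable[OF smooth_continuous[OF tf(1)]], symmetric])
      also have "... = FC ?v 0 $ j" by (simp add: FC_def hc_def)
      also have "... = 0" using u by (simp add: FC_truncate[OF A] divfree_def)
      finally show ?thesis .
    qed
    then show ?thesis by (simp add: vec_eq_iff)
  qed
  ultimately show ?thesis using tf by (simp add: solenoidal_test_def)
qed

text \<open>Each coefficient depends continuously on the field in the Sobolev norm, so the linear
  constraints survive the closure. Conversely, finite truncations of a divergence-free field are
  test fields and converge to it.\<close>

theorem V_iff: "u \<in> V s \<longleftrightarrow> u \<in> Sobolev s \<and> divfree u"
proof
  assume "u \<in> V s"
  then have u: "u \<in> Sobolev s" and ap: "\<And>e. e > 0 \<Longrightarrow> \<exists>v\<in>solenoidal_test. Sobolev_norm s (u - v) < e" by (auto simp: V_def)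
  have uL: "u \<in> L2" using u by (simp add: Sobolev_iff)
  have close: "\<exists>v. divfree v \<and> norm (FC u k - FC v k) < e" if "0 < e" for k e
  proof -
    let ?w = "sqrt (sobolev_weight s k)"
    have w: "0 < ?w" using sobolev_weight_pos by simp
    obtain v where v: "v \<in> solenoidal_test" "Sobolev_norm s (u - v) < e * ?w" using ap[of "e * ?w"] \<open>0 < e\<close> w by auto
    have vS: "v \<in> Sobolev s" by (rule solenoidal_test_divfree(2)[OF v(1)])
    have vL: "v \<in> L2" using vS by (simp add: Sobolev_iff)
    have d: "u - v \<in> Sobolev s" by (rule Sobolev_diff[OF u vS])
    have "sobolev_weight s k * (norm (FC (u - v) k))^2 \<le> (\<Sum>\<^sub>\<infinity>k. sobolev_weight s k * (norm (FC (u - v) k))^2)"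
      using finite_sum_le_infsum[of "\<lambda>k. sobolev_weight s k * (norm (FC (u - v) k))^2" UNIV "{k}"] d sobolev_weight_pos
      by (simp add: Sobolev_iff less_imp_le)
    then have "sqrt (sobolev_weight s k * (norm (FC (u - v) k))^2) \<le> Sobolev_norm s (u - v)"
      unfolding Sobolev_norm_eq[OF d] by (rule real_sqrt_le_mono)
    then have "?w * norm (FC u k - FC v k) < e * ?w" using v(2) by (simp add: real_sqrt_mult FC_diff[OF uL vL])
    then have "norm (FC u k - FC v k) < e" using w by (simp add: mult.commute)
    then show ?thesis using solenoidal_test_divfree(1)[OF v(1)] by blast
  qed
  have "FC u 0 = 0"
  proof (rule ccontr)
    assume "FC u 0 \<noteq> 0"
    then obtain v where "divfree v" "norm (FC u 0 - FC v 0) < norm (FC u 0)" using close[of "norm (FC u 0)" 0] by auto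
    then show False by (simp add: divfree_def)
  qed
  moreover have "(\<Sum>i\<in>UNIV. of_int (k $ i) * FC u k $ i) = 0" for k
  proof (rule ccontr)
    define a where "a = (\<Sum>i\<in>UNIV. of_int (k $ i) * FC u k $ i)"
    assume "a \<noteq> 0"
    \<comment> \<open>The summand 1 covers \<open>k = 0\<close>, where the norm vanishes.\<close>
    have n: "0 < norm (kvec k) + 1" by (simp add: add_nonneg_pos)
    then obtain v where v: "divfree v" "norm (FC u k - FC v k) < \<bar>a\<bar> / (norm (kvec k) + 1)"
      using close[of "\<bar>a\<bar> / (norm (kvec k) + 1)" k] \<open>a \<noteq> 0\<close> by auto
    have "a = kvec k \<bullet> (FC u k - FC v k)" using v(1) by (simp add: a_def divfree_def inner_vec_def right_diff_distrib sum_subtractf)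
    then have "\<bar>a\<bar> \<le> norm (kvec k) * norm (FC u k - FC v k)" using Cauchy_Schwarz_ineq2 by metis
    also have "... \<le> (norm (kvec k) + 1) * norm (FC u k - FC v k)" by (intro mult_right_mono) auto
    also have "... < (norm (kvec k) + 1) * (\<bar>a\<bar> / (norm (kvec k) + 1))" using v(2) n by (intro mult_strict_left_mono)
    also have "... = \<bar>a\<bar>" using n by simp
    finally show False by simp
  qed
  ultimately show "u \<in> Sobolev s \<and> divfree u" using u by (simp add: divfree_def)
next
  assume "u \<in> Sobolev s \<and> divfree u"
  then have u: "u \<in> Sobolev s" "divfree u" by auto
  have uL: "u \<in> L2" using u by (simp add: Sobolev_iff)
  define a where "a k = sobolev_weight s k * (norm (FC u k))^2" for k
  have a: "a summable_on UNIV" using u(1) by (simp add: Sobolev_iff a_def[abs_def])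
  have "\<exists>v\<in>solenoidal_test. Sobolev_norm s (u - v) < e" if "0 < e" for e
  proof -
    have "0 < e^2" using that by simp
    then obtain A where A: "finite A" "dist (sum a A) (infsum a UNIV) \<le> e^2 / 2"
      using infsum_finite_approximation[OF a, of "e^2 / 2"] by auto
    let ?v = "truncate_field A u"
    have v: "?v \<in> solenoidal_test" by (rule truncate_solenoidal[OF u(2) A(1)])
    have vS: "?v \<in> Sobolev s" by (rule solenoidal_test_divfree(2)[OF v])
    have vL: "?v \<in> L2" using vS by (simp add: Sobolev_iff)
    have "(\<Sum>\<^sub>\<infinity>k. sobolev_weight s k * (norm (FC (u - ?v) k))^2) = (\<Sum>\<^sub>\<infinity>k\<in>UNIV - A. a k)"
      by (rule infsum_cong_neutral) (auto simp: FC_diff[OF uL vL] FC_truncate[OF A(1)] a_def)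
    also have "... = infsum a UNIV - sum a A" using infsum_Diff[OF a summable_on_finite[OF A(1)]] A(1) by simp
    also have "... < e^2" using A(2) \<open>0 < e^2\<close> by (simp only: dist_real_def)
    finally have "sqrt (\<Sum>\<^sub>\<infinity>k. sobolev_weight s k * (norm (FC (u - ?v) k))^2) < sqrt (e^2)" by (rule real_sqrt_less_mono)
    then have "Sobolev_norm s (u - ?v) < e" using Sobolev_norm_eq[OF Sobolev_diff[OF u(1) vS]] that by simp
    then show ?thesis using v by blast
  qed
  then show "u \<in> V s" using u(1) by (simp add: V_def)
qed

theorem H_iff: "u \<in> H \<longleftrightarrow> u \<in> L2 \<and> divfree u"
proof -
  have "u \<in> L2 \<Longrightarrow> v \<in> solenoidal_test \<Longrightarrow> L2_norm (u - v) = Sobolev_norm 0 (u - v)" for u v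
    using solenoidal_test_divfree(2)[of v 0] by (intro L2_norm_eq L2_field_diff) (auto simp: L2_eq_Sobolev_0)
  then have "u \<in> H \<longleftrightarrow> u \<in> V 0" unfolding H_def V_def L2_eq_Sobolev_0 by auto
  then show ?thesis by (simp add: V_iff L2_eq_Sobolev_0)
qed

section \<open>Eigenfields of the Stokes operator\<close>

lemma orthonormal_pair_exists:
  fixes a :: "real^3"
  assumes "a \<noteq> 0"
  obtains e f where "e \<bullet> e = 1" "f \<bullet> f = 1" "e \<bullet> f = 0" "a \<bullet> e = 0" "a \<bullet> f = 0"
    "\<And>x. a \<bullet> x = 0 \<Longrightarrow> x = (x \<bullet> e) *\<^sub>R e + (x \<bullet> f) *\<^sub>R f"
proof -
  let ?S = "{x. a \<bullet> x = 0}"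
  obtain B where B: "B \<subseteq> ?S" "pairwise orthogonal B" "\<And>x. x \<in> B \<Longrightarrow> norm x = 1" "card B = dim ?S" "span B = ?S"
    using orthonormal_basis_subspace[OF subspace_hyperplane[of a]] by metis
  have "card B = 2" using B(4) dim_hyperplane[OF assms] by simp
  then obtain e f where ef: "B = {e, f}" "e \<noteq> f" by (auto simp: card_2_iff)
  have n: "e \<bullet> e = 1" "f \<bullet> f = 1" using B(3) ef by (auto simp: dot_square_norm)
  have o: "e \<bullet> f = 0" using B(2) ef by (auto simp: pairwise_def orthogonal_def)
  have "x = (x \<bullet> e) *\<^sub>R e + (x \<bullet> f) *\<^sub>R f" if "a \<bullet> x = 0" for x
  proof -
    have "x \<in> span {e, f}" using that B(5) ef by auto
    then obtain p q where x: "x = p *\<^sub>R e + q *\<^sub>R f" by (auto simp: span_insert span_singleton algebra_simps)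
    have "x \<bullet> e = p" "x \<bullet> f = q" using n o by (simp_all add: x inner_add_left inner_commute[of f e])
    then show ?thesis using x by simp
  qed
  then show ?thesis using that[of e f] n o B(1) ef by auto
qed

text \<open>The two polarisations of a divergence-free wave, indexed by \<open>bool\<close>. Which
  orthonormal basis of the plane orthogonal to \<open>k\<close> is taken does not matter.\<close>

definition frame :: "int^3 \<Rightarrow> bool \<Rightarrow> real^3" where
  "frame k = (SOME g. g True \<bullet> g True = 1 \<and> g False \<bullet> g False = 1 \<and> g True \<bullet> g False = 0 \<and>
     kvec k \<bullet> g True = 0 \<and> kvec k \<bullet> g False = 0 \<and>
     (\<forall>x. kvec k \<bullet> x = 0 \<longrightarrow> x = (x \<bullet> g True) *\<^sub>R g True + (x \<bullet> g False) *\<^sub>R g False))"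

lemma kvec_eq_0_iff: "kvec k = 0 \<longleftrightarrow> k = 0" by (simp add: vec_eq_iff)

lemma frame_props:
  assumes "k \<noteq> 0"
  shows "frame k b \<bullet> frame k b' = (if b = b' then 1 else 0)" "kvec k \<bullet> frame k b = 0"
    "kvec k \<bullet> x = 0 \<Longrightarrow> x = (x \<bullet> frame k True) *\<^sub>R frame k True + (x \<bullet> frame k False) *\<^sub>R frame k False"
proof -
  have "kvec k \<noteq> 0" using assms kvec_eq_0_iff by blast
  then obtain e f where ef: "e \<bullet> e = 1" "f \<bullet> f = 1" "e \<bullet> f = 0" "kvec k \<bullet> e = 0" "kvec k \<bullet> f = 0"
    "\<And>x. kvec k \<bullet> x = 0 \<Longrightarrow> x = (x \<bullet> e) *\<^sub>R e + (x \<bullet> f) *\<^sub>R f" by (rule orthonormal_pair_exists) blast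
  have "frame k True \<bullet> frame k True = 1 \<and> frame k False \<bullet> frame k False = 1 \<and> frame k True \<bullet> frame k False = 0 \<and>
     kvec k \<bullet> frame k True = 0 \<and> kvec k \<bullet> frame k False = 0 \<and>
     (\<forall>x. kvec k \<bullet> x = 0 \<longrightarrow> x = (x \<bullet> frame k True) *\<^sub>R frame k True + (x \<bullet> frame k False) *\<^sub>R frame k False)"
    unfolding frame_def by (rule someI[of _ "\<lambda>b. if b then e else f"]) (use ef in simp)
  then show "frame k b \<bullet> frame k b' = (if b = b' then 1 else 0)" "kvec k \<bullet> frame k b = 0"
    "kvec k \<bullet> x = 0 \<Longrightarrow> x = (x \<bullet> frame k True) *\<^sub>R frame k True + (x \<bullet> frame k False) *\<^sub>R frame k False"
    by (cases b; cases b'; simp add: inner_commute; fail)+ 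
qed

text \<open>\<open>N\<close> is made injective by listing its finite level sets one after the other.\<close>

lemma monotone_enumeration:
  fixes N :: "'a \<Rightarrow> nat"
  assumes inf: "infinite I" and fin: "\<And>n. finite {i\<in>I. N i = n}"
  obtains en :: "nat \<Rightarrow> 'a" where "bij_betw en UNIV I" "mono (\<lambda>j. N (en j))"
proof -
  define L where "L n = {i\<in>I. N i = n}" for n
  have finL: "finite (L n)" for n using fin by (simp add: L_def)
  have "\<forall>n. \<exists>h. bij_betw h (L n) {0..<card (L n)}" using ex_bij_betw_finite_nat[OF finL] by blast
  then obtain h where h: "\<And>n. bij_betw (h n) (L n) {0..<card (L n)}" by metis
  define code where "code i = (\<Sum>n<N i. card (L n)) + h (N i) i" for i
  have hlt: "h (N i) i < card (L (N i))" if "i \<in> I" for i using bij_betwE[OF h[of "N i"]] that by (auto simp: L_def)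
  have less: "code i < code j" if ij: "i \<in> I" "j \<in> I" "N i < N j" for i j
  proof -
    have "code i < (\<Sum>n<Suc (N i). card (L n))" using hlt[OF ij(1)] by (simp add: code_def)
    also have "... \<le> (\<Sum>n<N j. card (L n))" using ij(3) by (intro sum_mono2) auto
    also have "... \<le> code j" by (simp add: code_def)
    finally show ?thesis .
  qed
  have inj: "inj_on code I"
  proof (rule inj_onI)
    fix i j assume ij: "i \<in> I" "j \<in> I" "code i = code j"
    then have N: "N i = N j" using less[of i j] less[of j i] by (metis less_irrefl linorder_neqE_nat)
    then have "h (N i) i = h (N i) j" using ij(3) by (simp add: code_def)
    then show "i = j" using bij_betw_imp_inj_on[OF h[of "N i"]] ij N by (auto simp: L_def inj_on_def)
  qed
  have infC: "infinite (code ` I)" using inf inj by (simp add: finite_image_iff)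
  define en where "en j = the_inv_into I code (enumerate (code ` I) j)" for j
  have b1: "bij_betw (enumerate (code ` I)) UNIV (code ` I)" by (rule bij_enumerate[OF infC])
  have b2: "bij_betw (the_inv_into I code) (code ` I) I" by (rule bij_betw_the_inv_into) (simp add: bij_betw_def inj)
  have bij: "bij_betw en UNIV I" using bij_betw_trans[OF b1 b2] by (simp add: en_def[abs_def] o_def)
  have ce: "code (en j) = enumerate (code ` I) j" for j
    unfolding en_def by (rule f_the_inv_into_f[OF inj]) (rule enumerate_in_set[OF infC])
  have "mono (\<lambda>j. N (en j))"
  proof (rule monoI, rule ccontr)
    fix i j :: nat assume "i \<le> j" "\<not> N (en i) \<le> N (en j)"
    then have "code (en j) < code (en i)" using bij bij_betwE by (intro less) fastforce+
    then have "enumerate (code ` I) j < enumerate (code ` I) i" by (simp add: ce)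
    then show False using strict_mono_enumerate[OF infC] \<open>i \<le> j\<close> by (meson leD strict_mono_less_eq)
  qed
  then show ?thesis by (rule that[OF bij])
qed

text \<open>The eigenvalue without its factor \<open>(2 * pi)^2\<close>, as a natural number, so
  that \<open>monotone_enumeration\<close> can sort by it.\<close>

definition normsq :: "int^3 \<Rightarrow> nat" where
  "normsq k = nat (\<Sum>i\<in>UNIV. (k $ i)^2)"

lemma lam_normsq: "lam k = (2 * pi)^2 * real (normsq k)" by (simp add: lam_def normsq_def sum_nonneg)

lemma finite_normsq: "finite {k. normsq k = n}"
proof (rule finite_subset)
  show "finite {k :: int^3. \<forall>i. k $ i \<in> {- int n..int n}}" by (rule card_lattice_box) auto
  show "{k. normsq k = n} \<subseteq> {k. \<forall>i. k $ i \<in> {- int n..int n}}"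
  proof (intro subsetI CollectI allI)
    fix k i assume "k \<in> {k. normsq k = n}"
    then have s: "(\<Sum>i\<in>UNIV. (k $ i)^2) = int n" by (auto simp: normsq_def sum_nonneg)
    have "\<bar>k $ i\<bar> * 1 \<le> \<bar>k $ i\<bar> * \<bar>k $ i\<bar>" using mult_left_mono[of 1 "\<bar>k $ i\<bar>" "\<bar>k $ i\<bar>"] by (cases "k $ i = 0") auto
    also have "... = (k $ i)^2" by (simp add: power2_eq_square)
    also have "... \<le> (\<Sum>i\<in>UNIV. (k $ i)^2)" by (rule member_le_sum) auto
    finally show "k $ i \<in> {- int n..int n}" using s by auto
  qed
qed

lemma eigen_enum_exists:
  "\<exists>en :: nat \<Rightarrow> (int^3) \<times> bool. bij_betw en UNIV ((UNIV - {0}) \<times> UNIV) \<and> mono (\<lambda>j. normsq (fst (en j)))"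
proof -
  have "infinite (UNIV - {0 :: int^3})" by (rule infinite_remove[OF infinite_UNIV_char_0])
  then have inf: "infinite ((UNIV - {0 :: int^3}) \<times> (UNIV :: bool set))"
    using finite_cartesian_productD1[of "UNIV - {0 :: int^3}" "UNIV :: bool set"] by blast
  have fin: "finite {i \<in> (UNIV - {0 :: int^3}) \<times> (UNIV :: bool set). normsq (fst i) = n}" for n
    by (rule finite_subset[of _ "{k. normsq k = n} \<times> UNIV"]) (auto simp: finite_normsq)
  show ?thesis by (rule monotone_enumeration[OF inf fin]) blast
qed

text \<open>Sorted by \<open>normsq\<close> because \<open>stokes_eigenbasis\<close> asks for a
  monotone sequence of eigenvalues.\<close>

definition eigen_enum :: "nat \<Rightarrow> (int^3) \<times> bool" where
  "eigen_enum = (SOME en. bij_betw en UNIV ((UNIV - {0}) \<times> UNIV) \<and> mono (\<lambda>j. normsq (fst (en j))))"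

lemma eigen_enum: "bij_betw eigen_enum UNIV ((UNIV - {0}) \<times> UNIV)" "mono (\<lambda>j. normsq (fst (eigen_enum j)))"
  using someI_ex[OF eigen_enum_exists] by (auto simp: eigen_enum_def)

lemma eigen_enum_nonzero: "fst (eigen_enum n) \<noteq> 0"
  using bij_betwE[OF eigen_enum(1)] by (metis DiffD2 UNIV_I insertI1 mem_Times_iff)

lemma inj_eigen_enum: "inj eigen_enum"
  using eigen_enum(1) by (rule bij_betw_imp_inj_on)

definition eigval :: "nat \<Rightarrow> real" where
  "eigval n = lam (fst (eigen_enum n))"

definition eigfield :: "nat \<Rightarrow> field" where
  "eigfield n = (\<lambda>x. hartley (fst (eigen_enum n)) x *\<^sub>R case_prod frame (eigen_enum n))"

abbreviation inv_eigval :: "nat \<Rightarrow> real" where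
  "inv_eigval \<equiv> (\<lambda>n. 1 / eigval n)"

lemma eigval_ge_1: "1 \<le> eigval n"
proof -
  let ?k = "fst (eigen_enum n)"
  have "normsq ?k \<noteq> 0"
  proof
    assume "normsq ?k = 0"
    then have "(\<Sum>i\<in>UNIV. (?k $ i)^2) \<le> 0" by (simp add: normsq_def)
    then have "(\<Sum>i\<in>UNIV. (?k $ i)^2) = 0" by (intro antisym sum_nonneg) auto
    then have "?k = 0" by (simp add: sum_nonneg_eq_0_iff vec_eq_iff)
    then show False using eigen_enum_nonzero by blast
  qed
  then have "1 \<le> real (normsq ?k)" by simp
  moreover have "1 \<le> (2 * pi)^2" using pi_ge_two by (intro one_le_power) simp
  ultimately have "1 * 1 \<le> (2 * pi)^2 * real (normsq ?k)" by (intro mult_mono) auto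
  then show ?thesis by (simp add: eigval_def lam_normsq)
qed

lemma eigval_nonneg [simp]: "0 \<le> eigval n" and eigval_pos: "0 < eigval n"
  using eigval_ge_1[of n] by auto

lemma mono_eigval: "mono eigval"
  using eigen_enum(2) unfolding eigval_def lam_normsq mono_def by (auto intro!: mult_left_mono)

lemma eigval_at_top: "filterlim eigval at_top sequentially"
proof (rule filterlim_at_top_mono[OF filterlim_compose[OF filterlim_real_sequentially]])
  show "\<forall>\<^sub>F n in sequentially. real (normsq (fst (eigen_enum n))) \<le> eigval n"
  proof (rule always_eventually, rule allI)
    fix n
    have "1 \<le> (2 * pi)^2" using pi_ge_two by (intro one_le_power) simp
    then have "1 * real (normsq (fst (eigen_enum n))) \<le> eigval n" unfolding eigval_def lam_normsq by (intro mult_right_mono) auto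
    then show "real (normsq (fst (eigen_enum n))) \<le> eigval n" by simp
  qed
  show "filterlim (\<lambda>n. normsq (fst (eigen_enum n))) at_top sequentially" unfolding filterlim_at_top
  proof
    fix Z :: nat
    have "finite {i \<in> (UNIV - {0 :: int^3}) \<times> (UNIV :: bool set). normsq (fst i) < Z}"
      by (rule finite_subset[of _ "(\<Union>n<Z. {k. normsq k = n}) \<times> UNIV"]) (auto simp: finite_normsq)
    then have "finite (eigen_enum -` {i \<in> (UNIV - {0 :: int^3}) \<times> (UNIV :: bool set). normsq (fst i) < Z})"
      by (rule finite_vimageI[OF _ inj_eigen_enum])
    then have "finite {n. \<not> Z \<le> normsq (fst (eigen_enum n))}"
      by (rule rev_finite_subset) (use eigen_enum_nonzero in \<open>auto simp: mem_Times_iff\<close>)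
    then show "\<forall>\<^sub>F n in sequentially. Z \<le> normsq (fst (eigen_enum n))"
      by (simp add: eventually_cofinite[symmetric] cofinite_eq_sequentially)
  qed
qed

lemma eigfield_component: "(\<lambda>x. eigfield n x $ j) \<in> trig_poly"
proof -
  have "(\<lambda>x. eigfield n x $ j) = (\<lambda>x. case_prod frame (eigen_enum n) $ j * hartley (fst (eigen_enum n)) x)"
    by (simp add: eigfield_def fun_eq_iff)
  then show ?thesis by (simp add: trig_scale trig_hartley)
qed

lemma eigfield_L2: "eigfield n \<in> L2" by (intro L2_fieldI trig_sq_int trig_periodic eigfield_component)

lemma FC_eigfield: "FC (eigfield n) k = (if k = fst (eigen_enum n) then case_prod frame (eigen_enum n) else 0)"
proof -
  have "(\<lambda>x. eigfield n x $ j) = (\<lambda>x. case_prod frame (eigen_enum n) $ j * hartley (fst (eigen_enum n)) x)" for j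
    by (simp add: eigfield_def fun_eq_iff)
  then show ?thesis by (simp add: FC_def vec_eq_iff hc_scale hc_hartley)
qed

lemma divfree_iff: "divfree u \<longleftrightarrow> FC u 0 = 0 \<and> (\<forall>k. kvec k \<bullet> FC u k = 0)"
  by (simp add: divfree_def inner_vec_def)

lemma eigfield_divfree: "divfree (eigfield n)"
  unfolding divfree_iff FC_eigfield using eigen_enum_nonzero[of n] frame_props(2)[OF eigen_enum_nonzero[of n]]
  by (auto simp: case_prod_unfold)

lemma eigfield_H: "eigfield n \<in> H" by (simp add: H_iff eigfield_L2 eigfield_divfree)

lemma eigfield_Sobolev: "eigfield n \<in> Sobolev s" by (intro smooth_Sobolev trig_field_smooth eigfield_component)

lemma eigfield_V: "eigfield n \<in> V s" by (simp add: V_iff eigfield_Sobolev eigfield_divfree)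

section \<open>Coefficients with respect to the eigenfields\<close>

definition cf :: "field \<Rightarrow> nat \<Rightarrow> real" where
  "cf u n = L2_inner u (eigfield n)"

lemma cf_eq:
  assumes "u \<in> L2"
  shows "cf u n = FC u (fst (eigen_enum n)) \<bullet> case_prod frame (eigen_enum n)"
proof -
  let ?k = "fst (eigen_enum n)" and ?e = "case_prod frame (eigen_enum n)"
  have "(LINT x|torus. u x $ j * eigfield n x $ j) = FC u ?k $ j * ?e $ j" for j
  proof -
    have "(LINT x|torus. u x $ j * eigfield n x $ j) = (LINT x|torus. (u x $ j * hartley ?k x) * ?e $ j)"
      by (simp add: eigfield_def mult.assoc)
    then show ?thesis by (simp add: FC_def hc_def)
  qed
  then show ?thesis by (simp add: cf_def L2_inner_eq[OF assms eigfield_L2] inner_vec_def)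
qed

lemma cf_add: "u \<in> L2 \<Longrightarrow> v \<in> L2 \<Longrightarrow> cf (\<lambda>x. u x + v x) n = cf u n + cf v n"
  by (simp add: cf_eq L2_field_add FC_add inner_add_left)

lemma cf_diff: "u \<in> L2 \<Longrightarrow> v \<in> L2 \<Longrightarrow> cf (u - v) n = cf u n - cf v n"
  by (simp add: cf_eq L2_field_diff FC_diff inner_diff_left)

lemma cf_scale: "u \<in> L2 \<Longrightarrow> cf (\<lambda>x. c *\<^sub>R u x) n = c * cf u n" by (simp add: cf_eq L2_field_scale FC_scale)

lemma cf_sum: "(\<And>i. i \<in> I \<Longrightarrow> u i \<in> L2) \<Longrightarrow> cf (\<lambda>x. \<Sum>i\<in>I. u i x) n = (\<Sum>i\<in>I. cf (u i) n)"
proof (induction I rule: infinite_finite_induct)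
  case (insert i I)
  then show ?case by (simp add: cf_add L2_field_sum)
qed (simp_all add: cf_def L2_inner_def)

lemma cf_eigfield: "cf (eigfield m) n = (if m = n then 1 else 0)"
proof (cases "fst (eigen_enum m) = fst (eigen_enum n)")
  case True
  have "m = n \<longleftrightarrow> snd (eigen_enum m) = snd (eigen_enum n)" using True injD[OF inj_eigen_enum, of m n] by (auto simp: prod_eq_iff)
  then show ?thesis
    using True frame_props(1)[OF eigen_enum_nonzero[of n]] by (simp add: cf_eq[OF eigfield_L2] FC_eigfield case_prod_unfold)
next
  case False
  then show ?thesis by (auto simp: cf_eq[OF eigfield_L2] FC_eigfield)
qed

text \<open>Regroups the enumeration by frequency, with two polarisations each; the assumption at
  frequency 0 fills in the one frequency that the enumeration leaves out.\<close>

lemma suminf_eigen_enum: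
  fixes G :: "(int^3) \<times> bool \<Rightarrow> ennreal"
  assumes "\<And>b. G (0, b) = 0"
  shows "(\<Sum>n. G (eigen_enum n)) = (\<integral>\<^sup>+k. G (k, True) + G (k, False) \<partial>count_space UNIV)"
proof -
  have "(\<Sum>n. G (eigen_enum n)) = (\<integral>\<^sup>+n. G (eigen_enum n) \<partial>count_space UNIV)" by (simp add: nn_integral_count_space_nat)
  also have "... = (\<integral>\<^sup>+i. G i \<partial>count_space ((UNIV - {0}) \<times> UNIV))" by (rule nn_integral_bij_count_space[OF eigen_enum(1)])
  also have "... = (\<integral>\<^sup>+i. G i \<partial>count_space UNIV)" by (rule nn_integral_count_space_eq) (use assms in auto)
  also have "... = (\<integral>\<^sup>+k. \<integral>\<^sup>+b. G (k, b) \<partial>count_space UNIV \<partial>count_space UNIV)" by (rule nn_integral_fst_count_space[symmetric])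
  also have "... = (\<integral>\<^sup>+k. G (k, True) + G (k, False) \<partial>count_space UNIV)"
    by (intro nn_integral_cong) (simp add: nn_integral_count_space_finite UNIV_bool add.commute)
  finally show ?thesis .
qed

lemma nn_integral_lattice: "(\<integral>\<^sup>+k. f k \<partial>count_space UNIV) = (\<Sum>n. f (lattice_enum n))"
proof -
  have "(\<integral>\<^sup>+n. f (lattice_enum n) \<partial>count_space UNIV) = (\<integral>\<^sup>+k. f k \<partial>count_space UNIV)"
    by (rule nn_integral_bij_count_space[OF lattice_enum_bij])
  then show ?thesis by (simp add: nn_integral_count_space_nat)
qed

text \<open>At each frequency the coefficient vector lies in the plane spanned by the frame, where
  Pythagoras applies. The weight depends on the frequency alone and is shared by both
  polarisations.\<close>

lemma sqn_cf:
  assumes u: "u \<in> L2" "divfree u" and g: "\<And>k. 0 \<le> g k"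
  shows "sqn (\<lambda>n. g (eigval n)) (cf u) = (\<integral>\<^sup>+k. ennreal (g (lam k) * (norm (FC u k))^2) \<partial>count_space UNIV)"
proof -
  have F0: "FC u 0 = 0" and Fk: "kvec k \<bullet> FC u k = 0" for k using u(2) by (auto simp: divfree_iff)
  let ?G = "\<lambda>i. ennreal (g (lam (fst i)) * (FC u (fst i) \<bullet> case_prod frame i)^2)"
  have "sqn (\<lambda>n. g (eigval n)) (cf u) = (\<Sum>n. ?G (eigen_enum n))" by (simp add: sqn_def cf_eq[OF u(1)] eigval_def)
  also have "... = (\<integral>\<^sup>+k. ?G (k, True) + ?G (k, False) \<partial>count_space UNIV)" by (rule suminf_eigen_enum) (simp add: F0)
  also have "... = (\<integral>\<^sup>+k. ennreal (g (lam k) * (norm (FC u k))^2) \<partial>count_space UNIV)"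
  proof (intro nn_integral_cong)
    fix k :: "int^3"
    have "(norm (FC u k))^2 = (FC u k \<bullet> frame k True)^2 + (FC u k \<bullet> frame k False)^2"
    proof (cases "k = 0")
      case True
      then show ?thesis by (simp add: F0)
    next
      case False
      have "FC u k \<bullet> FC u k = FC u k \<bullet> ((FC u k \<bullet> frame k True) *\<^sub>R frame k True + (FC u k \<bullet> frame k False) *\<^sub>R frame k False)"
        using frame_props(3)[OF False Fk] by simp
      then show ?thesis unfolding power2_norm_eq_inner by (simp add: inner_add_right power2_eq_square)
    qed
    then have "g (lam k) * (norm (FC u k))^2 = g (lam k) * (FC u k \<bullet> frame k True)^2 + g (lam k) * (FC u k \<bullet> frame k False)^2"
      by (simp add: distrib_left)
    then show "?G (k, True) + ?G (k, False) = ennreal (g (lam k) * (norm (FC u k))^2)" using g[of "lam k"] by (simp add: ennreal_plus)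
  qed
  finally show ?thesis .
qed

lemma suminf_ennreal_finite_iff:
  assumes "\<And>n. 0 \<le> a n"
  shows "(\<Sum>n. ennreal (a n)) < \<infinity> \<longleftrightarrow> summable a"
proof -
  have "sqn a (\<lambda>n. 1) = (\<Sum>n. ennreal (a n))" unfolding sqn_def power_one mult_1_right ..
  moreover have "(\<lambda>n. a n * 1^2) = a" unfolding power_one mult_1_right ..
  moreover have "sqn a (\<lambda>n. 1) < \<infinity> \<longleftrightarrow> summable (\<lambda>n. a n * 1^2)" by (rule sqn_finite_iff[OF assms])
  ultimately show ?thesis by (simp only:)
qed

abbreviation sw :: "real \<Rightarrow> nat \<Rightarrow> real" where
  "sw s n \<equiv> (1 + eigval n) powr s"

lemma Sobolev_cf:
  assumes u: "u \<in> L2" "divfree u"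
  shows "u \<in> Sobolev s \<longleftrightarrow> sqn (sw s) (cf u) < \<infinity>"
    "u \<in> Sobolev s \<Longrightarrow> sqn (sw s) (cf u) = ennreal ((Sobolev_norm s u)^2)"
proof -
  let ?a = "\<lambda>k. sobolev_weight s k * (norm (FC u k))^2"
  have e: "sqn (sw s) (cf u) = (\<Sum>n. ennreal (?a (lattice_enum n)))" unfolding sobolev_weight_eq
    by (rule trans[OF sqn_cf[OF u, of "\<lambda>x. (1 + x) powr s"] nn_integral_lattice]) simp
  have fin: "(\<Sum>n. ennreal (?a (lattice_enum n))) < \<infinity> \<longleftrightarrow> summable (\<lambda>n. ?a (lattice_enum n))" by (rule suminf_ennreal_finite_iff) simp
  have lat: "?a summable_on UNIV \<longleftrightarrow> summable (\<lambda>n. ?a (lattice_enum n))" by (rule summable_on_lattice_iff) simp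
  show iff: "u \<in> Sobolev s \<longleftrightarrow> sqn (sw s) (cf u) < \<infinity>" by (simp only: Sobolev_iff lat e fin u(1) simp_thms)
  show "sqn (sw s) (cf u) = ennreal ((Sobolev_norm s u)^2)" if us: "u \<in> Sobolev s"
  proof -
    have s: "summable (\<lambda>n. ?a (lattice_enum n))" using us iff unfolding e fin by simp
    have "(?a has_sum (\<Sum>n. ?a (lattice_enum n))) UNIV" using summable_sums[OF s] by (subst has_sum_lattice_iff) auto
    then have "(\<Sum>\<^sub>\<infinity>k. ?a k) = (\<Sum>n. ?a (lattice_enum n))" by (rule infsumI)
    then show ?thesis unfolding e Sobolev_norm_eq[OF us] using s by (subst suminf_ennreal2) (auto simp: suminf_nonneg)
  qed
qed

lemma V_cf: "u \<in> V s \<longleftrightarrow> u \<in> H \<and> sqn (sw s) (cf u) < \<infinity>"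
  using Sobolev_cf(1)[of u s] by (auto simp: V_iff H_iff Sobolev_iff)

lemma V_subset_H: "u \<in> V s \<Longrightarrow> u \<in> H" by (simp add: V_cf)

lemma HD: "u \<in> H \<Longrightarrow> u \<in> L2" "u \<in> H \<Longrightarrow> divfree u" by (auto simp: H_iff)

lemma Sobolev_norm_cf:
  assumes "u \<in> V s"
  shows "sqn (sw s) (cf u) = ennreal ((Sobolev_norm s u)^2)" "0 \<le> Sobolev_norm s u"
proof -
  show "sqn (sw s) (cf u) = ennreal ((Sobolev_norm s u)^2)" using Sobolev_cf(2)[of u s] assms by (auto simp: V_iff Sobolev_iff)
  show "0 \<le> Sobolev_norm s u" unfolding Sobolev_norm_def by (intro real_sqrt_ge_zero infsum_nonneg) auto
qed

lemma sw_0: "sw 0 = (\<lambda>n. 1)"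
  using eigval_ge_1 by (auto simp: fun_eq_iff) (metis add_nonneg_pos eigval_nonneg less_irrefl zero_less_one add.commute)

lemma L2_inner_self_cf:
  assumes "u \<in> H"
  shows "ennreal (L2_inner u u) = sqn (\<lambda>n. 1) (cf u)" "sqn (\<lambda>n. 1) (cf u) < \<infinity>"
proof -
  have S: "u \<in> Sobolev 0" using HD(1)[OF assms] by (simp add: L2_eq_Sobolev_0)
  have "L2_inner u u = (Sobolev_norm 0 u)^2"
    using L2_norm_eq[OF HD(1)[OF assms]] has_sum_nonneg[OF FC_square_has_sum[OF HD(1)[OF assms]]]
    by (simp add: L2_norm_def) (metis real_sqrt_pow2)
  then show "ennreal (L2_inner u u) = sqn (\<lambda>n. 1) (cf u)"
    using Sobolev_cf(2)[OF HD(1)[OF assms] HD(2)[OF assms] S, unfolded sw_0] by simp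
  then show "sqn (\<lambda>n. 1) (cf u) < \<infinity>" by (metis ennreal_less_top infinity_ennreal_def)
qed

lemma H_add: "u \<in> H \<Longrightarrow> v \<in> H \<Longrightarrow> (\<lambda>x. u x + v x) \<in> H" by (simp add: H_iff L2_field_add divfree_add)

lemma H_scale: "u \<in> H \<Longrightarrow> (\<lambda>x. c *\<^sub>R u x) \<in> H" by (simp add: H_iff L2_field_scale divfree_scale)

lemma H_diff: "u \<in> H \<Longrightarrow> v \<in> H \<Longrightarrow> u - v \<in> H"
  using H_add[OF _ H_scale[of v "- 1"], of u] by (simp add: fun_diff_def)

lemma H_sum: "(\<And>i. i \<in> I \<Longrightarrow> u i \<in> H) \<Longrightarrow> (\<lambda>x. \<Sum>i\<in>I. u i x) \<in> H"
proof (induction I rule: infinite_finite_induct)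
  case (insert i I)
  then show ?case by (simp add: H_add)
qed (use H_scale[OF eigfield_H, of 0] in simp_all)

lemma cf_square_sums:
  assumes "u \<in> H"
  shows "(\<lambda>n. (cf u n)^2) sums L2_inner u u"
proof -
  have s: "summable (\<lambda>n. (cf u n)^2)" using L2_inner_self_cf(2)[OF assms] sqn_finite_iff[of "\<lambda>n. 1" "cf u"] by simp
  have "ennreal (L2_inner u u) = ennreal (\<Sum>n. (cf u n)^2)"
    using L2_inner_self_cf(1)[OF assms] sqn_eq_suminf[of "\<lambda>n. 1" "cf u"] s by simp
  moreover have "0 \<le> L2_inner u u" by (simp add: L2_inner_def)
  ultimately have "L2_inner u u = (\<Sum>n. (cf u n)^2)" using s by (subst (asm) ennreal_inj) (auto simp: suminf_nonneg)
  then show ?thesis using s by (simp add: summable_sums)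
qed

lemma L2_inner_cf:
  assumes u: "u \<in> H" and v: "v \<in> H"
  shows "(\<lambda>n. cf u n * cf v n) sums L2_inner u v"
proof -
  let ?p = "\<lambda>x. u x + v x"
  have p: "?p \<in> H" by (rule H_add[OF u v])
  have "(\<lambda>n. ((cf ?p n)^2 - (cf u n)^2 - (cf v n)^2) / 2) sums ((L2_inner ?p ?p - L2_inner u u - L2_inner v v) / 2)"
    by (intro sums_divide sums_diff cf_square_sums p u v)
  moreover have "((cf ?p n)^2 - (cf u n)^2 - (cf v n)^2) / 2 = cf u n * cf v n" for n using HD u v by (simp add: cf_add power2_sum)
  moreover have "(L2_inner ?p ?p - L2_inner u u - L2_inner v v) / 2 = L2_inner u v"
  proof -
    have i: "integrable torus (\<lambda>x. u x \<bullet> v x)" if "u \<in> L2" "v \<in> L2" for u v :: field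
      unfolding inner_vec_def using sq_int_mult_integrable[OF L2_component(1)[OF that(1)] L2_component(1)[OF that(2)]] by simp
    note uL = HD(1)[OF u] and vL = HD(1)[OF v]
    have "L2_inner ?p ?p = (LINT x|torus. u x \<bullet> u x + 2 * (u x \<bullet> v x) + v x \<bullet> v x)"
      unfolding L2_inner_def by (intro Bochner_Integration.integral_cong) (auto simp: inner_add_left inner_add_right inner_commute)
    also have "... = L2_inner u u + 2 * L2_inner u v + L2_inner v v"
      unfolding L2_inner_def using i[OF uL uL] i[OF uL vL] i[OF vL vL] by simp
    finally show ?thesis by simp
  qed
  ultimately show ?thesis by simp
qed

lemma H_eq_AE:
  assumes "u \<in> H" "v \<in> H" "\<And>n. cf u n = cf v n"
  shows "AE x in torus. u x = v x"
proof (rule FC_eq_AE)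
  have d: "u - v \<in> H" by (rule H_diff[OF assms(1,2)])
  have "(\<lambda>n. (cf (u - v) n)^2) sums L2_inner (u - v) (u - v)" by (rule cf_square_sums[OF d])
  then have z: "L2_inner (u - v) (u - v) = 0" using assms HD by (simp add: cf_diff sums_iff)
  show "FC u k = FC v k" for k
  proof -
    have "((\<lambda>k. (norm (FC (u - v) k))^2) has_sum 0) UNIV" using FC_square_has_sum[OF HD(1)[OF d]] z by simp
    from finite_sum_le_has_sum[OF this, of "{k}"] have "norm (FC (u - v) k) = 0" by simp
    then show ?thesis using assms HD by (simp add: FC_diff)
  qed
qed (use assms HD in auto)

lemma cf_cong_AE:
  assumes "AE x in torus. u x = v x" "u \<in> L2" "v \<in> L2"
  shows "cf u n = cf v n"
  using FC_cong_AE[OF assms] by (simp add: cf_eq assms)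

text \<open>The two scalars at a frequency are combined into a vector orthogonal to it, and
  Riesz-Fischer is applied to each of the three components.\<close>

theorem synthesis:
  assumes c: "sqn (\<lambda>n. 1) c < \<infinity>"
  obtains u where "u \<in> H" "cf u = c"
proof -
  define code where "code = the_inv eigen_enum"
  have code: "code (eigen_enum n) = n" for n unfolding code_def by (rule the_inv_f_f[OF inj_eigen_enum])
  define cc where "cc i = (if fst i = 0 then 0 else c (code i))" for i :: "(int^3) \<times> bool"
  have cc: "cc (eigen_enum n) = c n" for n using eigen_enum_nonzero by (simp add: cc_def code)
  define a where "a k = (if k = 0 then 0 else cc (k, True) *\<^sub>R frame k True + cc (k, False) *\<^sub>R frame k False)" for k
  have na: "(norm (a k))^2 = (cc (k, True))^2 + (cc (k, False))^2" for k
  proof (cases "k = 0")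
    case False
    then show ?thesis
      using frame_props(1)[OF False, of True True] frame_props(1)[OF False, of False False] frame_props(1)[OF False, of True False] frame_props(1)[OF False, of False True]
      unfolding power2_norm_eq_inner by (simp add: a_def inner_add_left inner_add_right power2_eq_square)
  qed (simp add: a_def cc_def)
  have "(\<Sum>n. ennreal ((norm (a (lattice_enum n)))^2)) = (\<integral>\<^sup>+k. ennreal ((norm (a k))^2) \<partial>count_space UNIV)"
    by (rule nn_integral_lattice[symmetric])
  also have "... = (\<integral>\<^sup>+k. ennreal ((cc (k, True))^2) + ennreal ((cc (k, False))^2) \<partial>count_space UNIV)"
    unfolding na by (intro nn_integral_cong) (simp add: ennreal_plus)
  also have "... = (\<Sum>n. ennreal ((cc (eigen_enum n))^2))" by (rule suminf_eigen_enum[symmetric]) (simp add: cc_def)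
  also have "... < \<infinity>" using c by (simp add: cc sqn_def)
  finally have "summable (\<lambda>n. (norm (a (lattice_enum n)))^2)"
    using sqn_finite_iff[of "\<lambda>n. 1" "\<lambda>n. norm (a (lattice_enum n))"] by (simp add: sqn_def)
  then have s: "(\<lambda>k. (norm (a k))^2) summable_on UNIV" by (subst summable_on_lattice_iff) auto
  have "\<exists>f. sq_int torus f \<and> periodic f \<and> (\<forall>k. hc f k = a k $ j)" for j
  proof -
    have "(\<lambda>k. (a k $ j)^2) summable_on UNIV"
      by (rule summable_on_comparison_test[OF s]) (auto simp: abs_le_square_iff[symmetric] component_le_norm_cart)
    then show ?thesis by (rule Riesz_Fischer) blast
  qed
  then obtain f where f: "\<And>j. sq_int torus (f j)" "\<And>j. periodic (f j)" "\<And>j k. hc (f j) k = a k $ j" by metis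
  define u :: field where "u x = (\<chi> j. f j x)" for x
  have uL: "u \<in> L2" by (intro L2_fieldI) (simp_all add: u_def f)
  have FCu: "FC u k = a k" for k by (simp add: FC_def u_def f vec_eq_iff)
  have "divfree u" unfolding divfree_iff FCu using frame_props(2) by (auto simp: a_def inner_add_right)
  then have uH: "u \<in> H" using uL by (simp add: H_iff)
  have "cf u n = c n" for n
  proof -
    obtain k b where kb: "eigen_enum n = (k, b)" by fastforce
    have k: "k \<noteq> 0" using eigen_enum_nonzero[of n] kb by simp
    have "cf u n = a k \<bullet> frame k b" by (simp add: cf_eq[OF uL] FCu kb)
    also have "... = cc (k, b)" using frame_props(1)[OF k] k by (cases b) (simp_all add: a_def inner_add_left)
    also have "... = c n" using cc[of n] kb by simp
    finally show ?thesis .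
  qed
  then show ?thesis using that[OF uH] by blast
qed

lemma cf_partial_sum:
  "cf (\<lambda>x. \<Sum>k<N. c k *\<^sub>R eigfield k x) n = (if n < N then c n else 0)"
proof -
  have "cf (\<lambda>x. \<Sum>k<N. c k *\<^sub>R eigfield k x) n = (\<Sum>k<N. c k * (if k = n then 1 else 0))"
    by (subst cf_sum) (simp_all add: L2_field_scale eigfield_L2 cf_scale cf_eigfield)
  also have "... = (if n < N then c n else 0)" by (simp add: if_distrib cong: if_cong)
  finally show ?thesis .
qed

lemma partial_sum_H: "(\<lambda>x. \<Sum>k<N. c k *\<^sub>R eigfield k x) \<in> H" by (intro H_sum H_scale eigfield_H)

lemma eigfield_expansion:
  assumes u: "u \<in> H"
  shows "(\<lambda>N. L2_norm (\<lambda>x. u x - (\<Sum>k<N. cf u k *\<^sub>R eigfield k x))) \<longlonglongrightarrow> 0"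
proof -
  let ?S = "\<lambda>N. \<lambda>x. \<Sum>k<N. cf u k *\<^sub>R eigfield k x"
  have "L2_inner (u - ?S N) (u - ?S N) = (\<Sum>n. (cf u (n + N))^2)" for N
  proof -
    have d: "cf (u - ?S N) n = (if n < N then 0 else cf u n)" for n
      using HD(1)[OF u] HD(1)[OF partial_sum_H] by (simp add: cf_diff cf_partial_sum)
    have s: "(\<lambda>n. (cf (u - ?S N) n)^2) sums L2_inner (u - ?S N) (u - ?S N)" by (intro cf_square_sums H_diff u partial_sum_H)
    have "(\<lambda>n. (cf (u - ?S N) (n + N))^2) sums (L2_inner (u - ?S N) (u - ?S N) - (\<Sum>n<N. (cf (u - ?S N) n)^2))"
      by (rule sums_split_initial_segment[OF s])
    then show ?thesis by (simp add: d sums_iff)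
  qed
  moreover have "(\<lambda>N. \<Sum>n. (cf u (n + N))^2) \<longlonglongrightarrow> 0" using suminf_exist_split2[OF sums_summable[OF cf_square_sums[OF u]]] by simp
  ultimately have "(\<lambda>N. sqrt (L2_inner (u - ?S N) (u - ?S N))) \<longlonglongrightarrow> sqrt 0" by (intro tendsto_real_sqrt) simp
  then show ?thesis by (simp add: L2_norm_def fun_diff_def)
qed

section \<open>Weak derivatives and powers of the Stokes operator\<close>

definition weakly_diff :: "(real^3 \<Rightarrow> real) \<Rightarrow> bool" where
  "weakly_diff f \<longleftrightarrow> sq_int torus f \<and> (\<lambda>k. lam k * (hc f k)^2) summable_on UNIV"

text \<open>Hartley functions are admissible test functions, which yields the coefficients;
  conversely, Parseval turns the coefficient identity into the identity for every smooth test
  function.\<close>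

lemma weak_derivative_iff:
  assumes f: "sq_int torus f" and g: "sq_int torus g"
  shows "(\<forall>\<psi>. periodic \<psi> \<and> smooth \<psi> \<longrightarrow> (LINT x|torus. f x * partial i \<psi> x) = - (LINT x|torus. g x * \<psi> x))
    \<longleftrightarrow> (\<forall>k. hc g k = - (2 * pi * of_int (k $ i)) * hc f (- k))" (is "?L \<longleftrightarrow> ?R")
proof
  assume L: ?L
  show ?R
  proof
    fix k
    have "(LINT x|torus. f x * partial i (hartley k) x) = - hc g k"
      using L periodic_hartley trig_smooth[OF trig_hartley] by (simp add: hc_def)
    moreover have "(LINT x|torus. f x * partial i (hartley k) x) = (LINT x|torus. 2 * pi * of_int (k $ i) * (f x * hartley (- k) x))"
      by (intro Bochner_Integration.integral_cong) (auto simp: partial_hartley)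
    moreover have "... = 2 * pi * of_int (k $ i) * hc f (- k)" by (simp add: hc_def)
    ultimately show "hc g k = - (2 * pi * of_int (k $ i)) * hc f (- k)" by simp
  qed
next
  assume R: ?R
  show ?L
  proof (intro allI impI)
    fix \<psi> :: "real^3 \<Rightarrow> real" assume "periodic \<psi> \<and> smooth \<psi>"
    then have p: "smooth \<psi>" "periodic \<psi>" by auto
    have 1: "((\<lambda>k. hc f k * hc (partial i \<psi>) k) has_sum (LINT x|torus. f x * partial i \<psi> x)) UNIV"
      by (intro Parseval f smooth_sq_int smoothD(2) p)
    have "((\<lambda>k. hc g k * hc \<psi> k) has_sum (LINT x|torus. g x * \<psi> x)) UNIV" by (intro Parseval g smooth_sq_int p)
    then have "((\<lambda>k. hc g (- k) * hc \<psi> (- k)) has_sum (LINT x|torus. g x * \<psi> x)) UNIV"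
      by (subst has_sum_reindex_bij_betw[OF bij_uminus_lattice, of "\<lambda>k. hc g k * hc \<psi> k"])
    then have "((\<lambda>k. - (hc g (- k) * hc \<psi> (- k))) has_sum - (LINT x|torus. g x * \<psi> x)) UNIV" by (rule has_sum_uminusI)
    moreover have "- (hc g (- k) * hc \<psi> (- k)) = hc f k * hc (partial i \<psi>) k" for k using R by (simp add: hc_partial[OF p])
    ultimately show "(LINT x|torus. f x * partial i \<psi> x) = - (LINT x|torus. g x * \<psi> x)" using infsumI[OF 1] infsumI by force
  qed
qed

text \<open>The function demanded by the choice in \<open>weak_partial\<close> exists by
  Riesz-Fischer, because \<open>lam k\<close> dominates the square of each factor
  \<open>2 * pi * of_int (k $ i)\<close>.\<close>

lemma weak_partial:
  assumes f: "weakly_diff f"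
  shows "sq_int torus (weak_partial i f)" "periodic (weak_partial i f)"
    "hc (weak_partial i f) k = - (2 * pi * of_int (k $ i)) * hc f (- k)"
    "periodic \<psi> \<Longrightarrow> smooth \<psi> \<Longrightarrow> (LINT x|torus. f x * partial i \<psi> x) = - (LINT x|torus. weak_partial i f x * \<psi> x)"
proof -
  have fs: "sq_int torus f" using f by (simp add: weakly_diff_def)
  have "(\<lambda>k. (- (2 * pi * of_int (k $ i)) * hc f (- k))^2) summable_on UNIV"
  proof (rule summable_on_comparison_test)
    show "(\<lambda>k. lam (- k) * (hc f (- k))^2) summable_on UNIV"
      using f summable_on_uminus_lattice_iff[of "\<lambda>k. lam k * (hc f k)^2"] by (simp add: weakly_diff_def)
    show "(- (2 * pi * of_int (k $ i)) * hc f (- k))^2 \<le> lam (- k) * (hc f (- k))^2" for k :: "int^3"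
    proof -
      have "(real_of_int (k $ i))^2 \<le> (\<Sum>i\<in>UNIV. (of_int (k $ i))^2)" by (rule member_le_sum) auto
      then have "(2 * pi)^2 * (real_of_int (k $ i))^2 \<le> lam k" unfolding lam_def by (intro mult_left_mono) auto
      then show ?thesis unfolding lam_uminus power_mult_distrib power2_minus by (intro mult_right_mono) (auto simp: power_mult_distrib)
    qed
  qed auto
  then obtain g where g: "sq_int torus g" "periodic g" "\<And>k. hc g k = - (2 * pi * of_int (k $ i)) * hc f (- k)"
    by (rule Riesz_Fischer) blast
  then have "\<exists>g. g \<in> L2 \<and> (\<forall>\<psi>. periodic \<psi> \<and> smooth \<psi> \<longrightarrow> (LINT x|torus. f x * partial i \<psi> x) = - (LINT x|torus. g x * \<psi> x))"
    using weak_derivative_iff[OF fs g(1)] by (auto simp: L2_scalar_iff)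
  from someI_ex[OF this] have w: "weak_partial i f \<in> L2"
    "\<forall>\<psi>. periodic \<psi> \<and> smooth \<psi> \<longrightarrow> (LINT x|torus. f x * partial i \<psi> x) = - (LINT x|torus. weak_partial i f x * \<psi> x)"
    unfolding weak_partial_def by blast+
  show ws: "sq_int torus (weak_partial i f)" "periodic (weak_partial i f)" using w(1) by (auto simp: L2_scalar_iff)
  show "hc (weak_partial i f) k = - (2 * pi * of_int (k $ i)) * hc f (- k)" using weak_derivative_iff[OF fs ws(1)] w(2) by blast
  show "(LINT x|torus. f x * partial i \<psi> x) = - (LINT x|torus. weak_partial i f x * \<psi> x)" if "periodic \<psi>" "smooth \<psi>"
    using w(2) that by blast
qed

lemma Sobolev_component:
  assumes "u \<in> Sobolev s"
  shows "(\<lambda>k. (1 + lam k) powr s * (hc (coord u j) k)^2) summable_on UNIV"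
proof (rule summable_on_comparison_test)
  show "(\<lambda>k. sobolev_weight s k * (norm (FC u k))^2) summable_on UNIV" using assms by (simp add: Sobolev_iff)
  show "(1 + lam k) powr s * (hc (coord u j) k)^2 \<le> sobolev_weight s k * (norm (FC u k))^2" for k unfolding sobolev_weight_eq
    using component_le_norm_cart[of "FC u k" j] by (intro mult_left_mono) (auto simp: FC_def abs_le_square_iff[symmetric])
qed auto

lemma Sobolev_weakly_diff:
  assumes u: "u \<in> Sobolev s" "1 \<le> s"
  shows "weakly_diff (coord u j)"
proof -
  have "(\<lambda>k. lam k * (hc (coord u j) k)^2) summable_on UNIV"
  proof (rule summable_on_comparison_test[OF Sobolev_component[OF u(1)]])
    fix k
    have "lam k \<le> (1 + lam k) powr 1" using lam_nonneg[of k] by simp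
    also have "... \<le> (1 + lam k) powr s" using u(2) lam_nonneg[of k] by (intro powr_mono) auto
    finally show "lam k * (hc (coord u j) k)^2 \<le> (1 + lam k) powr s * (hc (coord u j) k)^2" by (intro mult_right_mono) auto
  qed auto
  then show ?thesis using u(1) L2_component by (auto simp: weakly_diff_def Sobolev_iff)
qed

section \<open>The Stokes operator in coefficients\<close>

lemma laplacian_FC:
  assumes u: "u \<in> Sobolev 2"
  shows "laplacian u \<in> L2" "FC (laplacian u) k = - lam k *\<^sub>R FC u k"
proof -
  let ?u = "\<lambda>j x. u x $ j"
  have d1: "weakly_diff (?u j)" for j by (rule Sobolev_weakly_diff[OF u]) simp
  have d2: "weakly_diff (weak_partial i (?u j))" for i j unfolding weakly_diff_def
  proof
    show "sq_int torus (weak_partial i (?u j))" by (rule weak_partial(1)[OF d1])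
    have s: "(\<lambda>k. (1 + lam (- k)) powr 2 * (hc (?u j) (- k))^2) summable_on UNIV"
      using Sobolev_component[OF u, of j] summable_on_uminus_lattice_iff[of "\<lambda>k. (1 + lam k) powr 2 * (hc (?u j) k)^2"] by simp
    show "(\<lambda>k. lam k * (hc (weak_partial i (?u j)) k)^2) summable_on UNIV"
    proof (rule summable_on_comparison_test[OF s])
      fix k :: "int^3"
      have "(real_of_int (k $ i))^2 \<le> (\<Sum>i\<in>UNIV. (of_int (k $ i))^2)" by (rule member_le_sum) auto
      then have a: "(2 * pi * real_of_int (k $ i))^2 \<le> lam k" unfolding lam_def power_mult_distrib[of "2 * pi"] by (intro mult_left_mono) auto
      have "lam k * (2 * pi * real_of_int (k $ i))^2 \<le> lam k * lam k" by (intro mult_left_mono a) auto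
      also have "... \<le> (1 + lam k) * (1 + lam k)" by (intro mult_mono) auto
      also have "... = (1 + lam k) powr 2" using one_plus_lam_pos[of k] by (simp add: power2_eq_square)
      finally have "lam k * (2 * pi * real_of_int (k $ i))^2 * (hc (?u j) (- k))^2 \<le> (1 + lam k) powr 2 * (hc (?u j) (- k))^2"
        by (intro mult_right_mono) auto
      then show "lam k * (hc (weak_partial i (?u j)) k)^2 \<le> (1 + lam (- k)) powr 2 * (hc (?u j) (- k))^2"
        unfolding weak_partial(3)[OF d1] lam_uminus by (simp add: power_mult_distrib mult.assoc)
    qed auto
  qed
  note w = weak_partial[OF d2]
  have c: "(\<lambda>x. laplacian u x $ j) = (\<lambda>x. \<Sum>i\<in>UNIV. weak_partial i (weak_partial i (?u j)) x)" for j by (simp add: laplacian_def)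
  have ps: "periodic (\<lambda>x. \<Sum>i\<in>UNIV. weak_partial i (weak_partial i (?u j)) x)" for j using w(2) by (simp add: periodic_def)
  show "laplacian u \<in> L2" by (intro L2_fieldI) (unfold c, intro sq_int_sum w(1), rule ps)
  have "FC (laplacian u) k $ j = - lam k * FC u k $ j" for j
  proof -
    have "FC (laplacian u) k $ j = (\<Sum>i\<in>UNIV. hc (weak_partial i (weak_partial i (?u j))) k)"
      unfolding FC_def vec_lambda_beta c by (rule hc_sum) (rule w(1))
    also have "... = (\<Sum>i\<in>UNIV. - ((2 * pi * of_int (k $ i))^2 * hc (?u j) k))"
      unfolding w(3) weak_partial(3)[OF d1] by (simp add: power2_eq_square mult_ac)
    also have "... = - lam k * FC u k $ j" by (simp add: lam_def FC_def sum_negf power_mult_distrib sum_distrib_left sum_distrib_right)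
    finally show ?thesis .
  qed
  then show "FC (laplacian u) k = - lam k *\<^sub>R FC u k" by (simp add: vec_eq_iff)
qed

text \<open>On the torus the Laplacian of a divergence-free field is divergence-free, so the
  projection is evaluated on \<open>H\<close>, where it acts as the identity.\<close>

lemma leray_H:
  assumes f: "f \<in> H"
  shows "leray f \<in> H" "AE x in torus. leray f x = f x"
proof -
  have "\<exists>w. w \<in> H \<and> (\<forall>v\<in>H. L2_inner (f - w) v = 0)" using f by (intro exI[of _ f]) (simp add: L2_inner_def)
  from someI_ex[OF this] have w: "leray f \<in> H" "\<And>v. v \<in> H \<Longrightarrow> L2_inner (f - leray f) v = 0" unfolding leray_def by blast+
  show "leray f \<in> H" by (rule w(1))
  have "cf (leray f) n = cf f n" for n
    using w(2)[OF eigfield_H, of n] cf_diff[OF HD(1)[OF f] HD(1)[OF w(1)], of n] by (simp add: cf_def)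
  then show "AE x in torus. leray f x = f x" by (rule H_eq_AE[OF w(1) f])
qed

lemma stokes_cf:
  assumes u: "u \<in> Sobolev 2" "u \<in> H"
  shows "stokes u \<in> H" "cf (stokes u) n = eigval n * cf u n"
proof -
  note l = laplacian_FC[OF u(1)]
  have d: "divfree (laplacian u)" using HD(2)[OF u(2)] by (simp add: divfree_iff l(2))
  have lH: "laplacian u \<in> H" using l(1) d by (simp add: H_iff)
  note le = leray_H[OF lH]
  have e: "stokes u = (\<lambda>x. - 1 *\<^sub>R leray (laplacian u) x)" by (simp add: stokes_def)
  show "stokes u \<in> H" unfolding e by (rule H_scale[OF le(1)])
  have "cf (stokes u) n = - cf (leray (laplacian u)) n" unfolding e using cf_scale[OF HD(1)[OF le(1)], of "- 1"] by simp
  also have "cf (leray (laplacian u)) n = cf (laplacian u) n" by (rule cf_cong_AE[OF le(2) HD(1)[OF le(1)] l(1)])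
  also have "... = - eigval n * cf u n" by (simp add: cf_eq[OF l(1)] cf_eq[OF HD(1)[OF u(2)]] l(2) eigval_def)
  finally show "cf (stokes u) n = eigval n * cf u n" by simp
qed

lemma stokes_eigenbasis_eigfield: "stokes_eigenbasis eigfield eigval"
  unfolding stokes_eigenbasis_def
proof (intro conjI allI ballI)
  fix k
  show "eigfield k \<in> Sobolev 2 \<inter> H" using eigfield_Sobolev eigfield_H by blast
  have "AE x in torus. stokes (eigfield k) x = (\<lambda>x. eigval k *\<^sub>R eigfield k x) x" by (rule H_eq_AE)
       (auto simp: stokes_cf[OF eigfield_Sobolev eigfield_H] H_scale eigfield_H cf_scale[OF eigfield_L2] cf_eigfield)
  then show "AE x in torus. stokes (eigfield k) x = eigval k *\<^sub>R eigfield k x" by simp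
  show "L2_inner (eigfield k) (eigfield j) = (if k = j then 1 else 0)" for j using cf_eigfield[of k j] by (simp add: cf_def)
  show "(\<lambda>n. L2_norm (\<lambda>x. u x - (\<Sum>k<n. L2_inner u (eigfield k) *\<^sub>R eigfield k x))) \<longlonglongrightarrow> 0" if "u \<in> H" for u
    using eigfield_expansion[OF that] by (simp add: cf_def)
qed (auto simp: eigval_pos mono_eigval eigval_at_top)

lemma cf_le_L2_norm:
  assumes "u \<in> H"
  shows "\<bar>cf u n\<bar> \<le> L2_norm u"
proof -
  have "(cf u n)^2 \<le> L2_inner u u"
    using sum_le_suminf[OF sums_summable[OF cf_square_sums[OF assms]], of "{n}"] sums_unique[OF cf_square_sums[OF assms]] by simp
  then show ?thesis unfolding L2_norm_def by (simp add: real_le_rsqrt)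
qed

lemma cf_limit:
  assumes w: "w \<in> H" "\<And>N. S N \<in> H" and lim: "(\<lambda>N. L2_norm (\<lambda>x. w x - S N x)) \<longlonglongrightarrow> 0"
  shows "(\<lambda>N. cf (S N) n) \<longlonglongrightarrow> cf w n"
proof -
  have "(\<lambda>N. cf w n - cf (S N) n) \<longlonglongrightarrow> 0"
  proof (rule Lim_null_comparison[OF always_eventually lim], rule allI)
    fix N
    show "norm (cf w n - cf (S N) n) \<le> L2_norm (\<lambda>x. w x - S N x)"
      using cf_le_L2_norm[OF H_diff[OF w(1) w(2)], of N n] cf_diff[OF HD(1)[OF w(1)] HD(1)[OF w(2)], of N n] by (simp add: fun_diff_def)
  qed
  then show ?thesis using tendsto_diff[OF tendsto_const[of "cf w n"]] by fastforce
qed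

text \<open>\<open>stokes_power\<close> may rely on any eigenbasis. A member \<open>\<phi> k\<close>
  with nonzero coefficient at \<open>n\<close> must have \<open>\<mu> k = eigval n\<close>, so every
  nonzero term of the series already carries the factor \<open>eigval n powr s\<close>.\<close>

lemma cf_diagonal_of_eigenbasis:
  assumes eb: "stokes_eigenbasis \<phi> \<mu>" and u: "u \<in> H" and w: "w \<in> H"
    and lim: "(\<lambda>N. L2_norm (\<lambda>x. w x - (\<Sum>k<N. (\<mu> k powr s * L2_inner u (\<phi> k)) *\<^sub>R \<phi> k x))) \<longlonglongrightarrow> 0"
  shows "cf w n = eigval n powr s * cf u n"
proof -
  have \<phi>: "\<phi> k \<in> Sobolev 2" "\<phi> k \<in> H" "AE x in torus. stokes (\<phi> k) x = \<mu> k *\<^sub>R \<phi> k x" for k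
    using eb by (auto simp: stokes_eigenbasis_def)
  have ex: "(\<lambda>N. L2_norm (\<lambda>x. u x - (\<Sum>k<N. L2_inner u (\<phi> k) *\<^sub>R \<phi> k x))) \<longlonglongrightarrow> 0" using eb u by (auto simp: stokes_eigenbasis_def)
  have sup: "eigval n * cf (\<phi> k) n = \<mu> k * cf (\<phi> k) n" for k
    using cf_cong_AE[OF \<phi>(3)[of k] HD(1)[OF stokes_cf(1)[OF \<phi>(1,2)]] HD(1)[OF H_scale[OF \<phi>(2)]], of n]
      stokes_cf(2)[OF \<phi>(1,2), of k n] cf_scale[OF HD(1)[OF \<phi>(2)], of "\<mu> k" k n] by simp
  have HS: "(\<lambda>x. \<Sum>k<N. a k *\<^sub>R \<phi> k x) \<in> H" for a N by (intro H_sum H_scale \<phi>)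
  have cS: "cf (\<lambda>x. \<Sum>k<N. a k *\<^sub>R \<phi> k x) n = (\<Sum>k<N. a k * cf (\<phi> k) n)" for a N
    by (subst cf_sum) (simp_all add: L2_field_scale HD(1)[OF \<phi>(2)] cf_scale[OF HD(1)[OF \<phi>(2)]])
  have l1: "(\<lambda>N. \<Sum>k<N. L2_inner u (\<phi> k) * cf (\<phi> k) n) \<longlonglongrightarrow> cf u n" using cf_limit[OF u HS ex, of n] by (simp add: cS)
  have l2: "(\<lambda>N. \<Sum>k<N. (\<mu> k powr s * L2_inner u (\<phi> k)) * cf (\<phi> k) n) \<longlonglongrightarrow> cf w n" using cf_limit[OF w HS lim, of n] by (simp add: cS)
  have eq: "(\<mu> k powr s * L2_inner u (\<phi> k)) * cf (\<phi> k) n = eigval n powr s * (L2_inner u (\<phi> k) * cf (\<phi> k) n)" for k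
    using sup[of k] by (cases "cf (\<phi> k) n = 0") auto
  have "(\<lambda>N. \<Sum>k<N. (\<mu> k powr s * L2_inner u (\<phi> k)) * cf (\<phi> k) n) \<longlonglongrightarrow> eigval n powr s * cf u n"
    unfolding eq sum_distrib_left[symmetric] by (rule tendsto_mult_left[OF l1])
  then show ?thesis using LIMSEQ_unique[OF l2] by simp
qed

theorem stokes_power_cf:
  assumes u: "u \<in> H" and fin: "sqn (\<lambda>n. eigval n powr (2 * s)) (cf u) < \<infinity>"
  shows "stokes_power s u \<in> H" "cf (stokes_power s u) n = eigval n powr s * cf u n"
proof -
  have "(eigval n powr s)^2 = eigval n powr (2 * s)" for n by (simp add: power2_eq_square powr_add[symmetric])
  then have e: "1 * (eigval n powr s * cf u n)^2 = eigval n powr (2 * s) * (cf u n)^2" for n by (simp add: power_mult_distrib)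
  have "sqn (\<lambda>n. 1) (\<lambda>n. eigval n powr s * cf u n) < \<infinity>" using fin by (simp only: sqn_def e)
  then obtain w where w: "w \<in> H" "cf w = (\<lambda>n. eigval n powr s * cf u n)" by (rule synthesis) blast
  have "(\<lambda>n. L2_norm (\<lambda>x. w x - (\<Sum>k<n. (eigval k powr s * L2_inner u (eigfield k)) *\<^sub>R eigfield k x))) \<longlonglongrightarrow> 0"
    using eigfield_expansion[OF w(1)] unfolding w(2) cf_def .
  then have "\<exists>w. w \<in> H \<and> (\<exists>\<phi> \<mu>. stokes_eigenbasis \<phi> \<mu> \<and>
     (\<lambda>n. L2_norm (\<lambda>x. w x - (\<Sum>k<n. (\<mu> k powr s * L2_inner u (\<phi> k)) *\<^sub>R \<phi> k x))) \<longlonglongrightarrow> 0)" using w(1) stokes_eigenbasis_eigfield by blast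
  from someI_ex[OF this] obtain \<phi> \<mu> where p: "stokes_power s u \<in> H" "stokes_eigenbasis \<phi> \<mu>"
    "(\<lambda>n. L2_norm (\<lambda>x. stokes_power s u x - (\<Sum>k<n. (\<mu> k powr s * L2_inner u (\<phi> k)) *\<^sub>R \<phi> k x))) \<longlonglongrightarrow> 0" unfolding stokes_power_def by blast
  show "stokes_power s u \<in> H" by (rule p(1))
  show "cf (stokes_power s u) n = eigval n powr s * cf u n" by (rule cf_diagonal_of_eigenbasis[OF p(2) u p(1) p(3)])
qed

lemma sqn_eigval_powr_finite:
  assumes "u \<in> V s" "0 \<le> s"
  shows "sqn (\<lambda>n. eigval n powr s) (cf u) < \<infinity>"
proof -
  have "sqn (\<lambda>n. eigval n powr s) (cf u) \<le> sqn (sw s) (cf u)" using assms(2) by (intro sqn_mono mult_right_mono powr_mono2) auto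
  then show ?thesis using assms(1) unfolding V_cf by (auto intro: le_less_trans)
qed

theorem stokes_power_inner:
  assumes u: "u \<in> V s" and v: "v \<in> V s" and s: "0 \<le> s"
  shows "(\<lambda>n. eigval n powr s * (cf u n * cf v n)) sums L2_inner (stokes_power (s / 2) u) (stokes_power (s / 2) v)"
proof -
  have *: "stokes_power (s / 2) u \<in> H" "cf (stokes_power (s / 2) u) n = eigval n powr (s / 2) * cf u n" if "u \<in> V s" for u n
    using stokes_power_cf[OF V_subset_H[OF that], of "s / 2"] sqn_eigval_powr_finite[OF that s] by auto
  have eq: "eigval n powr (s / 2) * cf u n * (eigval n powr (s / 2) * cf v n) = eigval n powr s * (cf u n * cf v n)" for n
  proof -
    have "eigval n powr (s / 2) * eigval n powr (s / 2) = eigval n powr s" by (simp add: powr_add[symmetric])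
    then show ?thesis by (metis mult.assoc mult.commute mult.left_commute)
  qed
  show ?thesis by (rule L2_inner_cf[OF *(1)[OF u] *(1)[OF v], unfolded *(2)[OF u] *(2)[OF v] eq])
qed

section \<open>The convection term\<close>

text \<open>\<open>\<langle>B(u,v), w\<rangle>\<close> with the derivative moved to the test field \<open>w\<close>, so that it makes sense for \<open>u\<close> and \<open>v\<close> in \<open>L2\<close>.\<close>

definition trilinear :: "field \<Rightarrow> field \<Rightarrow> field \<Rightarrow> real" where
  "trilinear u v w = - (\<Sum>i\<in>UNIV. \<Sum>j\<in>UNIV. LINT x|torus. u x $ i * v x $ j * partial i (coord w j) x)"

definition Bform :: "field \<Rightarrow> field \<Rightarrow> nat \<Rightarrow> real" where
  "Bform u v n = trilinear u v (eigfield n)"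

definition trig_field :: "field \<Rightarrow> bool" where
  "trig_field w \<longleftrightarrow> (\<forall>j. (coord w j) \<in> trig_poly)"

lemma trig_fieldD: "trig_field w \<Longrightarrow> (coord w j) \<in> trig_poly" by (simp add: trig_field_def)

lemma trig_field_eigfield: "trig_field (eigfield n)" by (simp add: trig_field_def eigfield_component)

lemma trig_field_scale: "trig_field v \<Longrightarrow> trig_field (\<lambda>x. c *\<^sub>R v x)" by (simp add: trig_field_def trig_scale)

lemma trig_field_sum: "(\<And>i. i \<in> I \<Longrightarrow> trig_field (v i)) \<Longrightarrow> trig_field (\<lambda>x. \<Sum>i\<in>I. v i x)"
  by (simp add: trig_field_def trig_sum)

lemma trig_bounded:
  assumes "f \<in> trig_poly"
  obtains C where "0 \<le> C" "\<And>x. \<bar>f x\<bar> \<le> C"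
proof -
  have "\<exists>C\<ge>0. \<forall>x. \<bar>f x\<bar> \<le> C" using assms
  proof induction
    case (trig_hartley k)
    then show ?case using abs_hartley_le by (intro exI[of _ 2]) auto
  next
    case (trig_add f g)
    then obtain C D where "0 \<le> C" "0 \<le> D" "\<forall>x. \<bar>f x\<bar> \<le> C" "\<forall>x. \<bar>g x\<bar> \<le> D" by blast
    then show ?case by (intro exI[of _ "C + D"]) (auto intro: order_trans[OF abs_triangle_ineq add_mono])
  next
    case (trig_scale f c)
    then obtain C where "0 \<le> C" "\<forall>x. \<bar>f x\<bar> \<le> C" by blast
    then show ?case by (intro exI[of _ "\<bar>c\<bar> * C"]) (auto simp: abs_mult intro: mult_left_mono)
  qed
  then show ?thesis using that by blast
qed

lemma sq_int_mult_bounded: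
  assumes f: "sq_int torus f" and h: "h \<in> trig_poly"
  shows "sq_int torus (\<lambda>x. f x * h x)"
proof -
  obtain C where C: "0 \<le> C" "\<And>x. \<bar>h x\<bar> \<le> C" by (rule trig_bounded[OF h]) blast
  have m: "(\<lambda>x. f x * h x) \<in> borel_measurable torus" using sq_intD(1)[OF f] sq_intD(1)[OF trig_sq_int[OF h]] by simp
  have "integrable torus (\<lambda>x. (f x * h x)^2)"
  proof (rule Bochner_Integration.integrable_bound)
    show "integrable torus (\<lambda>x. C^2 * (f x)^2)" using sq_intD(2)[OF f] by simp
    have "(h x)^2 \<le> C^2" for x using C(2)[of x] C(1) by (simp add: abs_le_square_iff[symmetric])
    then have "(f x)^2 * (h x)^2 \<le> (f x)^2 * C^2" for x by (intro mult_left_mono) auto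
    then show "AE x in torus. norm ((f x * h x)^2) \<le> norm (C^2 * (f x)^2)" by (simp add: power_mult_distrib mult.commute)
  qed (use m in auto)
  then show ?thesis using m by (simp add: sq_int_def)
qed

lemma trilinear_integrable:
  assumes "u \<in> L2" "v \<in> L2" "h \<in> trig_poly"
  shows "integrable torus (\<lambda>x. u x $ i * v x $ j * h x)"
  using sq_int_mult_integrable[OF L2_component(1)[OF assms(1)] sq_int_mult_bounded[OF L2_component(1)[OF assms(2)] assms(3)]]
  by (simp add: mult.assoc)

lemma trilinear_add:
  assumes "u \<in> L2" "u' \<in> L2" "v \<in> L2" "v' \<in> L2" "trig_field w"
  shows "trilinear (\<lambda>x. u x + u' x) v w = trilinear u v w + trilinear u' v w"
    "trilinear u (\<lambda>x. v x + v' x) w = trilinear u v w + trilinear u v' w"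
proof -
  note i = trilinear_integrable[OF _ _ trig_partial[OF trig_fieldD[OF assms(5)]]]
  show "trilinear (\<lambda>x. u x + u' x) v w = trilinear u v w + trilinear u' v w"
    unfolding trilinear_def using i[OF assms(1,3)] i[OF assms(2,3)] by (simp add: distrib_right sum.distrib)
  show "trilinear u (\<lambda>x. v x + v' x) w = trilinear u v w + trilinear u v' w"
    unfolding trilinear_def using i[OF assms(1,3)] i[OF assms(1,4)] by (simp add: distrib_right distrib_left sum.distrib)
qed

lemma trilinear_scale_left: "trilinear (\<lambda>x. c *\<^sub>R u x) v w = c * trilinear u v w"
  and trilinear_scale_right: "trilinear u (\<lambda>x. c *\<^sub>R v x) w = c * trilinear u v w"
  unfolding trilinear_def by (simp_all add: sum_distrib_left mult_ac)

lemma trig_has_partial: "f \<in> trig_poly \<Longrightarrow> (f has_derivative frechet_derivative f (at x)) (at x)"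
  by (intro smooth_has_derivative trig_smooth)

lemma partial_trig_add:
  "f \<in> trig_poly \<Longrightarrow> g \<in> trig_poly \<Longrightarrow> partial i (\<lambda>x. f x + g x) x = partial i f x + partial i g x"
  using partial_eq[OF has_derivative_add[OF trig_has_partial trig_has_partial]] by (simp add: partial_def)

lemma partial_trig_scale: "f \<in> trig_poly \<Longrightarrow> partial i (\<lambda>x. c * f x) x = c * partial i f x"
  using partial_eq[OF has_derivative_mult_right[OF trig_has_partial]] by (simp add: partial_def)

lemma partial_trig_mult:
  "f \<in> trig_poly \<Longrightarrow> g \<in> trig_poly \<Longrightarrow> partial i (\<lambda>x. f x * g x) x = f x * partial i g x + partial i f x * g x"
  using partial_eq[OF has_derivative_mult[OF trig_has_partial trig_has_partial]] by (simp add: partial_def)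

lemma trilinear_add_test:
  assumes "u \<in> L2" "v \<in> L2" "trig_field w" "trig_field w'"
  shows "trilinear u v (\<lambda>x. w x + w' x) = trilinear u v w + trilinear u v w'"
  unfolding trilinear_def
  using trilinear_integrable[OF assms(1,2) trig_partial[OF trig_fieldD[OF assms(3)]]] trilinear_integrable[OF assms(1,2) trig_partial[OF trig_fieldD[OF assms(4)]]]
  by (simp add: partial_trig_add trig_fieldD assms distrib_left sum.distrib)

lemma trilinear_scale_test:
  assumes "trig_field w"
  shows "trilinear u v (\<lambda>x. c *\<^sub>R w x) = c * trilinear u v w"
  unfolding trilinear_def
  by (simp add: partial_trig_scale trig_fieldD assms sum_distrib_left mult.left_commute)

lemma trilinear_sum_test:
  assumes "u \<in> L2" "v \<in> L2"
  shows "trilinear u v (\<lambda>x. \<Sum>k<N. c k *\<^sub>R eigfield k x) = (\<Sum>k<N. c k * Bform u v k)"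
proof (induction N)
  case 0
  have "partial i (\<lambda>x. 0::real) x = 0" for i x using partial_eq[OF has_derivative_const] by blast
  then show ?case by (simp add: trilinear_def)
next
  case (Suc N)
  have "trilinear u v (\<lambda>x. (\<Sum>k<N. c k *\<^sub>R eigfield k x) + c N *\<^sub>R eigfield N x) =
      trilinear u v (\<lambda>x. \<Sum>k<N. c k *\<^sub>R eigfield k x) + trilinear u v (\<lambda>x. c N *\<^sub>R eigfield N x)"
    by (intro trilinear_add_test assms trig_field_sum trig_field_scale trig_field_eigfield)
  then show ?case using Suc by (simp add: trilinear_scale_test trig_field_eigfield Bform_def)
qed

text \<open>The coefficient form of the constraint makes all Hartley coefficients of the divergence
  vanish; completeness does the rest.\<close>

lemma trig_divergence:
  assumes u: "trig_field u" "divfree u"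
  shows "AE x in torus. (\<Sum>i\<in>UNIV. partial i (coord u i) x) = 0"
proof (rule hartley_complete)
  have ut: "(coord u j) \<in> trig_poly" for j using u by (auto simp: trig_field_def)
  show "sq_int torus (\<lambda>x. \<Sum>i\<in>UNIV. partial i (coord u i) x)" by (intro trig_sq_int trig_sum trig_partial ut)
  fix k
  have "hc (\<lambda>x. \<Sum>i\<in>UNIV. partial i (coord u i) x) k = (\<Sum>i\<in>UNIV. hc (partial i (coord u i)) k)"
    by (rule hc_sum) (intro trig_sq_int trig_partial ut)
  also have "... = (\<Sum>i\<in>UNIV. 2 * pi * (of_int ((- k) $ i) * FC u (- k) $ i))"
    by (simp add: hc_partial[OF trig_smooth[OF ut] trig_periodic[OF ut]] FC_def mult.assoc)
  also have "... = 0" using u(2)[unfolded divfree_def, THEN conjunct2, rule_format, of "- k"] unfolding sum_distrib_left[symmetric] by simp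
  finally show "hc (\<lambda>x. \<Sum>i\<in>UNIV. partial i (coord u i) x) k = 0" .
qed

text \<open>Up to sign the integrand is half of the derivative of \<open>q\<close>, the squared
  length of \<open>v\<close>, in direction \<open>u\<close>. Integration by parts moves the
  derivative onto \<open>u\<close>, whose divergence vanishes.\<close>

lemma trilinear_antisymmetric:
  assumes u: "trig_field u" "divfree u" and v: "trig_field v"
  shows "trilinear u v v = 0"
proof -
  define q where "q x = (\<Sum>j\<in>UNIV. v x $ j * v x $ j)" for x
  have vt: "(coord v j) \<in> trig_poly" and ut: "(coord u j) \<in> trig_poly" for j using u v by (auto simp: trig_field_def)
  have qt: "q \<in> trig_poly" unfolding q_def by (intro trig_sum trig_mult vt)
  have dq: "partial i q x = 2 * (\<Sum>j\<in>UNIV. v x $ j * partial i (coord v j) x)" for i x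
  proof -
    have "partial i q x = (\<Sum>j\<in>UNIV. v x $ j * frechet_derivative (coord v j) (at x) (axis i 1) + frechet_derivative (coord v j) (at x) (axis i 1) * v x $ j)"
      unfolding q_def by (rule partial_eq) (intro has_derivative_sum has_derivative_mult trig_has_partial vt)
    then show ?thesis by (simp add: partial_def sum_distrib_left mult.commute sum.distrib[symmetric])
  qed
  note div0 = trig_divergence[OF u]
  have ci: "integrable torus f" if "f \<in> trig_poly" for f by (intro continuous_torus_integrable trig_continuous that)
  \<comment> \<open>The Hartley function of frequency 0 is 1, so this is \<open>hc_partial\<close>
    at \<open>k = 0\<close>.\<close>
  have z: "(LINT x|torus. partial i (\<lambda>x. u x $ i * q x) x) = 0" for i
    using hc_partial[OF trig_smooth[OF trig_mult[OF ut qt]] trig_periodic[OF trig_mult[OF ut qt]], where i = i and k = 0] by (simp add: hc_def)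
  have "0 = (\<Sum>i\<in>UNIV. LINT x|torus. partial i (\<lambda>x. u x $ i * q x) x)" by (simp add: z)
  also have "... = (\<Sum>i\<in>UNIV. (LINT x|torus. u x $ i * partial i q x) + (LINT x|torus. partial i (coord u i) x * q x))"
    by (intro sum.cong refl, subst partial_trig_mult[OF ut qt], rule Bochner_Integration.integral_add)
       (intro ci trig_mult trig_partial ut qt)+
  also have "... = (\<Sum>i\<in>UNIV. LINT x|torus. u x $ i * partial i q x) + (\<Sum>i\<in>UNIV. LINT x|torus. partial i (coord u i) x * q x)"
    by (rule sum.distrib)
  also have "(\<Sum>i\<in>UNIV. LINT x|torus. partial i (coord u i) x * q x) = (LINT x|torus. (\<Sum>i\<in>UNIV. partial i (coord u i) x) * q x)"
    unfolding sum_distrib_right by (rule Bochner_Integration.integral_sum[symmetric]) (intro ci trig_mult trig_partial ut qt)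
  also have "... = (LINT x|torus. 0)"
  proof (rule integral_cong_AE)
    show "AE x in torus. (\<Sum>i\<in>UNIV. partial i (coord u i) x) * q x = 0" using div0 by eventually_elim simp
    show "(\<lambda>x. (\<Sum>i\<in>UNIV. partial i (coord u i) x) * q x) \<in> borel_measurable torus"
      by (intro borel_measurable_integrable ci trig_mult trig_sum trig_partial ut qt)
  qed simp
  also have "(\<Sum>i\<in>UNIV. LINT x|torus. u x $ i * partial i q x) = - 2 * trilinear u v v"
  proof -
    have "(LINT x|torus. u x $ i * partial i q x) = 2 * (\<Sum>j\<in>UNIV. LINT x|torus. u x $ i * v x $ j * partial i (coord v j) x)" for i
    proof -
      have "(LINT x|torus. u x $ i * partial i q x) = (LINT x|torus. 2 * (\<Sum>j\<in>UNIV. u x $ i * v x $ j * partial i (coord v j) x))"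
        by (intro Bochner_Integration.integral_cong refl) (simp add: dq sum_distrib_left mult_ac)
      also have "... = 2 * (\<Sum>j\<in>UNIV. LINT x|torus. u x $ i * v x $ j * partial i (coord v j) x)"
        by (subst integral_mult_right_zero, subst Bochner_Integration.integral_sum) (intro ci trig_mult trig_partial ut vt refl)+
      finally show ?thesis .
    qed
    then show ?thesis by (simp add: trilinear_def flip: sum_distrib_left)
  qed
  finally show ?thesis by simp
qed

section \<open>Bounds for the convection term\<close>

lemma partial_eigfield:
  "partial i (\<lambda>x. eigfield n x $ j) x =
    case_prod frame (eigen_enum n) $ j * (2 * pi * of_int (fst (eigen_enum n) $ i)) * hartley (- fst (eigen_enum n)) x"
proof -
  have e: "(\<lambda>x. eigfield n x $ j) = (\<lambda>x. case_prod frame (eigen_enum n) $ j * hartley (fst (eigen_enum n)) x)"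
    by (simp add: eigfield_def fun_eq_iff)
  show ?thesis unfolding e partial_trig_scale[OF trig_hartley] partial_hartley by simp
qed

text \<open>A mode of the convection term sees the products of components only through their Hartley
  coefficients at one frequency. The reflection of that frequency comes from differentiating the
  eigenfield.\<close>

lemma Bform_eq:
  "Bform u v n = - (\<Sum>i\<in>UNIV. \<Sum>j\<in>UNIV. case_prod frame (eigen_enum n) $ j * (2 * pi * of_int (fst (eigen_enum n) $ i)) *
     hc (\<lambda>x. u x $ i * v x $ j) (- fst (eigen_enum n)))"
proof -
  have "(LINT x|torus. u x $ i * v x $ j * (a * b * hartley k x)) = a * b * (LINT x|torus. u x $ i * v x $ j * hartley k x)" for i j a b k
    by (subst integral_mult_right_zero[symmetric]) (simp add: mult_ac)
  then show ?thesis unfolding Bform_def trilinear_def partial_eigfield hc_def by simp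
qed

text \<open>\<open>kw\<close> is built on the maximum norm plus 1 and the Sobolev weight on the
  Euclidean norm. The bridge is \<open>(1 + j)^2 \<le> 1 + 4 * j^2\<close> for naturals together
  with \<open>4 \<le> (2 * pi)^2\<close>.\<close>

lemma kw_le: "kw k \<le> (1 + lam k) powr (3 / 4)"
proof -
  define j where "j = Max (range (\<lambda>i. nat \<bar>k $ i\<bar>))"
  have "j \<in> range (\<lambda>i. nat \<bar>k $ i\<bar>)" unfolding j_def by (rule Max_in) auto
  then obtain i where i: "j = nat \<bar>k $ i\<bar>" by auto
  have "(real j)^2 = (of_int (k $ i))^2" by (simp add: i)
  also have "... \<le> (\<Sum>i\<in>UNIV. (of_int (k $ i))^2)" by (rule member_le_sum) auto
  finally have jk: "(real j)^2 \<le> (\<Sum>i\<in>UNIV. (of_int (k $ i))^2)" .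
  have "(2::real)^2 \<le> (2 * pi)^2" using pi_ge_two by (intro power_mono) auto
  then have "4 * (real j)^2 \<le> lam k" unfolding lam_def using jk by (intro mult_mono) auto
  moreover have "(1 + real j)^2 \<le> 1 + 4 * (real j)^2"
  proof -
    have "real j \<le> real j * real j" by (cases j) auto
    then show ?thesis by (simp add: power2_eq_square algebra_simps)
  qed
  ultimately have "(real (ksize k))^2 \<le> 1 + lam k" by (simp add: ksize_def j_def)
  then have "((real (ksize k))^2) powr (3 / 4) \<le> (1 + lam k) powr (3 / 4)" by (intro powr_mono2) auto
  moreover have "((real (ksize k))^2) powr (3 / 4) = kw k"
  proof -
    have "((real (ksize k))^2) = real (ksize k) powr 2" using ksize_pos[of k] by simp
    then show ?thesis unfolding kw_def by (simp only: powr_powr) simp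
  qed
  ultimately show ?thesis by simp
qed

lemma V_kw_summable:
  assumes "u \<in> V (3 / 4)"
  shows "kw_summable (coord u j)"
    "ennreal (\<Sum>j\<in>UNIV. kw_norm2 (coord u j)) \<le> sqn (sw (3 / 4)) (cf u)"
proof -
  have uS: "u \<in> Sobolev (3 / 4)" using assms by (simp add: V_iff)
  have uL: "u \<in> L2" using uS by (simp add: Sobolev_iff)
  have s: "(\<lambda>k. kw k * (hc (coord u j) k)^2) summable_on UNIV" for j
    by (rule summable_on_comparison_test[OF Sobolev_component[OF uS, of j]]) (auto intro!: mult_right_mono kw_le)
  then show "kw_summable (coord u j)" by (simp add: kw_summable_def L2_component uL)
  have "(\<Sum>j\<in>UNIV. kw_norm2 (coord u j)) = (\<Sum>\<^sub>\<infinity>k. \<Sum>j\<in>UNIV. kw k * (hc (coord u j) k)^2)" unfolding kw_norm2_def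
    by (rule infsumI[symmetric], rule has_sum_finite_sum) (auto intro!: has_sum_infsum s)
  also have "... \<le> (\<Sum>\<^sub>\<infinity>k. sobolev_weight (3 / 4) k * (norm (FC u k))^2)"
  proof (rule infsum_mono)
    show "(\<lambda>k. \<Sum>j\<in>UNIV. kw k * (hc (coord u j) k)^2) summable_on UNIV" by (intro summable_on_finite_sum s) simp
    show "(\<lambda>k. sobolev_weight (3 / 4) k * (norm (FC u k))^2) summable_on UNIV" using uS by (simp add: Sobolev_iff)
    show "(\<Sum>j\<in>UNIV. kw k * (hc (coord u j) k)^2) \<le> sobolev_weight (3 / 4) k * (norm (FC u k))^2" for k
      unfolding sobolev_weight_eq norm_vec3_square sum_distrib_left FC_def vec_lambda_beta
      by (intro sum_mono mult_right_mono kw_le) auto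
  qed
  also have "... = (Sobolev_norm (3 / 4) u)^2"
    unfolding Sobolev_norm_eq[OF uS] by (rule real_sqrt_pow2[symmetric]) (intro infsum_nonneg, auto)
  finally show "ennreal (\<Sum>j\<in>UNIV. kw_norm2 (coord u j)) \<le> sqn (sw (3 / 4)) (cf u)"
    unfolding Sobolev_norm_cf(1)[OF assms] by (rule ennreal_leI)
qed

lemma product_square_sums:
  assumes "sq_int torus f"
  shows "(\<integral>\<^sup>+k. ennreal ((hc f (- k))^2) \<partial>count_space UNIV) = ennreal (LINT x|torus. (f x)^2)"
proof -
  have "((\<lambda>k. (hc f (- k))^2) has_sum (LINT x|torus. (f x)^2)) UNIV"
    by (subst has_sum_reindex_bij_betw[OF bij_uminus_lattice, of "\<lambda>k. (hc f k)^2"]) (rule Parseval_square[OF assms])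
  then have s: "(\<lambda>n. (hc f (- lattice_enum n))^2) sums (LINT x|torus. (f x)^2)" by (subst (asm) has_sum_lattice_iff) auto
  show ?thesis
    unfolding nn_integral_lattice by (rule trans[OF suminf_ennreal2[OF _ sums_summable[OF s]]]) (simp_all only: sums_unique[OF s, symmetric] zero_le_power2)
qed

lemma UNIV_pair_CS:
  fixes a b :: "3 \<Rightarrow> 3 \<Rightarrow> real"
  shows "(\<Sum>i\<in>UNIV. \<Sum>j\<in>UNIV. a i j * b i j)^2 \<le> (\<Sum>i\<in>UNIV. \<Sum>j\<in>UNIV. (a i j)^2) * (\<Sum>i\<in>UNIV. \<Sum>j\<in>UNIV. (b i j)^2)"
  using Cauchy_Schwarz_ineq_sum[of "\<lambda>(i, j). a i j" "\<lambda>(i, j). b i j" "UNIV \<times> UNIV"]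
  unfolding sum.cartesian_product by (simp only: case_prod_unfold)

text \<open>Cauchy-Schwarz over the nine pairs of components. The squared factors sum to a unit
  vector's squared length times \<open>lam\<close>, so the derivative costs exactly one power of the
  eigenvalue.\<close>

lemma Bform_square_le:
  "(Bform u v n)^2 \<le> eigval n * (\<Sum>i\<in>UNIV. \<Sum>j\<in>UNIV. (hc (\<lambda>x. u x $ i * v x $ j) (- fst (eigen_enum n)))^2)"
proof -
  let ?k = "fst (eigen_enum n)" and ?e = "case_prod frame (eigen_enum n)"
  have "(Bform u v n)^2 \<le> (\<Sum>i\<in>UNIV. \<Sum>j\<in>UNIV. (?e $ j * (2 * pi * of_int (?k $ i)))^2) * (\<Sum>i\<in>UNIV. \<Sum>j\<in>UNIV. (hc (\<lambda>x. u x $ i * v x $ j) (- ?k))^2)"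
    unfolding Bform_eq power2_minus by (rule UNIV_pair_CS)
  also have "(\<Sum>i\<in>UNIV. \<Sum>j\<in>UNIV. (?e $ j * (2 * pi * of_int (?k $ i)))^2) = (\<Sum>j\<in>UNIV. (?e $ j)^2) * lam ?k"
    by (simp add: lam_def power_mult_distrib sum_distrib_left sum_distrib_right mult_ac)
  also have "(\<Sum>j\<in>UNIV. (?e $ j)^2) = 1" using frame_props(1)[OF eigen_enum_nonzero[of n], of "snd (eigen_enum n)" "snd (eigen_enum n)"]
    by (simp add: case_prod_unfold inner_vec_def power2_eq_square)
  finally show ?thesis by (simp add: eigval_def)
qed

text \<open>The weight \<open>inv_eigval\<close> cancels the derivative and leaves squared
  coefficients of the products, to which Parseval and \<open>product_estimate\<close> apply. Each
  frequency carries two polarisations: \<open>2 * 384 = 768\<close>.\<close>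

theorem Bform_bound:
  assumes u: "u \<in> V (3 / 4)" and v: "v \<in> V (3 / 4)"
  shows "sqn inv_eigval (Bform u v) \<le> ennreal 768 * (sqn (sw (3 / 4)) (cf u) * sqn (sw (3 / 4)) (cf v))"
proof -
  let ?G = "\<lambda>i j. hc (\<lambda>x. u x $ i * v x $ j)"
  let ?S = "\<lambda>k. \<Sum>i\<in>UNIV. \<Sum>j\<in>UNIV. (?G i j (- k))^2"
  let ?H = "\<lambda>z :: (int^3) \<times> bool. if fst z = 0 then 0 else ennreal (?S (fst z))"
  note pe = product_estimate[OF V_kw_summable(1)[OF u] V_kw_summable(1)[OF v]]
  have "sqn inv_eigval (Bform u v) \<le> (\<Sum>n. ?H (eigen_enum n))" unfolding sqn_def
  proof (intro suminf_le allI)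
    fix n
    have "1 / eigval n * (Bform u v n)^2 \<le> 1 / eigval n * (eigval n * ?S (fst (eigen_enum n)))"
      by (intro mult_left_mono Bform_square_le) auto
    also have "... = ?S (fst (eigen_enum n))" using eigval_pos[of n] by simp
    finally show "ennreal (1 / eigval n * (Bform u v n)^2) \<le> ?H (eigen_enum n)"
      using eigen_enum_nonzero[of n] by (simp add: ennreal_leI)
  qed auto
  also have "... = (\<integral>\<^sup>+k. ?H (k, True) + ?H (k, False) \<partial>count_space UNIV)" by (rule suminf_eigen_enum) simp
  also have "... \<le> (\<integral>\<^sup>+k. 2 * (\<Sum>i\<in>UNIV. \<Sum>j\<in>UNIV. ennreal ((?G i j (- k))^2)) \<partial>count_space UNIV)"
    by (intro nn_integral_mono) (auto simp: mult_2 sum_nonneg simp flip: sum_ennreal)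
  also have "... = 2 * (\<Sum>i\<in>UNIV. \<Sum>j\<in>UNIV. \<integral>\<^sup>+k. ennreal ((?G i j (- k))^2) \<partial>count_space UNIV)"
    by (simp only: nn_integral_cmult nn_integral_sum borel_measurable_count_space borel_measurable_sum)
  also have "... = 2 * (\<Sum>i\<in>UNIV. \<Sum>j\<in>UNIV. ennreal (LINT x|torus. (u x $ i * v x $ j)^2))" by (simp only: product_square_sums[OF pe(1)])
  also have "... \<le> 2 * (\<Sum>i\<in>UNIV. \<Sum>j\<in>UNIV. ennreal (384 * kw_norm2 (coord u i) * kw_norm2 (coord v j)))"
    by (intro mult_left_mono sum_mono ennreal_leI pe(2)) auto
  also have "... = 2 * ennreal (384 * ((\<Sum>i\<in>UNIV. kw_norm2 (coord u i)) * (\<Sum>j\<in>UNIV. kw_norm2 (coord v j))))"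
  proof -
    have "(\<Sum>i\<in>(UNIV :: 3 set). \<Sum>j\<in>(UNIV :: 3 set). 384 * kw_norm2 (coord u i) * kw_norm2 (coord v j)) =
        384 * ((\<Sum>i\<in>UNIV. kw_norm2 (coord u i)) * (\<Sum>j\<in>UNIV. kw_norm2 (coord v j)))"
      unfolding sum_product by (simp only: sum_distrib_left mult.assoc)
    moreover have "(\<Sum>i\<in>(UNIV :: 3 set). \<Sum>j\<in>(UNIV :: 3 set). ennreal (384 * kw_norm2 (coord u i) * kw_norm2 (coord v j))) =
        ennreal (\<Sum>i\<in>(UNIV :: 3 set). \<Sum>j\<in>(UNIV :: 3 set). 384 * kw_norm2 (coord u i) * kw_norm2 (coord v j))"
      by (subst sum_ennreal, intro mult_nonneg_nonneg kw_norm2_nonneg, simp, subst sum_ennreal, intro sum_nonneg mult_nonneg_nonneg kw_norm2_nonneg, simp, rule refl)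
    ultimately show ?thesis by (simp only:)
  qed
  also have "... = ennreal 768 * (ennreal (\<Sum>i\<in>UNIV. kw_norm2 (coord u i)) * ennreal (\<Sum>j\<in>UNIV. kw_norm2 (coord v j)))"
    by (simp add: numeral_times_ennreal kw_norm2_nonneg sum_nonneg mult.assoc flip: ennreal_mult)
  also have "... \<le> ennreal 768 * (sqn (sw (3 / 4)) (cf u) * sqn (sw (3 / 4)) (cf v))"
    by (intro mult_left_mono mult_mono V_kw_summable(2) u v) auto
  finally show ?thesis .
qed

lemma L2_component_square_le: "w \<in> L2 \<Longrightarrow> (LINT x|torus. (w x $ i)^2) \<le> L2_inner w w"
  unfolding L2_inner_eq power2_eq_square
  using member_le_sum[of i UNIV "\<lambda>i. LINT x|torus. w x $ i * w x $ i"] by (simp add: power2_eq_square[symmetric])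

text \<open>Source of \<open>F_comp\<close>. The 36 consists of nine pairs of components times the
  factor 4 from \<open>\<bar>hartley k x\<bar> \<le> 2\<close>.\<close>

lemma Bform_component_bound:
  obtains C :: real where "0 \<le> C" "\<And>u v. u \<in> L2 \<Longrightarrow> v \<in> L2 \<Longrightarrow> (Bform u v n)^2 \<le> C * (L2_inner u u * L2_inner v v)"
proof (rule that[of "eigval n * 36"])
  show "0 \<le> eigval n * 36" by simp
  fix u v :: field assume u: "u \<in> L2" and v: "v \<in> L2"
  let ?k = "- fst (eigen_enum n)"
  have nn: "0 \<le> L2_inner w w" for w by (simp add: L2_inner_def)
  have "(hc (\<lambda>x. u x $ i * v x $ j) ?k)^2 \<le> 4 * (L2_inner u u * L2_inner v v)" for i j
  proof -
    have hs: "sq_int torus (\<lambda>x. v x $ j * hartley ?k x)" by (rule sq_int_mult_bounded[OF L2_component(1)[OF v] trig_hartley])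
    have "(hc (\<lambda>x. u x $ i * v x $ j) ?k)^2 = (LINT x|torus. u x $ i * (v x $ j * hartley ?k x))^2" by (simp add: hc_def mult.assoc)
    also have "... \<le> (LINT x|torus. (u x $ i)^2) * (LINT x|torus. (v x $ j * hartley ?k x)^2)"
      by (rule sq_int_Cauchy_Schwarz[OF L2_component(1)[OF u] hs])
    also have "... \<le> L2_inner u u * (4 * L2_inner v v)"
    proof (intro mult_mono L2_component_square_le u)
      have "(LINT x|torus. (v x $ j * hartley ?k x)^2) \<le> (LINT x|torus. 4 * (v x $ j)^2)"
      proof (rule integral_mono)
        show "(v x $ j * hartley ?k x)^2 \<le> 4 * (v x $ j)^2" for x
        proof -
          have "(hartley ?k x)^2 \<le> 2^2" using abs_hartley_le[of ?k x] abs_le_square_iff[of "hartley ?k x" 2] by simp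
          then have "(v x $ j)^2 * (hartley ?k x)^2 \<le> (v x $ j)^2 * 4" by (intro mult_left_mono) auto
          then show ?thesis by (simp add: power_mult_distrib mult.commute)
        qed
      qed (use sq_intD(2)[OF hs] sq_intD(2)[OF L2_component(1)[OF v]] in auto)
      also have "... \<le> 4 * L2_inner v v" using L2_component_square_le[OF v] by simp
      finally show "(LINT x|torus. (v x $ j * hartley ?k x)^2) \<le> 4 * L2_inner v v" .
    qed (use nn in auto)
    finally show ?thesis by simp
  qed
  then have "(\<Sum>i\<in>(UNIV :: 3 set). \<Sum>j\<in>(UNIV :: 3 set). (hc (\<lambda>x. u x $ i * v x $ j) ?k)^2) \<le> (\<Sum>i\<in>(UNIV :: 3 set). \<Sum>j\<in>(UNIV :: 3 set). 4 * (L2_inner u u * L2_inner v v))"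
    by (intro sum_mono)
  also have "... = 36 * (L2_inner u u * L2_inner v v)" by simp
  finally show "(Bform u v n)^2 \<le> eigval n * 36 * (L2_inner u u * L2_inner v v)"
    using order_trans[OF Bform_square_le[of u v n] mult_left_mono[OF _ eigval_nonneg[of n]]] by (simp add: mult.assoc)
qed

lemma Bform_cong_AE:
  assumes "AE x in torus. u x = u' x" "AE x in torus. v x = v' x" "u \<in> L2" "u' \<in> L2" "v \<in> L2" "v' \<in> L2"
  shows "Bform u v n = Bform u' v' n"
proof -
  have "hc (\<lambda>x. u x $ i * v x $ j) k = hc (\<lambda>x. u' x $ i * v' x $ j) k" for i j k
  proof (rule hc_cong_AE)
    show "AE x in torus. u x $ i * v x $ j = u' x $ i * v' x $ j" using assms(1,2) by eventually_elim simp
  qed (intro borel_measurable_times sq_intD(1) L2_component assms)+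
  then show ?thesis by (simp add: Bform_eq)
qed

section \<open>Galerkin truncations, skewness and the pairing\<close>

definition proj :: "nat \<Rightarrow> field \<Rightarrow> field" where
  "proj N u = (\<lambda>x. \<Sum>k<N. cf u k *\<^sub>R eigfield k x)"

lemma proj_trig: "trig_field (proj N u)"
  unfolding proj_def by (intro trig_field_sum trig_field_scale trig_field_eigfield)

lemma proj_H: "proj N u \<in> H"
  unfolding proj_def by (rule partial_sum_H)

lemma cf_proj: "cf (proj N u) n = (if n < N then cf u n else 0)"
  unfolding proj_def by (rule cf_partial_sum)

lemma squeeze_0:
  fixes f :: "nat \<Rightarrow> real"
  assumes "\<And>n. 0 \<le> f n" "\<And>n. f n \<le> g n" "g \<longlonglongrightarrow> 0"
  shows "f \<longlonglongrightarrow> 0"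
  using assms(1,2) by (intro real_tendsto_sandwich[OF _ _ tendsto_const assms(3)] always_eventually allI) blast+

lemma Sobolev_norm_sums:
  assumes "u \<in> V s"
  shows "(\<lambda>n. sw s n * (cf u n)^2) sums (Sobolev_norm s u)^2"
proof -
  have "sqn (sw s) (cf u) < \<infinity>" using assms by (simp add: V_cf)
  then have s: "summable (\<lambda>n. sw s n * (cf u n)^2)" by (subst (asm) sqn_finite_iff) auto
  have "ennreal (\<Sum>n. sw s n * (cf u n)^2) = ennreal ((Sobolev_norm s u)^2)"
    using sqn_eq_suminf[OF _ s] Sobolev_norm_cf(1)[OF assms] by simp
  then have "(\<Sum>n. sw s n * (cf u n)^2) = (Sobolev_norm s u)^2" by (subst (asm) ennreal_inj) (auto intro!: suminf_nonneg s)
  then show ?thesis using summable_sums[OF s] by simp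
qed

lemma proj_V: "proj N u \<in> V s"
proof -
  have "summable (\<lambda>n. sw s n * (cf (proj N u) n)^2)" by (rule summable_finite[of "{..<N}"]) (auto simp: cf_proj)
  then have "sqn (sw s) (cf (proj N u)) < \<infinity>" by (subst sqn_finite_iff) auto
  then show ?thesis unfolding V_cf using proj_H by blast
qed

lemma V_diff:
  assumes "u \<in> V s" "v \<in> V s"
  shows "u - v \<in> V s"
proof -
  have "cf (u - v) = (\<lambda>n. cf u n - cf v n)" using assms by (auto simp: fun_eq_iff V_cf intro!: cf_diff HD(1))
  moreover have "sqn (sw s) (\<lambda>n. cf u n - cf v n) \<le> 2 * sqn (sw s) (cf u) + 2 * sqn (sw s) (cf v)" by (rule sqn_diff) simp
  moreover have "... < \<infinity>" using assms by (simp add: V_cf ennreal_mult_less_top)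
  ultimately show ?thesis using assms by (auto simp: V_cf intro: H_diff order.strict_trans1)
qed

lemma V_mono:
  assumes "u \<in> V s" "t \<le> s"
  shows "u \<in> V t"
proof -
  have "sqn (sw t) (cf u) \<le> sqn (sw s) (cf u)" by (intro sqn_mono mult_right_mono powr_mono assms) auto
  then show ?thesis using assms by (auto simp: V_cf intro: order.strict_trans1)
qed

lemma Sobolev_norm_diff_proj:
  assumes u: "u \<in> V s"
  shows "(\<lambda>N. (Sobolev_norm s (u - proj N u))^2) \<longlonglongrightarrow> 0"
proof -
  note S = Sobolev_norm_sums[OF u]
  have "(Sobolev_norm s u)^2 - (\<Sum>n<N. sw s n * (cf u n)^2) = (Sobolev_norm s (u - proj N u))^2" for N
  proof (rule sums_unique2)
    have "(\<lambda>n. sw s n * (cf u n)^2 - (if n \<in> {..<N} then sw s n * (cf u n)^2 else 0)) sums ((Sobolev_norm s u)^2 - (\<Sum>n<N. sw s n * (cf u n)^2))"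
      by (intro sums_diff S sums_If_finite_set) simp
    also have "(\<lambda>n. sw s n * (cf u n)^2 - (if n \<in> {..<N} then sw s n * (cf u n)^2 else 0)) = (\<lambda>n. sw s n * (cf (u - proj N u) n)^2)"
      using u by (auto simp: fun_eq_iff cf_diff HD(1)[OF V_subset_H[OF u]] HD(1)[OF proj_H] cf_proj)
    finally show "(\<lambda>n. sw s n * (cf (u - proj N u) n)^2) sums ((Sobolev_norm s u)^2 - (\<Sum>n<N. sw s n * (cf u n)^2))" .
    show "(\<lambda>n. sw s n * (cf (u - proj N u) n)^2) sums (Sobolev_norm s (u - proj N u))^2" by (intro Sobolev_norm_sums V_diff u proj_V)
  qed
  moreover have "(\<lambda>N. (Sobolev_norm s u)^2 - (\<Sum>n<N. sw s n * (cf u n)^2)) \<longlonglongrightarrow> (Sobolev_norm s u)^2 - (Sobolev_norm s u)^2"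
    using S unfolding sums_def by (intro tendsto_diff tendsto_const)
  ultimately show ?thesis by simp
qed

lemma Sobolev_norm_proj_le:
  assumes u: "u \<in> V s"
  shows "(Sobolev_norm s (proj N u))^2 \<le> (Sobolev_norm s u)^2"
  by (rule sums_le[OF _ Sobolev_norm_sums[OF proj_V] Sobolev_norm_sums[OF u]]) (auto simp: cf_proj)

lemma Bform_diff:
  assumes "u \<in> L2" "u' \<in> L2" "v \<in> L2"
  shows "Bform (u - u') v n = Bform u v n - Bform u' v n" "Bform v (u - u') n = Bform v u n - Bform v u' n"
proof -
  have e: "u - u' = (\<lambda>x. u x + (-1) *\<^sub>R u' x)" by (simp add: fun_eq_iff)
  have u': "(\<lambda>x. (-1) *\<^sub>R u' x) \<in> L2" using Sobolev_scale[of u' 0 "-1"] assms by (simp add: L2_eq_Sobolev_0)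
  show "Bform (u - u') v n = Bform u v n - Bform u' v n"
    unfolding Bform_def e trilinear_add(1)[OF assms(1) u' assms(3,3) trig_field_eigfield] trilinear_scale_left by simp
  show "Bform v (u - u') n = Bform v u n - Bform v u' n"
    unfolding Bform_def e trilinear_add(2)[OF assms(3,3) assms(1) u' trig_field_eigfield] trilinear_scale_right by simp
qed

lemma eigval_Cauchy_Schwarz:
  "(\<Sum>n<N. c n * d n)^2 \<le> (\<Sum>n<N. 1 / eigval n * (c n)^2) * (\<Sum>n<N. eigval n * (d n)^2)"
  using Cauchy_Schwarz_ineq_sum[of "\<lambda>n. c n / sqrt (eigval n)" "\<lambda>n. sqrt (eigval n) * d n" "{..<N}"] eigval_pos
  by (simp add: power_mult_distrib power_divide less_imp_neq[OF eigval_pos, symmetric])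

text \<open>Duality between the weights \<open>inv_eigval\<close> and \<open>eigval\<close>; the
  leading constant is independent of \<open>N\<close>.\<close>

lemma Bform_sum_bound:
  assumes u: "u \<in> V (3 / 4)" and v: "v \<in> V (3 / 4)"
  shows "(\<Sum>n<N. Bform u v n * c n)^2 \<le> 768 * ((Sobolev_norm (3 / 4) u)^2 * (Sobolev_norm (3 / 4) v)^2) * (\<Sum>n<N. eigval n * (c n)^2)"
proof -
  let ?R = "768 * ((Sobolev_norm (3 / 4) u)^2 * (Sobolev_norm (3 / 4) v)^2)"
  have "ennreal (\<Sum>n<N. 1 / eigval n * (Bform u v n)^2) = (\<Sum>n<N. ennreal (1 / eigval n * (Bform u v n)^2))" by (rule sum_ennreal[symmetric]) simp
  also have "... \<le> sqn inv_eigval (Bform u v)" unfolding sqn_def by (rule sum_le_suminf) auto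
  also have "... \<le> ennreal ?R"
    using Bform_bound[OF u v] unfolding Sobolev_norm_cf(1)[OF u] Sobolev_norm_cf(1)[OF v] by (simp add: ennreal_mult)
  finally have "(\<Sum>n<N. 1 / eigval n * (Bform u v n)^2) \<le> ?R" by (subst (asm) ennreal_le_iff) auto
  moreover note eigval_Cauchy_Schwarz[of "Bform u v" c N]
  ultimately show ?thesis by (elim order_trans mult_right_mono) (auto intro!: sum_nonneg)
qed

lemma eigval_powr_1 [simp]: "eigval n powr 1 = eigval n"
  using eigval_pos[of n] by simp

lemma V_eigval_summable: "u \<in> V 1 \<Longrightarrow> summable (\<lambda>n. eigval n * (cf u n)^2)"
  using sqn_eigval_powr_finite[of u 1] sqn_finite_iff[of eigval "cf u"] unfolding eigval_powr_1 by simp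

text \<open>For the truncation \<open>proj N u\<close> the skewness is exact. Replacing
  \<open>u\<close> by it, one argument at a time, costs a multiple of the Sobolev norm of order 3/4
  of \<open>u - proj N u\<close>, which tends to 0. The constant is
  \<open>2 * 2 * 768 = 3072\<close>.\<close>

theorem Bform_energy:
  assumes u: "u \<in> V 1"
  shows "(\<lambda>n. Bform u u n * cf u n) sums 0"
proof -
  let ?S = "\<lambda>v. (Sobolev_norm (3 / 4) v)^2" and ?L = "\<Sum>n. eigval n * (cf u n)^2"
  have u': "u \<in> V (3 / 4)" and uL: "u \<in> L2" using V_mono[OF u, of "3 / 4"] HD(1)[OF V_subset_H[OF u]] by auto
  note L = sum_le_suminf[OF V_eigval_summable[OF u], of "{..<N}" for N]
  have b: "(\<Sum>n<N. Bform v w n * cf u n)^2 \<le> 768 * (?S v * ?S w) * ?L" if "v \<in> V (3 / 4)" "w \<in> V (3 / 4)" for v w N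
    by (rule order_trans[OF Bform_sum_bound[OF that] mult_left_mono[OF L]]) auto
  have sq: "(a + b)^2 \<le> 2 * a^2 + 2 * b^2" for a b :: real using sum_squares_bound[of a b] by (simp add: power2_sum)
  have "(\<Sum>n<N. Bform u u n * cf u n)^2 \<le> 3072 * (?S u * ?L) * ?S (u - proj N u)" for N
  proof -
    let ?p = "proj N u"
    have pL: "?p \<in> L2" by (rule HD(1)[OF proj_H])
    have d: "u - ?p \<in> V (3 / 4)" by (intro V_diff u' proj_V)
    have "(\<Sum>n<N. Bform ?p ?p n * cf u n) = (\<Sum>n<N. cf u n * Bform ?p ?p n)" by (simp add: mult.commute)
    also have "... = trilinear ?p ?p ?p" unfolding proj_def[of N u] by (rule trilinear_sum_test[symmetric]) (use pL in \<open>auto simp: proj_def\<close>)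
    also have "... = 0" by (rule trilinear_antisymmetric[OF proj_trig HD(2)[OF proj_H] proj_trig])
    finally have z: "(\<Sum>n<N. Bform ?p ?p n * cf u n) = 0" .
    have "(\<Sum>n<N. Bform u u n * cf u n) = (\<Sum>n<N. Bform (u - ?p) u n * cf u n) + (\<Sum>n<N. Bform ?p (u - ?p) n * cf u n) + (\<Sum>n<N. Bform ?p ?p n * cf u n)"
      unfolding sum.distrib[symmetric] by (intro sum.cong refl) (simp add: Bform_diff[OF uL pL uL] Bform_diff[OF uL pL pL] algebra_simps)
    then have "(\<Sum>n<N. Bform u u n * cf u n)^2 \<le> 2 * (\<Sum>n<N. Bform (u - ?p) u n * cf u n)^2 + 2 * (\<Sum>n<N. Bform ?p (u - ?p) n * cf u n)^2"
      by (simp only: z add_0_right sq)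
    also have "... \<le> 2 * (768 * (?S (u - ?p) * ?S u) * ?L) + 2 * (768 * (?S ?p * ?S (u - ?p)) * ?L)"
      by (intro add_mono mult_left_mono b d u' proj_V) auto
    also have "... \<le> 2 * (768 * (?S (u - ?p) * ?S u) * ?L) + 2 * (768 * (?S u * ?S (u - ?p)) * ?L)"
      by (intro add_mono mult_left_mono mult_right_mono Sobolev_norm_proj_le u') (auto intro!: suminf_nonneg V_eigval_summable u)
    finally show ?thesis by (simp add: mult_ac)
  qed
  moreover have "(\<lambda>N. 3072 * (?S u * ?L) * ?S (u - proj N u)) \<longlonglongrightarrow> 0"
    using tendsto_mult_right_zero[OF Sobolev_norm_diff_proj[OF u']] by blast
  ultimately have "(\<lambda>N. (\<Sum>n<N. Bform u u n * cf u n)^2) \<longlonglongrightarrow> 0" by (rule squeeze_0[rotated]) (simp only: zero_le_power2)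
  then show ?thesis unfolding sums_def by (rule tendsto_0_of_square)
qed

lemma proj_component_tendsto:
  assumes "u \<in> H"
  shows "(\<lambda>N. LINT x|torus. (proj N u x $ i - u x $ i)^2) \<longlonglongrightarrow> 0"
proof (rule real_tendsto_sandwich[OF _ _ tendsto_const])
  have d: "(\<lambda>x. u x - proj N u x) \<in> L2" for N using HD(1)[OF H_diff[OF assms proj_H]] by (simp add: fun_diff_def)
  have "(LINT x|torus. (proj N u x $ i - u x $ i)^2) \<le> (L2_norm (\<lambda>x. u x - proj N u x))^2" for N
    using L2_component_square_le[OF d, of N i] by (simp add: L2_norm_def power2_commute) (simp add: L2_inner_def)
  then show "\<forall>\<^sub>F N in sequentially. (LINT x|torus. (proj N u x $ i - u x $ i)^2) \<le> (L2_norm (\<lambda>x. u x - proj N u x))^2" by simp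
  show "(\<lambda>N. (L2_norm (\<lambda>x. u x - proj N u x))^2) \<longlonglongrightarrow> 0" using tendsto_power[OF eigfield_expansion[OF assms], of 2] by (simp add: proj_def)
qed simp

text \<open>Moves the derivative from \<open>v\<close> back to \<open>u\<close>, with the product of
  components of \<open>w\<close> and \<open>v\<close> as test function for the weak derivative. The
  term in which the derivative falls on \<open>w\<close> contains its divergence and
  vanishes.\<close>

lemma trilinear_weak_trig:
  assumes w: "trig_field w" "divfree w" and u: "u \<in> V 1" and v: "trig_field v"
  shows "trilinear w u v = (\<Sum>i\<in>UNIV. \<Sum>j\<in>UNIV. LINT x|torus. w x $ i * (weak_partial i (coord u j) x * v x $ j))"
proof -
  have wt: "(coord w j) \<in> trig_poly" and vt: "(coord v j) \<in> trig_poly" for j using w v by (auto simp: trig_field_def)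
  have uL: "u \<in> L2" by (rule HD(1)[OF V_subset_H[OF u]])
  have wd: "weakly_diff (coord u j)" for j using Sobolev_weakly_diff[of u 1] u by (simp add: V_iff)
  have i: "integrable torus (\<lambda>x. u x $ j * h x)" if "h \<in> trig_poly" for h j
    by (rule sq_int_mult_integrable[OF L2_component(1)[OF uL] trig_sq_int[OF that]])
  have e: "(LINT x|torus. w x $ i * u x $ j * partial i (coord v j) x) =
      - (LINT x|torus. w x $ i * (weak_partial i (coord u j) x * v x $ j)) - (LINT x|torus. u x $ j * (partial i (coord w i) x * v x $ j))" for i j
  proof -
    have "(LINT x|torus. u x $ j * (w x $ i * partial i (coord v j) x)) + (LINT x|torus. u x $ j * (partial i (coord w i) x * v x $ j))
        = (LINT x|torus. u x $ j * partial i (\<lambda>x. w x $ i * v x $ j) x)" by (subst Bochner_Integration.integral_add[symmetric])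
         (auto intro!: i trig_mult trig_partial wt vt simp: partial_trig_mult[OF wt vt] distrib_left)
    also have "... = - (LINT x|torus. weak_partial i (coord u j) x * (w x $ i * v x $ j))"
      by (intro weak_partial(4) wd trig_periodic trig_smooth trig_mult wt vt)
    finally show ?thesis by (simp add: mult_ac)
  qed
  have z: "(\<Sum>i\<in>UNIV. LINT x|torus. u x $ j * (partial i (coord w i) x * v x $ j)) = 0" for j
  proof -
    have "(\<Sum>i\<in>UNIV. LINT x|torus. u x $ j * (partial i (coord w i) x * v x $ j)) = (LINT x|torus. (\<Sum>i\<in>UNIV. u x $ j * (partial i (coord w i) x * v x $ j)))"
      by (rule Bochner_Integration.integral_sum[symmetric]) (intro i trig_mult trig_partial wt vt)
    also have "... = (LINT x|torus. 0)"
    proof (rule integral_cong_AE)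
      show "AE x in torus. (\<Sum>i\<in>UNIV. u x $ j * (partial i (coord w i) x * v x $ j)) = 0"
        using trig_divergence[OF w] by eventually_elim (simp flip: sum_distrib_left sum_distrib_right)
      show "(\<lambda>x. \<Sum>i\<in>UNIV. u x $ j * (partial i (coord w i) x * v x $ j)) \<in> borel_measurable torus"
        by (intro borel_measurable_sum borel_measurable_integrable i trig_mult trig_partial wt vt)
    qed simp
    finally show ?thesis by simp
  qed
  have "(\<Sum>i\<in>UNIV. \<Sum>j\<in>UNIV. LINT x|torus. u x $ j * (partial i (coord w i) x * v x $ j)) = 0" by (subst sum.swap) (simp add: z)
  then show ?thesis unfolding trilinear_def e by (simp add: sum_subtractf sum_negf)
qed

text \<open>Both sides are continuous in \<open>w\<close> for the L2 norm because the remaining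
  factors are square integrable, so \<open>w\<close> may be approximated by its truncations.\<close>

lemma trilinear_weak:
  assumes w: "w \<in> H" and u: "u \<in> V 1" and v: "trig_field v"
  shows "trilinear w u v = (\<Sum>i\<in>UNIV. \<Sum>j\<in>UNIV. LINT x|torus. w x $ i * (weak_partial i (coord u j) x * v x $ j))"
proof (rule LIMSEQ_unique)
  have wL: "w \<in> L2" and uL: "u \<in> L2" using HD(1)[OF w] HD(1)[OF V_subset_H[OF u]] by auto
  have wd: "weakly_diff (coord u j)" for j using Sobolev_weakly_diff[of u 1] u by (simp add: V_iff)
  note lim = L2_tendsto_integral_mult[OF trig_sq_int[OF trig_fieldD[OF proj_trig]] L2_component(1)[OF wL] _ proj_component_tendsto[OF w]]
  have "(\<lambda>N. - (\<Sum>i\<in>UNIV. \<Sum>j\<in>UNIV. LINT x|torus. proj N w x $ i * (u x $ j * partial i (coord v j) x))) \<longlonglongrightarrow>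
      - (\<Sum>i\<in>UNIV. \<Sum>j\<in>UNIV. LINT x|torus. w x $ i * (u x $ j * partial i (coord v j) x))"
    by (intro tendsto_minus tendsto_sum lim sq_int_mult_bounded L2_component uL trig_partial trig_fieldD v)
  then show "(\<lambda>N. trilinear (proj N w) u v) \<longlonglongrightarrow> trilinear w u v" by (simp add: trilinear_def mult.assoc)
  show "(\<lambda>N. trilinear (proj N w) u v) \<longlonglongrightarrow> (\<Sum>i\<in>UNIV. \<Sum>j\<in>UNIV. LINT x|torus. w x $ i * (weak_partial i (coord u j) x * v x $ j))"
    unfolding trilinear_weak_trig[OF proj_trig HD(2)[OF proj_H] u v]
    by (intro tendsto_sum lim sq_int_mult_bounded weak_partial(1) wd trig_fieldD v)
qed

text \<open>The partial sums are the pairings with the truncations of \<open>v\<close>. By the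
  product estimate the products of \<open>u\<close> with these truncations converge in L2, and they
  are integrated against the square integrable weak derivatives of \<open>u\<close>.\<close>

theorem Bform_sums_B_pairing:
  assumes u: "u \<in> V 1" and v: "v \<in> V 1"
  shows "(\<lambda>n. Bform u u n * cf v n) sums B_pairing u u v"
proof -
  have uL: "u \<in> L2" and vL: "v \<in> L2" using HD(1)[OF V_subset_H[OF u]] HD(1)[OF V_subset_H[OF v]] by auto
  have u': "u \<in> V (3 / 4)" and v': "v \<in> V (3 / 4)" using V_mono[OF u, of "3 / 4"] V_mono[OF v, of "3 / 4"] by auto
  have wd: "weakly_diff (coord u j)" for j using Sobolev_weakly_diff[of u 1] u by (simp add: V_iff)
  let ?D = "\<lambda>i j. weak_partial i (coord u j)"
  note D = weak_partial(1)[OF wd]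
  note pe = product_estimate[OF V_kw_summable(1)[OF u'] V_kw_summable(1)]
  have "(\<lambda>N. LINT x|torus. u x $ i * proj N v x $ j * ?D i j x) \<longlonglongrightarrow> (LINT x|torus. u x $ i * v x $ j * ?D i j x)" for i j
  proof (rule L2_tendsto_integral_mult[OF pe(1)[OF proj_V] pe(1)[OF v'] D])
    let ?k = "kw_norm2 (coord u i)"
    have "(LINT x|torus. (u x $ i * proj N v x $ j - u x $ i * v x $ j)^2) \<le> 384 * ?k * (Sobolev_norm (3 / 4) (v - proj N v))^2" for N
    proof -
      have d: "v - proj N v \<in> V (3 / 4)" by (intro V_diff v' proj_V)
      have "ennreal (\<Sum>j\<in>UNIV. kw_norm2 (\<lambda>x. (v - proj N v) x $ j)) \<le> ennreal ((Sobolev_norm (3 / 4) (v - proj N v))^2)"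
        using V_kw_summable(2)[OF d] by (simp only: Sobolev_norm_cf(1)[OF d])
      then have "(\<Sum>j\<in>UNIV. kw_norm2 (\<lambda>x. (v - proj N v) x $ j)) \<le> (Sobolev_norm (3 / 4) (v - proj N v))^2" by (subst (asm) ennreal_le_iff) auto
      then have "kw_norm2 (\<lambda>x. (v - proj N v) x $ j) \<le> (Sobolev_norm (3 / 4) (v - proj N v))^2"
        by (rule order_trans[rotated]) (rule member_le_sum, auto intro: kw_norm2_nonneg)
      then have "384 * ?k * kw_norm2 (\<lambda>x. (v - proj N v) x $ j) \<le> 384 * ?k * (Sobolev_norm (3 / 4) (v - proj N v))^2"
        by (intro mult_left_mono) (auto intro: kw_norm2_nonneg)
      with pe(2)[OF d, of i j] have "(LINT x|torus. (u x $ i * (v - proj N v) x $ j)^2) \<le> 384 * ?k * (Sobolev_norm (3 / 4) (v - proj N v))^2"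
        by linarith
      moreover have "(u x $ i * (v - proj N v) x $ j)^2 = (u x $ i * proj N v x $ j - u x $ i * v x $ j)^2" for x
        unfolding right_diff_distrib[symmetric] power_mult_distrib by (simp add: power2_commute)
      ultimately show ?thesis by simp
    qed
    moreover have "(\<lambda>N. 384 * ?k * (Sobolev_norm (3 / 4) (v - proj N v))^2) \<longlonglongrightarrow> 0"
      by (intro tendsto_mult_right_zero Sobolev_norm_diff_proj v')
    ultimately show "(\<lambda>N. LINT x|torus. (u x $ i * proj N v x $ j - u x $ i * v x $ j)^2) \<longlonglongrightarrow> 0" by (rule squeeze_0[rotated]) simp
  qed
  then have "(\<lambda>N. \<Sum>i\<in>UNIV. \<Sum>j\<in>UNIV. LINT x|torus. u x $ i * proj N v x $ j * ?D i j x) \<longlonglongrightarrow> (\<Sum>i\<in>UNIV. \<Sum>j\<in>UNIV. LINT x|torus. u x $ i * v x $ j * ?D i j x)"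
    by (intro tendsto_sum)
  also have "(\<lambda>N. \<Sum>i\<in>UNIV. \<Sum>j\<in>UNIV. LINT x|torus. u x $ i * proj N v x $ j * ?D i j x) = (\<lambda>N. \<Sum>n<N. Bform u u n * cf v n)"
  proof
    fix N
    have "trilinear u u (proj N v) = (\<Sum>n<N. cf v n * Bform u u n)" unfolding proj_def by (rule trilinear_sum_test[OF uL uL])
    then show "(\<Sum>i\<in>UNIV. \<Sum>j\<in>UNIV. LINT x|torus. u x $ i * proj N v x $ j * ?D i j x) = (\<Sum>n<N. Bform u u n * cf v n)"
      unfolding trilinear_weak[OF V_subset_H[OF u] u proj_trig] by (simp add: mult_ac)
  qed
  also have "(\<Sum>i\<in>UNIV. \<Sum>j\<in>UNIV. LINT x|torus. u x $ i * v x $ j * ?D i j x) = B_pairing u u v"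
  proof -
    have i: "integrable torus (\<lambda>x. u x $ i * v x $ j * ?D i j x)" for i j by (rule sq_int_mult_integrable[OF pe(1)[OF v'] D])
    have "advect u u x \<bullet> v x = (\<Sum>i\<in>UNIV. \<Sum>j\<in>UNIV. u x $ i * v x $ j * ?D i j x)" for x
      unfolding advect_def inner_vec_def by (subst sum.swap) (simp add: sum_distrib_left sum_distrib_right mult_ac)
    then have "B_pairing u u v = (LINT x|torus. (\<Sum>i\<in>UNIV. \<Sum>j\<in>UNIV. u x $ i * v x $ j * ?D i j x))" by (simp add: B_pairing_def)
    also have "... = (\<Sum>i\<in>UNIV. LINT x|torus. (\<Sum>j\<in>UNIV. u x $ i * v x $ j * ?D i j x))"
      by (intro Bochner_Integration.integral_sum Bochner_Integration.integrable_sum i)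
    also have "... = (\<Sum>i\<in>UNIV. \<Sum>j\<in>UNIV. LINT x|torus. u x $ i * v x $ j * ?D i j x)"
      by (intro sum.cong refl Bochner_Integration.integral_sum i)
    finally show ?thesis ..
  qed
  finally show ?thesis unfolding sums_def .
qed

section \<open>The equation in eigenfield coordinates\<close>

definition syn :: "(nat \<Rightarrow> real) \<Rightarrow> field" where
  "syn c = (SOME u. u \<in> H \<and> cf u = c)"

lemma syn:
  assumes "sqn (\<lambda>n. 1) c < \<infinity>"
  shows "syn c \<in> H" "cf (syn c) = c"
proof -
  have "\<exists>u. u \<in> H \<and> cf u = c" by (rule synthesis[OF assms]) blast
  from someI_ex[OF this] show "syn c \<in> H" "cf (syn c) = c" by (auto simp: syn_def)
qed

text \<open>Eigenvalues of the operator that acts on the time derivative.\<close>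

definition voigt :: "real \<Rightarrow> real \<Rightarrow> nat \<Rightarrow> real" where
  "voigt \<alpha> r n = 1 + \<alpha> powr (2 * r) * eigval n powr r"

lemma voigt_ge_1: "1 \<le> voigt \<alpha> r n" by (simp add: voigt_def)

lemma sqn_1_le_voigt: "sqn (\<lambda>n. 1) c \<le> sqn (voigt \<alpha> r) c" by (intro sqn_mono mult_right_mono voigt_ge_1) simp

lemma syn_voigt:
  assumes "sqn (voigt \<alpha> r) c < \<infinity>"
  shows "syn c \<in> H" "cf (syn c) = c" "syn c \<in> L2"
  using syn[OF order.strict_trans1[OF sqn_1_le_voigt assms]] HD(1) by auto

lemma sw_le_eigval: "0 \<le> s \<Longrightarrow> sw s n \<le> 2 powr s * eigval n powr s"
  using eigval_ge_1[of n] by (subst powr_mult[symmetric]) (auto intro!: powr_mono2)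

lemma syn_V1:
  assumes "sqn (voigt \<alpha> r) c < \<infinity>" "sqn eigval c < \<infinity>"
  shows "syn c \<in> V 1"
proof -
  have "sqn (sw 1) c \<le> sqn (\<lambda>n. 2 * eigval n) c" using sw_le_eigval[of 1] eigval_pos by (intro sqn_mono mult_right_mono) auto
  also have "... = ennreal 2 * sqn eigval c" by (rule sqn_scale) auto
  also have "... < \<infinity>" using assms(2) by (simp add: ennreal_mult_less_top)
  finally show ?thesis using syn_voigt[OF assms(1)] by (simp add: V_cf)
qed

text \<open>The square root grows at least like \<open>eigval n powr ((r + 1) / 2)\<close>, and
  \<open>(r + 1) / 2 \<ge> 3 / 4\<close> is the condition \<open>r \<ge> 1 / 2\<close>. The constant
  2 covers \<open>2 powr (3 / 4)\<close>.\<close>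

lemma sw_le_sigma:
  assumes "0 < \<alpha>" "1 / 2 \<le> r"
  shows "sw (3 / 4) n \<le> 2 / \<alpha> powr r * sqrt (voigt \<alpha> r n * eigval n)"
proof -
  have l: "1 \<le> eigval n" by (rule eigval_ge_1)
  have "\<alpha> powr r * eigval n powr (3 / 4) \<le> \<alpha> powr r * eigval n powr ((r + 1) / 2)"
    using assms l by (intro mult_left_mono powr_mono) auto
  also have "... = sqrt (\<alpha> powr (2 * r) * eigval n powr r * eigval n)"
  proof (rule real_sqrt_unique[symmetric])
    have "(\<alpha> powr r)^2 = \<alpha> powr (2 * r)" by (simp add: power2_eq_square flip: powr_add)
    moreover have "(eigval n powr ((r + 1) / 2))^2 = eigval n powr r * eigval n"
      using l by (simp add: power2_eq_square flip: powr_add) (simp add: powr_add)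
    ultimately show "(\<alpha> powr r * eigval n powr ((r + 1) / 2))^2 = \<alpha> powr (2 * r) * eigval n powr r * eigval n"
      by (simp add: power_mult_distrib mult.assoc)
  qed auto
  also have "... \<le> sqrt (voigt \<alpha> r n * eigval n)" by (intro real_sqrt_le_mono mult_right_mono) (auto simp: voigt_def)
  finally have "eigval n powr (3 / 4) \<le> sqrt (voigt \<alpha> r n * eigval n) / \<alpha> powr r" using assms by (simp add: field_simps)
  moreover have "sw (3 / 4) n \<le> 2 powr (3 / 4) * eigval n powr (3 / 4)" by (rule sw_le_eigval) simp
  moreover have "2 powr (3 / 4) * eigval n powr (3 / 4) \<le> 2 powr 1 * eigval n powr (3 / 4)" by (intro mult_right_mono powr_mono) auto
  ultimately show ?thesis by simp
qed

theorem voigt_semilinear: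
  assumes "0 < \<nu>" "0 < \<alpha>" "1 / 2 \<le> r"
  obtains K C where "semilinear_evolution (voigt \<alpha> r) eigval \<nu> (\<lambda>c d. Bform (syn c) (syn d)) K C"
proof -
  interpret D: diagonal_evolution "voigt \<alpha> r" eigval \<nu> by unfold_locales (auto intro: voigt_ge_1 eigval_ge_1 assms)
  let ?m = "voigt \<alpha> r" and ?F = "\<lambda>c d. Bform (syn c) (syn d)"
  note sv = syn_voigt[where \<alpha> = \<alpha> and r = r]
  define B where "B = 2 / \<alpha> powr r"
  have B: "0 < B" using assms by (simp add: B_def)
  have "\<exists>C. \<forall>n. 0 \<le> C n \<and> (\<forall>u v. u \<in> L2 \<longrightarrow> v \<in> L2 \<longrightarrow> (Bform u v n)^2 \<le> C n * (L2_inner u u * L2_inner v v))"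
    by (rule choice, rule allI, rule Bform_component_bound) blast
  then obtain C where C0: "\<And>n. 0 \<le> C n" and C: "\<And>u v n. u \<in> L2 \<Longrightarrow> v \<in> L2 \<Longrightarrow> (Bform u v n)^2 \<le> C n * (L2_inner u u * L2_inner v v)"
    by blast
  have comp: "ennreal ((?F c d n)^2) \<le> ennreal (C n) * (sqn ?m c * sqn ?m d)" if "sqn ?m c < \<infinity>" "sqn ?m d < \<infinity>" for c d n
  proof -
    have i: "ennreal (L2_inner (syn e) (syn e)) \<le> sqn ?m e" "0 \<le> L2_inner (syn e) (syn e)" if "sqn ?m e < \<infinity>" for e
      using L2_inner_self_cf(1)[OF sv(1)[OF that]] sqn_1_le_voigt[of e] by (auto simp: sv[OF that] L2_inner_def)
    have "ennreal ((?F c d n)^2) \<le> ennreal (C n * (L2_inner (syn c) (syn c) * L2_inner (syn d) (syn d)))"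
      by (intro ennreal_leI C sv(3) that)
    also have "... = ennreal (C n) * (ennreal (L2_inner (syn c) (syn c)) * ennreal (L2_inner (syn d) (syn d)))"
      using C0 i(2) that by (simp add: ennreal_mult)
    also have "... \<le> ennreal (C n) * (sqn ?m c * sqn ?m d)" by (intro mult_left_mono mult_mono i that) auto
    finally show ?thesis .
  qed
  have s: "sqn (sw (3 / 4)) c \<le> ennreal B * sqn D.\<sigma> c" for c
  proof -
    have "sqn (sw (3 / 4)) c \<le> sqn (\<lambda>n. B * D.\<sigma> n) c" unfolding B_def D.\<sigma>_def by (intro sqn_mono mult_right_mono sw_le_sigma assms) auto
    also have "... = ennreal B * sqn D.\<sigma> c" using B by (intro sqn_scale) auto
    finally show ?thesis .
  qed
  have "semilinear_evolution ?m eigval \<nu> ?F (768 * B^2) C"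
  proof (unfold_locales, goal_cases)
    case 1 show ?case using B by simp
  next
    case 2 show ?case by (rule C0)
  next
    case (3 c d n)
    have L: "syn c \<in> L2" "syn d \<in> L2" using sv 3 by auto
    have mm: "sqn ?m (\<lambda>n. c n - d n) < \<infinity>" using order.strict_trans1[OF sqn_diff[of ?m c d]] 3 by (auto simp: ennreal_mult_less_top)
    \<comment> \<open>\<open>syn\<close> chooses a representative, so it respects differences only
      almost everywhere.\<close>
    have ae: "AE x in torus. syn (\<lambda>n. c n - d n) x = (syn c - syn d) x"
      by (rule H_eq_AE[of _ "syn c - syn d"]) (auto intro!: sv mm H_diff 3 simp: cf_diff[OF L] sv[OF mm] sv[OF 3(1)] sv[OF 3(2)])
    have dL: "syn c - syn d \<in> L2" by (intro HD H_diff sv 3)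
    have "Bform (syn (\<lambda>n. c n - d n)) (syn c) n = Bform (syn c - syn d) (syn c) n"
      by (rule Bform_cong_AE[OF ae _ sv(3)[OF mm] dL L(1) L(1)]) simp
    moreover have "Bform (syn d) (syn (\<lambda>n. c n - d n)) n = Bform (syn d) (syn c - syn d) n"
      by (rule Bform_cong_AE[OF _ ae L(2) L(2) sv(3)[OF mm] dL]) simp
    ultimately show ?case by (simp add: Bform_diff[OF L L(1)] Bform_diff[OF L L(2)])
  next
    case (4 c d n) then show ?case by (rule comp)
  next
    case (5 c d)
    have K: "ennreal (768 * B^2) \<noteq> 0" using B by (simp add: ennreal_eq_0_iff)
    \<comment> \<open>If one \<open>\<sigma>\<close>-norm is 0 and the other infinite, the
      right-hand side is 0 by the convention for such products in \<open>ennreal\<close>, so the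
      left-hand side must be shown to vanish; \<open>comp\<close> does this.\<close>
    have zero: "sqn D.il (?F c d) = 0" if "c = (\<lambda>n. 0) \<or> d = (\<lambda>n. 0)"
    proof -
      have z: "sqn ?m c * sqn ?m d = 0" using that by (elim disjE) (simp_all only: sqn_zero mult_zero_left mult_zero_right)
      have "?F c d n = 0" for n using comp[OF 5, of n] unfolding z mult_zero_right by simp
      then have "?F c d = (\<lambda>n. 0)" by (rule ext)
      then show ?thesis by simp
    qed
    show ?case
    proof (cases "c = (\<lambda>n. 0) \<or> d = (\<lambda>n. 0)")
      case True then show ?thesis by (simp add: zero)
    next
      case False
      then have nz: "sqn D.\<sigma> c \<noteq> 0" "sqn D.\<sigma> d \<noteq> 0" using sqn_eq_0[of D.\<sigma>] D.\<sigma>_pos by blast+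
      show ?thesis
      proof (cases "sqn D.\<sigma> c = \<infinity> \<or> sqn D.\<sigma> d = \<infinity>")
        case True then show ?thesis using nz K by (auto simp: ennreal_mult_top ennreal_top_mult)
      next
        case False
        have V: "syn c \<in> V (3 / 4)" "syn d \<in> V (3 / 4)"
          using s[of c] s[of d] False 5 by (auto simp: V_cf sv ennreal_mult_less_top top.not_eq_extremum intro!: order.strict_trans1[OF s])
        have "sqn D.il (?F c d) \<le> ennreal 768 * (sqn (sw (3 / 4)) c * sqn (sw (3 / 4)) d)"
          using Bform_bound[OF V] by (simp add: D.il_def[abs_def] sv(2)[OF 5(1)] sv(2)[OF 5(2)])
        also have "... \<le> ennreal 768 * ((ennreal B * sqn D.\<sigma> c) * (ennreal B * sqn D.\<sigma> d))" by (intro mult_left_mono mult_mono s) auto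
        also have "... = ennreal (768 * B^2) * (sqn D.\<sigma> c * sqn D.\<sigma> d)" using B by (simp add: ennreal_mult power2_eq_square mult_ac)
        finally show ?thesis .
      qed
    qed
  next
    case (6 c) then show ?case using Bform_energy[OF syn_V1[OF 6]] by (simp add: sv)
  qed
  then show ?thesis by (rule that)
qed

section \<open>Bochner spaces\<close>

text \<open>The Bochner spaces live on the open time interval and the mode equations on the closed
  one; the endpoints form a null set.\<close>

lemma AE_open_closed: "(AE t in lebesgue_on {0<..<T}. P t) \<longleftrightarrow> (AE t in lebesgue_on {0..T}. P t)" for T :: real
proof -
  have "AE t :: real in lebesgue. t \<noteq> 0" "AE t :: real in lebesgue. t \<noteq> T" using AE_completion[OF AE_lborel_singleton] by blast+
  then have "AE t in lebesgue. (t \<in> {0<..<T} \<longrightarrow> P t) \<longleftrightarrow> (t \<in> {0..T} \<longrightarrow> P t)" by eventually_elim auto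
  then have "(AE t in lebesgue. t \<in> {0<..<T} \<longrightarrow> P t) \<longleftrightarrow> (AE t in lebesgue. t \<in> {0..T} \<longrightarrow> P t)" by (rule eventually_subst)
  then show ?thesis by (simp add: AE_restrict_space_iff)
qed

lemma AE_subinterval:
  assumes "AE \<tau> in lebesgue_on {s..t}. P \<tau>" "s \<le> s'" "t' \<le> (t :: real)"
  shows "AE \<tau> in lebesgue_on {s'..t'}. P \<tau>"
  using assms by (auto simp: AE_restrict_space_iff elim!: eventually_mono)

lemma nn_integral_open_closed: "(\<integral>\<^sup>+t. g t \<partial>lebesgue_on {0<..<T}) = II 0 T g"
proof -
  have "AE t :: real in lebesgue. t \<noteq> 0" "AE t :: real in lebesgue. t \<noteq> T" using AE_completion[OF AE_lborel_singleton] by blast+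
  then have "AE t in lebesgue. g t * indicator {0<..<T} t = g t * indicator {0..T} t" by eventually_elim (auto simp: indicator_def)
  then show ?thesis unfolding II_eq by (subst nn_integral_restrict_space) (auto intro: nn_integral_cong_AE)
qed

lemma integrable_open_closed: "integrable (lebesgue_on {0<..<T}) f \<longleftrightarrow> integrable (lebesgue_on {0..T}) f"
  for f :: "real \<Rightarrow> real"
  using absolutely_integrable_on_Icc_iff_Ioo[where f = f and a = 0 and b = T] by (simp add: integrable_restrict_space set_integrable_def)

lemma LINT_open_closed:
  assumes "integrable (lebesgue_on {0..T}) (f :: real \<Rightarrow> real)"
  shows "(LINT t|lebesgue_on {0<..<T}. f t) = (LINT t|lebesgue_on {0..T}. f t)"
  using assms lebesgue_integral_eq_integral[OF assms] lebesgue_integral_eq_integral[of "{0<..<T}" f]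
  by (simp add: integrable_open_closed integral_open_interval_real)

text \<open>The integrand is identified only almost everywhere; its measurability comes from
  completeness of Lebesgue measure.\<close>

lemma LINT_AE_continuous:
  fixes f h :: "real \<Rightarrow> real"
  assumes "continuous_on {s..t} h" "AE \<tau> in lebesgue_on {s..t}. f \<tau> = h \<tau>"
  shows "(LINT \<tau>|lebesgue_on {s..t}. f \<tau>) = integral {s..t} h"
proof -
  have h: "integrable (lebesgue_on {s..t}) h" by (rule continuous_imp_integrable_real[OF assms(1)])
  have "AE \<tau> in lebesgue_on {s..t}. h \<tau> = f \<tau>" using assms(2) by eventually_elim simp
  from borel_measurable_AE_interval[OF borel_measurable_integrable[OF h] this]
  have "(LINT \<tau>|lebesgue_on {s..t}. f \<tau>) = (LINT \<tau>|lebesgue_on {s..t}. h \<tau>)"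
    using assms(2) borel_measurable_integrable[OF h] by (intro integral_cong_AE)
  then show ?thesis using lebesgue_integral_eq_integral[OF h] by simp
qed

lemma eigval_le_sw: "sqn eigval c \<le> sqn (sw 1) c"
  using eigval_pos by (intro sqn_mono mult_right_mono) (auto intro: less_imp_le)

lemma V_sqn_eigval: "u \<in> V 1 \<Longrightarrow> sqn eigval (cf u) < \<infinity>"
  using eigval_le_sw[of "cf u"] by (auto simp: V_cf intro: order.strict_trans1)

text \<open>Sequences with finite \<open>sqn inv_eigval\<close> act on \<open>V 1\<close> by
  duality: Cauchy-Schwarz with weights \<open>1 / eigval n\<close> and \<open>eigval n\<close>,
  first for partial sums and then in the limit.\<close>

lemma dual_sums:
  assumes h: "sqn inv_eigval h < \<infinity>" and v: "v \<in> V 1"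
  shows "summable (\<lambda>n. h n * cf v n)" "\<bar>\<Sum>n. h n * cf v n\<bar> \<le> sqrt (enn2real (sqn inv_eigval h)) * Sobolev_norm 1 v"
proof -
  have sh: "summable (\<lambda>n. 1 / eigval n * (h n)^2)" using h by (subst (asm) sqn_finite_iff) auto
  note sv = V_eigval_summable[OF v]
  show s: "summable (\<lambda>n. h n * cf v n)"
    by (rule summable_comparison_test'[OF summable_add[OF sh sv]]) (simp only: real_norm_def abs_mult_le_weighted[OF eigval_pos])
  have A0: "0 \<le> (\<Sum>n. 1 / eigval n * (h n)^2)" by (rule suminf_nonneg[OF sh]) simp
  have "sqn inv_eigval h = ennreal (\<Sum>n. 1 / eigval n * (h n)^2)" by (rule sqn_eq_suminf[OF _ sh]) simp
  then have A: "enn2real (sqn inv_eigval h) = (\<Sum>n. 1 / eigval n * (h n)^2)" by (simp only: enn2real_ennreal[OF A0])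
  have B: "(\<Sum>n<N. eigval n * (cf v n)^2) \<le> (Sobolev_norm 1 v)^2" for N
  proof -
    have "(\<Sum>n<N. eigval n * (cf v n)^2) \<le> (\<Sum>n<N. sw 1 n * (cf v n)^2)"
      using eigval_pos by (intro sum_mono mult_right_mono) (auto intro: less_imp_le)
    also have "... \<le> (Sobolev_norm 1 v)^2"
      using sum_le_suminf[OF sums_summable[OF Sobolev_norm_sums[OF v]], of "{..<N}"] sums_unique[OF Sobolev_norm_sums[OF v]] by simp
    finally show ?thesis .
  qed
  have "(\<Sum>n<N. h n * cf v n)^2 \<le> (\<Sum>n. 1 / eigval n * (h n)^2) * (Sobolev_norm 1 v)^2" for N
    by (rule order_trans[OF eigval_Cauchy_Schwarz mult_mono[OF sum_le_suminf[OF sh] B]]) (use A0 in \<open>auto intro!: sum_nonneg\<close>)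
  moreover have "(\<lambda>N. (\<Sum>n<N. h n * cf v n)^2) \<longlonglongrightarrow> (\<Sum>n. h n * cf v n)^2" by (intro tendsto_power summable_LIMSEQ s)
  ultimately have "(\<Sum>n. h n * cf v n)^2 \<le> (\<Sum>n. 1 / eigval n * (h n)^2) * (Sobolev_norm 1 v)^2" by (intro LIMSEQ_le_const2) auto
  then have "\<bar>\<Sum>n. h n * cf v n\<bar> \<le> sqrt ((\<Sum>n. 1 / eigval n * (h n)^2) * (Sobolev_norm 1 v)^2)" by (intro real_le_rsqrt) simp
  then show "\<bar>\<Sum>n. h n * cf v n\<bar> \<le> sqrt (enn2real (sqn inv_eigval h)) * Sobolev_norm 1 v"
    using Sobolev_norm_cf(2)[OF v] by (simp add: A real_sqrt_mult)
qed

text \<open>Dominated convergence for series. The factor 3 is the distance to \<open>c k\<close>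
  that approximants of size at most \<open>2 * \<bar>c k\<bar>\<close> can have.\<close>

lemma sqn_dominated_tendsto_0:
  assumes w: "\<And>k. 0 \<le> w k" and c: "sqn w c < \<infinity>" and d: "\<And>N k. \<bar>d N k\<bar> \<le> 3 * \<bar>c k\<bar>" "\<And>k. (\<lambda>N. d N k) \<longlonglongrightarrow> 0"
  shows "(\<lambda>N. sqn w (d N)) \<longlonglongrightarrow> 0"
proof -
  have s: "summable (\<lambda>k. w k * (c k)^2)" using c w by (simp only: sqn_finite_iff)
  have b: "w k * (d N k)^2 \<le> 9 * (w k * (c k)^2)" for N k
  proof -
    have "\<bar>d N k\<bar> \<le> \<bar>3 * c k\<bar>" using d(1)[of N k] by (simp add: abs_mult)
    then have "(d N k)^2 \<le> (3 * c k)^2" by (simp only: abs_le_square_iff)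
    from mult_left_mono[OF this w[of k]] show ?thesis by (simp add: power_mult_distrib mult.left_commute)
  qed
  have sN: "summable (\<lambda>k. w k * (d N k)^2)" for N by (rule summable_comparison_test'[OF summable_mult[OF s, of 9]]) (use b w in simp)
  have "(\<lambda>N. \<Sum>k. w k * (d N k)^2) \<longlonglongrightarrow> (\<Sum>k::nat. 0::real)"
  proof (rule tannerys_theorem[THEN conjunct2, THEN conjunct2])
    show "(\<lambda>N. w k * (d N k)^2) \<longlonglongrightarrow> 0" for k using tendsto_mult_right_zero[OF tendsto_null_power[OF d(2)[of k], of 2], of "w k"] by simp
    show "\<forall>\<^sub>F (k, N) in sequentially \<times>\<^sub>F sequentially. norm (w k * (d N k)^2) \<le> 9 * (w k * (c k)^2)"
      using b w by (intro always_eventually) auto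
  qed (auto intro: summable_mult s)
  then have "(\<lambda>N. ennreal (\<Sum>k. w k * (d N k)^2)) \<longlonglongrightarrow> ennreal 0" by (intro tendsto_ennrealI) simp
  then show ?thesis by (simp add: sqn_eq_suminf[OF w sN])
qed

text \<open>Strong measurability asks for approximants with finitely many values. The
  \<open>N\<close>-th one keeps the first \<open>N\<close> modes, each replaced by a real simple
  function. One sequence serves all weights, so it converges in both norms of the intersection space
  at once.\<close>

lemma simple_coefficients:
  assumes c: "\<And>n. (\<lambda>t. c t n) \<in> borel_measurable M"
  obtains s :: "nat \<Rightarrow> 'a \<Rightarrow> nat \<Rightarrow> real" where "\<And>N. simple_function M (s N)" "\<And>N t k. N \<le> k \<Longrightarrow> s N t k = 0"
    "\<forall>w. \<forall>t\<in>space M. (\<forall>n. 0 \<le> w n) \<longrightarrow> sqn w (c t) < \<infinity> \<longrightarrow> (\<lambda>N. sqn w (\<lambda>n. s N t n - c t n)) \<longlonglongrightarrow> 0"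
proof -
  have "\<forall>n. \<exists>F. (\<forall>i. simple_function M (F i)) \<and> (\<forall>x\<in>space M. (\<lambda>i. F i x) \<longlonglongrightarrow> c x n) \<and>
      (\<forall>i. \<forall>x\<in>space M. dist (F i x) 0 \<le> 2 * dist (c x n) 0)" by (intro allI borel_measurable_implies_sequence_metric c)
  from choice[OF this] obtain F where "\<forall>n. (\<forall>i. simple_function M (F n i)) \<and> (\<forall>x\<in>space M. (\<lambda>i. F n i x) \<longlonglongrightarrow> c x n) \<and>
      (\<forall>i. \<forall>x\<in>space M. dist (F n i x) 0 \<le> 2 * dist (c x n) 0)" ..
  then have F: "\<And>n i. simple_function M (F n i)" "\<And>n x. x \<in> space M \<Longrightarrow> (\<lambda>i. F n i x) \<longlonglongrightarrow> c x n"
      "\<And>n i x. x \<in> space M \<Longrightarrow> \<bar>F n i x\<bar> \<le> 2 * \<bar>c x n\<bar>" by auto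
  define s where "s N t k = (if k < N then F k N t else 0)" for N t k
  have "simple_function M (\<lambda>t k. if k < j then F k N t else 0)" for N j
  proof (induction j)
    case 0 then show ?case by simp
  next
    case (Suc j)
    \<comment> \<open>Coordinates are added one at a time: a sequence-valued map with finitely many
      nonzero coordinates, all simple, is simple.\<close>
    have "simple_function M (\<lambda>t. (\<lambda>k. if k < j then F k N t else 0)(j := F j N t))"
      by (rule simple_function_compose2[where h = "\<lambda>f b. f(j := b)", OF Suc F(1)])
    also have "(\<lambda>t. (\<lambda>k. if k < j then F k N t else 0)(j := F j N t)) = (\<lambda>t k. if k < Suc j then F k N t else 0)"
      by (auto simp: fun_eq_iff less_Suc_eq)
    finally show ?case .
  qed
  then have "simple_function M (s N)" for N unfolding s_def[abs_def] by simp
  moreover have "s N t k = 0" if "N \<le> k" for N t k using that by (simp add: s_def)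
  moreover have "(\<lambda>N. sqn w (\<lambda>n. s N t n - c t n)) \<longlonglongrightarrow> 0" if "\<And>n. 0 \<le> w n" "t \<in> space M" "sqn w (c t) < \<infinity>" for w t
  proof (rule sqn_dominated_tendsto_0[OF that(1,3)])
    show "\<bar>s N t k - c t k\<bar> \<le> 3 * \<bar>c t k\<bar>" for N k using F(3)[OF that(2), of k N] by (auto simp: s_def)
    have e: "\<forall>\<^sub>F N in sequentially. s N t k = F k N t" for k using eventually_gt_at_top[of k] by eventually_elim (simp add: s_def)
    have "(\<lambda>N. s N t k) \<longlonglongrightarrow> c t k" for k using F(2)[OF that(2), of k] tendsto_cong[OF e[of k]] by simp
    then show "(\<lambda>N. s N t k - c t k) \<longlonglongrightarrow> 0" for k by (simp add: LIM_zero)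
  qed
  ultimately show ?thesis by (intro that[of s]) auto
qed

lemma zero_V: "(\<lambda>x. 0) \<in> V s"
  using proj_V[of 0 "\<lambda>x. 0" s] by (simp add: proj_def)

lemma Sobolev_norm_zero: "Sobolev_norm s (\<lambda>x. 0) = 0"
proof -
  have "cf (\<lambda>x. 0) n = 0" for n using cf_proj[of 0 "\<lambda>x. 0" n] by (simp add: proj_def)
  then have "(\<lambda>n. 0) sums (Sobolev_norm s (\<lambda>x. 0))^2" using Sobolev_norm_sums[OF zero_V, of s] by simp
  from sums_unique2[OF this sums_zero] show ?thesis by simp
qed

section \<open>The dual of the intersection space and strong measurability\<close>

lemma Sobolev_1_le_V_inter_norm: "v \<in> V_inter r \<Longrightarrow> Sobolev_norm 1 v \<le> V_inter_norm r v"
  using Sobolev_norm_cf(2) by (auto simp: V_inter_def V_inter_norm_def)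

text \<open>\<open>V_dual_norm\<close> is a supremum of reals and carries information only for
  bounded functionals, so a bound \<open>C\<close> is carried along explicitly.\<close>

definition dual_bounded :: "real \<Rightarrow> real \<Rightarrow> (field \<Rightarrow> real) \<Rightarrow> bool" where
  "dual_bounded r C g \<longleftrightarrow> 0 \<le> C \<and> (\<forall>v\<in>V_inter r. \<bar>g v\<bar> \<le> C * V_inter_norm r v)"

lemma V_dual_norm_bounds:
  assumes "dual_bounded r C g"
  shows "0 \<le> V_dual_norm r g" "V_dual_norm r g \<le> C" "v \<in> V_inter r \<Longrightarrow> V_inter_norm r v \<le> 1 \<Longrightarrow> \<bar>g v\<bar> \<le> V_dual_norm r g"
proof -
  let ?B = "{v \<in> V_inter r. V_inter_norm r v \<le> 1}"
  have z: "(\<lambda>x. 0) \<in> ?B" by (simp add: V_inter_def V_inter_norm_def zero_V Sobolev_norm_zero)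
  have C: "\<bar>g v\<bar> \<le> C" if "v \<in> ?B" for v
  proof -
    have "\<bar>g v\<bar> \<le> C * V_inter_norm r v" using assms that by (simp add: dual_bounded_def)
    also have "... \<le> C * 1" using assms that by (intro mult_left_mono) (auto simp: dual_bounded_def)
    finally show ?thesis by simp
  qed
  show "V_dual_norm r g \<le> C" unfolding V_dual_norm_def using z C by (intro cSUP_least) auto
  have bdd: "bdd_above ((\<lambda>v. \<bar>g v\<bar>) ` ?B)" using C by (intro bdd_aboveI2) auto
  show u: "\<bar>g v\<bar> \<le> V_dual_norm r g" if "v \<in> V_inter r" "V_inter_norm r v \<le> 1" for v
    unfolding V_dual_norm_def using that by (intro cSUP_upper bdd) simp
  show "0 \<le> V_dual_norm r g" using u[of "\<lambda>x. 0"] z by (auto intro: order_trans[OF abs_ge_zero])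
qed

lemma dual_bounded_diff:
  assumes "dual_bounded r C f" "dual_bounded r D g"
  shows "dual_bounded r (C + D) (f - g)"
  unfolding dual_bounded_def
proof (intro conjI ballI)
  fix v assume v: "v \<in> V_inter r"
  have "\<bar>f v\<bar> \<le> C * V_inter_norm r v" "\<bar>g v\<bar> \<le> D * V_inter_norm r v" using assms v by (auto simp: dual_bounded_def)
  then show "\<bar>(f - g) v\<bar> \<le> (C + D) * V_inter_norm r v" unfolding fun_diff_def distrib_right by linarith
qed (use assms in \<open>simp add: dual_bounded_def\<close>)

text \<open>Continuity of the dual norm along approximating functionals; its measurability in time
  rests on this.\<close>

lemma V_dual_norm_triangle:
  assumes f: "dual_bounded r C f" and g: "dual_bounded r D g"
  shows "\<bar>V_dual_norm r f - V_dual_norm r g\<bar> \<le> V_dual_norm r (f - g)"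
proof -
  have le: "V_dual_norm r a \<le> V_dual_norm r b + V_dual_norm r (f - g)"
    if a: "dual_bounded r A a" and b: "dual_bounded r B b" and ab: "\<And>v. \<bar>a v\<bar> \<le> \<bar>b v\<bar> + \<bar>(f - g) v\<bar>" for a b A B
    unfolding V_dual_norm_def[of r a]
  proof (rule cSUP_least)
    show "{v \<in> V_inter r. V_inter_norm r v \<le> 1} \<noteq> {}"
      by (auto simp: V_inter_def V_inter_norm_def zero_V Sobolev_norm_zero intro!: exI[of _ "\<lambda>x. 0"])
    fix v assume "v \<in> {v \<in> V_inter r. V_inter_norm r v \<le> 1}"
    then show "\<bar>a v\<bar> \<le> V_dual_norm r b + V_dual_norm r (f - g)"
      using V_dual_norm_bounds(3)[OF b, of v] V_dual_norm_bounds(3)[OF dual_bounded_diff[OF f g], of v] ab[of v] by auto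
  qed
  have "V_dual_norm r f \<le> V_dual_norm r g + V_dual_norm r (f - g)" by (rule le[OF f g]) simp
  moreover have "V_dual_norm r g \<le> V_dual_norm r f + V_dual_norm r (f - g)" by (rule le[OF g f]) simp
  ultimately show ?thesis by linarith
qed

definition dualf :: "(nat \<Rightarrow> real) \<Rightarrow> field \<Rightarrow> real" where
  "dualf h v = (\<Sum>n. h n * cf v n)"

lemma dualf_bounded:
  assumes "sqn inv_eigval h < \<infinity>"
  shows "dual_bounded r (sqrt (enn2real (sqn inv_eigval h))) (dualf h)"
  unfolding dual_bounded_def
proof (intro conjI ballI)
  fix v assume v: "v \<in> V_inter r"
  then have "\<bar>dualf h v\<bar> \<le> sqrt (enn2real (sqn inv_eigval h)) * Sobolev_norm 1 v"
    unfolding dualf_def by (intro dual_sums(2) assms) (simp add: V_inter_def)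
  also have "... \<le> sqrt (enn2real (sqn inv_eigval h)) * V_inter_norm r v" by (intro mult_left_mono Sobolev_1_le_V_inter_norm v) simp
  finally show "\<bar>dualf h v\<bar> \<le> sqrt (enn2real (sqn inv_eigval h)) * V_inter_norm r v" .
qed simp

lemma V_inter_L2: "v \<in> V_inter r \<Longrightarrow> v \<in> L2" by (auto simp: V_inter_def intro: HD V_subset_H)

lemma dualf_V_dual:
  assumes "sqn inv_eigval h < \<infinity>"
  shows "dualf h \<in> V_dual r"
  unfolding V_dual_def
proof (intro CollectI conjI ballI allI exI)
  fix u v assume u: "u \<in> V_inter r" and v: "v \<in> V_inter r"
  have "summable (\<lambda>n. h n * cf u n)" "summable (\<lambda>n. h n * cf v n)" using dual_sums(1)[OF assms] u v by (auto simp: V_inter_def)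
  then show "dualf h (\<lambda>x. u x + v x) = dualf h u + dualf h v"
    by (simp add: dualf_def cf_add[OF V_inter_L2[OF u] V_inter_L2[OF v]] distrib_left suminf_add)
next
  fix c u assume u: "u \<in> V_inter r"
  then have "summable (\<lambda>n. h n * cf u n)" using dual_sums(1)[OF assms] by (auto simp: V_inter_def)
  then show "dualf h (\<lambda>x. c *\<^sub>R u x) = c * dualf h u"
    by (simp add: dualf_def cf_scale[OF V_inter_L2[OF u]] mult.left_commute suminf_mult)
next
  show "u \<in> V_inter r \<Longrightarrow> \<bar>dualf h u\<bar> \<le> sqrt (enn2real (sqn inv_eigval h)) * V_inter_norm r u" for u
    using dualf_bounded[OF assms] by (simp add: dual_bounded_def)
qed

lemma V_dual_norm_dualf_diff:
  assumes h: "sqn inv_eigval h < \<infinity>" and k: "sqn inv_eigval k < \<infinity>"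
  shows "V_dual_norm r (dualf h - dualf k) \<le> sqrt (enn2real (sqn inv_eigval (\<lambda>n. h n - k n)))"
    "0 \<le> V_dual_norm r (dualf h - dualf k)"
proof -
  have "sqn inv_eigval (\<lambda>n. h n - k n) < \<infinity>"
    using order.strict_trans1[OF sqn_diff[of "\<lambda>n. 1 / eigval n" h k]] h k by (simp add: ennreal_mult_less_top)
  then have "dual_bounded r (sqrt (enn2real (sqn inv_eigval (\<lambda>n. h n - k n)))) (dualf (\<lambda>n. h n - k n))" by (rule dualf_bounded)
  moreover have "dualf (\<lambda>n. h n - k n) v = (dualf h - dualf k) v" if "v \<in> V_inter r" for v
    using dual_sums(1)[OF h, of v] dual_sums(1)[OF k, of v] that by (simp add: dualf_def V_inter_def left_diff_distrib suminf_diff)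
  ultimately have "dual_bounded r (sqrt (enn2real (sqn inv_eigval (\<lambda>n. h n - k n)))) (dualf h - dualf k)"
    by (simp add: dual_bounded_def)
  then show "V_dual_norm r (dualf h - dualf k) \<le> sqrt (enn2real (sqn inv_eigval (\<lambda>n. h n - k n)))"
    "0 \<le> V_dual_norm r (dualf h - dualf k)" by (auto dest: V_dual_norm_bounds)
qed

lemma sqrt_enn2real_tendsto_0: "(f \<longlongrightarrow> 0) F \<Longrightarrow> ((\<lambda>x. sqrt (enn2real (f x))) \<longlongrightarrow> 0) F"
  using tendsto_real_sqrt[OF tendsto_enn2real[of f 0 F]] by simp

lemma dualf_bochner_L2:
  assumes m: "\<And>n. (\<lambda>t. h t n) \<in> borel_measurable (lebesgue_on {0<..<T})"
    and fin: "\<And>t. t \<in> {0<..<T} \<Longrightarrow> sqn inv_eigval (h t) < \<infinity>"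
    and int: "(\<integral>\<^sup>+t. sqn inv_eigval (h t) \<partial>lebesgue_on {0<..<T}) < \<infinity>"
  shows "(\<lambda>t. dualf (h t)) \<in> bochner_L2 T (V_dual r) (V_dual_norm r)"
proof -
  let ?M = "lebesgue_on {0<..<T}" and ?w = "\<lambda>n. 1 / eigval n"
  obtain s where s': "\<And>N. simple_function ?M (s N)" "\<And>N t k. N \<le> k \<Longrightarrow> s N t k = 0"
    "\<forall>w. \<forall>t\<in>space ?M. (\<forall>n. 0 \<le> w n) \<longrightarrow> sqn w (h t) < \<infinity> \<longrightarrow> (\<lambda>N. sqn w (\<lambda>n. s N t n - h t n)) \<longlonglongrightarrow> 0"
    by (rule simple_coefficients[where c = h, OF m]) blast
  note s = s'(1,2) s'(3)[rule_format]
  have sf: "sqn ?w (s N t) < \<infinity>" for N t by (subst sqn_finite_iff) (simp, rule summable_finite[of "{..<N}"], simp_all add: s(2))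
  have lim: "(\<lambda>N. V_dual_norm r (dualf (s N t) - dualf (h t))) \<longlonglongrightarrow> 0" if t: "t \<in> {0<..<T}" for t
    by (rule squeeze_0[OF V_dual_norm_dualf_diff(2)[OF sf fin[OF t]] V_dual_norm_dualf_diff(1)[OF sf fin[OF t]]])
       (intro sqrt_enn2real_tendsto_0 s(3) fin, use t in auto)
  have meas: "(\<lambda>t. V_dual_norm r (dualf (h t))) \<in> borel_measurable ?M"
  proof (rule borel_measurable_LIMSEQ_real)
    show "(\<lambda>t. V_dual_norm r (dualf (s N t))) \<in> borel_measurable ?M" for N
      by (rule borel_measurable_simple_function, rule simple_function_compose1[OF s(1)])
    fix t assume "t \<in> space ?M"
    then have t: "t \<in> {0<..<T}" by simp
    have "(\<lambda>N. \<bar>V_dual_norm r (dualf (s N t)) - V_dual_norm r (dualf (h t))\<bar>) \<longlonglongrightarrow> 0"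
      by (rule squeeze_0[OF _ _ lim[OF t]]) (auto intro!: V_dual_norm_triangle dualf_bounded sf fin t)
    then show "(\<lambda>N. V_dual_norm r (dualf (s N t))) \<longlonglongrightarrow> V_dual_norm r (dualf (h t))" by (simp add: tendsto_rabs_zero_iff LIM_zero_iff)
  qed
  have "integrable ?M (\<lambda>t. (V_dual_norm r (dualf (h t)))^2)"
  proof (rule integrableI_bounded)
    show "(\<lambda>t. (V_dual_norm r (dualf (h t)))^2) \<in> borel_measurable ?M" using meas by simp
    have "(\<integral>\<^sup>+t. ennreal (norm ((V_dual_norm r (dualf (h t)))^2)) \<partial>?M) \<le> (\<integral>\<^sup>+t. sqn ?w (h t) \<partial>?M)"
    proof (rule nn_integral_mono)
      fix t assume "t \<in> space ?M"
      then have t: "t \<in> {0<..<T}" by simp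
      have "(V_dual_norm r (dualf (h t)))^2 \<le> (sqrt (enn2real (sqn ?w (h t))))^2"
        using V_dual_norm_bounds(1,2)[OF dualf_bounded[OF fin[OF t]]] by (intro power_mono)
      then have "ennreal ((V_dual_norm r (dualf (h t)))^2) \<le> ennreal (enn2real (sqn ?w (h t)))" by (intro ennreal_leI) simp
      also have "... = sqn ?w (h t)" using fin[OF t] by simp
      finally show "ennreal (norm ((V_dual_norm r (dualf (h t)))^2)) \<le> sqn ?w (h t)" by simp
    qed
    then show "(\<integral>\<^sup>+t. ennreal (norm ((V_dual_norm r (dualf (h t)))^2)) \<partial>?M) < \<infinity>" using int by (rule order.strict_trans1)
  qed
  moreover have "AE t in ?M. (\<lambda>N. V_dual_norm r (dualf (s N t) - dualf (h t))) \<longlonglongrightarrow> 0" using lim by (intro AE_I2) simp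
  moreover have "simple_function ?M (\<lambda>t. dualf (s N t))" for N by (rule simple_function_compose1[OF s(1)])
  moreover have "AE t in ?M. dualf (h t) \<in> V_dual r" using fin by (intro AE_I2 dualf_V_dual) simp
  ultimately show ?thesis
    unfolding bochner_L2_def using dualf_V_dual[OF sf] by (intro CollectI conjI exI[of _ "\<lambda>N t. dualf (s N t)"]) auto
qed

text \<open>Outside \<open>V s\<close> both sides are \<open>0\<close>: the left by the value of a divergent sum, the right by that of
  \<open>enn2real\<close> at infinity.\<close>

lemma Sobolev_norm_H:
  assumes "u \<in> H"
  shows "Sobolev_norm s u = sqrt (enn2real (sqn (sw s) (cf u)))"
proof (cases "u \<in> V s")
  case True
  then show ?thesis using Sobolev_norm_cf[OF True] by simp
next
  case False
  then have "sqn (sw s) (cf u) = \<infinity>" using assms by (metis V_cf infinity_ennreal_def top.not_eq_extremum)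
  moreover have "u \<notin> Sobolev s" using False assms HD[OF assms] by (simp add: V_iff)
  then have "Sobolev_norm s u = 0" using HD(1)[OF assms] by (simp add: Sobolev_def Sobolev_norm_def infsum_not_exists)
  ultimately show ?thesis by simp
qed

lemma syn_bochner_L2:
  assumes m: "\<And>n. (\<lambda>t. c t n) \<in> borel_measurable (lebesgue_on {0<..<T})"
    and fin: "\<And>t. t \<in> {0<..<T} \<Longrightarrow> sqn (\<lambda>n. 1) (c t) < \<infinity>"
    and int: "(\<integral>\<^sup>+t. sqn (sw 1) (c t) \<partial>lebesgue_on {0<..<T}) < \<infinity>" "(\<integral>\<^sup>+t. sqn (sw r) (c t) \<partial>lebesgue_on {0<..<T}) < \<infinity>"
  shows "(\<lambda>t. syn (c t)) \<in> bochner_L2 T (V_inter r) (V_inter_norm r)"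
proof -
  let ?M = "lebesgue_on {0<..<T}"
  define \<Psi> :: "nat \<Rightarrow> (nat \<Rightarrow> real) \<Rightarrow> field" where "\<Psi> N a = (\<lambda>x. \<Sum>k<N. a k *\<^sub>R eigfield k x)" for N a
  obtain s where s': "\<And>N. simple_function ?M (s N)" "\<And>N t k. N \<le> k \<Longrightarrow> s N t k = 0"
    "\<forall>w. \<forall>t\<in>space ?M. (\<forall>n. 0 \<le> w n) \<longrightarrow> sqn w (c t) < \<infinity> \<longrightarrow> (\<lambda>N. sqn w (\<lambda>n. s N t n - c t n)) \<longlonglongrightarrow> 0"
    by (rule simple_coefficients[where c = c, OF m]) blast
  note s = s'(1,2) s'(3)[rule_format]
  have sqm: "(\<lambda>t. sqn w (c t)) \<in> borel_measurable ?M" for w by (intro sqn_measurable m)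
  have cs: "cf (\<Psi> N (s N t)) = s N t" for N t unfolding \<Psi>_def cf_partial_sum[abs_def] by (auto simp: fun_eq_iff cf_partial_sum s(2))
  have sf: "sqn (sw q) (s N t) < \<infinity>" for N t q by (subst sqn_finite_iff) (simp, rule summable_finite[of "{..<N}"], simp_all add: s(2))
  have \<Psi>V: "\<Psi> N (s N t) \<in> V q" for N t q unfolding V_cf cs using sf by (auto simp: \<Psi>_def partial_sum_H)
  have sy: "syn (c t) \<in> H" "cf (syn (c t)) = c t" if "t \<in> {0<..<T}" for t using syn[OF fin[OF that]] by auto
  have ae: "AE t in ?M. sqn (sw 1) (c t) < \<infinity> \<and> sqn (sw r) (c t) < \<infinity>"
    using nn_integral_PInf_AE[OF sqm, of "sw 1"] nn_integral_PInf_AE[OF sqm, of "sw r"] int by (auto simp: top.not_eq_extremum)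
  have lim1: "(\<lambda>N. Sobolev_norm q (\<Psi> N (s N t) - syn (c t))) \<longlonglongrightarrow> 0" if t: "t \<in> {0<..<T}" and q: "sqn (sw q) (c t) < \<infinity>" for t q
  proof -
    have "\<Psi> N (s N t) - syn (c t) \<in> H" for N by (intro H_diff V_subset_H[OF \<Psi>V] sy t)
    moreover have "cf (\<Psi> N (s N t) - syn (c t)) = (\<lambda>n. s N t n - c t n)" for N
      by (auto simp: fun_eq_iff cs sy(2)[OF t] cf_diff[OF HD(1)[OF V_subset_H[OF \<Psi>V]] HD(1)[OF sy(1)[OF t]]])
    ultimately have "Sobolev_norm q (\<Psi> N (s N t) - syn (c t)) = sqrt (enn2real (sqn (sw q) (\<lambda>n. s N t n - c t n)))" for N
      by (simp add: Sobolev_norm_H)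
    then show ?thesis using s(3)[of t "sw q"] t q by (simp add: sqrt_enn2real_tendsto_0)
  qed
  have norm_eq: "V_inter_norm r (syn (c t)) = sqrt (enn2real (sqn (sw 1) (c t))) + sqrt (enn2real (sqn (sw r) (c t)))" if "t \<in> {0<..<T}" for t
    using sy[OF that] by (simp add: V_inter_norm_def Sobolev_norm_H)
  have "integrable ?M (\<lambda>t. (V_inter_norm r (syn (c t)))^2)"
  proof (rule integrableI_bounded)
    have "(\<lambda>t. (sqrt (enn2real (sqn (sw 1) (c t))) + sqrt (enn2real (sqn (sw r) (c t))))^2) \<in> borel_measurable ?M" using sqm by simp
    then show "(\<lambda>t. (V_inter_norm r (syn (c t)))^2) \<in> borel_measurable ?M"
      by (rule measurable_cong[THEN iffD1, rotated]) (simp add: norm_eq)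
    have "(\<integral>\<^sup>+t. ennreal (norm ((V_inter_norm r (syn (c t)))^2)) \<partial>?M) \<le> (\<integral>\<^sup>+t. 2 * sqn (sw 1) (c t) + 2 * sqn (sw r) (c t) \<partial>?M)"
    proof (rule nn_integral_mono_AE)
      have "AE t in ?M. t \<in> {0<..<T}" by (rule AE_I2) simp
      with ae show "AE t in ?M. ennreal (norm ((V_inter_norm r (syn (c t)))^2)) \<le> 2 * sqn (sw 1) (c t) + 2 * sqn (sw r) (c t)"
      proof eventually_elim
        case (elim t)
        let ?a = "enn2real (sqn (sw 1) (c t))" and ?b = "enn2real (sqn (sw r) (c t))"
        have "(sqrt ?a + sqrt ?b)^2 \<le> 2 * ?a + 2 * ?b" using sum_squares_bound[of "sqrt ?a" "sqrt ?b"] by (simp add: power2_sum)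
        then have "ennreal ((sqrt ?a + sqrt ?b)^2) \<le> ennreal (2 * ?a + 2 * ?b)" by (rule ennreal_leI)
        also have "... = 2 * ennreal ?a + 2 * ennreal ?b" by (simp add: ennreal_plus ennreal_mult)
        also have "... = 2 * sqn (sw 1) (c t) + 2 * sqn (sw r) (c t)" using elim by simp
        finally show ?case using elim by (simp add: norm_eq)
      qed
    qed
    also have "... = 2 * (\<integral>\<^sup>+t. sqn (sw 1) (c t) \<partial>?M) + 2 * (\<integral>\<^sup>+t. sqn (sw r) (c t) \<partial>?M)"
      using sqm by (simp add: nn_integral_add nn_integral_cmult)
    also have "... < \<infinity>" using int by (simp add: ennreal_mult_less_top)
    finally show "(\<integral>\<^sup>+t. ennreal (norm ((V_inter_norm r (syn (c t)))^2)) \<partial>?M) < \<infinity>" .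
  qed
  moreover have "AE t in ?M. t \<in> {0<..<T}" by (rule AE_I2) simp
  with ae have "AE t in ?M. (\<lambda>N. V_inter_norm r (\<Psi> N (s N t) - syn (c t))) \<longlonglongrightarrow> 0"
    unfolding V_inter_norm_def by eventually_elim (intro tendsto_add_zero lim1, auto)
  moreover from \<open>AE t in ?M. t \<in> {0<..<T}\<close> ae have "AE t in ?M. syn (c t) \<in> V_inter r"
    by eventually_elim (use sy in \<open>auto simp: V_inter_def V_cf\<close>)
  moreover have "simple_function ?M (\<lambda>t. \<Psi> N (s N t))" for N by (rule simple_function_compose1[OF s(1)])
  ultimately show ?thesis
    unfolding bochner_L2_def using \<Psi>V by (intro CollectI conjI exI[of _ "\<lambda>N t. \<Psi> N (s N t)"]) (auto simp: V_inter_def)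
qed

lemma stokes_power_inner_eigfield:
  assumes "u \<in> V s" "0 \<le> s"
  shows "L2_inner (stokes_power (s / 2) u) (stokes_power (s / 2) (eigfield n)) = eigval n powr s * cf u n"
proof (rule sums_unique2[OF stokes_power_inner[OF assms(1) eigfield_V assms(2)]])
  have "(\<lambda>k. eigval k powr s * (cf u k * cf (eigfield n) k)) = (\<lambda>k. if k = n then eigval k powr s * cf u k else 0)"
    by (auto simp: cf_eigfield)
  then show "(\<lambda>k. eigval k powr s * (cf u k * cf (eigfield n) k)) sums (eigval n powr s * cf u n)"
    using sums_single[of n "\<lambda>k. eigval k powr s * cf u k"] by simp
qed

lemma B_pairing_eigfield: "u \<in> V 1 \<Longrightarrow> B_pairing u u (eigfield n) = Bform u u n"
proof (rule sums_unique2[OF Bform_sums_B_pairing[OF _ eigfield_V]])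
  have "(\<lambda>k. Bform u u k * cf (eigfield n) k) = (\<lambda>k. if k = n then Bform u u k else 0)" by (auto simp: cf_eigfield)
  then show "(\<lambda>k. Bform u u k * cf (eigfield n) k) sums Bform u u n" using sums_single[of n "Bform u u"] by simp
qed

lemma Bform_syn_cf:
  assumes "u \<in> H"
  shows "Bform (syn (cf u)) (syn (cf u)) n = Bform u u n"
proof -
  note s = syn[OF L2_inner_self_cf(2)[OF assms]]
  have "AE x in torus. syn (cf u) x = u x" by (rule H_eq_AE[OF s(1) assms]) (simp add: s(2))
  then show ?thesis by (intro Bform_cong_AE HD(1) s assms)
qed

section \<open>Weak solutions\<close>

locale voigt_evolution = semilinear_evolution "voigt \<alpha> r" eigval \<nu> "\<lambda>c d. Bform (syn c) (syn d)" K C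
  for \<nu> \<alpha> r K C +
  assumes alpha_pos: "0 < \<alpha>" and r_ge: "1 / 2 \<le> r"
begin

section \<open>From weak solutions to mode equations\<close>

lemma sqn_voigt_le: "sqn (voigt \<alpha> r) c \<le> ennreal (1 + \<alpha> powr (2 * r)) * sqn (sw r) c"
proof -
  have "1 \<le> sw r n" "eigval n powr r \<le> sw r n" for n using r_ge eigval_ge_1[of n] by (auto intro!: ge_one_powr_ge_zero powr_mono2)
  then have "voigt \<alpha> r n \<le> (1 + \<alpha> powr (2 * r)) * sw r n" for n
    unfolding voigt_def distrib_right by (intro add_mono mult_left_mono) auto
  then have "sqn (voigt \<alpha> r) c \<le> sqn (\<lambda>n. (1 + \<alpha> powr (2 * r)) * sw r n) c" by (intro sqn_mono mult_right_mono) auto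
  also have "... = ennreal (1 + \<alpha> powr (2 * r)) * sqn (sw r) c" by (rule sqn_scale) auto
  finally show ?thesis .
qed

lemma sqn_sw_le: "sqn (sw r) c \<le> ennreal (2 powr r / \<alpha> powr (2 * r)) * sqn (voigt \<alpha> r) c"
proof -
  have "sw r n \<le> 2 powr r / \<alpha> powr (2 * r) * voigt \<alpha> r n" for n
  proof -
    have "sw r n \<le> 2 powr r * eigval n powr r" using r_ge by (intro sw_le_eigval) simp
    also have "... = 2 powr r / \<alpha> powr (2 * r) * (\<alpha> powr (2 * r) * eigval n powr r)" using alpha_pos by simp
    also have "... \<le> 2 powr r / \<alpha> powr (2 * r) * voigt \<alpha> r n" by (intro mult_left_mono) (auto simp: voigt_def)
    finally show ?thesis .
  qed
  then have "sqn (sw r) c \<le> sqn (\<lambda>n. 2 powr r / \<alpha> powr (2 * r) * voigt \<alpha> r n) c" by (intro sqn_mono mult_right_mono) auto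
  also have "... = ennreal (2 powr r / \<alpha> powr (2 * r)) * sqn (voigt \<alpha> r) c" by (rule sqn_scale) auto
  finally show ?thesis .
qed

lemma V_iff_voigt: "u \<in> V r \<longleftrightarrow> u \<in> H \<and> sqn (voigt \<alpha> r) (cf u) < \<infinity>"
  unfolding V_cf using order.strict_trans1[OF sqn_voigt_le[of "cf u"]] order.strict_trans1[OF sqn_sw_le[of "cf u"]]
  by (auto simp: ennreal_mult_less_top)

lemma syn_V:
  assumes "sqn (voigt \<alpha> r) c < \<infinity>"
  shows "syn c \<in> V r" "cf (syn c) = c"
  using syn_voigt[OF assms] assms by (auto simp: V_iff_voigt)

text \<open>Eigenfields lie in \<open>V_inter r\<close>, so testing with them yields the mode
  equations. At almost every time \<open>w \<tau>\<close> lies in \<open>V 1\<close>, where the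
  pairings equal continuous functions of time; this turns the Lebesgue integrals into integrals of
  the modes.\<close>

lemma weak_solution_imp_solution:
  assumes u0: "u0 \<in> V r" and T: "0 < T" and w: "weak_solution \<nu> \<alpha> r u0 T w"
  shows "solution 0 T (\<lambda>t. cf (w t))" "cf (w 0) = cf u0"
proof -
  let ?y = "\<lambda>t. cf (w t)" and ?m = "voigt \<alpha> r"
  let ?N = "\<lambda>\<tau> n. Bform (syn (?y \<tau>)) (syn (?y \<tau>)) n"
  have wV: "w t \<in> V r" and wlim: "((\<lambda>t'. Sobolev_norm r (w t' - w t)) \<longlongrightarrow> 0) (at t within {0..T})" if "t \<in> {0..T}" for t
    using w that by (auto simp: weak_solution_def continuous_V_def)
  have wc: "weighted_continuous 0 T ?y" unfolding weighted_continuous_def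
  proof (intro ballI conjI)
    fix t assume t: "t \<in> {0..T}"
    then show "sqn ?m (?y t) < \<infinity>" using wV V_iff_voigt by blast
    let ?A = "1 + \<alpha> powr (2 * r)"
    have "sqn ?m (\<lambda>n. ?y t' n - ?y t n) \<le> ennreal (?A * (Sobolev_norm r (w t' - w t))^2)" if "t' \<in> {0..T}" for t'
    proof -
      have "(\<lambda>n. ?y t' n - ?y t n) = cf (w t' - w t)" using HD(1)[OF V_subset_H[OF wV]] that t by (simp add: fun_eq_iff cf_diff)
      then show ?thesis
        using sqn_voigt_le[of "cf (w t' - w t)"] Sobolev_norm_cf(1)[OF V_diff[OF wV wV], of t' t] that t by (simp add: ennreal_mult)
    qed
    then have e: "\<forall>\<^sub>F t' in at t within {0..T}. sqn ?m (\<lambda>n. ?y t' n - ?y t n) \<le> ennreal (?A * (Sobolev_norm r (w t' - w t))^2)"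
      unfolding eventually_at_filter by (intro always_eventually) auto
    have "((\<lambda>t'. ennreal (?A * (Sobolev_norm r (w t' - w t))^2)) \<longlongrightarrow> ennreal 0) (at t within {0..T})"
      by (intro tendsto_ennrealI tendsto_mult_right_zero tendsto_null_power wlim t) simp
    from tendsto_sandwich[OF always_eventually e tendsto_const this]
    show "((\<lambda>t'. sqn ?m (\<lambda>n. ?y t' n - ?y t n)) \<longlongrightarrow> 0) (at t within {0..T})" by simp
  qed
  have bo: "integrable (lebesgue_on {0<..<T}) (\<lambda>t. (V_inter_norm r (w t))^2)" "AE t in lebesgue_on {0<..<T}. w t \<in> V_inter r"
    using w by (auto simp: weak_solution_def bochner_L2_def)
  have fin: "II 0 T (\<lambda>\<tau>. sqn eigval (?y \<tau>)) < \<infinity>"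
  proof -
    have "II 0 T (\<lambda>\<tau>. sqn eigval (?y \<tau>)) \<le> (\<integral>\<^sup>+t. ennreal (norm ((V_inter_norm r (w t))^2)) \<partial>lebesgue_on {0<..<T})"
      unfolding nn_integral_open_closed[symmetric]
    proof (rule nn_integral_mono_AE)
      show "AE t in lebesgue_on {0<..<T}. sqn eigval (?y t) \<le> ennreal (norm ((V_inter_norm r (w t))^2))" using bo(2)
      proof eventually_elim
        case (elim t)
        then have v: "w t \<in> V 1" by (simp add: V_inter_def)
        have "(Sobolev_norm 1 (w t))^2 \<le> (V_inter_norm r (w t))^2"
          by (intro power_mono Sobolev_1_le_V_inter_norm elim Sobolev_norm_cf(2) v)
        then have "ennreal ((Sobolev_norm 1 (w t))^2) \<le> ennreal (norm ((V_inter_norm r (w t))^2))" by (intro ennreal_leI) simp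
        then show ?case using order_trans[OF eigval_le_sw[of "cf (w t)"]] by (simp only: Sobolev_norm_cf(1)[OF v])
      qed
    qed
    also have "... < \<infinity>" using bo(1) by (simp only: integrable_iff_bounded)
    finally show ?thesis .
  qed
  have ae: "AE \<tau> in lebesgue_on {0..T}. w \<tau> \<in> V 1" using bo(2) unfolding AE_open_closed by eventually_elim (simp add: V_inter_def)
  have yc: "continuous_on {0..T} (\<lambda>\<tau>. ?y \<tau> n)" for n by (rule weighted_continuous_modes[OF wc])
  have Nc: "continuous_on {0..T} (\<lambda>\<tau>. ?N \<tau> n)" for n by (rule F_continuous[OF wc])
  have eq: "?m n * ?y t n = ?m n * cf u0 n + integral {0..t} (\<lambda>\<tau>. - ?N \<tau> n - (\<nu> * eigval n) * ?y \<tau> n)" if t: "t \<in> {0..T}" for t n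
  proof -
    have sub: "{0..t} \<subseteq> {0..T}" using t by auto
    note yt = continuous_on_subset[OF yc sub] and Nt = continuous_on_subset[OF Nc sub]
    have aet: "AE \<tau> in lebesgue_on {0..t}. w \<tau> \<in> V 1" using AE_subinterval[OF ae] t by simp
    have e: "eigfield n \<in> V_inter r" by (simp add: V_inter_def eigfield_V)
    have "L2_inner (w t) (eigfield n)
        + \<alpha> powr (2 * r) * L2_inner (stokes_power (r / 2) (w t)) (stokes_power (r / 2) (eigfield n))
        + \<nu> * (LINT \<tau>|lebesgue_on {0..t}. L2_inner (stokes_power (1 / 2) (w \<tau>)) (stokes_power (1 / 2) (eigfield n)))
      = - (LINT \<tau>|lebesgue_on {0..t}. B_pairing (w \<tau>) (w \<tau>) (eigfield n)) + L2_inner u0 (eigfield n)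
        + \<alpha> powr (2 * r) * L2_inner (stokes_power (r / 2) u0) (stokes_power (r / 2) (eigfield n))"
      using w t e unfolding weak_solution_def by blast
    moreover have "(LINT \<tau>|lebesgue_on {0..t}. L2_inner (stokes_power (1 / 2) (w \<tau>)) (stokes_power (1 / 2) (eigfield n)))
        = integral {0..t} (\<lambda>\<tau>. eigval n * ?y \<tau> n)"
      by (rule LINT_AE_continuous) (intro continuous_intros yt, use aet in eventually_elim, simp add: stokes_power_inner_eigfield)
    moreover have "(LINT \<tau>|lebesgue_on {0..t}. B_pairing (w \<tau>) (w \<tau>) (eigfield n)) = integral {0..t} (\<lambda>\<tau>. ?N \<tau> n)"
      by (rule LINT_AE_continuous[OF Nt], use aet in eventually_elim) (simp add: B_pairing_eigfield Bform_syn_cf V_subset_H)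
    moreover have "integral {0..t} (\<lambda>\<tau>. - ?N \<tau> n - (\<nu> * eigval n) * ?y \<tau> n) = - integral {0..t} (\<lambda>\<tau>. ?N \<tau> n) - \<nu> * integral {0..t} (\<lambda>\<tau>. eigval n * ?y \<tau> n)"
      by (subst Henstock_Kurzweil_Integration.integral_diff)
         (auto intro!: integrable_continuous_interval continuous_intros yt Nt simp: mult.assoc)
    ultimately show ?thesis
      using r_ge by (simp add: stokes_power_inner_eigfield[OF wV[OF t]] stokes_power_inner_eigfield[OF u0] voigt_def distrib_right flip: cf_def)
  qed
  show y0: "cf (w 0) = cf u0"
  proof
    \<comment> \<open>At \<open>t = 0\<close> the integral is over a single point, and
      \<open>voigt \<alpha> r n\<close> is positive.\<close>
    fix n show "cf (w 0) n = cf u0 n" using eq[of 0 n] T m_pos[of n] by simp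
  qed
  have "linear_solution 0 T (\<lambda>t n. - ?N t n) ?y"
    unfolding linear_solution_def y0 by (intro allI conjI ballI eq yc continuous_on_minus Nc)
  then show "solution 0 T ?y" unfolding solution_def using wc fin by blast
qed

section \<open>From mode equations to weak solutions\<close>

lemma multiplier_finite:
  fixes \<phi> :: "real \<Rightarrow> real"
  assumes \<phi>: "continuous_on {0..T} \<phi>" and y: "sqn_int 0 T w y < \<infinity>" "\<And>n. continuous_on {0..T} (\<lambda>\<tau>. y \<tau> n)" "\<And>n. 0 \<le> w n"
  shows "II 0 T (\<lambda>\<tau>. sqn w (\<lambda>n. \<phi> \<tau> * y \<tau> n)) < \<infinity>"
proof -
  have "bounded (\<phi> ` {0..T})" by (intro compact_imp_bounded compact_continuous_image \<phi>) simp
  then obtain M where M: "\<And>\<tau>. \<tau> \<in> {0..T} \<Longrightarrow> \<bar>\<phi> \<tau>\<bar> \<le> M" unfolding bounded_iff by (auto simp del: atLeastAtMost_iff)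
  have "II 0 T (\<lambda>\<tau>. sqn w (\<lambda>n. \<phi> \<tau> * y \<tau> n)) \<le> II 0 T (\<lambda>\<tau>. ennreal (M^2) * sqn w (y \<tau>))"
  proof (rule II_mono)
    fix \<tau> assume \<tau>: "\<tau> \<in> {0..T}"
    have "(\<phi> \<tau>)^2 \<le> M^2" using M[OF \<tau>] abs_le_square_iff[of "\<phi> \<tau>" M] by auto
    then have "w n * (\<phi> \<tau> * y \<tau> n)^2 \<le> M^2 * w n * (y \<tau> n)^2" for n
      using mult_right_mono[of "(\<phi> \<tau>)^2" "M^2" "w n * (y \<tau> n)^2"] y(3)[of n] by (simp add: power_mult_distrib mult_ac)
    then have "sqn w (\<lambda>n. \<phi> \<tau> * y \<tau> n) \<le> sqn (\<lambda>n. M^2 * w n) (y \<tau>)" by (rule sqn_mono)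
    also have "... = ennreal (M^2) * sqn w (y \<tau>)" by (rule sqn_scale) (auto simp: y(3))
    finally show "sqn w (\<lambda>n. \<phi> \<tau> * y \<tau> n) \<le> ennreal (M^2) * sqn w (y \<tau>)" .
  qed
  also have "... = ennreal (M^2) * sqn_int 0 T w y" unfolding II_def by (intro nn_integral_cmult measurable_sqn_interval y)
  also have "... < \<infinity>" using y(1) by (simp add: ennreal_mult_less_top)
  finally show ?thesis .
qed

text \<open>The time derivative of mode \<open>n\<close> along a solution with coefficients
  \<open>c\<close>.\<close>

definition velocity :: "(nat \<Rightarrow> real) \<Rightarrow> nat \<Rightarrow> real" where
  "velocity c n = (- Bform (syn c) (syn c) n - \<nu> * eigval n * c n) / voigt \<alpha> r n"

lemma il_eq: "il = inv_eigval" by (simp add: fun_eq_iff il_def)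

lemma II_const_finite: "a < \<infinity> \<Longrightarrow> II 0 T (\<lambda>t. a) < \<infinity>"
proof -
  have "emeasure (lebesgue_on {0..T}) (space (lebesgue_on {0..T})) = emeasure lebesgue {0..T}" by (simp add: emeasure_restrict_space)
  then show "a < \<infinity> \<Longrightarrow> ?thesis" unfolding II_def by (cases "0 \<le> T") (auto simp: ennreal_mult_less_top)
qed

lemma series_integral:
  assumes "\<And>n. continuous_on {0..t} (\<lambda>\<tau>. y \<tau> n)" "sqn_int 0 t il y < \<infinity>" "v \<in> V 1"
    and "AE \<tau> in lebesgue_on {0..t}. (\<lambda>n. y \<tau> n * cf v n) sums f \<tau>"
  shows "integrable (lebesgue_on {0..t}) f"
    "(\<lambda>n. integral {0..t} (\<lambda>\<tau>. y \<tau> n) * cf v n) sums (LINT \<tau>|lebesgue_on {0..t}. f \<tau>)"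
  using mode_series_integral[where d = "\<lambda>\<tau>. cf v", OF assms(1,2) _ II_const_finite[OF V_sqn_eigval[OF assms(3)]] assms(4)] by simp_all

text \<open>The dual norm has weight \<open>1 / eigval n\<close>. In it the viscous term becomes
  \<open>\<nu>^2\<close> times \<open>sqn eigval\<close>, the convection term is controlled by
  \<open>Z\<close>, and division by \<open>voigt \<alpha> r n \<ge> 1\<close> does not increase
  anything.\<close>

lemma velocity_finite:
  assumes c: "solution 0 T c"
  shows "II 0 T (\<lambda>\<tau>. sqn il (velocity (c \<tau>))) < \<infinity>"
proof -
  note S = solutionD[OF c]
  let ?N = "\<lambda>\<tau> n. Bform (syn (c \<tau>)) (syn (c \<tau>)) n"
  have "sqn il (velocity (c \<tau>)) \<le> 2 * sqn il (\<lambda>n. - ?N \<tau> n) + ennreal (2 * \<nu>^2) * sqn eigval (c \<tau>)" for \<tau>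
  proof -
    have "sqn il (velocity (c \<tau>)) \<le> sqn il (\<lambda>n. - ?N \<tau> n - \<nu> * eigval n * c \<tau> n)"
    proof (intro sqn_mono mult_left_mono)
      fix n
      have "1 \<le> (voigt \<alpha> r n)^2" using m_ge[of n] by simp
      then show "(velocity (c \<tau>) n)^2 \<le> (- ?N \<tau> n - \<nu> * eigval n * c \<tau> n)^2"
        unfolding velocity_def power_divide using divide_left_mono[of 1 "(voigt \<alpha> r n)^2" "(- ?N \<tau> n - \<nu> * eigval n * c \<tau> n)^2"]
          less_imp_neq[OF m_pos[of n]] by simp
    qed simp
    also have "... \<le> 2 * sqn il (\<lambda>n. - ?N \<tau> n) + 2 * sqn il (\<lambda>n. \<nu> * eigval n * c \<tau> n)" by (rule sqn_diff) simp
    also have "sqn il (\<lambda>n. \<nu> * eigval n * c \<tau> n) = sqn (\<lambda>n. \<nu>^2 * eigval n) (c \<tau>)"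
      unfolding sqn_def il_def using eigval_pos by (simp add: power_mult_distrib power2_eq_square less_imp_neq[OF eigval_pos, symmetric] mult_ac)
    also have "... = ennreal (\<nu>^2) * sqn eigval (c \<tau>)" by (rule sqn_scale) auto
    finally show ?thesis by (simp add: ennreal_mult mult.assoc)
  qed
  then have "II 0 T (\<lambda>\<tau>. sqn il (velocity (c \<tau>))) \<le> II 0 T (\<lambda>\<tau>. 2 * sqn il (\<lambda>n. - ?N \<tau> n) + ennreal (2 * \<nu>^2) * sqn eigval (c \<tau>))" by (intro II_mono)
  also have "... = 2 * II 0 T (\<lambda>\<tau>. sqn il (\<lambda>n. - ?N \<tau> n)) + ennreal (2 * \<nu>^2) * sqn_int 0 T eigval c"
  proof -
    have "(\<lambda>\<tau>. sqn il (\<lambda>n. - ?N \<tau> n)) \<in> borel_measurable (lebesgue_on {0..T})"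
      by (intro measurable_sqn_interval continuous_on_minus F_continuous S)
    moreover have "(\<lambda>\<tau>. sqn eigval (c \<tau>)) \<in> borel_measurable (lebesgue_on {0..T})" by (intro measurable_sqn_interval S)
    ultimately show ?thesis unfolding II_def by (simp add: nn_integral_add nn_integral_cmult)
  qed
  also have "... < \<infinity>" using order.strict_trans1[OF source_bound[OF S(4,5)]] S(2,6) by (simp add: ennreal_mult_less_top)
  finally show ?thesis .
qed

lemma solution_has_derivative:
  assumes c: "solution 0 T c" and t: "t \<in> {0..T}"
  shows "((\<lambda>t. c t n) has_real_derivative velocity (c t) n) (at t within {0..T})"
  unfolding velocity_def
  by (rule continuous_integral_equation_deriv[OF m_pos _ _ t])
     (intro continuous_intros F_continuous solutionD(1,4)[OF c], rule linear_solutionD(3)[OF solutionD(3)[OF c]])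

lemma continuous_velocity: "solution 0 T c \<Longrightarrow> continuous_on {0..T} (\<lambda>\<tau>. velocity (c \<tau>) n)"
  unfolding velocity_def using m_pos by (intro continuous_intros F_continuous solutionD(1,4)) (auto simp: less_imp_neq[OF m_pos, symmetric])

text \<open>On the null set of times where the velocity has infinite dual norm the functional is 0,
  because \<open>dualf_bochner_L2\<close> needs finiteness at every time.\<close>

definition velocity_dual :: "(nat \<Rightarrow> real) \<Rightarrow> field \<Rightarrow> real" where
  "velocity_dual c = dualf (if sqn il (velocity c) < \<infinity> then velocity c else (\<lambda>n. 0))"

lemma velocity_bochner_L2:
  assumes c: "solution 0 T c"
  shows "(\<lambda>t. velocity_dual (c t)) \<in> bochner_L2 T (V_dual r) (V_dual_norm r)"
  unfolding velocity_dual_def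
proof (rule dualf_bochner_L2)
  let ?M = "lebesgue_on {0<..<T}"
  have m: "(\<lambda>t. velocity (c t) n) \<in> borel_measurable ?M" for n
    by (intro continuous_imp_measurable_on_sets_lebesgue continuous_on_subset[OF continuous_velocity[OF c]]) auto
  then have "(\<lambda>t. sqn il (velocity (c t))) \<in> borel_measurable ?M" by (intro sqn_measurable)
  then have p: "Measurable.pred ?M (\<lambda>t. sqn il (velocity (c t)) < \<infinity>)" by measurable
  have "(\<lambda>t. if sqn il (velocity (c t)) < \<infinity> then velocity (c t) n else 0) \<in> borel_measurable ?M" for n using p m by measurable
  then show "(\<lambda>t. (if sqn il (velocity (c t)) < \<infinity> then velocity (c t) else (\<lambda>n. 0)) n) \<in> borel_measurable ?M" for n
    by (simp add: if_distribR)
  show "sqn inv_eigval (if sqn il (velocity (c t)) < \<infinity> then velocity (c t) else (\<lambda>n. 0)) < \<infinity>" for t by (simp add: il_eq)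
  have "(\<integral>\<^sup>+t. sqn inv_eigval (if sqn il (velocity (c t)) < \<infinity> then velocity (c t) else (\<lambda>n. 0)) \<partial>?M) \<le> II 0 T (\<lambda>t. sqn il (velocity (c t)))"
    unfolding nn_integral_open_closed[symmetric] by (intro nn_integral_mono) (simp add: il_eq)
  then show "(\<integral>\<^sup>+t. sqn inv_eigval (if sqn il (velocity (c t)) < \<infinity> then velocity (c t) else (\<lambda>n. 0)) \<partial>?M) < \<infinity>"
    using velocity_finite[OF c] by (rule order.strict_trans1)
qed

lemma solution_bochner_L2:
  assumes c: "solution 0 T c"
  shows "(\<lambda>t. syn (c t)) \<in> bochner_L2 T (V_inter r) (V_inter_norm r)"
proof (rule syn_bochner_L2)
  note S = solutionD[OF c]
  let ?M = "lebesgue_on {0<..<T}"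
  show "(\<lambda>t. c t n) \<in> borel_measurable ?M" for n
    by (intro continuous_imp_measurable_on_sets_lebesgue continuous_on_subset[OF S(4)]) auto
  show "sqn (\<lambda>n. 1) (c t) < \<infinity>" if "t \<in> {0<..<T}" for t using order.strict_trans1[OF sqn_1_le_voigt S(5)[of t]] that by simp
  have "sqn (sw 1) d \<le> ennreal 2 * sqn eigval d" for d
  proof -
    have "sqn (sw 1) d \<le> sqn (\<lambda>n. 2 * eigval n) d" using sw_le_eigval[of 1] by (intro sqn_mono mult_right_mono) auto
    then show ?thesis by (simp add: sqn_scale)
  qed
  then have "(\<integral>\<^sup>+t. sqn (sw 1) (c t) \<partial>?M) \<le> II 0 T (\<lambda>t. ennreal 2 * sqn eigval (c t))"
    unfolding nn_integral_open_closed by (intro II_mono)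
  also have "... = ennreal 2 * II 0 T (\<lambda>t. sqn eigval (c t))" unfolding II_def by (intro nn_integral_cmult measurable_sqn_interval S)
  also have "... < \<infinity>" using S(2) by (simp add: ennreal_mult_less_top)
  finally show "(\<integral>\<^sup>+t. sqn (sw 1) (c t) \<partial>?M) < \<infinity>" .
  obtain A where A: "0 \<le> A" "\<And>t. t \<in> {0..T} \<Longrightarrow> sqn (voigt \<alpha> r) (c t) \<le> ennreal A" by (rule weighted_continuous_bounded[OF S(1)]) blast
  let ?B = "2 powr r / \<alpha> powr (2 * r)"
  have "(\<integral>\<^sup>+t. sqn (sw r) (c t) \<partial>?M) \<le> II 0 T (\<lambda>t. ennreal (?B * A))" unfolding nn_integral_open_closed
  proof (rule II_mono)
    fix t assume "t \<in> {0..T}"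
    then have "sqn (sw r) (c t) \<le> ennreal ?B * ennreal A" by (intro order_trans[OF sqn_sw_le mult_left_mono[OF A(2)]]) auto
    then show "sqn (sw r) (c t) \<le> ennreal (?B * A)" using A(1) by (simp only: ennreal_mult divide_nonneg_nonneg powr_ge_zero)
  qed
  then show "(\<integral>\<^sup>+t. sqn (sw r) (c t) \<partial>?M) < \<infinity>" using II_const_finite[of "ennreal (?B * A)"] by (auto intro: order.strict_trans1)
qed

lemma solution_continuous_V:
  assumes c: "solution 0 T c"
  shows "(\<lambda>t. syn (c t)) \<in> continuous_V T r"
  unfolding continuous_V_def
proof (intro CollectI conjI ballI)
  note S = solutionD[OF c]
  fix t assume t: "t \<in> {0..T}"
  show "syn (c t) \<in> V r" by (rule syn_V[OF S(5)[OF t]])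
  let ?B = "2 powr r / \<alpha> powr (2 * r)"
  have n: "Sobolev_norm r (syn (c t') - syn (c t)) = sqrt (enn2real (sqn (sw r) (\<lambda>n. c t' n - c t n)))" if t': "t' \<in> {0..T}" for t'
  proof -
    note a = syn_V[OF S(5)[OF t]] syn_V[OF S(5)[OF t']]
    have "cf (syn (c t') - syn (c t)) = (\<lambda>n. c t' n - c t n)"
      using cf_diff[OF HD(1)[OF V_subset_H[OF a(3)]] HD(1)[OF V_subset_H[OF a(1)]]] by (simp add: fun_eq_iff a)
    then show ?thesis using Sobolev_norm_H[OF H_diff[OF V_subset_H[OF a(3)] V_subset_H[OF a(1)]]] by simp
  qed
  have "((\<lambda>t'. ennreal ?B * sqn (voigt \<alpha> r) (\<lambda>n. c t' n - c t n)) \<longlongrightarrow> ennreal ?B * 0) (at t within {0..T})"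
    by (intro ennreal_tendsto_cmult weighted_continuousD(2)[OF S(1) t]) simp
  from tendsto_sandwich[OF always_eventually always_eventually tendsto_const this, of "\<lambda>t'. sqn (sw r) (\<lambda>n. c t' n - c t n)"]
  have "((\<lambda>t'. sqn (sw r) (\<lambda>n. c t' n - c t n)) \<longlongrightarrow> 0) (at t within {0..T})" by (simp add: sqn_sw_le)
  then have "((\<lambda>t'. sqrt (enn2real (sqn (sw r) (\<lambda>n. c t' n - c t n)))) \<longlongrightarrow> 0) (at t within {0..T})" by (rule sqrt_enn2real_tendsto_0)
  then show "((\<lambda>t'. Sobolev_norm r (syn (c t') - syn (c t))) \<longlongrightarrow> 0) (at t within {0..T})"
    by (rule Lim_transform_eventually) (auto simp: eventually_at_filter n intro!: always_eventually)
qed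

text \<open>Integration by parts mode by mode, without boundary terms since \<open>\<psi>\<close>
  vanishes at both ends; then both series are exchanged with the time integrals.\<close>

lemma solution_time_derivative:
  assumes c: "solution 0 T c" and T: "0 < T"
  shows "has_time_derivative T r (\<lambda>t. syn (c t)) (\<lambda>t. velocity_dual (c t))"
  unfolding has_time_derivative_def
proof (intro ballI)
  note S = solutionD[OF c]
  fix \<psi> v assume \<psi>: "\<psi> \<in> time_test T" and v: "v \<in> V_inter r"
  have v1: "v \<in> V 1" using v by (simp add: V_inter_def)
  have d\<psi>: "(deriv ^^ n) \<psi> differentiable_on UNIV" for n using \<psi> by (simp add: time_test_def)
  have c1: "continuous_on {0..T} (deriv \<psi>)" using differentiable_imp_continuous_on[OF d\<psi>[of 1]] by (auto intro: continuous_on_subset)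
  have c0: "continuous_on {0..T} \<psi>" using differentiable_imp_continuous_on[OF d\<psi>[of 0]] by (auto intro: continuous_on_subset)
  have der: "(\<psi> has_real_derivative deriv \<psi> t) (at t within {0..T})" for t
  proof -
    have "\<psi> differentiable (at t)" using d\<psi>[of 0] by (simp add: differentiable_on_def)
    then have "DERIV \<psi> t :> deriv \<psi> t" by (rule DERIV_deriv_iff_real_differentiable[THEN iffD2])
    then show ?thesis by (rule has_field_derivative_at_within)
  qed
  have z: "\<psi> 0 = 0" "\<psi> T = 0" using \<psi> by (auto simp: time_test_def)
  have mode: "integral {0..T} (\<lambda>t. deriv \<psi> t * c t n) = - integral {0..T} (\<lambda>t. \<psi> t * velocity (c t) n)" for n
  proof -
    have "((\<lambda>t. \<psi> t * c t n) has_vector_derivative \<psi> t * velocity (c t) n + deriv \<psi> t * c t n) (at t within {0..T})" if "t \<in> {0..T}" for t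
      unfolding has_real_derivative_iff_has_vector_derivative[symmetric] by (rule DERIV_mult'[OF der solution_has_derivative[OF c that]])
    from fundamental_theorem_of_calculus[OF less_imp_le[OF T] this]
    have "integral {0..T} (\<lambda>t. \<psi> t * velocity (c t) n + deriv \<psi> t * c t n) = 0" unfolding z by (simp add: integral_unique)
    moreover have "integral {0..T} (\<lambda>t. \<psi> t * velocity (c t) n + deriv \<psi> t * c t n)
        = integral {0..T} (\<lambda>t. \<psi> t * velocity (c t) n) + integral {0..T} (\<lambda>t. deriv \<psi> t * c t n)"
      by (intro Henstock_Kurzweil_Integration.integral_add integrable_continuous_interval continuous_intros c0 c1 S continuous_velocity[OF c])
    ultimately show ?thesis by simp
  qed
  have s1: "integrable (lebesgue_on {0..T}) (\<lambda>t. deriv \<psi> t * L2_inner (syn (c t)) v)"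
    "(\<lambda>n. integral {0..T} (\<lambda>t. deriv \<psi> t * c t n) * cf v n) sums (LINT t|lebesgue_on {0..T}. deriv \<psi> t * L2_inner (syn (c t)) v)"
  proof -
    have "sqn il d \<le> sqn eigval d" for d
    proof (intro sqn_mono mult_right_mono)
      fix n
      have "1 / eigval n \<le> 1 / 1" using eigval_ge_1[of n] by (intro divide_left_mono) auto
      then show "il n \<le> eigval n" using eigval_ge_1[of n] unfolding il_def by linarith
    qed simp
    then have "sqn_int 0 T il c < \<infinity>" by (intro order.strict_trans1[OF II_mono S(2)])
    then have f: "II 0 T (\<lambda>\<tau>. sqn il (\<lambda>n. deriv \<psi> \<tau> * c \<tau> n)) < \<infinity>" by (intro multiplier_finite c1 S) auto
    have "(\<lambda>n. deriv \<psi> \<tau> * c \<tau> n * cf v n) sums (deriv \<psi> \<tau> * L2_inner (syn (c \<tau>)) v)" if "\<tau> \<in> {0..T}" for \<tau>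
      using sums_mult[OF L2_inner_cf[OF V_subset_H V_subset_H, OF syn_V(1)[OF S(5)[OF that]] v1], of "deriv \<psi> \<tau>"] syn_V(2)[OF S(5)[OF that]]
      by (simp add: mult.assoc)
    then have "AE \<tau> in lebesgue_on {0..T}. (\<lambda>n. deriv \<psi> \<tau> * c \<tau> n * cf v n) sums (deriv \<psi> \<tau> * L2_inner (syn (c \<tau>)) v)" by (intro AE_I2) simp
    note si = series_integral[OF _ f v1 this]
    show "integrable (lebesgue_on {0..T}) (\<lambda>t. deriv \<psi> t * L2_inner (syn (c t)) v)"
      "(\<lambda>n. integral {0..T} (\<lambda>t. deriv \<psi> t * c t n) * cf v n) sums (LINT t|lebesgue_on {0..T}. deriv \<psi> t * L2_inner (syn (c t)) v)"
      by (rule si; intro continuous_intros c1 S)+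
  qed
  have s2: "integrable (lebesgue_on {0..T}) (\<lambda>t. \<psi> t * velocity_dual (c t) v)"
    "(\<lambda>n. integral {0..T} (\<lambda>t. \<psi> t * velocity (c t) n) * cf v n) sums (LINT t|lebesgue_on {0..T}. \<psi> t * velocity_dual (c t) v)"
  proof -
    note cv = continuous_velocity[OF c]
    have f: "II 0 T (\<lambda>\<tau>. sqn il (\<lambda>n. \<psi> \<tau> * velocity (c \<tau>) n)) < \<infinity>" by (intro multiplier_finite c0 velocity_finite c cv) auto
    have "AE \<tau> in lebesgue_on {0..T}. sqn il (velocity (c \<tau>)) < \<infinity>" by (rule II_AE_finite[OF cv velocity_finite[OF c]])
    then have "AE \<tau> in lebesgue_on {0..T}. (\<lambda>n. \<psi> \<tau> * velocity (c \<tau>) n * cf v n) sums (\<psi> \<tau> * velocity_dual (c \<tau>) v)"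
    proof eventually_elim
      case (elim \<tau>)
      then have "(\<lambda>n. velocity (c \<tau>) n * cf v n) sums velocity_dual (c \<tau>) v"
        unfolding velocity_dual_def dualf_def using summable_sums[OF dual_sums(1)[OF _ v1]] by (simp add: il_eq)
      from sums_mult[OF this, of "\<psi> \<tau>"] show ?case by (simp add: mult.assoc)
    qed
    note si = series_integral[OF _ f v1 this]
    show "integrable (lebesgue_on {0..T}) (\<lambda>t. \<psi> t * velocity_dual (c t) v)"
      "(\<lambda>n. integral {0..T} (\<lambda>t. \<psi> t * velocity (c t) n) * cf v n) sums (LINT t|lebesgue_on {0..T}. \<psi> t * velocity_dual (c t) v)"
      by (rule si; intro continuous_intros c0 cv)+
  qed
  have "(\<lambda>n. integral {0..T} (\<lambda>t. deriv \<psi> t * c t n) * cf v n) sums (- (LINT t|lebesgue_on {0..T}. \<psi> t * velocity_dual (c t) v))"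
    using sums_minus[OF s2(2)] by (simp add: mode)
  then show "(LINT t|lebesgue_on {0<..<T}. deriv \<psi> t * L2_inner (syn (c t)) v) = - (LINT t|lebesgue_on {0<..<T}. \<psi> t * velocity_dual (c t) v)"
    unfolding LINT_open_closed[OF s1(1)] LINT_open_closed[OF s2(1)] by (rule sums_unique2[OF s1(2)])
qed

text \<open>The integral equation of mode \<open>n\<close> is multiplied by \<open>cf v n\<close>
  and summed over \<open>n\<close>. Both sides of the weak formulation are sums of the resulting
  series, which agree term by term.\<close>

lemma solution_weak_equation:
  assumes c: "solution 0 T c" and c0: "c 0 = cf u0" and u0: "u0 \<in> V r" and t: "t \<in> {0..T}" and v: "v \<in> V_inter r"
  shows "L2_inner (syn (c t)) v + \<alpha> powr (2 * r) * L2_inner (stokes_power (r / 2) (syn (c t))) (stokes_power (r / 2) v)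
      + \<nu> * (LINT \<tau>|lebesgue_on {0..t}. L2_inner (stokes_power (1 / 2) (syn (c \<tau>))) (stokes_power (1 / 2) v))
    = - (LINT \<tau>|lebesgue_on {0..t}. B_pairing (syn (c \<tau>)) (syn (c \<tau>)) v) + L2_inner u0 v
      + \<alpha> powr (2 * r) * L2_inner (stokes_power (r / 2) u0) (stokes_power (r / 2) v)"
proof (rule sums_unique2)
  have ct: "solution 0 t c" using solution_mono[OF c] t by simp
  note S = solutionD[OF ct]
  have St: "t \<in> {0..t}" using t by simp
  let ?N = "\<lambda>\<tau> n. Bform (syn (c \<tau>)) (syn (c \<tau>)) n"
  have v1: "v \<in> V 1" "v \<in> V r" using v by (auto simp: V_inter_def)
  have r0: "0 \<le> r" using r_ge by simp
  have Nc: "continuous_on {0..t} (\<lambda>\<tau>. ?N \<tau> n)" for n by (rule F_continuous[OF S(1)])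
  have "AE \<tau> in lebesgue_on {0..t}. sqn eigval (c \<tau>) < \<infinity>" by (rule II_AE_finite[OF S(4,2)])
  moreover have "AE \<tau> in lebesgue_on {0..t}. \<tau> \<in> {0..t}" by (rule AE_I2) simp
  ultimately have ae: "AE \<tau> in lebesgue_on {0..t}. syn (c \<tau>) \<in> V 1 \<and> cf (syn (c \<tau>)) = c \<tau>"
    by eventually_elim (use syn_V1 syn_V(2) S(5) in blast)
  have diss: "(\<lambda>n. integral {0..t} (\<lambda>\<tau>. eigval n * c \<tau> n) * cf v n) sums
      (LINT \<tau>|lebesgue_on {0..t}. L2_inner (stokes_power (1 / 2) (syn (c \<tau>))) (stokes_power (1 / 2) v))"
  proof (rule series_integral(2)[OF _ _ v1(1)])
    have "sqn il (\<lambda>n. eigval n * d n) = sqn eigval d" for d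
      unfolding sqn_def il_def by (simp add: power_mult_distrib power2_eq_square less_imp_neq[OF eigval_pos, symmetric] mult_ac)
    then show "II 0 t (\<lambda>\<tau>. sqn il (\<lambda>n. eigval n * c \<tau> n)) < \<infinity>" using S(2) by simp
    show "AE \<tau> in lebesgue_on {0..t}. (\<lambda>n. eigval n * c \<tau> n * cf v n) sums L2_inner (stokes_power (1 / 2) (syn (c \<tau>))) (stokes_power (1 / 2) v)"
      using ae
    proof eventually_elim
      case (elim \<tau>)
      then show ?case using stokes_power_inner[of "syn (c \<tau>)" 1 v] v1 by (simp add: mult.assoc)
    qed
  qed (intro continuous_intros S)
  have conv: "(\<lambda>n. integral {0..t} (\<lambda>\<tau>. ?N \<tau> n) * cf v n) sums (LINT \<tau>|lebesgue_on {0..t}. B_pairing (syn (c \<tau>)) (syn (c \<tau>)) v)"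
  proof (rule series_integral(2)[OF Nc _ v1(1)])
    have "II 0 t (\<lambda>\<tau>. sqn il (\<lambda>n. - ?N \<tau> n)) < \<infinity>"
      using order.strict_trans1[OF source_bound[OF S(4,5)]] S(6) by (simp add: ennreal_mult_less_top)
    then show "II 0 t (\<lambda>\<tau>. sqn il (?N \<tau>)) < \<infinity>" by (simp add: sqn_uminus)
    show "AE \<tau> in lebesgue_on {0..t}. (\<lambda>n. ?N \<tau> n * cf v n) sums B_pairing (syn (c \<tau>)) (syn (c \<tau>)) v"
      using ae by eventually_elim (intro Bform_sums_B_pairing v1, simp)
  qed
  have inner: "(\<lambda>n. voigt \<alpha> r n * (cf u n * cf v n)) sums (L2_inner u v + \<alpha> powr (2 * r) * L2_inner (stokes_power (r / 2) u) (stokes_power (r / 2) v))" if "u \<in> V r" for u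
    using sums_add[OF L2_inner_cf[OF V_subset_H[OF that] V_subset_H[OF v1(1)]] sums_mult[OF stokes_power_inner[OF that v1(2) r0], of "\<alpha> powr (2 * r)"]]
    by (simp add: voigt_def distrib_right mult.assoc)
  note uV = syn_V[OF S(5)[OF St]]
  show "(\<lambda>n. voigt \<alpha> r n * (c t n * cf v n) + \<nu> * (integral {0..t} (\<lambda>\<tau>. eigval n * c \<tau> n) * cf v n)) sums
     (L2_inner (syn (c t)) v + \<alpha> powr (2 * r) * L2_inner (stokes_power (r / 2) (syn (c t))) (stokes_power (r / 2) v)
      + \<nu> * (LINT \<tau>|lebesgue_on {0..t}. L2_inner (stokes_power (1 / 2) (syn (c \<tau>))) (stokes_power (1 / 2) v)))"
    using sums_add[OF inner[OF uV(1)] sums_mult[OF diss, of \<nu>]] by (simp add: uV(2))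
  have "voigt \<alpha> r n * (c t n * cf v n) + \<nu> * (integral {0..t} (\<lambda>\<tau>. eigval n * c \<tau> n) * cf v n)
      = - (integral {0..t} (\<lambda>\<tau>. ?N \<tau> n) * cf v n) + voigt \<alpha> r n * (cf u0 n * cf v n)" for n
  proof -
    have "integral {0..t} (\<lambda>\<tau>. - ?N \<tau> n - (\<nu> * eigval n) * c \<tau> n) = - integral {0..t} (\<lambda>\<tau>. ?N \<tau> n) - \<nu> * integral {0..t} (\<lambda>\<tau>. eigval n * c \<tau> n)"
      by (subst Henstock_Kurzweil_Integration.integral_diff)
         (auto intro!: integrable_continuous_interval continuous_intros S Nc simp: mult.assoc)
    with linear_solutionD(3)[OF S(3) St, of n]
    have e: "voigt \<alpha> r n * c t n = voigt \<alpha> r n * cf u0 n - integral {0..t} (\<lambda>\<tau>. ?N \<tau> n) - \<nu> * integral {0..t} (\<lambda>\<tau>. eigval n * c \<tau> n)"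
      unfolding c0 by linarith
    have "voigt \<alpha> r n * (c t n * cf v n) = (voigt \<alpha> r n * c t n) * cf v n" by simp
    then show ?thesis unfolding e by (simp add: algebra_simps)
  qed
  note e = this
  show "(\<lambda>n. voigt \<alpha> r n * (c t n * cf v n) + \<nu> * (integral {0..t} (\<lambda>\<tau>. eigval n * c \<tau> n) * cf v n)) sums
     (- (LINT \<tau>|lebesgue_on {0..t}. B_pairing (syn (c \<tau>)) (syn (c \<tau>)) v) + L2_inner u0 v
      + \<alpha> powr (2 * r) * L2_inner (stokes_power (r / 2) u0) (stokes_power (r / 2) v))"
    unfolding e using sums_add[OF sums_minus[OF conv] inner[OF u0]] by (simp only: add.assoc)
qed

lemma solution_imp_weak_solution:
  assumes c: "solution 0 T c" and c0: "c 0 = cf u0" and u0: "u0 \<in> V r" and T: "0 < T"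
  shows "weak_solution \<nu> \<alpha> r u0 T (\<lambda>t. syn (c t))"
  unfolding weak_solution_def
  by (intro conjI ballI exI[of _ "\<lambda>t. velocity_dual (c t)"] solution_continuous_V solution_bochner_L2 velocity_bochner_L2
      solution_time_derivative solution_weak_equation[OF c c0 u0] assms)

text \<open>Uniqueness compares coefficients: two weak solutions solve the same mode equations from
  the same datum, and equal coefficients mean equality almost everywhere.\<close>

theorem weak_solution_exists_unique:
  assumes u0: "u0 \<in> V r" and T: "0 < T"
  shows "\<exists>u. weak_solution \<nu> \<alpha> r u0 T u \<and> (\<forall>w. weak_solution \<nu> \<alpha> r u0 T w \<longrightarrow> (\<forall>t\<in>{0..T}. AE x in torus. w t x = u t x))"
proof -
  have "sqn (voigt \<alpha> r) (cf u0) < \<infinity>" using u0 V_iff_voigt by blast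
  from global_existence[OF this less_imp_le[OF T]] obtain c where c: "solution 0 T c" "c 0 = cf u0" by blast
  have "AE x in torus. w t x = syn (c t) x" if w: "weak_solution \<nu> \<alpha> r u0 T w" and t: "t \<in> {0..T}" for w t
  proof -
    note W = weak_solution_imp_solution[OF u0 T w]
    have e: "cf (w t) = c t" using unique[OF W(1) c(1) _ t] W(2) c(2) by simp
    have "w t \<in> V r" using w t by (simp add: weak_solution_def continuous_V_def)
    then show ?thesis using syn_V[OF solutionD(5)[OF c(1) t]] e by (intro H_eq_AE V_subset_H) auto
  qed
  with solution_imp_weak_solution[OF c u0 T] show ?thesis by blast
qed

end

theorem theorem4p2:
  fixes \<nu> \<alpha> r :: real and u0 :: field
  assumes "\<nu> > 0" and "\<alpha> > 0" and "r \<ge> 1 / 2" and "u0 \<in> V r"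
  shows "\<forall>T>0. \<exists>u. weak_solution \<nu> \<alpha> r u0 T u \<and>
           (\<forall>w. weak_solution \<nu> \<alpha> r u0 T w \<longrightarrow>
              (\<forall>t\<in>{0..T}. AE x in torus. w t x = u t x))"
proof -
  obtain K C where "semilinear_evolution (voigt \<alpha> r) eigval \<nu> (\<lambda>c d. Bform (syn c) (syn d)) K C"
    by (rule voigt_semilinear[OF assms(1-3)])
  then interpret voigt_evolution \<nu> \<alpha> r K C using assms by (intro voigt_evolution.intro voigt_evolution_axioms.intro)
  show ?thesis using weak_solution_exists_unique[OF assms(4)] by blast
qed

end
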